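(* Suppose $E=\mathbb R^d$ and $\lambda$ is Lebesgue measure. Let $K$ be a Hermitian integral operator on $L^2(\mathbb R^d,\lambda)$ of local trace class with $0\le K\le I$ and $\|K\|<1$, and let $\mu$ be the unique determinantal point process with correlation kernel $K$. Suppose in addition that (a) $J:=K(I-K)^{-1}$ has a continuous integral kernel $J(x,y)$, $x,y\in\mathbb R^d$; (b) $J$ has finite range $R<\infty$, in that $J(x,y)=0$ for $|x-y|>R$; (c) $\mu$ does not percolate, in that $\mu(\exists\text{ infinite cluster of }B_R(\cdot))=0$. Let $$\hat c_*(\alpha,\xi)=\lim_{\Delta\uparrow E}\det J(\alpha\xi_\Delta,\alpha\xi_\Delta)/\det J(\xi_\Delta,\xi_\Delta).$$ Then $\hat c_*$ is continuous $L\otimes\mu$-almost everywhere. Specifically, $$\hat c_*(\alpha,\xi)=\det J(\alpha\xi_W,\alpha\xi_W)/\det J(\xi_W,\xi_W)\;1_{\{\mathrm{diam}\,W(\alpha,\xi)<\infty\}},$$ where $W(\alpha,\xi)$ is the union of the clusters of $B_R(\alpha\xi)$ hitting $\alpha$, and $\xi_W:=\xi_{W(\alpha,\xi)}$ is the restriction of $\xi$ to $W(\alpha,\xi)$.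
   Context: Configurations: $\mathcal B_0$ is the system of relatively compact Borel sets of $E=\mathbb R^d$. $\mathcal X$ is the set of all locally finite subsets (configurations) $\xi\subset E$, equipped with the vague topology (identifying $\xi$ with the Radon measure $\sum_{x\in\xi}\delta_x$) and its Borel $\sigma$-algebra $\mathcal F$. For $\Lambda\subset E$, $\xi_\Lambda=\xi\cap\Lambda$; $\alpha\xi$ is shorthand for $\alpha\cup\xi$. A point process is a probability measure on $(\mathcal X,\mathcal F)$. $\mathcal X_0\subset\mathcal X$ is the set of finite configurations, with the trace $\sigma$-algebra, and $L$ is the measure on $\mathcal X_0$ with $\int f\,dL=\sum_{m\ge0}\frac1{m!}\int_{E^m}f(\{x_1,\dots,x_m\})\,\lambda(dx_1)\cdots\lambda(dx_m)$ for measurable $f\ge0$. Determinantal process: for $k:E^2\to\mathbb C$ and $\alpha\in\mathcal X_0$ write $k(\alpha,\alpha)=(k(x,y))_{x,y\in\alpha}$ (the determinant of the empty matrix is $1$). "Positive" for operators and "positive definite" for matrices are meant in the weak sense ($0$ may belong to the spectrum), and $S\le T$ means that $T-S$ is positive; $I$ is the identity. $P_\Lambda$ is the projection of $L^2(E,\lambda)$ onto $L^2(\Lambda,\lambda|_\Lambda)$ and $T_\Lambda=P_\Lambda TP_\Lambda$; $T$ is of local trace class if $T_\Lambda$ is trace class for all $\Lambda\in\mathcal B_0$. The integral kernel $K(x,y)$ of $K$ is chosen such that $K(\alpha,\alpha)$ is positive definite for $L$-almost all $\alpha$ and $\mathrm{Tr}\,K_\Lambda=\int_\Lambda K(x,x)\,\lambda(dx)$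 for all $\Lambda\in\mathcal B_0$. The determinantal point process with correlation kernel $K$ is the point process $\mu$ with correlation function $\rho(\alpha)=\det K(\alpha,\alpha)$, i.e. $\int\mu(d\xi)\sum_{\alpha\in\mathcal X_0,\,\alpha\subset\xi}u(\alpha)=\int u\rho\,dL$ for all measurable $u:\mathcal X_0\to[0,\infty)$. The function $\hat c_*$: a ratio of determinants is set equal to zero if its denominator vanishes. The limit is taken as $\Delta\in\mathcal B_0$ increases to $E$; it exists because the ratio is decreasing in $\Delta$. Boolean model: $B_R(\xi)=\bigcup_{x\in\xi}b_R(x)$, where $b_R(x)$ is the closed ball of radius $R$ centered at $x$. The connected components of $B_R(\xi)$ are called clusters; a cluster is infinite if it consists of infinitely many points of $\xi$ (equivalently, if its diameter is infinite).
   Formalization: As 0/0=0 breaks continuity (e.g. K=0), ĉ_* is shown continuous a.e. relative to the ξ with no det J(ξ_Δ,ξ_Δ) zero; the explicit formula is continuous a.e. on the whole space and equals ĉ_* a.e. Finite configurations carry the weak, not the vague, topology. *)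

theory Defs
  imports
    "HOL-Analysis.Analysis"
    "HOL-Probability.Probability_Measure"
    "HOL-Combinatorics.Permutations"
begin

section \<open>Configurations\<close>

definition bdd_borel :: "'a::euclidean_space set set" where
  "bdd_borel = {\<Lambda> \<in> sets borel. bounded \<Lambda>}"

definition configs :: "'a::euclidean_space set set" where
  "configs = {\<xi>. \<forall>\<Lambda>\<in>bdd_borel. finite (\<xi> \<inter> \<Lambda>)}"

definition fin_configs :: "'a::euclidean_space set set" where
  "fin_configs = {\<alpha>. finite \<alpha>}"

text \<open>The initial topology on \<open>C\<close> for the maps \<open>\<xi> \<mapsto> \<integral> f d\<xi>\<close> with \<open>f \<in> \<Phi>\<close>, where the integral
  against the counting measure of \<open>\<xi>\<close> is written as a set-indexed sum.\<close>

definition config_topology ::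
    "'a::euclidean_space set set \<Rightarrow> ('a \<Rightarrow> real) set \<Rightarrow> 'a set topology" where
  "config_topology C \<Phi> =
     topology_generated_by {{\<xi> \<in> C. (\<Sum>\<^sub>\<infinity>x\<in>\<xi>. f x) \<in> U} | f U. f \<in> \<Phi> \<and> open U}"

definition vague_topology :: "'a::euclidean_space set topology" where
  "vague_topology = config_topology configs
     {f. continuous_on UNIV f \<and> compact (closure {x. f x \<noteq> 0})}"

text \<open>As a topological space, the set of finite configurations carries the weak topology of finite
  measures (test functions: bounded and continuous). Equivalently, it is the disjoint union over
  \<open>m\<close> of the spaces of \<open>m\<close>-point sets with the quotient topology. The trace of the vague topology
  is too coarse here: it lets points of a finite configuration disappear to infinity. Both
  topologies have the same Borel sets.\<close>

definition weak_topology :: "'a::euclidean_space set topology" where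
  "weak_topology = config_topology fin_configs {f. continuous_on UNIV f \<and> bounded (range f)}"

definition config_space :: "'a::euclidean_space set measure" where
  "config_space = sigma configs {U. openin vague_topology U}"

definition fin_config_space :: "'a::euclidean_space set measure" where
  "fin_config_space = restrict_space config_space fin_configs"

definition point_process :: "'a::euclidean_space set measure \<Rightarrow> bool" where
  "point_process \<mu> \<longleftrightarrow> prob_space \<mu> \<and> space \<mu> = space config_space \<and> sets \<mu> = sets config_space"

text \<open>\<open>L(A) = \<Sum>\<^sub>m 1/m! \<lambda>\<^sup>m {x. {x\<^sub>1, \<dots>, x\<^sub>m} \<in> A}\<close>, with \<open>\<lambda>\<close> Lebesgue measure; an \<open>m\<close>-tuple is an
  extensional function on \<open>{..<m}\<close>.\<close>

definition L_measure :: "'a::euclidean_space set measure" where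
  "L_measure = measure_of fin_configs (sets fin_config_space)
     (\<lambda>A. \<Sum>m. ennreal (1 / fact m) *
        emeasure (Pi\<^sub>M {..<m} (\<lambda>_. lborel))
          {x \<in> space (Pi\<^sub>M {..<m} (\<lambda>_. lborel)). x ` {..<m} \<in> A})"

section \<open>Operators on \<open>L\<^sup>2(\<real>\<^sup>d; \<complex>)\<close>\<close>

text \<open>Elements of \<open>L\<^sup>2\<close> are represented by Borel functions; operators act on representatives and all
  operator identities are understood up to Lebesgue-null sets.\<close>

definition L2 :: "('a::euclidean_space \<Rightarrow> complex) set" where
  "L2 = {f \<in> borel_measurable lborel. integrable lborel (\<lambda>x. (cmod (f x))\<^sup>2)}"

definition l2_inner :: "('a::euclidean_space \<Rightarrow> complex) \<Rightarrow> ('a \<Rightarrow> complex) \<Rightarrow> complex" where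
  "l2_inner f g = (\<integral>x. cnj (f x) * g x \<partial>lborel)"

definition l2_norm :: "('a::euclidean_space \<Rightarrow> complex) \<Rightarrow> real" where
  "l2_norm f = sqrt (\<integral>x. (cmod (f x))\<^sup>2 \<partial>lborel)"

type_synonym 'a l2_op = "('a \<Rightarrow> complex) \<Rightarrow> 'a \<Rightarrow> complex"

definition bounded_op :: "'a::euclidean_space l2_op \<Rightarrow> bool" where
  "bounded_op T \<longleftrightarrow>
     (\<forall>f\<in>L2. T f \<in> L2) \<and>
     (\<forall>f\<in>L2. \<forall>g\<in>L2. AE x in lborel. T (\<lambda>y. f y + g y) x = T f x + T g x) \<and>
     (\<forall>c. \<forall>f\<in>L2. AE x in lborel. T (\<lambda>y. c * f y) x = c * T f x) \<and>
     (\<exists>B. \<forall>f\<in>L2. l2_norm (T f) \<le> B * l2_norm f)"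

definition op_norm :: "'a::euclidean_space l2_op \<Rightarrow> real" where
  "op_norm T = Sup {l2_norm (T f) | f. f \<in> L2 \<and> l2_norm f \<le> 1}"

definition hermitian_op :: "'a::euclidean_space l2_op \<Rightarrow> bool" where
  "hermitian_op T \<longleftrightarrow> (\<forall>f\<in>L2. \<forall>g\<in>L2. l2_inner (T f) g = l2_inner f (T g))"

definition positive_op :: "'a::euclidean_space l2_op \<Rightarrow> bool" where
  "positive_op T \<longleftrightarrow> (\<forall>f\<in>L2. l2_inner f (T f) \<in> \<real>\<^sub>\<ge>\<^sub>0)"

definition id_op :: "'a l2_op" where
  "id_op f = f"

definition zero_op :: "'a l2_op" where
  "zero_op f = (\<lambda>x. 0)"

definition diff_op :: "'a l2_op \<Rightarrow> 'a l2_op \<Rightarrow> 'a l2_op" where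
  "diff_op S T f = (\<lambda>x. S f x - T f x)"

definition op_le :: "'a::euclidean_space l2_op \<Rightarrow> 'a l2_op \<Rightarrow> bool" where
  "op_le S T \<longleftrightarrow> positive_op (diff_op T S)"

definition inv_op :: "'a::euclidean_space l2_op \<Rightarrow> 'a l2_op" where
  "inv_op T = (SOME S. bounded_op S \<and>
     (\<forall>f\<in>L2. (AE x in lborel. S (T f) x = f x) \<and> (AE x in lborel. T (S f) x = f x)))"

definition J_op :: "'a::euclidean_space l2_op \<Rightarrow> 'a l2_op" where
  "J_op K = K \<circ> inv_op (diff_op id_op K)"

definition compress :: "'a::euclidean_space set \<Rightarrow> 'a l2_op \<Rightarrow> 'a l2_op" where
  "compress \<Lambda> T f = (\<lambda>x. indicator \<Lambda> x * T (\<lambda>y. indicator \<Lambda> y * f y) x)"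

definition orthonormal_basis :: "(nat \<Rightarrow> 'a::euclidean_space \<Rightarrow> complex) \<Rightarrow> bool" where
  "orthonormal_basis e \<longleftrightarrow>
     (\<forall>n. e n \<in> L2) \<and>
     (\<forall>m n. l2_inner (e m) (e n) = of_bool (m = n)) \<and>
     (\<forall>f\<in>L2. (\<forall>n. l2_inner (e n) f = 0) \<longrightarrow> (AE x in lborel. f x = 0))"

text \<open>\<open>Tr \<bar>T\<bar> < \<infinity>\<close>. The absolute value \<open>A = \<bar>T\<bar>\<close> is the positive operator with
  \<open>A\<^sup>2 = T\<^sup>* T\<close>; this equation is written in the weak form \<open>\<langle>A f, A g\<rangle> = \<langle>T f, T g\<rangle>\<close>.\<close>

definition trace_class :: "'a::euclidean_space l2_op \<Rightarrow> bool" where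
  "trace_class T \<longleftrightarrow> bounded_op T \<and>
     (\<exists>A. bounded_op A \<and> positive_op A \<and>
        (\<forall>f\<in>L2. \<forall>g\<in>L2. l2_inner (A f) (A g) = l2_inner (T f) (T g)) \<and>
        (\<exists>e. orthonormal_basis e \<and> summable (\<lambda>n. l2_inner (e n) (A (e n)))))"

text \<open>The trace does not depend on the choice of the basis.\<close>

definition op_trace :: "'a::euclidean_space l2_op \<Rightarrow> complex" where
  "op_trace T = (let e = (SOME e. orthonormal_basis e) in \<Sum>n. l2_inner (e n) (T (e n)))"

definition local_trace_class :: "'a::euclidean_space l2_op \<Rightarrow> bool" where
  "local_trace_class T \<longleftrightarrow> (\<forall>\<Lambda>\<in>bdd_borel. trace_class (compress \<Lambda> T))"

definition integral_kernel ::
    "'a::euclidean_space l2_op \<Rightarrow> ('a \<Rightarrow> 'a \<Rightarrow> complex) \<Rightarrow> bool" where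
  "integral_kernel T k \<longleftrightarrow>
     (\<lambda>(x, y). k x y) \<in> borel_measurable (lborel \<Otimes>\<^sub>M lborel) \<and>
     (\<forall>f\<in>L2. AE x in lborel.
        integrable lborel (\<lambda>y. k x y * f y) \<and> T f x = (\<integral>y. k x y * f y \<partial>lborel))"

section \<open>Determinantal point processes\<close>

text \<open>Determinant and positive definiteness of the matrix \<open>(k x y)\<close> indexed by the finite set
  \<open>\<alpha>\<close>; the determinant is given by the Leibniz formula, so it is \<open>1\<close> for \<open>\<alpha> = {}\<close>.\<close>

definition kdet :: "('a \<Rightarrow> 'a \<Rightarrow> complex) \<Rightarrow> 'a set \<Rightarrow> complex" where
  "kdet k \<alpha> = (\<Sum>p | p permutes \<alpha>. of_int (sign p) * (\<Prod>x\<in>\<alpha>. k x (p x)))"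

definition kposdef :: "('a \<Rightarrow> 'a \<Rightarrow> complex) \<Rightarrow> 'a set \<Rightarrow> bool" where
  "kposdef k \<alpha> \<longleftrightarrow> (\<forall>c. (\<Sum>x\<in>\<alpha>. \<Sum>y\<in>\<alpha>. cnj (c x) * k x y * c y) \<in> \<real>\<^sub>\<ge>\<^sub>0)"

definition correlation_kernel ::
    "'a::euclidean_space l2_op \<Rightarrow> ('a \<Rightarrow> 'a \<Rightarrow> complex) \<Rightarrow> bool" where
  "correlation_kernel K k \<longleftrightarrow>
     integral_kernel K k \<and>
     (AE \<alpha> in L_measure. kposdef k \<alpha>) \<and>
     (\<forall>\<Lambda>\<in>bdd_borel. set_integrable lborel \<Lambda> (\<lambda>x. k x x) \<and>
        op_trace (compress \<Lambda> K) = (LINT x:\<Lambda>|lborel. k x x))"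

text \<open>For \<open>k\<close> as above, \<open>kdet k \<alpha>\<close> is real and nonnegative for almost all \<open>\<alpha>\<close>, so passing to
  the real part is harmless. The sum over all finite \<open>\<alpha> \<subseteq> \<xi>\<close> is an integral against a counting
  measure.\<close>

definition determinantal_process ::
    "'a::euclidean_space set measure \<Rightarrow> ('a \<Rightarrow> 'a \<Rightarrow> complex) \<Rightarrow> bool" where
  "determinantal_process \<mu> k \<longleftrightarrow> point_process \<mu> \<and>
     (\<forall>u \<in> borel_measurable fin_config_space. (\<forall>\<alpha>. 0 \<le> u \<alpha>) \<longrightarrow>
        (\<integral>\<^sup>+\<xi>. (\<integral>\<^sup>+\<alpha>. ennreal (u \<alpha>) \<partial>count_space {\<alpha> \<in> fin_configs. \<alpha> \<subseteq> \<xi>}) \<partial>\<mu>) =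
        (\<integral>\<^sup>+\<alpha>. ennreal (u \<alpha>) * ennreal (Re (kdet k \<alpha>)) \<partial>L_measure))"

section \<open>The Boolean model and the limiting ratio\<close>

definition boolean_model :: "real \<Rightarrow> 'a::euclidean_space set \<Rightarrow> 'a set" where
  "boolean_model R \<xi> = (\<Union>x\<in>\<xi>. cball x R)"

definition clusters :: "real \<Rightarrow> 'a::euclidean_space set \<Rightarrow> 'a set set" where
  "clusters R \<xi> = components (boolean_model R \<xi>)"

definition has_infinite_cluster :: "real \<Rightarrow> 'a::euclidean_space set \<Rightarrow> bool" where
  "has_infinite_cluster R \<xi> \<longleftrightarrow> (\<exists>C\<in>clusters R \<xi>. infinite (\<xi> \<inter> C))"

definition W_set :: "real \<Rightarrow> 'a::euclidean_space set \<Rightarrow> 'a set \<Rightarrow> 'a set" where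
  "W_set R \<alpha> \<xi> = \<Union>{C \<in> clusters R (\<alpha> \<union> \<xi>). C \<inter> \<alpha> \<noteq> {}}"

definition increasing_to_all :: "'a::euclidean_space set filter" where
  "increasing_to_all = (INF \<Lambda>\<in>bdd_borel. principal {\<Delta> \<in> bdd_borel. \<Lambda> \<subseteq> \<Delta>})"

text \<open>Division by zero yields zero, which is the convention wanted for ratios of determinants.\<close>

definition det_ratio ::
    "('a \<Rightarrow> 'a \<Rightarrow> complex) \<Rightarrow> 'a set \<Rightarrow> 'a set \<Rightarrow> 'a set \<Rightarrow> complex" where
  "det_ratio j \<alpha> \<xi> \<Delta> = kdet j (\<alpha> \<union> (\<xi> \<inter> \<Delta>)) / kdet j (\<xi> \<inter> \<Delta>)"

definition c_star ::
    "('a::euclidean_space \<Rightarrow> 'a \<Rightarrow> complex) \<Rightarrow> 'a set \<Rightarrow> 'a set \<Rightarrow> complex" where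
  "c_star j \<alpha> \<xi> = Lim increasing_to_all (det_ratio j \<alpha> \<xi>)"

definition cluster_ratio ::
    "real \<Rightarrow> ('a::euclidean_space \<Rightarrow> 'a \<Rightarrow> complex) \<Rightarrow> 'a set \<Rightarrow> 'a set \<Rightarrow> complex" where
  "cluster_ratio R j \<alpha> \<xi> = det_ratio j \<alpha> \<xi> (W_set R \<alpha> \<xi>) * of_bool (bounded (W_set R \<alpha> \<xi>))"

text \<open>The configurations for which no denominator in the definition of \<open>c_star\<close> vanishes. If
  \<open>det J\<close> vanishes on configurations arbitrarily far away from the origin, then the convention
  \<open>0/0 = 0\<close> makes \<open>c_star\<close> jump to \<open>0\<close> along sequences \<open>\<xi>\<^sub>n \<rightarrow> \<xi>\<close> outside this set (in the
  extreme case \<open>J = 0\<close>, \<open>c_star j {} {z\<^sub>n} = 0\<close> with \<open>\<bar>z\<^sub>n\<bar> \<rightarrow> \<infinity>\<close>, while \<open>c_star j {} {} = 1\<close>).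
  Continuity of \<open>c_star\<close> is therefore understood relative to this set.\<close>

definition nondegenerate :: "('a::euclidean_space \<Rightarrow> 'a \<Rightarrow> complex) \<Rightarrow> 'a set set" where
  "nondegenerate j = {\<xi> \<in> configs. \<forall>\<Delta>\<in>bdd_borel. kdet j (\<xi> \<inter> \<Delta>) \<noteq> 0}"

end

theory Submission
  imports Defs "Jordan_Normal_Form.Determinant"
begin

text \<open>If no denominator vanishes and \<open>W(\<alpha>, \<xi>)\<close> is bounded, then points outside \<open>W\<close> have distance more
  than \<open>2R\<close> from \<open>\<alpha>\<close> and from the points of \<open>\<xi>\<close> in \<open>W\<close>. Since \<open>J\<close> has range \<open>R\<close>, all determinants factor
  along this separation, and the ratio defining \<open>c_star\<close> is constant once \<open>\<Delta>\<close> contains \<open>\<xi> \<inter> W\<close>. The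
  separation persists under small perturbations of \<open>(\<alpha>, \<xi>)\<close>, so both functionals are locally equal
  to the same quotient of two determinants, which are continuous functions of finitely many points.
  Absence of percolation gives boundedness of \<open>W\<close>, because adding a finite set merges only finitely
  many finite clusters.

  That almost surely no denominator vanishes follows from the correlation formula applied to the
  indicator of the configurations having a subset \<open>\<beta>\<close> with \<open>det J(\<beta>, \<beta>) = 0\<close>, once
  \<open>K(\<alpha>, \<alpha>) \<le> J(\<alpha>, \<alpha>)\<close> as matrices for almost all \<open>\<alpha>\<close>. As operators, \<open>K \<le> J\<close> since
  \<open>J - K = K\<^sup>2 (I - K)\<^sup>-\<^sup>1\<close>. To pass to kernels, both operators are compressed to the functions that
  are constant on the cells of finer and finer finite partitions. The compressed kernels satisfy the
  inequality everywhere; off the diagonal they converge in \<open>L\<^sup>1\<close>, and on the diagonal the trace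
  condition on the kernel of \<open>K\<close> excludes a loss of mass.\<close>

section \<open>Determinants and positive definite matrices\<close>

text \<open>The obstacle is the diagonal. An operator determines its kernel only up to null sets of
  the product space, and the diagonal is such a set, whereas \<open>kdet k \<alpha>\<close> uses the
  diagonal entries. Positive definiteness on two-point sets bounds |k(x,y)| by the mean of k(x,x)
  and k(y,y). Averaged over a cell times itself, this keeps the trace of the compressed operator
  below the integral of the diagonal. The trace condition turns the bound into an equality in the
  limit, and since the bound holds cell by cell, the difference of the two totals already controls
  the error in the mean. Only degeneracy has to pass from J to K: if v is a null vector of J on
  \<beta>, extended by zero to \<alpha>, then 0 \<le> <v, K v> \<le> <v, J v> = 0, and positivity
  makes v a null vector of K on \<alpha>. Continuity is claimed only where \<alpha> and \<xi> are
  disjoint, which holds almost everywhere: a shared point counts once in \<alpha> \<union> \<xi> but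
  can split into two under perturbation.\<close>

lemma kdet_image:
  assumes "finite A" "inj_on s A"
  shows "kdet k (s ` A) = kdet (\<lambda>x y. k (s x) (s y)) A"
proof -
  have bb: "bij_betw s A (s ` A)" using assms by (simp add: inj_on_imp_bij_betw)
  have bi: "bij_betw (inv_into A s) (s ` A) A" using bb by (rule bij_betw_inv_into)
  \<comment> \<open>Conjugation with \<open>s\<close> matches the permutations of the two index
    sets; it keeps the sign and only reorders the factors of each product.\<close>
  show ?thesis unfolding kdet_def
  proof (rule sum.reindex_bij_witness[where j = "map_permutation (s ` A) (inv_into A s)"
        and i = "map_permutation A s"], goal_cases)
    case (1 p)
    then show ?case
      by (intro map_permutation_compose_inv[OF bi]) (auto simp: f_inv_into_f)
  next
    case (2 p)
    then show ?case using map_permutation_permutes[OF bi] by auto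
  next
    case (3 p)
    then show ?case
      by (intro map_permutation_compose_inv[OF bb]) (use assms in auto)
  next
    case (4 p)
    then show ?case using map_permutation_permutes[OF bb] by auto
  next
    case (5 p)
    have "sign (map_permutation (s ` A) (inv_into A s) p) = sign p"
      using 5 assms bi by (intro sign_map_permutation) (auto simp: bij_betw_def)
    moreover have "k (s x) (s (map_permutation (s ` A) (inv_into A s) p x)) = k (s x) (p (s x))"
      if "x \<in> A" for x
    proof -
      have "inj_on (inv_into A s) (s ` A)" using bi by (simp add: bij_betw_def)
      from map_permutation_apply[OF this, of "s x" p] that assms
      have "map_permutation (s ` A) (inv_into A s) p x = inv_into A s (p (s x))" by simp
      moreover have "p (s x) \<in> s ` A" using 5 that by (simp add: permutes_in_image)
      ultimately show ?thesis by (simp add: f_inv_into_f)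
    qed
    ultimately show ?case
      by (simp add: prod.reindex[OF assms(2)])
  qed
qed

text \<open>Bridge from the Leibniz sum over a set of points to matrices, where block determinants
  and null vectors are available. The enumeration \<open>s\<close> is arbitrary because
  \<open>kdet\<close> does not depend on the labelling.\<close>

lemma kdet_eq_det:
  assumes "bij_betw s {0..<n} A"
  shows "kdet k A = det (mat n n (\<lambda>(i, l). k (s i) (s l)))"
proof -
  have "kdet k (s ` {0..<n}) = kdet (\<lambda>x y. k (s x) (s y)) {0..<n}"
    using assms by (intro kdet_image) (auto simp: bij_betw_def)
  also have "\<dots> = det (mat n n (\<lambda>(i, l). k (s i) (s l)))"
    unfolding kdet_def det_def
    by (auto intro!: sum.cong prod.cong simp: permutes_in_image)
  finally show ?thesis using assms by (simp add: bij_betw_def)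
qed

text \<open>One vanishing off-diagonal block makes the matrix block triangular. This is how the
  finite range of \<open>j\<close> decouples distant groups of points.\<close>

lemma kdet_union_block:
  assumes "finite A" "finite B" "A \<inter> B = {}"
    and z: "\<And>x y. x \<in> A \<Longrightarrow> y \<in> B \<Longrightarrow> k x y = 0"
  shows "kdet k (A \<union> B) = kdet k A * kdet k B"
proof -
  obtain f where f: "bij_betw f {0..<card A} A" using assms ex_bij_betw_nat_finite by blast
  obtain g where g: "bij_betw g {0..<card B} B" using assms ex_bij_betw_nat_finite by blast
  define n m where "n = card A" and "m = card B"
  \<comment> \<open>Listing the points of \<open>A\<close> before those of \<open>B\<close> puts the
    zero block in the upper right corner.\<close>
  define s where "s i = (if i < n then f i else g (i - n))" for i
  have fi: "f i \<in> A" if "i < n" for i using f that by (auto simp: bij_betw_def n_def)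
  have gi: "g i \<in> B" if "i < m" for i using g that by (auto simp: bij_betw_def m_def)
  have bs: "bij_betw s {0..<n+m} (A \<union> B)"
  proof -
    have "bij_betw s {0..<n} A = bij_betw f {0..<n} A" by (rule bij_betw_cong) (auto simp: s_def)
    then have "bij_betw s {0..<n} A" using f by (simp add: n_def)
    have "bij_betw (\<lambda>i. i - n) {n..<n+m} {0..<m}"
      by (rule bij_betw_byWitness[where f' = "\<lambda>i. i + n"]) auto
    then have "bij_betw (g \<circ> (\<lambda>i. i - n)) {n..<n+m} B"
      using g unfolding m_def by (rule bij_betw_trans)
    moreover have "bij_betw s {n..<n+m} B = bij_betw (g \<circ> (\<lambda>i. i - n)) {n..<n+m} B"
      by (rule bij_betw_cong) (auto simp: s_def)
    ultimately have "bij_betw s {n..<n+m} B" by simp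
    with \<open>bij_betw s {0..<n} A\<close> have "bij_betw s ({0..<n} \<union> {n..<n+m}) (A \<union> B)"
      using assms(3) by (rule bij_betw_combine)
    moreover have "{0..<n} \<union> {n..<n+m} = {0..<n+m}" by auto
    ultimately show ?thesis by simp
  qed
  let ?A1 = "mat n n (\<lambda>(i, l). k (f i) (f l))"
  let ?A4 = "mat m m (\<lambda>(i, l). k (g i) (g l))"
  let ?A3 = "mat m n (\<lambda>(i, l). k (g i) (f l))"
  have "mat (n+m) (n+m) (\<lambda>(i, l). k (s i) (s l)) = four_block_mat ?A1 (0\<^sub>m n m) ?A3 ?A4"
    by (rule eq_matI) (auto simp: s_def fi gi z)
  moreover have "det (four_block_mat ?A1 (0\<^sub>m n m) ?A3 ?A4) = det ?A1 * det ?A4"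
    by (rule det_four_block_mat_upper_right_zero) auto
  ultimately show ?thesis
    using kdet_eq_det[OF bs] kdet_eq_det[OF f[folded n_def]] kdet_eq_det[OF g[folded m_def]] by simp
qed

text \<open>Null vectors are written as functions on the points themselves, so that a null vector
  for a subset can be extended by zero to a larger set.\<close>

lemma kdet_eq_0_iff:
  assumes "finite A"
  shows "kdet k A = 0 \<longleftrightarrow> (\<exists>v. (\<exists>x\<in>A. v x \<noteq> 0) \<and> (\<forall>x\<in>A. (\<Sum>y\<in>A. k x y * v y) = 0))"
proof -
  obtain f where f: "bij_betw f {0..<card A} A" using assms ex_bij_betw_nat_finite by blast
  define n where "n = card A"
  note f = f[folded n_def]
  let ?M = "mat n n (\<lambda>(i, l). k (f i) (f l))"
  have fA: "A = f ` {0..<n}" using f by (simp add: bij_betw_def)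
  have sumA: "(\<Sum>y\<in>A. h y) = (\<Sum>l = 0..<n. h (f l))" for h :: "_ \<Rightarrow> complex"
    using sum.reindex_bij_betw[OF f, of h] by simp
  have "kdet k A = 0 \<longleftrightarrow> (\<exists>v. v \<in> carrier_vec n \<and> v \<noteq> 0\<^sub>v n \<and> ?M *\<^sub>v v = 0\<^sub>v n)"
    using kdet_eq_det[OF f, of k] det_0_iff_vec_prod_zero[of ?M n] by simp
  also have "\<dots> \<longleftrightarrow> (\<exists>v. (\<exists>x\<in>A. v x \<noteq> 0) \<and> (\<forall>x\<in>A. (\<Sum>y\<in>A. k x y * v y) = 0))"
  proof
    assume "\<exists>v. v \<in> carrier_vec n \<and> v \<noteq> 0\<^sub>v n \<and> ?M *\<^sub>v v = 0\<^sub>v n"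
    then obtain v where v: "v \<in> carrier_vec n" "v \<noteq> 0\<^sub>v n" "?M *\<^sub>v v = 0\<^sub>v n" by blast
    define w where "w x = v $ (inv_into {0..<n} f x)" for x
    have wf: "w (f i) = v $ i" if "i < n" for i
      using f that by (simp add: w_def bij_betw_def)
    from v obtain i where i: "i < n" "v $ i \<noteq> 0" by (auto simp: vec_eq_iff)
    have "(\<Sum>y\<in>A. k x y * w y) = 0" if "x \<in> A" for x
    proof -
      from that fA obtain l where l: "l < n" "x = f l" by auto
      have "(?M *\<^sub>v v) $ l = (\<Sum>i = 0..<n. k (f l) (f i) * v $ i)"
        using l v(1) by (simp add: scalar_prod_def)
      also have "\<dots> = (\<Sum>i = 0..<n. k (f l) (f i) * w (f i))"
        by (intro sum.cong) (auto simp: wf)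
      finally show ?thesis using v(3) l by (simp add: sumA)
    qed
    then show "\<exists>v. (\<exists>x\<in>A. v x \<noteq> 0) \<and> (\<forall>x\<in>A. (\<Sum>y\<in>A. k x y * v y) = 0)"
      using i wf fA by (intro exI[of _ w]) force
  next
    assume "\<exists>v. (\<exists>x\<in>A. v x \<noteq> 0) \<and> (\<forall>x\<in>A. (\<Sum>y\<in>A. k x y * v y) = 0)"
    then obtain v x where v: "x \<in> A" "v x \<noteq> 0" "\<forall>x\<in>A. (\<Sum>y\<in>A. k x y * v y) = 0" by blast
    from v fA obtain l where l: "l < n" "x = f l" by auto
    define w where "w = vec n (\<lambda>i. v (f i))"
    have "?M *\<^sub>v w = 0\<^sub>v n"
    proof (rule eq_vecI)
      fix i assume "i < dim_vec (0\<^sub>v n :: complex vec)"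
      then have i: "i < n" by simp
      then have "(?M *\<^sub>v w) $ i = (\<Sum>l = 0..<n. k (f i) (f l) * v (f l))"
        by (simp add: scalar_prod_def w_def)
      also have "\<dots> = 0" using v(3) i fA sumA by auto
      finally show "(?M *\<^sub>v w) $ i = 0\<^sub>v n $ i" using i by simp
    qed simp
    moreover have "w \<noteq> 0\<^sub>v n" using l v by (auto simp: w_def vec_eq_iff intro!: exI[of _ l])
    ultimately show "\<exists>v. v \<in> carrier_vec n \<and> v \<noteq> 0\<^sub>v n \<and> ?M *\<^sub>v v = 0\<^sub>v n"
      by (intro exI[of _ w]) (auto simp: w_def)
  qed
  finally show ?thesis .
qed

section \<open>Sesquilinear forms and positive semidefinite matrices\<close>

definition qform :: "('a \<Rightarrow> 'a \<Rightarrow> complex) \<Rightarrow> 'a set \<Rightarrow> ('a \<Rightarrow> complex) \<Rightarrow> ('a \<Rightarrow> complex) \<Rightarrow> complex" where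
  "qform k A a b = (\<Sum>x\<in>A. \<Sum>y\<in>A. cnj (a x) * k x y * b y)"

lemma kposdef_qform: "kposdef k A \<longleftrightarrow> (\<forall>c. qform k A c c \<in> \<real>\<^sub>\<ge>\<^sub>0)"
  by (simp add: kposdef_def qform_def)

lemma qform_add_scaled:
  "qform k A (\<lambda>x. v x + t * w x) (\<lambda>x. v x + t * w x) =
     qform k A v v + cnj t * qform k A w v + t * qform k A v w + t * cnj t * qform k A w w"
  by (simp add: qform_def sum.distrib sum_distrib_left algebra_simps)

lemma qform_unit_left:
  assumes "finite A" "z \<in> A"
  shows "qform k A (\<lambda>x. of_bool (x = z)) v = (\<Sum>y\<in>A. k z y * v y)"
proof -
  have "(\<Sum>y\<in>A. cnj (of_bool (x = z)) * k x y * v y) = (if x = z then (\<Sum>y\<in>A. k z y * v y) else 0)" for x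
    by simp
  then show ?thesis using assms by (simp add: qform_def)
qed

text \<open>\<open>kposdef\<close> only demands that the form is real and nonnegative on pairs of
  equal vectors; Hermitian symmetry follows by polarization. Real values at v + w and at v + iw
  settle the imaginary and the real part, respectively.\<close>

lemma kposdef_qform_cnj:
  assumes "kposdef k A"
  shows "qform k A v w = cnj (qform k A w v)"
proof -
  have im: "Im (qform k A c c) = 0" for c
    using assms by (auto simp: kposdef_qform complex_nonneg_Reals_iff)
  from im[of "\<lambda>x. v x + 1 * w x"] im[of v] im[of w]
  have 1: "Im (qform k A w v) + Im (qform k A v w) = 0"
    by (simp only: qform_add_scaled) simp
  from im[of "\<lambda>x. v x + \<i> * w x"] im[of v] im[of w]
  have 2: "Re (qform k A v w) = Re (qform k A w v)"
    by (simp only: qform_add_scaled) simp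
  show ?thesis using 1 2 by (simp add: complex_eq_iff)
qed

text \<open>The Cauchy-Schwarz argument for a semidefinite form: if the form vanished at
  \<open>v\<close> but \<open>v\<close> paired nontrivially with a coordinate vector
  \<open>w\<close>, a small step from \<open>v\<close> along \<open>w\<close> would make the form
  negative.\<close>

lemma kposdef_null_vector:
  assumes pd: "kposdef k A" and fin: "finite A" and 0: "qform k A v v = 0" and z: "z \<in> A"
  shows "(\<Sum>y\<in>A. k z y * v y) = 0"
proof (rule ccontr)
  define w where "w x = (of_bool (x = z) :: complex)" for x
  define q where "q = qform k A w v"
  assume "\<not> ?thesis"
  then have q0: "q \<noteq> 0" using qform_unit_left[OF fin z, of k v] by (simp add: q_def w_def [abs_def])
  define c where "c = Re (qform k A w w)"
  have c0: "c \<ge> 0" using pd by (auto simp: c_def kposdef_qform complex_nonneg_Reals_iff)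
  have cc: "qform k A w w = of_real c"
    using pd by (auto simp: c_def kposdef_qform complex_nonneg_Reals_iff complex_eq_iff)
  \<comment> \<open>Any positive e with e c < 2 would do; the summand 1 covers the case c =
    0.\<close>
  define e where "e = 1 / (c + 1)"
  have e: "e > 0" "e * c < 1" using c0 by (auto simp: e_def field_simps)
  \<comment> \<open>This phase makes both cross terms equal to -e |q|^2, against a quadratic term
    e^2 c |q|^2.\<close>
  define t where "t = - of_real e * q"
  have "qform k A (\<lambda>x. v x + t * w x) (\<lambda>x. v x + t * w x) =
      cnj t * q + t * cnj q + t * cnj t * of_real c"
    using 0 cc kposdef_qform_cnj[OF pd, of v w] by (simp only: qform_add_scaled) (simp add: q_def)
  also have "\<dots> = (- 2 * of_real e + (of_real e)\<^sup>2 * of_real c) * (q * cnj q)"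
    unfolding t_def by (simp add: algebra_simps power2_eq_square)
  also have "q * cnj q = of_real ((cmod q)\<^sup>2)" by (rule complex_norm_square[symmetric])
  also have "(- 2 * of_real e + (of_real e)\<^sup>2 * of_real c) * (of_real ((cmod q)\<^sup>2) :: complex)
      = of_real ((- 2 * e + e\<^sup>2 * c) * (cmod q)\<^sup>2)" by simp
  finally have "qform k A (\<lambda>x. v x + t * w x) (\<lambda>x. v x + t * w x) =
      of_real ((- 2 * e + e\<^sup>2 * c) * (cmod q)\<^sup>2)" .
  moreover have "qform k A (\<lambda>x. v x + t * w x) (\<lambda>x. v x + t * w x) \<in> \<real>\<^sub>\<ge>\<^sub>0"
    using pd by (simp add: kposdef_qform)
  ultimately have "0 \<le> (- 2 * e + e\<^sup>2 * c) * (cmod q)\<^sup>2"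
    by (metis Re_complex_of_real complex_nonneg_Reals_iff)
  also have "\<dots> = e * (cmod q)\<^sup>2 * (e * c - 2)" by (simp add: algebra_simps power2_eq_square)
  also have "\<dots> < 0" using e q0 by (intro mult_pos_neg) auto
  finally show False by simp
qed

lemma kposdef_subset:
  assumes "kposdef k A" "B \<subseteq> A" "finite A"
  shows "kposdef k B"
  unfolding kposdef_def
proof
  fix c :: "_ \<Rightarrow> complex"
  define d where "d x = (if x \<in> B then c x else 0)" for x
  have "(\<Sum>y\<in>A. cnj (d x) * k x y * d y) = (\<Sum>y\<in>B. cnj (d x) * k x y * c y)" for x
    by (rule sum.mono_neutral_cong_right) (use assms in \<open>auto simp: d_def\<close>)
  moreover have "(\<Sum>x\<in>A. \<Sum>y\<in>B. cnj (d x) * k x y * c y) = (\<Sum>x\<in>B. \<Sum>y\<in>B. cnj (c x) * k x y * c y)"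
    by (rule sum.mono_neutral_cong_right) (use assms in \<open>auto simp: d_def\<close>)
  ultimately have "(\<Sum>x\<in>A. \<Sum>y\<in>A. cnj (d x) * k x y * d y) = (\<Sum>x\<in>B. \<Sum>y\<in>B. cnj (c x) * k x y * c y)"
    by simp
  then show "(\<Sum>x\<in>B. \<Sum>y\<in>B. cnj (c x) * k x y * c y) \<in> \<real>\<^sub>\<ge>\<^sub>0"
    using spec[OF assms(1)[unfolded kposdef_def], of d] by simp
qed

text \<open>A null vector of \<open>j\<close> on \<open>B\<close>, extended by zero, need not be a
  null vector of \<open>j\<close> on \<open>A\<close>, but its quadratic form on \<open>A\<close>
  vanishes. The form of \<open>k\<close> lies between 0 and that value, and for semidefinite
  \<open>k\<close> a vanishing form means a null vector.\<close>

lemma kdet_eq_0_mono: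
  assumes k: "kposdef k A" and jk: "kposdef (\<lambda>x y. j x y - k x y) A"
    and fin: "finite A" and B: "B \<subseteq> A" and 0: "kdet j B = 0"
  shows "kdet k A = 0"
proof -
  have finB: "finite B" using B fin finite_subset by blast
  from 0 obtain v x where v: "x \<in> B" "v x \<noteq> 0" "\<forall>x\<in>B. (\<Sum>y\<in>B. j x y * v y) = 0"
    using kdet_eq_0_iff[OF finB] by blast
  define w where "w x = (if x \<in> B then v x else 0)" for x
  have "qform j A w w = (\<Sum>x\<in>B. cnj (v x) * (\<Sum>y\<in>B. j x y * v y))"
  proof -
    have "(\<Sum>y\<in>A. cnj (w x) * j x y * w y) = cnj (w x) * (\<Sum>y\<in>B. j x y * v y)" for x
      unfolding sum_distrib_left
      by (rule sum.mono_neutral_cong_right) (use fin B in \<open>auto simp: w_def\<close>)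
    moreover have "(\<Sum>x\<in>A. cnj (w x) * (\<Sum>y\<in>B. j x y * v y)) = (\<Sum>x\<in>B. cnj (v x) * (\<Sum>y\<in>B. j x y * v y))"
      by (rule sum.mono_neutral_cong_right) (use fin B in \<open>auto simp: w_def\<close>)
    ultimately show ?thesis by (simp add: qform_def)
  qed
  then have jw: "qform j A w w = 0" using v by simp
  have "qform (\<lambda>x y. j x y - k x y) A w w = qform j A w w - qform k A w w"
    by (simp add: qform_def sum_subtractf algebra_simps)
  then have "- qform k A w w \<in> \<real>\<^sub>\<ge>\<^sub>0" using jk jw by (auto simp: kposdef_qform dest!: spec[of _ w])
  moreover have "qform k A w w \<in> \<real>\<^sub>\<ge>\<^sub>0" using k by (simp add: kposdef_qform)
  ultimately have "qform k A w w = 0" by (auto simp: complex_nonneg_Reals_iff complex_eq_iff)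
  then have "\<forall>z\<in>A. (\<Sum>y\<in>A. k z y * w y) = 0" using kposdef_null_vector[OF k fin] by blast
  moreover have "w x \<noteq> 0" "x \<in> A" using v B by (auto simp: w_def)
  ultimately show ?thesis using kdet_eq_0_iff[OF fin] by blast
qed

lemma kposdef_diag:
  assumes "kposdef k A" "finite A" "x \<in> A"
  shows "k x x \<in> \<real>\<^sub>\<ge>\<^sub>0"
proof -
  have "qform k A (\<lambda>z. of_bool (z = x)) (\<lambda>z. of_bool (z = x)) = k x x"
    using assms by (subst qform_unit_left) (auto simp: of_bool_def if_distrib cong: if_cong)
  then show ?thesis using assms by (metis kposdef_qform)
qed

lemma kposdef_hermitian:
  assumes "kposdef k A" "finite A" "x \<in> A" "y \<in> A"
  shows "k x y = cnj (k y x)"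
proof -
  have "qform k A (\<lambda>z. of_bool (z = x)) (\<lambda>z. of_bool (z = y)) = k x y" if "x \<in> A" "y \<in> A" for x y
    using that assms(2) by (subst qform_unit_left) (auto simp: of_bool_def if_distrib cong: if_cong)
  then show ?thesis using kposdef_qform_cnj[OF assms(1)] assms by metis
qed

text \<open>Cholesky elimination of one point at a time: subtracting a rank-one term removes the row
  and column of \<open>z\<close>, and the remaining Schur complement is again positive semidefinite.
  The functions \<open>b r\<close> are the rank-one summands to which Bessel's inequality is applied
  in \<open>trace_bound\<close>.\<close>

lemma kposdef_factorization:
  assumes "finite A" "kposdef k A"
  shows "\<exists>N b. \<forall>x\<in>A. \<forall>y\<in>A. k x y = (\<Sum>r<(N::nat). b r x * cnj (b r y))"
  using assms
proof (induction A arbitrary: k rule: finite_induct)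
  case empty
  then show ?case by simp
next
  case (insert z A)
  let ?Z = "insert z A"
  have finZ: "finite ?Z" using insert by simp
  note pd = insert.prems
  have herm: "\<And>x y. x \<in> ?Z \<Longrightarrow> y \<in> ?Z \<Longrightarrow> k x y = cnj (k y x)"
    using kposdef_hermitian[OF pd finZ] by blast
  have diag: "k z z \<in> \<real>\<^sub>\<ge>\<^sub>0" using kposdef_diag[OF pd finZ] by simp
  show ?case
  proof (cases "k z z = 0")
    \<comment> \<open>A zero pivot forces the whole row and column of \<open>z\<close> to vanish, so
      every factor is set to 0 at \<open>z\<close>.\<close>
    case True
    have "qform k ?Z (\<lambda>y. of_bool (y = z)) (\<lambda>y. of_bool (y = z)) = 0"
      using True insert(1) finZ
      by (subst qform_unit_left) (auto simp: of_bool_def if_distrib insert(2) cong: if_cong)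
    from kposdef_null_vector[OF pd finZ this]
    have kz: "k x z = 0" if "x \<in> ?Z" for x
      using that finZ by (auto simp: of_bool_def if_distrib cong: if_cong simp del: sum.insert)
    have kz': "k z x = 0" if "x \<in> ?Z" for x using kz[OF that] herm[of z x] that by simp
    have "kposdef k A" using kposdef_subset[OF pd _ finZ] by auto
    from insert.IH[OF this] obtain N b where b: "\<forall>x\<in>A. \<forall>y\<in>A. k x y = (\<Sum>r<(N::nat). b r x * cnj (b r y))"
      by blast
    show ?thesis
    proof (rule exI[of _ N], rule exI[of _ "\<lambda>r x. if x = z then 0 else b r x"], intro ballI)
      fix x y assume xy: "x \<in> ?Z" "y \<in> ?Z"
      show "k x y = (\<Sum>r<N. (if x = z then 0 else b r x) * cnj (if y = z then 0 else b r y))"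
      proof (cases "x = z \<or> y = z")
        case True
        then show ?thesis using kz kz' xy by auto
      next
        case False
        then show ?thesis using b xy by simp
      qed
    qed
  next
    case False
    define a where "a = Re (k z z)"
    have a: "a > 0" "k z z = of_real a"
      using False diag by (auto simp: a_def complex_nonneg_Reals_iff complex_eq_iff)
    define c where "c x = k x z / of_real (sqrt a)" for x
    define k' where "k' x y = k x y - c x * cnj (c y)" for x y
    have cc: "c x * cnj (c y) = k x z * cnj (k y z) / of_real a" for x y
      using a by (simp add: c_def flip: of_real_mult)
    have "kposdef k' A"
      unfolding kposdef_qform
    proof
      fix v :: "_ \<Rightarrow> complex"
      define s where "s = (\<Sum>y\<in>A. k z y * v y)"
      have s': "(\<Sum>x\<in>A. cnj (v x) * k x z) = cnj s"
        unfolding s_def cnj_sum using herm[of _ z] by (intro sum.cong) (auto simp: mult.commute)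
      \<comment> \<open>This value at \<open>z\<close> minimizes the form of \<open>k\<close> for
        given \<open>v\<close> on \<open>A\<close>: it cancels the row of \<open>z\<close>, and what
        remains is exactly the form of the Schur complement \<open>k'\<close>.\<close>
      define w where "w x = (if x = z then - s / of_real a else v x)" for x
      have sw: "(\<Sum>x\<in>A. h x * w x) = (\<Sum>x\<in>A. h x * v x)"
        "(\<Sum>x\<in>A. cnj (w x) * h x) = (\<Sum>x\<in>A. cnj (v x) * h x)" for h
        using insert(2) by (auto intro!: sum.cong simp: w_def)
      have "qform k ?Z w w = cnj (w z) * (k z z * w z + s) + (\<Sum>x\<in>A. cnj (w x) * (k x z * w z + (\<Sum>y\<in>A. k x y * v y)))"
        using insert(1,2) by (simp add: qform_def s_def sw mult.assoc flip: sum_distrib_left distrib_left)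
      also have "k z z * w z + s = 0" using a by (simp add: w_def)
      also have "(\<Sum>x\<in>A. cnj (w x) * (k x z * w z + (\<Sum>y\<in>A. k x y * v y)))
          = cnj s * w z + qform k A v v"
        unfolding sw by (simp add: qform_def distrib_left sum.distrib sum_distrib_left sum_distrib_right
            mult.assoc flip: s')
      also have "w z = - s / of_real a" by (simp add: w_def)
      finally have 1: "qform k ?Z w w = qform k A v v - s * cnj s / of_real a" by simp
      have "qform k' A v v = qform k A v v - (\<Sum>x\<in>A. \<Sum>y\<in>A. cnj (v x) * k x z * (cnj (k y z) * v y)) / of_real a"
        by (simp add: qform_def k'_def cc sum_subtractf left_diff_distrib right_diff_distrib
            sum_divide_distrib mult_ac)
      also have "(\<Sum>x\<in>A. \<Sum>y\<in>A. cnj (v x) * k x z * (cnj (k y z) * v y)) = cnj s * (\<Sum>y\<in>A. cnj (k y z) * v y)"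
        by (simp only: s'[symmetric] sum_product)
      also have "(\<Sum>y\<in>A. cnj (k y z) * v y) = s"
        unfolding s_def using herm[of z] by (intro sum.cong) auto
      finally have "qform k' A v v = qform k ?Z w w" using 1 by (simp add: mult.commute)
      then show "qform k' A v v \<in> \<real>\<^sub>\<ge>\<^sub>0" using pd by (simp add: kposdef_qform)
    qed
    from insert.IH[OF this] obtain N b where b: "\<forall>x\<in>A. \<forall>y\<in>A. k' x y = (\<Sum>r<(N::nat). b r x * cnj (b r y))"
      by blast
    have kz: "k x z = c x * cnj (c z)" "k z x = c z * cnj (c x)" if "x \<in> ?Z" for x
      using a herm[of z x] that by (auto simp: cc)
    show ?thesis
    proof (rule exI[of _ "Suc N"], rule exI[of _ "\<lambda>r x. if r < N then (if x = z then 0 else b r x) else c x"],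
        intro ballI)
      fix x y assume xy: "x \<in> ?Z" "y \<in> ?Z"
      show "k x y = (\<Sum>r<Suc N. (if r < N then if x = z then 0 else b r x else c x) *
          cnj (if r < N then if y = z then 0 else b r y else c y))"
      proof (cases "x = z \<or> y = z")
        case True
        then show ?thesis using kz xy by auto
      next
        case False
        then have "k x y = k' x y + c x * cnj (c y)" "x \<in> A" "y \<in> A" using xy by (auto simp: k'_def)
        then show ?thesis using b False by simp
      qed
    qed
  qed
qed

text \<open>The determinant is a polynomial in continuous entries. The index set stays
  \<open>A\<close> while the points move, so the estimate makes sense before the moved points are
  known to be distinct; \<open>kdet_image\<close> then turns it into the determinant of the moved
  set.\<close>

lemma kdet_perturb:
  fixes k :: "'a::metric_space \<Rightarrow> 'a \<Rightarrow> complex"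
  assumes "finite A" "continuous_on UNIV (\<lambda>(x, y). k x y)" "e > 0"
  shows "\<exists>d>0. \<forall>s. (\<forall>a\<in>A. dist (s a) a < d) \<longrightarrow> cmod (kdet (\<lambda>x y. k (s x) (s y)) A - kdet k A) < e"
proof (rule ccontr)
  assume "\<not> ?thesis"
  then have "\<forall>d>0. \<exists>s. (\<forall>a\<in>A. dist (s a) a < d) \<and> \<not> cmod (kdet (\<lambda>x y. k (s x) (s y)) A - kdet k A) < e"
    by blast
  then have "\<forall>n. \<exists>s. (\<forall>a\<in>A. dist (s a) a < 1 / Suc n) \<and> \<not> cmod (kdet (\<lambda>x y. k (s x) (s y)) A - kdet k A) < e"
    by simp
  then obtain s where s: "\<And>n a. a \<in> A \<Longrightarrow> dist (s n a) a < 1 / Suc n"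
    and far: "\<And>n. \<not> cmod (kdet (\<lambda>x y. k (s n x) (s n y)) A - kdet k A) < e"
    by metis
  have lim: "(\<lambda>n. s n a) \<longlonglongrightarrow> a" if "a \<in> A" for a
  proof (rule tendstoI)
    fix r :: real assume "r > 0"
    then have "eventually (\<lambda>n. 1 / real (Suc n) < r) sequentially"
      using order_tendstoD(2)[OF LIMSEQ_inverse_real_of_nat] by (simp add: inverse_eq_divide)
    then show "eventually (\<lambda>n. dist (s n a) a < r) sequentially"
      by eventually_elim (use s[OF that] in \<open>metis order.strict_trans\<close>)
  qed
  have limk: "(\<lambda>n. k (s n a) (s n b)) \<longlonglongrightarrow> k a b" if "a \<in> A" "b \<in> A" for a b
  proof -
    have "(\<lambda>n. (s n a, s n b)) \<longlonglongrightarrow> (a, b)" using lim that by (intro tendsto_Pair)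
    from continuous_on_tendsto_compose[OF assms(2) this] show ?thesis by simp
  qed
  have "(\<lambda>n. kdet (\<lambda>x y. k (s n x) (s n y)) A) \<longlonglongrightarrow> kdet k A"
    unfolding kdet_def
    by (intro tendsto_sum tendsto_mult tendsto_prod tendsto_const limk) (auto simp: permutes_in_image)
  from tendstoD[OF this assms(3)] far show False
    by (auto simp: dist_norm eventually_sequentially)
qed

section \<open>Clusters and neighbourhoods of configurations\<close>

lemma finite_config_cball:
  assumes "\<xi> \<in> configs" shows "finite (\<xi> \<inter> cball x r)"
  using assms by (auto simp: configs_def bdd_borel_def)

lemma finite_config_bounded:
  assumes "\<xi> \<in> configs" "bounded S" shows "finite (\<xi> \<inter> S)"
proof -
  obtain r where "S \<subseteq> cball 0 r" using assms(2) by (auto simp: bounded_iff subset_iff)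
  then show ?thesis using finite_config_cball[OF assms(1), of 0 r] by (meson Int_mono finite_subset order_refl)
qed

lemma configs_subset: "\<xi> \<in> configs \<Longrightarrow> \<eta> \<subseteq> \<xi> \<Longrightarrow> \<eta> \<in> configs"
  unfolding configs_def by (auto intro: finite_subset[OF Int_mono])

lemma configs_finite: "finite \<xi> \<Longrightarrow> \<xi> \<in> configs"
  by (simp add: configs_def)

lemma configs_Un: "\<xi> \<in> configs \<Longrightarrow> \<eta> \<in> configs \<Longrightarrow> \<xi> \<union> \<eta> \<in> configs"
  by (simp add: configs_def Int_Un_distrib2)

text \<open>The balls form a locally finite family: a ball of radius \<open>R\<close> that comes
  within distance 1 of \<open>x\<close> has its centre within R + 1 of \<open>x\<close>, which
  leaves finitely many.\<close>

lemma closed_boolean_model: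
  assumes "\<xi> \<in> configs"
  shows "closed (boolean_model R \<xi>)"
proof -
  have "open (- boolean_model R \<xi>)"
    unfolding open_contains_ball
  proof
    fix x assume x: "x \<in> - boolean_model R \<xi>"
    define F where "F = \<xi> \<inter> cball x (R + 1)"
    have "finite F" unfolding F_def using assms by (rule finite_config_cball)
    then have "open (- (\<Union>y\<in>F. cball y R))" by (intro open_Compl closed_UN) auto
    moreover have "x \<in> - (\<Union>y\<in>F. cball y R)" using x by (auto simp: boolean_model_def F_def)
    ultimately obtain e where e: "e > 0" "ball x e \<subseteq> - (\<Union>y\<in>F. cball y R)"
      by (meson openE)
    have "ball x (min e 1) \<subseteq> - boolean_model R \<xi>"
    proof
      fix z assume z: "z \<in> ball x (min e 1)"
      show "z \<in> - boolean_model R \<xi>"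
      proof
        assume "z \<in> boolean_model R \<xi>"
        then obtain y where y: "y \<in> \<xi>" "dist y z \<le> R" by (auto simp: boolean_model_def)
        then have "dist x y \<le> R + 1" using z dist_triangle[of x y z] by (simp add: dist_commute)
        then have "y \<in> F" using y by (simp add: F_def)
        then show False using e z y by auto
      qed
    qed
    then show "\<exists>e>0. ball x e \<subseteq> - boolean_model R \<xi>" using e(1) by (intro exI[of _ "min e 1"]) auto
  qed
  then show ?thesis by (simp add: closed_open)
qed

lemma cball_cluster:
  assumes C: "C \<in> clusters R \<xi>" and y: "y \<in> \<xi>" "cball y R \<inter> C \<noteq> {}"
  shows "cball y R \<subseteq> C"
proof -
  have "cball y R \<subseteq> boolean_model R \<xi>" using y by (auto simp: boolean_model_def)
  moreover have "connected (cball y R)" by simp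
  ultimately show ?thesis
    using C y(2) unfolding clusters_def by (metis Int_commute components_maximal)
qed

text \<open>Two closed balls whose centres are at most 2R apart share the midpoint of the centres,
  hence lie in the same component.\<close>

lemma cluster_neighbour:
  fixes \<xi> :: "'a::euclidean_space set"
  assumes C: "C \<in> clusters R \<xi>" and y: "y \<in> \<xi>" "y \<in> C" and z: "z \<in> \<xi>" "dist y z \<le> 2 * R" and R: "R \<ge> 0"
  shows "z \<in> C"
proof -
  have "y \<in> cball y R \<inter> C" using y R by simp
  then have "cball y R \<inter> C \<noteq> {}" by blast
  from cball_cluster[OF C y(1) this] have "cball y R \<subseteq> C" .
  moreover have "midpoint y z \<in> cball y R" "midpoint y z \<in> cball z R"
    using z(2) by (auto simp: dist_midpoint)
  ultimately have "cball z R \<inter> C \<noteq> {}" by blast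
  from cball_cluster[OF C z(1) this] R show ?thesis by auto
qed

lemma W_set_superset:
  assumes "R \<ge> 0" shows "\<alpha> \<subseteq> W_set R \<alpha> \<xi>"
proof
  fix a assume a: "a \<in> \<alpha>"
  then have "a \<in> boolean_model R (\<alpha> \<union> \<xi>)" using assms by (force simp: boolean_model_def)
  then obtain C where "C \<in> clusters R (\<alpha> \<union> \<xi>)" "a \<in> C"
    unfolding clusters_def by (metis Union_components Union_iff)
  then show "a \<in> W_set R \<alpha> \<xi>" using a by (auto simp: W_set_def)
qed

lemma W_set_neighbour:
  fixes \<alpha> \<xi> :: "'a::euclidean_space set"
  assumes "R \<ge> 0" "y \<in> \<alpha> \<union> \<xi>" "y \<in> W_set R \<alpha> \<xi>" "z \<in> \<alpha> \<union> \<xi>" "dist y z \<le> 2 * R"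
  shows "z \<in> W_set R \<alpha> \<xi>"
  using assms cluster_neighbour[of _ R "\<alpha> \<union> \<xi>" y z] unfolding W_set_def by blast

text \<open>A subset of the points containing \<open>\<alpha>\<close> that no edge of the \<open>2R\<close>-graph leaves has balls
  separated from all other balls, so it captures \<open>W\<close>.\<close>

lemma W_set_subset:
  fixes \<alpha> \<xi> :: "'a::euclidean_space set"
  assumes fin: "\<alpha> \<in> configs" "\<xi> \<in> configs" and S: "\<alpha> \<subseteq> S" "S \<subseteq> \<alpha> \<union> \<xi>"
    and far: "\<And>y s. y \<in> \<xi> - S \<Longrightarrow> s \<in> S \<Longrightarrow> dist y s > 2 * R" and R: "R \<ge> 0"
  shows "W_set R \<alpha> \<xi> \<subseteq> boolean_model R S"
proof
  fix x assume "x \<in> W_set R \<alpha> \<xi>"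
  then obtain C a where C: "C \<in> clusters R (\<alpha> \<union> \<xi>)" "a \<in> C" "a \<in> \<alpha>" "x \<in> C" by (auto simp: W_set_def)
  define B1 B2 where "B1 = boolean_model R S" and "B2 = boolean_model R (\<xi> - S)"
  have cS: "S \<in> configs" "\<xi> - S \<in> configs"
    using configs_subset[OF configs_Un[OF fin] S(2)] configs_subset[OF fin(2)] by auto
  have cl: "closed B1" "closed B2" unfolding B1_def B2_def using cS closed_boolean_model by auto
  have disj: "B1 \<inter> B2 = {}"
  proof (rule ccontr)
    assume "B1 \<inter> B2 \<noteq> {}"
    then obtain z where z: "z \<in> B1" "z \<in> B2" by blast
    from z(1) obtain s where "s \<in> S" "dist s z \<le> R" by (auto simp: B1_def boolean_model_def)
    moreover from z(2) obtain y where "y \<in> \<xi> - S" "dist y z \<le> R"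
      by (auto simp: B2_def boolean_model_def)
    ultimately show False using far[of y s] dist_triangle[of y s z] by (simp add: dist_commute)
  qed
  have "C \<subseteq> boolean_model R (\<alpha> \<union> \<xi>)" using C(1) unfolding clusters_def by (rule in_components_subset)
  also have "\<dots> \<subseteq> B1 \<union> B2" using S by (auto simp: B1_def B2_def boolean_model_def)
  finally have sub: "C \<subseteq> B1 \<union> B2" .
  have "connected C" using C(1) unfolding clusters_def by (rule in_components_connected)
  moreover have "a \<in> B1 \<inter> C" using C S R by (force simp: B1_def boolean_model_def)
  ultimately have "B2 \<inter> C = {}" using cl disj sub unfolding connected_closed by blast
  then show "x \<in> boolean_model R S" using C sub by (auto simp: B1_def)
qed

lemma bounded_boolean_model:
  assumes "finite S" shows "bounded (boolean_model R S)"
  using assms by (auto simp: boolean_model_def)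

lemma bounded_W_set:
  fixes \<alpha> \<xi> :: "'a::euclidean_space set"
  assumes fin: "finite \<alpha>" "\<xi> \<in> configs" and R: "R \<ge> 0" and np: "\<not> has_infinite_cluster R \<xi>"
  shows "bounded (W_set R \<alpha> \<xi>)"
proof -
  define N where "N = \<xi> \<inter> (\<Union>a\<in>\<alpha>. cball a (2 * R))"
  have "finite N" unfolding N_def using fin by (intro finite_config_bounded) auto
  define Cl where "Cl x = connected_component_set (boolean_model R \<xi>) x" for x
  have inB: "x \<in> boolean_model R \<xi>" if "x \<in> \<xi>" for x using that R by (force simp: boolean_model_def)
  have Cl: "Cl x \<in> clusters R \<xi>" "x \<in> Cl x" if "x \<in> \<xi>" for x
    using inB[OF that] by (auto simp: Cl_def clusters_def components_def connected_component_refl_eq)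
  \<comment> \<open>\<open>N\<close> collects the points that \<open>\<alpha>\<close> reaches
    directly. Adding their clusters in \<open>\<xi>\<close> gives a finite set that no step of
    length at most 2R leaves.\<close>
  define S where "S = \<alpha> \<union> (\<Union>x\<in>N. \<xi> \<inter> Cl x)"
  have "finite (\<xi> \<inter> Cl x)" if "x \<in> N" for x
    using np Cl(1)[of x] that by (auto simp: has_infinite_cluster_def N_def)
  with \<open>finite N\<close> have "finite (\<Union>x\<in>N. \<xi> \<inter> Cl x)" by (rule finite_UN_I)
  then have finS: "finite S" unfolding S_def using fin(1) by (simp only: finite_Un)
  have "W_set R \<alpha> \<xi> \<subseteq> boolean_model R S"
  proof (rule W_set_subset)
    fix y s assume y: "y \<in> \<xi> - S" and s: "s \<in> S"
    show "2 * R < dist y s"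
    proof (rule ccontr)
      assume "\<not> 2 * R < dist y s"
      then have d: "dist s y \<le> 2 * R" by (simp add: dist_commute)
      show False
      proof (cases "s \<in> \<alpha>")
        case True
        then have "y \<in> N" using d y by (auto simp: N_def)
        then show False using Cl(2)[of y] y by (auto simp: S_def)
      next
        case False
        then obtain x where x: "x \<in> N" "s \<in> \<xi>" "s \<in> Cl x" using s by (auto simp: S_def)
        then have "y \<in> Cl x" using cluster_neighbour[OF Cl(1) x(2,3) _ d R] y by (auto simp: N_def)
        then show False using x y by (auto simp: S_def)
      qed
    qed
  qed (use fin R in \<open>auto simp: S_def configs_finite\<close>)
  then show ?thesis using bounded_boolean_model[OF finS] bounded_subset by blast
qed

subsection \<open>Neighbourhoods of configurations\<close>

lemma infsum_finite_support:
  fixes f :: "'a \<Rightarrow> real"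
  assumes "finite {x\<in>\<xi>. f x \<noteq> 0}"
  shows "(\<Sum>\<^sub>\<infinity>x\<in>\<xi>. f x) = (\<Sum>x\<in>{x\<in>\<xi>. f x \<noteq> 0}. f x)"
proof -
  have "(\<Sum>\<^sub>\<infinity>x\<in>\<xi>. f x) = (\<Sum>\<^sub>\<infinity>x\<in>{x\<in>\<xi>. f x \<noteq> 0}. f x)"
    by (rule infsum_cong_neutral) auto
  then show ?thesis using assms by simp
qed

lemma openin_config_topology:
  "f \<in> \<Phi> \<Longrightarrow> open U \<Longrightarrow> openin (config_topology C \<Phi>) {\<xi> \<in> C. (\<Sum>\<^sub>\<infinity>x\<in>\<xi>. f x) \<in> U}"
  unfolding config_topology_def by (intro topology_generated_by_Basis) auto

abbreviation test_functions :: "('a::euclidean_space \<Rightarrow> real) set" where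
  "test_functions \<equiv> {f. continuous_on UNIV f \<and> compact (closure {x. f x \<noteq> 0})}"

text \<open>Stated for every class \<open>\<Phi>\<close> that contains the compactly supported test
  functions, so that the vague and the weak topology can share the neighbourhood lemmas.\<close>

lemma topspace_config_topology:
  assumes "test_functions \<subseteq> \<Phi>" shows "topspace (config_topology C \<Phi>) = C"
proof -
  have "(\<lambda>x. 0) \<in> \<Phi>" using assms by auto
  then have "C \<in> {{\<xi> \<in> C. (\<Sum>\<^sub>\<infinity>x\<in>\<xi>. f x) \<in> U} | f U. f \<in> \<Phi> \<and> open U}"
    by (intro CollectI exI[of _ "\<lambda>x. 0"] exI[of _ UNIV]) auto
  then show ?thesis
    unfolding config_topology_def topology_generated_by_topspace by auto
qed

lemma test_functions_weak: "test_functions \<subseteq> {f. continuous_on UNIV f \<and> bounded (range f)}"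
proof safe
  fix f :: "'a \<Rightarrow> real" assume f: "continuous_on UNIV f" "compact (closure {x. f x \<noteq> 0})"
  have "bounded (f ` closure {x. f x \<noteq> 0})"
    using f continuous_on_subset by (intro compact_imp_bounded compact_continuous_image) blast+
  then have "bounded (insert 0 (f ` closure {x. f x \<noteq> 0}))" by simp
  moreover have "range f \<subseteq> insert 0 (f ` closure {x. f x \<noteq> 0})" using closure_subset[of "{x. f x \<noteq> 0}"] by auto
  ultimately show "bounded (range f)" using bounded_subset by blast
qed

lemma topspace_vague [simp]: "topspace vague_topology = configs"
  unfolding vague_topology_def by (rule topspace_config_topology) auto

lemma topspace_weak [simp]: "topspace weak_topology = fin_configs"
  unfolding weak_topology_def by (rule topspace_config_topology[OF test_functions_weak])

lemma finite_support_config: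
  assumes "\<xi> \<in> configs" "f \<in> test_functions"
  shows "finite {x\<in>\<xi>. f x \<noteq> 0}"
proof -
  have "bounded {x. f x \<noteq> 0}" using assms(2) compact_closure by auto
  from finite_config_bounded[OF assms(1) this] show ?thesis by (simp add: Int_def)
qed

lemma test_functionI:
  assumes "continuous_on UNIV f" "\<And>x. f x \<noteq> 0 \<Longrightarrow> x \<in> cball a r"
  shows "f \<in> test_functions"
  using assms by (auto simp: compact_closure intro!: bounded_subset[OF bounded_cball[of a r]])

text \<open>The tent function is positive exactly on the open ball, so a positive sum means that
  some point lies there.\<close>

lemma openin_hit:
  assumes C: "C \<subseteq> configs" and \<Phi>: "test_functions \<subseteq> \<Phi>" and r: "r > 0"
  shows "openin (config_topology C \<Phi>) {\<xi> \<in> C. \<xi> \<inter> ball a r \<noteq> {}}"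
proof -
  define f where "f x = max 0 (r - dist x a)" for x
  have f: "f \<in> test_functions"
    unfolding f_def by (rule test_functionI[of _ a r]) (auto intro!: continuous_intros simp: dist_commute split: if_splits)
  have "{\<xi> \<in> C. \<xi> \<inter> ball a r \<noteq> {}} = {\<xi> \<in> C. (\<Sum>\<^sub>\<infinity>x\<in>\<xi>. f x) \<in> {0<..}}"
  proof (intro Collect_cong conj_cong refl)
    fix \<xi> assume "\<xi> \<in> C"
    then have fin: "finite {x\<in>\<xi>. f x \<noteq> 0}" using finite_support_config f C by auto
    have "{x\<in>\<xi>. f x \<noteq> 0} = \<xi> \<inter> ball a r" by (auto simp: f_def dist_commute)
    moreover have "(\<Sum>x\<in>{x\<in>\<xi>. f x \<noteq> 0}. f x) > 0 \<longleftrightarrow> {x\<in>\<xi>. f x \<noteq> 0} \<noteq> {}"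
    proof
      assume "{x\<in>\<xi>. f x \<noteq> 0} \<noteq> {}"
      then show "(\<Sum>x\<in>{x\<in>\<xi>. f x \<noteq> 0}. f x) > 0" using fin
        by (intro sum_pos) (auto simp: f_def)
    next
      assume "(\<Sum>x\<in>{x\<in>\<xi>. f x \<noteq> 0}. f x) > 0"
      then show "{x\<in>\<xi>. f x \<noteq> 0} \<noteq> {}" by (metis less_irrefl sum.empty)
    qed
    ultimately show "\<xi> \<inter> ball a r \<noteq> {} \<longleftrightarrow> (\<Sum>\<^sub>\<infinity>x\<in>\<xi>. f x) \<in> {0<..}"
      by (simp add: infsum_finite_support[OF fin])
  qed
  then show ?thesis using openin_config_topology[of f \<Phi> "{0<..}" C] f \<Phi> by auto
qed

text \<open>The bump is 1 on the ball of radius \<open>r\<close> and vanishes outside radius 2r. At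
  \<open>\<xi>\<close> only \<open>a\<close> can contribute, so the sum is at most 1, while two
  points in the small ball would give at least 2; the threshold 3/2 separates the two cases.\<close>

lemma nhd_unique:
  assumes C: "C \<subseteq> configs" and \<Phi>: "test_functions \<subseteq> \<Phi>" and r: "r > 0"
    and \<xi>: "\<xi> \<in> C" and a: "\<And>b. b \<in> \<xi> \<Longrightarrow> b \<noteq> a \<Longrightarrow> dist a b > 2 * r"
  shows "\<exists>V. openin (config_topology C \<Phi>) V \<and> \<xi> \<in> V \<and>
    (\<forall>\<xi>'\<in>V. \<forall>x\<in>\<xi>'. \<forall>y\<in>\<xi>'. dist x a < r \<longrightarrow> dist y a < r \<longrightarrow> x = y)"
proof -
  define f where "f x = max 0 (min 1 (2 - dist x a / r))" for x
  have f: "f \<in> test_functions"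
  proof (rule test_functionI[of _ a "2 * r"])
    show "continuous_on UNIV f" unfolding f_def using r by (intro continuous_intros) auto
    show "x \<in> cball a (2 * r)" if "f x \<noteq> 0" for x
    proof -
      have "dist x a / r < 2" using that by (auto simp: f_def max_def min_def split: if_splits)
      then show ?thesis using r by (simp add: field_simps dist_commute)
    qed
  qed
  define V where "V = {\<xi> \<in> C. (\<Sum>\<^sub>\<infinity>x\<in>\<xi>. f x) \<in> {..<3/2}}"
  have "openin (config_topology C \<Phi>) V"
    unfolding V_def using f \<Phi> by (intro openin_config_topology) auto
  moreover have "\<xi> \<in> V"
  proof -
    have fin: "finite {x\<in>\<xi>. f x \<noteq> 0}" using finite_support_config f C \<xi> by auto
    have "{x\<in>\<xi>. f x \<noteq> 0} \<subseteq> {a}"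
    proof
      fix x assume x: "x \<in> {x\<in>\<xi>. f x \<noteq> 0}"
      then have "dist x a / r < 2" by (auto simp: f_def max_def min_def split: if_splits)
      then have "dist a x < 2 * r" using r by (simp add: field_simps dist_commute)
      then show "x \<in> {a}" using a[of x] x by auto
    qed
    then have "(\<Sum>x\<in>{x\<in>\<xi>. f x \<noteq> 0}. f x) \<le> (\<Sum>x\<in>{a}. f x)"
      by (intro sum_mono2) (auto simp: f_def)
    also have "\<dots> \<le> 1" by (simp add: f_def)
    finally show ?thesis using \<xi> by (simp add: V_def infsum_finite_support[OF fin])
  qed
  moreover have "x = y" if V: "\<xi>' \<in> V" and xy: "x \<in> \<xi>'" "y \<in> \<xi>'" "dist x a < r" "dist y a < r" for \<xi>' x y
  proof (rule ccontr)
    assume ne: "x \<noteq> y"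
    have fin: "finite {x\<in>\<xi>'. f x \<noteq> 0}" using finite_support_config f C V by (auto simp: V_def)
    have 1: "f x = 1" "f y = 1" using xy r by (auto simp: f_def field_simps)
    have "2 = (\<Sum>x\<in>{x, y}. f x)" using 1 ne by simp
    also have "\<dots> \<le> (\<Sum>x\<in>{x\<in>\<xi>'. f x \<noteq> 0}. f x)"
      by (rule sum_mono2[OF fin]) (use xy 1 in \<open>auto simp: f_def\<close>)
    finally show False using V by (simp add: V_def infsum_finite_support[OF fin])
  qed
  ultimately show ?thesis by blast
qed

text \<open>If \<open>g\<close> vanishes on \<open>\<xi>\<close>, its sum is 0 there and below 1 on
  a neighbourhood; since \<open>g\<close> is nonnegative, each single value is then below 1. Finite
  supports turn the infinite sums into finite ones.\<close>

lemma nhd_avoid: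
  assumes g: "g \<in> \<Phi>" and pos: "\<And>x. g x \<ge> 0" and fin: "\<And>\<xi>. \<xi> \<in> C \<Longrightarrow> finite {x\<in>\<xi>. g x \<noteq> 0}"
    and \<xi>: "\<xi> \<in> C" and 0: "\<And>x. x \<in> \<xi> \<Longrightarrow> g x = (0::real)"
  shows "\<exists>V. openin (config_topology C \<Phi>) V \<and> \<xi> \<in> V \<and> (\<forall>\<xi>'\<in>V. \<forall>x\<in>\<xi>'. g x < 1)"
proof -
  define V where "V = {\<xi> \<in> C. (\<Sum>\<^sub>\<infinity>x\<in>\<xi>. g x) \<in> {..<1}}"
  have "openin (config_topology C \<Phi>) V"
    unfolding V_def using g by (intro openin_config_topology) auto
  moreover have "\<xi> \<in> V"
  proof -
    have "(\<Sum>\<^sub>\<infinity>x\<in>\<xi>. g x) = 0" using 0 by (rule infsum_0)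
    then show ?thesis using \<xi> by (simp add: V_def)
  qed
  moreover have "g x < 1" if V: "\<xi>' \<in> V" and x: "x \<in> \<xi>'" for \<xi>' x
  proof (cases "g x = 0")
    case False
    have fin': "finite {x\<in>\<xi>'. g x \<noteq> 0}" using fin V by (auto simp: V_def)
    have "g x \<le> (\<Sum>x\<in>{x\<in>\<xi>'. g x \<noteq> 0}. g x)"
      by (rule member_le_sum) (use x False pos fin' in auto)
    then show ?thesis using V by (simp add: V_def infsum_finite_support[OF fin'])
  qed simp
  ultimately show ?thesis by blast
qed

text \<open>\<open>g\<close> is a cutoff, 1 up to radius M - 1 and 0 beyond M, times a product that
  vanishes at the points of \<open>\<xi>\<close>. A point inside radius M - 1 and at distance at
  least \<open>r\<close> from all of them would have value 1, which \<open>nhd_avoid\<close>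
  forbids.\<close>

lemma vague_nhd_near:
  fixes \<xi> :: "'a::euclidean_space set"
  assumes \<xi>: "\<xi> \<in> configs" and r: "r > 0"
  shows "\<exists>V. openin vague_topology V \<and> \<xi> \<in> V \<and>
    (\<forall>\<xi>'\<in>V. \<forall>x\<in>\<xi>'. norm x \<le> M - 1 \<longrightarrow> (\<exists>a\<in>\<xi> \<inter> cball 0 M. dist x a < r))"
proof -
  define A where "A = \<xi> \<inter> cball 0 M"
  have A: "finite A" unfolding A_def using \<xi> by (rule finite_config_cball)
  define g :: "'a \<Rightarrow> real" where "g x = max 0 (min 1 (M - norm x)) * (\<Prod>a\<in>A. min 1 (dist x a / r))" for x
  have g: "g \<in> test_functions"
    unfolding g_def using r
    by (intro test_functionI[of _ 0 M]) (auto intro!: continuous_intros split: if_splits)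
  have "\<exists>V. openin (config_topology configs test_functions) V \<and> \<xi> \<in> V \<and> (\<forall>\<xi>'\<in>V. \<forall>x\<in>\<xi>'. g x < 1)"
  proof (rule nhd_avoid[OF g])
    show "g x \<ge> 0" for x using r by (auto simp: g_def intro!: mult_nonneg_nonneg prod_nonneg)
    show "finite {x\<in>\<xi>. g x \<noteq> 0}" if "\<xi> \<in> configs" for \<xi> using finite_support_config[OF that g] .
    show "g x = 0" if "x \<in> \<xi>" for x
    proof (cases "norm x \<le> M")
      case True
      then have "x \<in> A" using that by (simp add: A_def)
      then have "(\<Prod>a\<in>A. min 1 (dist x a / r)) = 0" using A r by (intro prod_zero bexI[of _ x]) auto
      then show ?thesis by (simp add: g_def)
    next
      case False
      then show ?thesis by (simp add: g_def)
    qed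
  qed (use \<xi> in auto)
  then obtain V where V: "openin vague_topology V" "\<xi> \<in> V" "\<forall>\<xi>'\<in>V. \<forall>x\<in>\<xi>'. g x < 1"
    unfolding vague_topology_def by blast
  have "\<exists>a\<in>A. dist x a < r" if "\<xi>' \<in> V" "x \<in> \<xi>'" "norm x \<le> M - 1" for \<xi>' x
  proof (rule ccontr)
    assume "\<not> ?thesis"
    then have "(\<Prod>a\<in>A. min 1 (dist x a / r)) = 1" using r by (intro prod.neutral) (auto simp: not_less field_simps)
    then have "g x = 1" using that by (simp add: g_def)
    then show False using V that by fastforce
  qed
  then show ?thesis using V(1,2) unfolding A_def by blast
qed

text \<open>The product carries no cutoff, so it is bounded but not compactly supported. This is
  where the weak topology enters: it excludes additional points of a nearby configuration far
  away.\<close>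

lemma weak_nhd_near:
  fixes \<alpha> :: "'a::euclidean_space set"
  assumes \<alpha>: "finite \<alpha>" and r: "r > 0"
  shows "\<exists>V. openin weak_topology V \<and> \<alpha> \<in> V \<and> (\<forall>\<alpha>'\<in>V. \<forall>x\<in>\<alpha>'. \<exists>a\<in>\<alpha>. dist x a < r)"
proof -
  define g :: "'a \<Rightarrow> real" where "g x = (\<Prod>a\<in>\<alpha>. min 1 (dist x a / r))" for x
  have pos: "g x \<ge> 0" for x using r by (auto simp: g_def intro!: prod_nonneg)
  have le: "g x \<le> 1" for x using r unfolding g_def by (intro prod_le_1) auto
  have g: "g \<in> {f. continuous_on UNIV f \<and> bounded (range f)}"
    using pos le r by (auto simp: bounded_iff g_def[abs_def] intro!: continuous_intros exI[of _ 1])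
  have "\<exists>V. openin (config_topology fin_configs {f. continuous_on UNIV f \<and> bounded (range f)}) V \<and> \<alpha> \<in> V
      \<and> (\<forall>\<xi>'\<in>V. \<forall>x\<in>\<xi>'. g x < 1)"
  proof (rule nhd_avoid[OF g pos])
    show "finite {x\<in>\<xi>. g x \<noteq> 0}" if "\<xi> \<in> fin_configs" for \<xi> using that by (simp add: fin_configs_def)
    show "g x = 0" if "x \<in> \<alpha>" for x
      unfolding g_def using that \<alpha> r by (intro prod_zero bexI[of _ x]) auto
  qed (use \<alpha> in \<open>auto simp: fin_configs_def\<close>)
  then obtain V where V: "openin weak_topology V" "\<alpha> \<in> V" "\<forall>\<xi>'\<in>V. \<forall>x\<in>\<xi>'. g x < 1"
    unfolding weak_topology_def by blast
  have "\<exists>a\<in>\<alpha>. dist x a < r" if "\<xi>' \<in> V" "x \<in> \<xi>'" for \<xi>' x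
  proof (rule ccontr)
    assume "\<not> ?thesis"
    then have "g x = 1" unfolding g_def using r by (intro prod.neutral) (auto simp: not_less field_simps)
    then show False using V that by fastforce
  qed
  then show ?thesis using V(1,2) by blast
qed

lemma fin_configs_subset: "fin_configs \<subseteq> configs"
  by (auto simp: fin_configs_def configs_finite)

text \<open>Hitting each small ball and having at most one point in it both hold on neighbourhoods.
  The resulting matching of points allows a configuration to be followed through a
  perturbation.\<close>

lemma nhd_exactly_one:
  assumes C: "C \<subseteq> configs" and \<Phi>: "test_functions \<subseteq> \<Phi>" and r: "r > 0"
    and \<xi>: "\<xi> \<in> C" and A: "finite A" "A \<subseteq> \<xi>" and sep: "\<And>a b. a \<in> A \<Longrightarrow> b \<in> \<xi> \<Longrightarrow> b \<noteq> a \<Longrightarrow> dist a b > 2 * r"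
  shows "\<exists>V. openin (config_topology C \<Phi>) V \<and> \<xi> \<in> V \<and>
    (\<forall>\<xi>'\<in>V. \<forall>a\<in>A. \<exists>!x. x \<in> \<xi>' \<and> dist x a < r)"
proof -
  have "\<exists>V. openin (config_topology C \<Phi>) V \<and> \<xi> \<in> V \<and> (\<forall>\<xi>'\<in>V. \<exists>!x. x \<in> \<xi>' \<and> dist x a < r)" if aA: "a \<in> A" for a
  proof -
    obtain V where V: "openin (config_topology C \<Phi>) V" "\<xi> \<in> V"
      "\<forall>\<xi>'\<in>V. \<forall>x\<in>\<xi>'. \<forall>y\<in>\<xi>'. dist x a < r \<longrightarrow> dist y a < r \<longrightarrow> x = y"
      using nhd_unique[OF C \<Phi> r \<xi>, of a] sep[OF aA] by blast
    let ?H = "{\<xi> \<in> C. \<xi> \<inter> ball a r \<noteq> {}}"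
    have "openin (config_topology C \<Phi>) (V \<inter> ?H)" using V(1) openin_hit[OF C \<Phi> r] by blast
    moreover have "\<xi> \<in> V \<inter> ?H" using V(2) \<xi> aA A r by force
    moreover have "\<exists>!x. x \<in> \<xi>' \<and> dist x a < r" if "\<xi>' \<in> V \<inter> ?H" for \<xi>'
    proof -
      from that obtain x where "x \<in> \<xi>'" "dist x a < r" by (auto simp: dist_commute)
      then show ?thesis using V(3) that by blast
    qed
    ultimately show ?thesis by (intro exI[of _ "V \<inter> ?H"] conjI ballI)
  qed
  then obtain V where V: "\<And>a. a \<in> A \<Longrightarrow> openin (config_topology C \<Phi>) (V a)" "\<And>a. a \<in> A \<Longrightarrow> \<xi> \<in> V a"
    "\<And>a \<xi>'. a \<in> A \<Longrightarrow> \<xi>' \<in> V a \<Longrightarrow> \<exists>!x. x \<in> \<xi>' \<and> dist x a < r" by metis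
  let ?W = "(\<Inter>a\<in>A. V a) \<inter> topspace (config_topology C \<Phi>)"
  have "openin (config_topology C \<Phi>) ?W" using A(1) V(1) by (rule openin_INT)
  moreover have "\<xi> \<in> ?W" using V(2) \<xi> topspace_config_topology[OF \<Phi>] by auto
  ultimately show ?thesis using V(3) by (intro exI[of _ ?W]) auto
qed

section \<open>Cluster ratios and their continuity\<close>

text \<open>The leftover points \<open>E\<close> are out of range of \<open>\<alpha>\<close> and
  \<open>D\<close>, so \<open>kdet j E\<close> is a common factor of numerator and denominator; it
  cancels because the denominator is nonzero.\<close>

lemma det_ratio_far:
  fixes \<alpha> \<xi> D :: "'a::euclidean_space set"
  assumes fin: "finite \<alpha>" "finite (\<xi> \<inter> \<Delta>)" and D: "D \<subseteq> \<xi> \<inter> \<Delta>"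
    and far: "\<And>y z. y \<in> (\<xi> \<inter> \<Delta>) - D \<Longrightarrow> z \<in> \<alpha> \<union> D \<Longrightarrow> dist y z > 2 * R"
    and R: "R \<ge> 0" and j: "\<And>x y. norm (x - y) > R \<Longrightarrow> j x y = 0"
    and nz: "kdet j (\<xi> \<inter> \<Delta>) \<noteq> 0"
  shows "det_ratio j \<alpha> \<xi> \<Delta> = kdet j (\<alpha> \<union> D) / kdet j D"
proof -
  define E where "E = (\<xi> \<inter> \<Delta>) - D"
  have finE: "finite E" "finite D" using fin D by (auto simp: E_def intro: finite_subset[OF D])
  have far': "j z y = 0" if "y \<in> E" "z \<in> \<alpha> \<union> D" for y z
  proof -
    have "norm (z - y) > R" using far[of y z] that R by (simp add: E_def dist_norm norm_minus_commute)
    then show ?thesis by (rule j)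
  qed
  have disj: "(\<alpha> \<union> D) \<inter> E = {}"
  proof (rule ccontr)
    assume "(\<alpha> \<union> D) \<inter> E \<noteq> {}"
    then obtain y where "y \<in> E" "y \<in> \<alpha> \<union> D" by blast
    from far[of y y] this R show False by (simp add: E_def)
  qed
  have 1: "kdet j ((\<alpha> \<union> D) \<union> E) = kdet j (\<alpha> \<union> D) * kdet j E"
    by (rule kdet_union_block) (use disj far' finE fin in auto)
  have 2: "kdet j (D \<union> E) = kdet j D * kdet j E"
    by (rule kdet_union_block) (use disj far' finE fin in auto)
  have "(\<alpha> \<union> D) \<union> E = \<alpha> \<union> (\<xi> \<inter> \<Delta>)" "D \<union> E = \<xi> \<inter> \<Delta>" using D by (auto simp: E_def)
  then show ?thesis using 1 2 nz by (simp add: det_ratio_def)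
qed

lemma eventually_increasing_to_all:
  assumes "\<Lambda> \<in> bdd_borel"
  shows "eventually (\<lambda>\<Delta>. \<Delta> \<in> bdd_borel \<and> \<Lambda> \<subseteq> \<Delta>) increasing_to_all"
  unfolding increasing_to_all_def
  by (rule eventually_INF1[OF assms]) (simp add: eventually_principal)

text \<open>Uniqueness of limits, on which evaluating \<open>Lim\<close> depends, requires a proper
  filter. The filter base is directed because bounded Borel sets are closed under unions.\<close>

lemma increasing_to_all_neq_bot: "(increasing_to_all :: 'a::euclidean_space set filter) \<noteq> bot"
  unfolding increasing_to_all_def
proof (subst INF_filter_bot_base)
  fix A B :: "'a set" assume "A \<in> bdd_borel" "B \<in> bdd_borel"
  then have "A \<union> B \<in> bdd_borel" by (auto simp: bdd_borel_def)
  then show "\<exists>x\<in>bdd_borel. principal {\<Delta> \<in> bdd_borel. x \<subseteq> \<Delta>}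
      \<le> inf (principal {\<Delta> \<in> bdd_borel. A \<subseteq> \<Delta>}) (principal {\<Delta> \<in> bdd_borel. B \<subseteq> \<Delta>})"
    by (intro bexI[of _ "A \<union> B"]) auto
next
  show "\<not> (\<exists>i\<in>bdd_borel. principal {\<Delta> \<in> bdd_borel. i \<subseteq> \<Delta>} = (bot :: 'a set filter))"
    by (auto simp: principal_eq_bot_iff)
qed

text \<open>The ratio is constant as soon as \<Delta> contains \<open>D\<close>, so the limit exists
  without any appeal to monotonicity in \<Delta>.\<close>

lemma c_star_eq:
  fixes \<alpha> \<xi> D :: "'a::euclidean_space set"
  assumes fin: "finite \<alpha>" and \<xi>: "\<xi> \<in> nondegenerate j" and D: "finite D" "D \<subseteq> \<xi>"
    and far: "\<And>y z. y \<in> \<xi> - D \<Longrightarrow> z \<in> \<alpha> \<union> D \<Longrightarrow> dist y z > 2 * R"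
    and R: "R \<ge> 0" and j: "\<And>x y. norm (x - y) > R \<Longrightarrow> j x y = 0"
  shows "c_star j \<alpha> \<xi> = kdet j (\<alpha> \<union> D) / kdet j D"
proof -
  \<comment> \<open>A finite set is itself a bounded Borel set, hence an index of the
    filter.\<close>
  have "D \<in> bdd_borel" using D by (simp add: bdd_borel_def finite_imp_bounded finite_imp_closed borel_closed)
  then have "eventually (\<lambda>\<Delta>. \<Delta> \<in> bdd_borel \<and> D \<subseteq> \<Delta>) increasing_to_all"
    by (rule eventually_increasing_to_all)
  then have "eventually (\<lambda>\<Delta>. det_ratio j \<alpha> \<xi> \<Delta> = kdet j (\<alpha> \<union> D) / kdet j D) increasing_to_all"
  proof eventually_elim
    case (elim \<Delta>)
    then have "finite (\<xi> \<inter> \<Delta>)" "kdet j (\<xi> \<inter> \<Delta>) \<noteq> 0"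
      using \<xi> by (auto simp: nondegenerate_def configs_def)
    then show ?case using elim D far
      by (intro det_ratio_far[OF fin _ _ _ R j]) auto
  qed
  then have "(det_ratio j \<alpha> \<xi> \<longlongrightarrow> kdet j (\<alpha> \<union> D) / kdet j D) increasing_to_all"
    by (rule tendsto_eventually)
  then show ?thesis unfolding c_star_def
    using increasing_to_all_neq_bot by (intro tendsto_Lim) auto
qed

text \<open>\<open>D\<close> may be larger than the part of \<open>\<xi>\<close> in W. This matters
  for perturbed configurations: points at distance exactly 2R can come apart, and W can lose points.
  The part of \<open>D\<close> outside W is itself separated and cancels.\<close>

lemma cluster_ratio_eq:
  fixes \<alpha> \<xi> D :: "'a::euclidean_space set"
  assumes fin: "finite \<alpha>" and \<xi>: "\<xi> \<in> configs" and D: "finite D" "D \<subseteq> \<xi>"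
    and far: "\<And>y z. y \<in> \<xi> - D \<Longrightarrow> z \<in> \<alpha> \<union> D \<Longrightarrow> dist y z > 2 * R"
    and R: "R \<ge> 0" and j: "\<And>x y. norm (x - y) > R \<Longrightarrow> j x y = 0"
    and nz: "kdet j D \<noteq> 0"
  shows "cluster_ratio R j \<alpha> \<xi> = kdet j (\<alpha> \<union> D) / kdet j D"
proof -
  let ?W = "W_set R \<alpha> \<xi>"
  have sub: "?W \<subseteq> boolean_model R (\<alpha> \<union> D)"
    using fin \<xi> D far R by (intro W_set_subset) (auto simp: configs_finite)
  then have bdd: "bounded ?W" using bounded_boolean_model fin D(1) bounded_subset by blast
  have \<xi>W: "\<xi> \<inter> ?W \<subseteq> D"
  proof
    fix y assume y: "y \<in> \<xi> \<inter> ?W"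
    then have "y \<in> boolean_model R (\<alpha> \<union> D)" using sub by blast
    then obtain s where s: "s \<in> \<alpha> \<union> D" "dist s y \<le> R" unfolding boolean_model_def by auto
    show "y \<in> D"
    proof (rule ccontr)
      assume "y \<notin> D"
      then have "dist y s > 2 * R" using far[of y s] y s by auto
      then show False using s R by (simp add: dist_commute)
    qed
  qed
  \<comment> \<open>\<open>det_ratio_far\<close> is used with \<open>D\<close> in the role of the
    configuration, the part of \<open>\<xi>\<close> in W as its core, and \<open>UNIV\<close> as the
    window.\<close>
  have "det_ratio j \<alpha> D UNIV = kdet j (\<alpha> \<union> (\<xi> \<inter> ?W)) / kdet j (\<xi> \<inter> ?W)"
  proof (rule det_ratio_far[OF fin _ _ _ R j])
    fix y z assume y: "y \<in> D \<inter> UNIV - \<xi> \<inter> ?W" and z: "z \<in> \<alpha> \<union> \<xi> \<inter> ?W"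
    have "z \<in> ?W" using z W_set_superset[OF R, of \<alpha> \<xi>] by auto
    show "2 * R < dist y z"
    proof (rule ccontr)
      assume "\<not> 2 * R < dist y z"
      then have "y \<in> ?W" using y z D \<open>z \<in> ?W\<close>
        by (intro W_set_neighbour[OF R _ \<open>z \<in> ?W\<close>]) (auto simp: dist_commute)
      then show False using y D by auto
    qed
  qed (use D \<xi>W nz in auto)
  then show ?thesis using bdd by (simp add: cluster_ratio_def det_ratio_def)
qed

lemma W_set_far:
  fixes \<alpha> \<xi> :: "'a::euclidean_space set"
  assumes R: "R \<ge> 0" and y: "y \<in> \<xi> - W_set R \<alpha> \<xi>" and z: "z \<in> \<alpha> \<union> (\<xi> \<inter> W_set R \<alpha> \<xi>)"
  shows "dist y z > 2 * R"
proof (rule ccontr)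
  assume "\<not> dist y z > 2 * R"
  moreover have "z \<in> W_set R \<alpha> \<xi>" using z W_set_superset[OF R, of \<alpha> \<xi>] by auto
  ultimately have "y \<in> W_set R \<alpha> \<xi>"
    using y z by (intro W_set_neighbour[OF R _ \<open>z \<in> W_set R \<alpha> \<xi>\<close>]) (auto simp: dist_commute)
  then show False using y by simp
qed

lemma finite_gap:
  fixes c :: real
  assumes "finite P" "\<And>p. p \<in> P \<Longrightarrow> f p > c"
  shows "\<exists>e>0. \<forall>p\<in>P. f p > c + e"
proof (cases "P = {}")
  case False
  define m where "m = Min (f ` P)"
  have "m > c" "\<forall>p\<in>P. m \<le> f p" using assms False by (auto simp: m_def)
  then have "(m - c) / 2 > 0" "\<forall>p\<in>P. f p > c + (m - c) / 2" by (fastforce simp: field_simps)+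
  then show ?thesis by blast
qed (auto intro: exI[of _ 1])

text \<open>The relation between the range \<open>R\<close> of \<open>j\<close> and the distance \<open>2R\<close> at which balls touch leaves
  room: points at distance exactly \<open>2R\<close> need no separate treatment.\<close>

lemma nhd_cluster:
  fixes \<alpha> \<xi> :: "'a::euclidean_space set"
  assumes \<alpha>: "finite \<alpha>" and \<xi>: "\<xi> \<in> configs" and disj: "\<alpha> \<inter> \<xi> = {}" and R: "R \<ge> 0"
    and bdd: "bounded (W_set R \<alpha> \<xi>)" and j: "continuous_on UNIV (\<lambda>(x, y). j x y)" and e: "e > 0"
  defines "D \<equiv> \<xi> \<inter> W_set R \<alpha> \<xi>"
  shows "\<exists>U V. openin weak_topology U \<and> openin vague_topology V \<and> \<alpha> \<in> U \<and> \<xi> \<in> V \<and>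
    (\<forall>\<alpha>'\<in>U. \<forall>\<xi>'\<in>V. \<exists>D'\<subseteq>\<xi>'. finite D' \<and>
       (\<forall>y\<in>\<xi>' - D'. \<forall>z\<in>\<alpha>' \<union> D'. dist y z > 2 * R) \<and>
       cmod (kdet j (\<alpha>' \<union> D') - kdet j (\<alpha> \<union> D)) < e \<and> cmod (kdet j D' - kdet j D) < e)"
proof -
  have finD: "finite D" unfolding D_def using \<xi> bdd by (rule finite_config_bounded)
  obtain B where B: "\<And>x. x \<in> \<alpha> \<union> D \<Longrightarrow> norm x \<le> B" "B \<ge> 0"
  proof -
    have "bounded (\<alpha> \<union> D)" using \<alpha> finD by (intro finite_imp_bounded) auto
    then obtain b where "\<forall>x\<in>\<alpha> \<union> D. norm x \<le> b" unfolding bounded_iff by blast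
    then show ?thesis by (intro that[of "max b 0"]) force+
  qed
  \<comment> \<open>Moved points of \<open>\<alpha> \<union> D\<close> have norm below B + 1/2. A
    point of norm above M - 1 = B + 2R + 2 is therefore farther than 2R from all of them and needs
    no matching.\<close>
  define M where "M = B + 2 * R + 3"
  define A where "A = \<xi> \<inter> cball 0 M"
  \<comment> \<open>The radius M + 1 ensures that points of \<open>\<xi>\<close> outside
    \<open>A2\<close> are more than 1 away from \<open>A\<close>, so only finitely many distances
    restrict the scale \<open>d\<close>.\<close>
  define A2 where "A2 = \<alpha> \<union> (\<xi> \<inter> cball 0 (M + 1))"
  have finA: "finite A" "finite A2" using \<xi> \<alpha> by (auto simp: A_def A2_def intro: finite_config_cball)
  have DA: "D \<subseteq> A" using B by (auto simp: D_def A_def M_def intro!: order_trans[OF B(1)] simp: R)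
  obtain e1 where e1: "e1 > 0" "\<forall>p\<in>(A - D) \<times> (\<alpha> \<union> D). dist (fst p) (snd p) > 2 * R + e1"
  proof -
    have "\<exists>e>0. \<forall>p\<in>(A - D) \<times> (\<alpha> \<union> D). dist (fst p) (snd p) > 2 * R + e"
    proof (rule finite_gap)
      fix p assume p: "p \<in> (A - D) \<times> (\<alpha> \<union> D)"
      then have "fst p \<in> \<xi> - W_set R \<alpha> \<xi>" "snd p \<in> \<alpha> \<union> (\<xi> \<inter> W_set R \<alpha> \<xi>)"
        by (auto simp: A_def D_def)
      then show "2 * R < dist (fst p) (snd p)" by (rule W_set_far[OF R])
    qed (use finA \<alpha> finD in auto)
    then show ?thesis using that by blast
  qed
  obtain e2 where e2: "e2 > 0" "\<forall>p\<in>{p\<in>A2 \<times> A2. fst p \<noteq> snd p}. dist (fst p) (snd p) > 0 + e2"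
  proof -
    have "\<exists>e>0. \<forall>p\<in>{p\<in>A2 \<times> A2. fst p \<noteq> snd p}. dist (fst p) (snd p) > 0 + e"
      by (rule finite_gap) (use finA in auto)
    then show ?thesis using that by blast
  qed
  obtain d1 where d1: "d1 > 0" "\<And>s. (\<forall>a\<in>\<alpha> \<union> D. dist (s a) a < d1) \<Longrightarrow>
      cmod (kdet (\<lambda>x y. j (s x) (s y)) (\<alpha> \<union> D) - kdet j (\<alpha> \<union> D)) < e"
    using kdet_perturb[OF _ j e, of "\<alpha> \<union> D"] \<alpha> finD by auto
  obtain d2 where d2: "d2 > 0" "\<And>s. (\<forall>a\<in>D. dist (s a) a < d2) \<Longrightarrow>
      cmod (kdet (\<lambda>x y. j (s x) (s y)) D - kdet j D) < e"
    using kdet_perturb[OF finD j e] by auto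
  \<comment> \<open>Two moves by less than \<open>d\<close> cost at most \<open>e1\<close> of the
    gap beyond 2R; the bound by \<open>e2\<close> keeps moved points distinct and their matching
    unique; \<open>d1\<close> and \<open>d2\<close> control the two determinants; 1/2 is the slack
    in \<open>M\<close> and \<open>A2\<close>.\<close>
  define d where "d = Min {e1 / 2, e2 / 2, d1, d2, 1 / 2}"
  have d: "d > 0" "2 * d \<le> e1" "2 * d \<le> e2" "d \<le> d1" "d \<le> d2" "d \<le> 1 / 2"
    using e1 e2 d1 d2 by (auto simp: d_def min_def)
  have sepA2: "dist a b > 2 * d" if "a \<in> A2" "b \<in> A2" "a \<noteq> b" for a b
  proof -
    have "dist a b > e2" using bspec[OF e2(2), of "(a, b)"] that by simp
    then show ?thesis using d by simp
  qed
  have sep\<alpha>: "dist a b > 2 * d" if "a \<in> \<alpha>" "b \<in> \<alpha>" "b \<noteq> a" for a b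
    using sepA2[of a b] that by (auto simp: A2_def)
  have sep\<xi>: "dist a b > 2 * d" if "a \<in> A" "b \<in> \<xi>" "b \<noteq> a" for a b
  proof (cases "norm b \<le> M + 1")
    case True
    then show ?thesis using sepA2[of a b] that by (auto simp: A2_def A_def)
  next
    case False
    then have "dist a b > 1" using that norm_triangle_ineq2[of b a]
      by (auto simp: A_def dist_norm norm_minus_commute)
    then show ?thesis using d by simp
  qed
  obtain U1 where U1: "openin weak_topology U1" "\<alpha> \<in> U1" "\<And>\<alpha>' a. \<alpha>' \<in> U1 \<Longrightarrow> a \<in> \<alpha> \<Longrightarrow> \<exists>!x. x \<in> \<alpha>' \<and> dist x a < d"
    using nhd_exactly_one[OF fin_configs_subset test_functions_weak d(1), of \<alpha> \<alpha>] \<alpha> sep\<alpha>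
    unfolding weak_topology_def by (auto simp: fin_configs_def)
  obtain U2 where U2: "openin weak_topology U2" "\<alpha> \<in> U2" "\<And>\<alpha>' x. \<alpha>' \<in> U2 \<Longrightarrow> x \<in> \<alpha>' \<Longrightarrow> \<exists>a\<in>\<alpha>. dist x a < d"
    using weak_nhd_near[OF \<alpha> d(1)] by blast
  have "\<exists>V. openin vague_topology V \<and> \<xi> \<in> V \<and> (\<forall>\<xi>'\<in>V. \<forall>a\<in>A. \<exists>!x. x \<in> \<xi>' \<and> dist x a < d)"
    unfolding vague_topology_def
    by (rule nhd_exactly_one[OF order_refl order_refl d(1) \<xi> finA(1)]) (use sep\<xi> in \<open>auto simp: A_def\<close>)
  then obtain V1 where V1': "openin vague_topology V1 \<and> \<xi> \<in> V1 \<and>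
      (\<forall>\<xi>'\<in>V1. \<forall>a\<in>A. \<exists>!x. x \<in> \<xi>' \<and> dist x a < d)" ..
  then have V1: "openin vague_topology V1" "\<xi> \<in> V1" by simp_all
  have V1_ex1: "\<exists>!x. x \<in> \<xi>' \<and> dist x a < d" if "\<xi>' \<in> V1" "a \<in> A" for \<xi>' a
    by (rule bspec[OF bspec[OF conjunct2[OF conjunct2[OF V1']] that(1)] that(2)])
  obtain V2 where V2: "openin vague_topology V2" "\<xi> \<in> V2"
    "\<And>\<xi>' x. \<xi>' \<in> V2 \<Longrightarrow> x \<in> \<xi>' \<Longrightarrow> norm x \<le> M - 1 \<Longrightarrow> \<exists>a\<in>A. dist x a < d"
    using vague_nhd_near[OF \<xi> d(1), of M] unfolding A_def by blast
  have "\<exists>D'\<subseteq>\<xi>'. finite D' \<and> (\<forall>y\<in>\<xi>' - D'. \<forall>z\<in>\<alpha>' \<union> D'. dist y z > 2 * R) \<and>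
       cmod (kdet j (\<alpha>' \<union> D') - kdet j (\<alpha> \<union> D)) < e \<and> cmod (kdet j D' - kdet j D) < e"
    if \<alpha>': "\<alpha>' \<in> U1 \<inter> U2" and \<xi>': "\<xi>' \<in> V1 \<inter> V2" for \<alpha>' \<xi>'
  proof -
    \<comment> \<open>Each point goes to its unique close partner, sought in
      \<open>\<alpha>'\<close> or in \<open>\<xi>'\<close> according to its origin; disjointness of
      \<open>\<alpha>\<close> and \<open>\<xi>\<close> makes the origin unambiguous.\<close>
    define s where "s a = (if a \<in> \<alpha> then THE x. x \<in> \<alpha>' \<and> dist x a < d else THE x. x \<in> \<xi>' \<and> dist x a < d)" for a
    have s\<alpha>: "s a \<in> \<alpha>'" "dist (s a) a < d" if "a \<in> \<alpha>" for a
      using theI'[OF U1(3)[OF _ that]] \<alpha>' that by (auto simp: s_def)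
    have sD: "s a \<in> \<xi>'" "dist (s a) a < d" if "a \<in> D" for a
    proof -
      have "a \<in> A" "a \<notin> \<alpha>" using that DA disj by (auto simp: D_def)
      then show "s a \<in> \<xi>'" "dist (s a) a < d"
        using theI'[OF V1_ex1[of \<xi>' a]] \<xi>' by (auto simp: s_def)
    qed
    \<comment> \<open>Surjectivity rests on the weak topology: through \<open>U2\<close>, every
      point of \<open>\<alpha>'\<close> is close to some point of \<open>\<alpha>\<close>.\<close>
    have s\<alpha>_eq: "s ` \<alpha> = \<alpha>'"
    proof
      show "\<alpha>' \<subseteq> s ` \<alpha>"
      proof
        fix x assume x: "x \<in> \<alpha>'"
        then obtain a where a: "a \<in> \<alpha>" "dist x a < d" using U2(3) \<alpha>' by blast
        then have "s a = x" using U1(3)[of \<alpha>' a] \<alpha>' s\<alpha>[of a] x by auto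
        then show "x \<in> s ` \<alpha>" using a by auto
      qed
    qed (use s\<alpha> in auto)
    have sd: "dist (s a) a < d" if "a \<in> \<alpha> \<union> D" for a using that s\<alpha> sD by auto
    have inj: "inj_on s (\<alpha> \<union> D)"
    proof
      fix a b assume ab: "a \<in> \<alpha> \<union> D" "b \<in> \<alpha> \<union> D" "s a = s b"
      show "a = b"
      proof (rule ccontr)
        assume "a \<noteq> b"
        then have "dist a b > 2 * d" using ab DA by (intro sepA2) (auto simp: A2_def A_def)
        moreover have "dist a b \<le> dist (s a) a + dist (s b) b"
          using dist_triangle[of a b "s a"] ab(3) by (simp add: dist_commute)
        ultimately show False using sd[OF ab(1)] sd[OF ab(2)] by simp
      qed
    qed
    define D' where "D' = s ` D"
    have img: "s ` (\<alpha> \<union> D) = \<alpha>' \<union> D'" by (simp add: image_Un s\<alpha>_eq D'_def)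
    have k1: "kdet j (\<alpha>' \<union> D') = kdet (\<lambda>x y. j (s x) (s y)) (\<alpha> \<union> D)"
      unfolding img[symmetric] using \<alpha> finD inj by (intro kdet_image) auto
    have k2: "kdet j D' = kdet (\<lambda>x y. j (s x) (s y)) D"
      unfolding D'_def using finD inj by (intro kdet_image) (auto intro: inj_on_subset)
    have far: "dist y z > 2 * R" if y: "y \<in> \<xi>' - D'" and z: "z \<in> \<alpha>' \<union> D'" for y z
    proof -
      from z img obtain a where a: "a \<in> \<alpha> \<union> D" "z = s a" by auto
      have za: "dist z a < d" using sd[OF a(1)] a by simp
      show ?thesis
      proof (cases "norm y \<le> M - 1")
        case True
        then obtain b where b: "b \<in> A" "dist y b < d" using V2(3) \<xi>' y by blast
        have "b \<notin> D"
        proof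
          assume "b \<in> D"
          then have "y = s b" using V1_ex1[of \<xi>' b] \<xi>' b sD[of b] y by auto
          then show False using y \<open>b \<in> D\<close> by (auto simp: D'_def)
        qed
        then have "dist b a > 2 * R + e1" using e1(2) b a by auto
        moreover have "dist b a \<le> dist y b + dist y z + dist z a"
          using dist_triangle[of b a y] dist_triangle[of y a z] by (simp add: dist_commute)
        ultimately show ?thesis using b za d by simp
      next
        case False
        have "norm z \<le> B + d" using B(1)[OF a(1)] za norm_triangle_ineq2[of z a] by (simp add: dist_norm)
        then have "dist y z > M - 1 - (B + d)"
          using False norm_triangle_ineq2[of y z] by (simp add: dist_norm)
        then show ?thesis using d by (simp add: M_def)
      qed
    qed
    show ?thesis
      unfolding k1 k2[symmetric]
    proof (intro exI[of _ D'] conjI ballI)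
      show "D' \<subseteq> \<xi>'" using sD by (auto simp: D'_def)
      show "finite D'" using finD by (simp add: D'_def)
      show "2 * R < dist y z" if "y \<in> \<xi>' - D'" "z \<in> \<alpha>' \<union> D'" for y z using far that by blast
      show "cmod (kdet j (\<alpha>' \<union> D') - kdet j (\<alpha> \<union> D)) < e"
        unfolding k1 using sd d by (intro d1(2)) force
      show "cmod (kdet j D' - kdet j D) < e"
        unfolding k2 using sd d by (intro d2(2)) force
    qed
  qed
  moreover have "openin weak_topology (U1 \<inter> U2)" "openin vague_topology (V1 \<inter> V2)"
    using U1 U2 V1 V2 by auto
  ultimately show ?thesis using U1(2) U2(2) V1(2) V2(2)
    by (intro exI[of _ "U1 \<inter> U2"] exI[of _ "V1 \<inter> V2"]) blast
qed

lemma quotient_nhd: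
  fixes a b :: complex
  assumes "b \<noteq> 0" "open V" "a / b \<in> V"
  shows "\<exists>e>0. \<forall>x y. cmod (x - a) < e \<longrightarrow> cmod (y - b) < e \<longrightarrow> y \<noteq> 0 \<and> x / y \<in> V"
proof -
  have "((\<lambda>p. fst p / snd p) \<longlongrightarrow> fst (a, b) / snd (a, b)) (nhds (a, b))"
    using assms(1) by (intro tendsto_divide tendsto_fst tendsto_snd filterlim_ident) auto
  then have "eventually (\<lambda>p. fst p / snd p \<in> V) (nhds (a, b))"
    using assms by (auto intro: topological_tendstoD)
  moreover have "((\<lambda>p. snd p) \<longlongrightarrow> b) (nhds (a, b))"
    using tendsto_snd[OF filterlim_ident[of "nhds (a, b)"]] by simp
  then have "eventually (\<lambda>p. snd p \<noteq> 0) (nhds (a, b))"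
    using assms(1) tendsto_imp_eventually_ne by blast
  ultimately have "eventually (\<lambda>p. snd p \<noteq> 0 \<and> fst p / snd p \<in> V) (nhds (a, b))"
    by eventually_elim auto
  then obtain e where e: "e > 0" "\<And>p. dist p (a, b) < e \<Longrightarrow> snd p \<noteq> 0 \<and> fst p / snd p \<in> V"
    unfolding eventually_nhds_metric by blast
  have "y \<noteq> 0 \<and> x / y \<in> V" if "cmod (x - a) < e / 2" "cmod (y - b) < e / 2" for x y
  proof -
    have "dist (x, y) (a, b) \<le> cmod (x - a) + cmod (y - b)"
      unfolding dist_Pair_Pair by (simp only: dist_norm, rule sqrt_sum_squares_le_sum) auto
    then show ?thesis using e(2)[of "(x, y)"] that by simp
  qed
  then show ?thesis using e(1) by (intro exI[of _ "e / 2"]) auto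
qed

text \<open>Near \<open>(\<alpha>, \<xi>)\<close> both functionals are the quotient
  \<open>kdet j (\<alpha>' \<union> D') / kdet j D'\<close> with the same \<open>D'\<close>, so one
  neighbourhood serves both. For \<open>c_star\<close> the formula is available only at
  nondegenerate configurations, whence the subtopology; for \<open>cluster_ratio\<close> it is
  enough that the single denominator \<open>kdet j D'\<close> is nonzero.\<close>

lemma topcontinuous_cluster_functionals:
  fixes \<alpha> \<xi> :: "'a::euclidean_space set"
  assumes \<alpha>: "finite \<alpha>" and \<xi>: "\<xi> \<in> configs" and disj: "\<alpha> \<inter> \<xi> = {}" and R: "R \<ge> 0"
    and np: "\<not> has_infinite_cluster R \<xi>" and jc: "continuous_on UNIV (\<lambda>(x, y). j x y)"
    and j: "\<And>x y. norm (x - y) > R \<Longrightarrow> j x y = 0"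
    and nz: "\<And>\<beta>. finite \<beta> \<Longrightarrow> \<beta> \<subseteq> \<xi> \<Longrightarrow> kdet j \<beta> \<noteq> 0"
  shows "topcontinuous_at (prod_topology weak_topology (subtopology vague_topology (nondegenerate j)))
              euclidean (\<lambda>(\<alpha>, \<xi>). c_star j \<alpha> \<xi>) (\<alpha>, \<xi>)" (is ?th1)
    and "topcontinuous_at (prod_topology weak_topology vague_topology)
              euclidean (\<lambda>(\<alpha>, \<xi>). cluster_ratio R j \<alpha> \<xi>) (\<alpha>, \<xi>)" (is ?th2)
    and "c_star j \<alpha> \<xi> = cluster_ratio R j \<alpha> \<xi>" (is ?th3)
proof -
  define D where "D = \<xi> \<inter> W_set R \<alpha> \<xi>"
  have bdd: "bounded (W_set R \<alpha> \<xi>)" using bounded_W_set[OF \<alpha> \<xi> R np] .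
  have finD: "finite D" unfolding D_def using \<xi> bdd by (rule finite_config_bounded)
  have D: "D \<subseteq> \<xi>" by (simp add: D_def)
  have far: "dist y z > 2 * R" if "y \<in> \<xi> - D" "z \<in> \<alpha> \<union> D" for y z
    using W_set_far[OF R, of y \<xi> \<alpha> z] that by (auto simp: D_def)
  have nd: "\<xi> \<in> nondegenerate j"
    using \<xi> nz by (auto simp: nondegenerate_def configs_def)
  have nzD: "kdet j D \<noteq> 0" using nz finD D by blast
  have cs: "c_star j \<alpha> \<xi> = kdet j (\<alpha> \<union> D) / kdet j D"
    using c_star_eq[OF \<alpha> nd finD D far R j] by blast
  have cr: "cluster_ratio R j \<alpha> \<xi> = kdet j (\<alpha> \<union> D) / kdet j D"
    using cluster_ratio_eq[OF \<alpha> \<xi> finD D far R j nzD] by blast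
  show ?th3 using cs cr by simp
  have key: "\<exists>S T. openin weak_topology S \<and> openin vague_topology T \<and> \<alpha> \<in> S \<and> \<xi> \<in> T \<and>
      (\<forall>\<alpha>'\<in>S. \<forall>\<xi>'\<in>T. cluster_ratio R j \<alpha>' \<xi>' \<in> V \<and>
         (\<xi>' \<in> nondegenerate j \<longrightarrow> c_star j \<alpha>' \<xi>' \<in> V))"
    if V: "open V" "kdet j (\<alpha> \<union> D) / kdet j D \<in> V" for V
  proof -
    obtain e where e: "e > 0" "\<And>x y. cmod (x - kdet j (\<alpha> \<union> D)) < e \<Longrightarrow> cmod (y - kdet j D) < e \<Longrightarrow>
        y \<noteq> 0 \<and> x / y \<in> V"
      using quotient_nhd[OF nzD V] by blast
    obtain S T where ST: "openin weak_topology S" "openin vague_topology T" "\<alpha> \<in> S" "\<xi> \<in> T"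
      and near: "\<And>\<alpha>' \<xi>'. \<alpha>' \<in> S \<Longrightarrow> \<xi>' \<in> T \<Longrightarrow> \<exists>D'\<subseteq>\<xi>'. finite D' \<and>
       (\<forall>y\<in>\<xi>' - D'. \<forall>z\<in>\<alpha>' \<union> D'. dist y z > 2 * R) \<and>
       cmod (kdet j (\<alpha>' \<union> D') - kdet j (\<alpha> \<union> D)) < e \<and> cmod (kdet j D' - kdet j D) < e"
      using nhd_cluster[OF \<alpha> \<xi> disj R bdd jc e(1)] unfolding D_def by blast
    have "cluster_ratio R j \<alpha>' \<xi>' \<in> V \<and> (\<xi>' \<in> nondegenerate j \<longrightarrow> c_star j \<alpha>' \<xi>' \<in> V)"
      if ins: "\<alpha>' \<in> S" "\<xi>' \<in> T" for \<alpha>' \<xi>'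
    proof -
      have fin': "finite \<alpha>'" "\<xi>' \<in> configs"
        using openin_subset[OF ST(1)] openin_subset[OF ST(2)] ins by (auto simp: fin_configs_def)
      obtain D' where D': "D' \<subseteq> \<xi>'" "finite D'" "\<And>y z. y \<in> \<xi>' - D' \<Longrightarrow> z \<in> \<alpha>' \<union> D' \<Longrightarrow> dist y z > 2 * R"
        "cmod (kdet j (\<alpha>' \<union> D') - kdet j (\<alpha> \<union> D)) < e" "cmod (kdet j D' - kdet j D) < e"
        using near[OF ins] by blast
      from e(2)[OF D'(4,5)] have V': "kdet j D' \<noteq> 0" "kdet j (\<alpha>' \<union> D') / kdet j D' \<in> V" by auto
      show ?thesis
        using cluster_ratio_eq[OF fin' D'(2,1,3) R j V'(1)] c_star_eq[OF fin'(1) _ D'(2,1,3) R j] V'(2)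
        by auto
    qed
    then show ?thesis using ST by blast
  qed
  show ?th1
    unfolding topcontinuous_at_def
  proof (intro conjI allI impI)
    fix V :: "complex set" assume "openin euclidean V \<and> (case (\<alpha>, \<xi>) of (\<alpha>, \<xi>) \<Rightarrow> c_star j \<alpha> \<xi>) \<in> V"
    then have "open V" "kdet j (\<alpha> \<union> D) / kdet j D \<in> V" using cs by auto
    from key[OF this] obtain S T where ST: "openin weak_topology S" "openin vague_topology T" "\<alpha> \<in> S" "\<xi> \<in> T"
      "\<And>\<alpha>' \<xi>'. \<alpha>' \<in> S \<Longrightarrow> \<xi>' \<in> T \<Longrightarrow> \<xi>' \<in> nondegenerate j \<Longrightarrow> c_star j \<alpha>' \<xi>' \<in> V" by blast
    have "openin (subtopology vague_topology (nondegenerate j)) (T \<inter> nondegenerate j)"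
      using ST(2) by (auto simp: openin_subtopology)
    then show "\<exists>U. openin (prod_topology weak_topology (subtopology vague_topology (nondegenerate j))) U \<and>
        (\<alpha>, \<xi>) \<in> U \<and> (\<forall>y\<in>U. (case y of (\<alpha>, \<xi>) \<Rightarrow> c_star j \<alpha> \<xi>) \<in> V)"
      using ST nd by (intro exI[of _ "S \<times> (T \<inter> nondegenerate j)"]) (auto simp: openin_prod_Times_iff)
  qed (use \<alpha> \<xi> nd in \<open>auto simp: fin_configs_def\<close>)
  show ?th2
    unfolding topcontinuous_at_def
  proof (intro conjI allI impI)
    fix V :: "complex set" assume "openin euclidean V \<and> (case (\<alpha>, \<xi>) of (\<alpha>, \<xi>) \<Rightarrow> cluster_ratio R j \<alpha> \<xi>) \<in> V"
    then have "open V" "kdet j (\<alpha> \<union> D) / kdet j D \<in> V" using cr by auto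
    from key[OF this] obtain S T where ST: "openin weak_topology S" "openin vague_topology T" "\<alpha> \<in> S" "\<xi> \<in> T"
      "\<And>\<alpha>' \<xi>'. \<alpha>' \<in> S \<Longrightarrow> \<xi>' \<in> T \<Longrightarrow> cluster_ratio R j \<alpha>' \<xi>' \<in> V" by blast
    then show "\<exists>U. openin (prod_topology weak_topology vague_topology) U \<and>
        (\<alpha>, \<xi>) \<in> U \<and> (\<forall>y\<in>U. (case y of (\<alpha>, \<xi>) \<Rightarrow> cluster_ratio R j \<alpha> \<xi>) \<in> V)"
      by (intro exI[of _ "S \<times> T"]) (auto simp: openin_prod_Times_iff)
  qed (use \<alpha> \<xi> in \<open>auto simp: fin_configs_def\<close>)
qed

text \<open>Restricting to a ball and imposing a minimal distance makes the condition vaguely closed.\<close>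

lemma openin_no_degenerate_subset:
  fixes j :: "'a::euclidean_space \<Rightarrow> 'a \<Rightarrow> complex" and M :: real
  assumes jc: "continuous_on UNIV (\<lambda>(x, y). j x y)" and r: "r > 0"
  defines "bad \<equiv> \<lambda>\<beta>. \<beta> \<subseteq> cball 0 M \<and> (\<forall>x\<in>\<beta>. \<forall>y\<in>\<beta>. x \<noteq> y \<longrightarrow> dist x y \<ge> r) \<and> kdet j \<beta> = 0"
  shows "openin vague_topology {\<xi> \<in> configs. \<forall>\<beta>\<subseteq>\<xi>. finite \<beta> \<longrightarrow> \<not> bad \<beta>}"
proof (subst openin_subopen, intro ballI)
  fix \<xi> assume "\<xi> \<in> {\<xi> \<in> configs. \<forall>\<beta>\<subseteq>\<xi>. finite \<beta> \<longrightarrow> \<not> bad \<beta>}"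
  then have \<xi>: "\<xi> \<in> configs" "\<And>\<beta>. \<beta> \<subseteq> \<xi> \<Longrightarrow> finite \<beta> \<Longrightarrow> \<not> bad \<beta>" by auto
  \<comment> \<open>One unit more than \<open>M\<close>, because \<open>vague_nhd_near\<close>
    controls points only up to its radius minus 1.\<close>
  define A where "A = \<xi> \<inter> cball 0 (M + 1)"
  have finA: "finite A" unfolding A_def using \<xi>(1) by (rule finite_config_cball)
  have "\<exists>d>0. \<forall>s. inj_on s B \<longrightarrow> (\<forall>a\<in>B. dist (s a) a < d) \<longrightarrow> \<not> bad (s ` B)" if B: "B \<in> Pow A" for B
  proof -
    have finB: "finite B" using B finA finite_subset by auto
    have "\<not> bad B" using B \<xi>(2)[of B] finB by (auto simp: A_def)
    \<comment> \<open>A set can fail to be bad by leaving the ball, by containing a pair that is too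
      close, or by having a nonzero determinant. Each of these survives small injective
      moves.\<close>
    then consider a where "a \<in> B" "norm a > M" | x y where "x \<in> B" "y \<in> B" "x \<noteq> y" "dist x y < r"
      | "kdet j B \<noteq> 0" by (force simp: bad_def subset_iff)
    then show ?thesis
    proof cases
      case 1
      have "\<not> bad (s ` B)" if s: "\<forall>b\<in>B. dist (s b) b < norm a - M" for s
      proof
        assume "bad (s ` B)"
        then have "norm (s a) \<le> M" using 1 by (auto simp: bad_def)
        moreover have "dist (s a) a < norm a - M" using s 1 by blast
        ultimately show False using norm_triangle_ineq2[of a "s a"]
          by (simp add: dist_norm norm_minus_commute)
      qed
      then show ?thesis using 1 by (intro exI[of _ "norm a - M"]) auto
    next
      case 2
      have "\<not> bad (s ` B)" if s: "\<forall>b\<in>B. dist (s b) b < (r - dist x y) / 2" and inj: "inj_on s B" for s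
      proof
        assume "bad (s ` B)"
        moreover have "s x \<noteq> s y" using 2 inj by (auto simp: inj_on_def)
        ultimately have "dist (s x) (s y) \<ge> r" using 2 by (auto simp: bad_def)
        moreover have "dist (s x) x < (r - dist x y) / 2" "dist (s y) y < (r - dist x y) / 2" using s 2 by blast+
        moreover have "dist (s x) (s y) \<le> dist (s x) x + dist x y + dist (s y) y"
          using dist_triangle[of "s x" "s y" x] dist_triangle[of x "s y" y] by (simp add: dist_commute)
        ultimately show False by (simp add: field_simps)
      qed
      then show ?thesis using 2 by (intro exI[of _ "(r - dist x y) / 2"]) auto
    next
      case 3
      then obtain d where d: "d > 0" "\<And>s. (\<forall>a\<in>B. dist (s a) a < d) \<Longrightarrow>
          cmod (kdet (\<lambda>x y. j (s x) (s y)) B - kdet j B) < cmod (kdet j B)"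
        using kdet_perturb[OF finB jc, of "cmod (kdet j B)"] by auto
      have "\<not> bad (s ` B)" if "\<forall>b\<in>B. dist (s b) b < d" "inj_on s B" for s
        using d(2)[OF that(1)] kdet_image[OF finB that(2), of j] by (auto simp: bad_def)
      then show ?thesis using d(1) by blast
    qed
  qed
  then obtain d where d: "\<And>B. B \<in> Pow A \<Longrightarrow> d B > 0"
    "\<And>B s. B \<in> Pow A \<Longrightarrow> inj_on s B \<Longrightarrow> (\<forall>a\<in>B. dist (s a) a < d B) \<Longrightarrow> \<not> bad (s ` B)"
    by metis
  \<comment> \<open>The bound r / 2 prevents two points of a bad set, which are at least
    \<open>r\<close> apart, from being close to the same point of \<open>A\<close>. This makes the
    assignment \<open>t\<close> injective.\<close>
  define d0 where "d0 = Min (insert (r / 2) (d ` Pow A))"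
  have fin0: "finite (insert (r / 2) (d ` Pow A))" using finA by simp
  have d0: "d0 > 0" "d0 \<le> r / 2" "\<And>B. B \<in> Pow A \<Longrightarrow> d0 \<le> d B"
  proof -
    show "d0 > 0" unfolding d0_def using fin0 d(1) r by (subst Min_gr_iff) auto
    show "d0 \<le> r / 2" unfolding d0_def by (rule Min_le[OF fin0]) simp
    show "d0 \<le> d B" if "B \<in> Pow A" for B
      unfolding d0_def by (rule Min_le[OF fin0]) (use that in blast)
  qed
  obtain V where V: "openin vague_topology V" "\<xi> \<in> V"
    "\<And>\<xi>' x. \<xi>' \<in> V \<Longrightarrow> x \<in> \<xi>' \<Longrightarrow> norm x \<le> M + 1 - 1 \<Longrightarrow> \<exists>a\<in>A. dist x a < d0"
    using vague_nhd_near[OF \<xi>(1) d0(1), of "M + 1"] unfolding A_def by blast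
  have "\<not> bad \<beta>" if \<xi>': "\<xi>' \<in> V" and \<beta>: "\<beta> \<subseteq> \<xi>'" "finite \<beta>" for \<xi>' \<beta>
  proof
    assume bad: "bad \<beta>"
    have "\<exists>a\<in>A. dist x a < d0" if "x \<in> \<beta>" for x
    proof -
      have "x \<in> \<xi>'" "norm x \<le> M + 1 - 1" using bad that \<beta> by (auto simp: bad_def subset_iff)
      then show ?thesis by (rule V(3)[OF \<xi>'])
    qed
    then obtain t where t: "\<And>x. x \<in> \<beta> \<Longrightarrow> t x \<in> A" "\<And>x. x \<in> \<beta> \<Longrightarrow> dist x (t x) < d0" by metis
    have inj: "inj_on t \<beta>"
    proof
      fix x y assume xy: "x \<in> \<beta>" "y \<in> \<beta>" "t x = t y"
      show "x = y"
      proof (rule ccontr)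
        assume "x \<noteq> y"
        then have "dist x y \<ge> r" using bad xy by (auto simp: bad_def)
        moreover have "dist x y \<le> dist x (t x) + dist y (t y)"
          using dist_triangle[of x y "t x"] xy by (simp add: dist_commute)
        ultimately show False using t(2)[OF xy(1)] t(2)[OF xy(2)] d0(2) by simp
      qed
    qed
    define s where "s = the_inv_into \<beta> t"
    have st: "s (t x) = x" if "x \<in> \<beta>" for x using inj that by (simp add: s_def the_inv_into_f_f)
    have PA: "t ` \<beta> \<in> Pow A" using t by auto
    have "\<not> bad (s ` t ` \<beta>)"
    proof (rule d(2)[OF PA])
      show "inj_on s (t ` \<beta>)" by (rule inj_onI) (use st in auto)
      show "\<forall>a\<in>t ` \<beta>. dist (s a) a < d (t ` \<beta>)"
        using st t(2) d0(3)[OF PA] by fastforce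
    qed
    moreover have "s ` t ` \<beta> = \<beta>" using st by force
    ultimately show False using bad by simp
  qed
  then show "\<exists>T. openin vague_topology T \<and> \<xi> \<in> T \<and> T \<subseteq> {\<xi> \<in> configs. \<forall>\<beta>\<subseteq>\<xi>. finite \<beta> \<longrightarrow> \<not> bad \<beta>}"
    using V(1,2) openin_subset[OF V(1)] by (intro exI[of _ V]) auto
qed

section \<open>The semi-inner product space of square integrable functions\<close>

lemma borel_measurable_cnj [measurable (raw)]:
  "f \<in> borel_measurable M \<Longrightarrow> (\<lambda>x. cnj (f x)) \<in> borel_measurable M"
  by (rule borel_measurable_continuous_on[of cnj]) (auto intro: continuous_intros)

lemma L2_measurable [measurable_dest]: "f \<in> L2 \<Longrightarrow> f \<in> borel_measurable borel"
  by (simp add: L2_def)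

lemma L2_integrable: "f \<in> L2 \<Longrightarrow> integrable lborel (\<lambda>x. (cmod (f x))\<^sup>2)"
  by (simp add: L2_def)

lemma L2I: "f \<in> borel_measurable borel \<Longrightarrow> integrable lborel (\<lambda>x. (cmod (f x))\<^sup>2) \<Longrightarrow> f \<in> L2"
  by (simp add: L2_def)

lemma L2_zero [simp]: "(\<lambda>x. 0) \<in> L2"
  by (simp add: L2_def)

lemma L2_mult_bound:
  assumes "f \<in> L2" "h \<in> borel_measurable borel" "\<And>x. cmod (h x) \<le> C * cmod (f x)"
  shows "h \<in> L2"
proof (rule L2I)
  show "integrable lborel (\<lambda>x. (cmod (h x))\<^sup>2)"
  proof (rule Bochner_Integration.integrable_bound)
    show "integrable lborel (\<lambda>x. C\<^sup>2 * (cmod (f x))\<^sup>2)" using L2_integrable[OF assms(1)] by simp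
    show "AE x in lborel. norm ((cmod (h x))\<^sup>2) \<le> norm (C\<^sup>2 * (cmod (f x))\<^sup>2)"
    proof (rule AE_I2)
      fix x
      have "(cmod (h x))\<^sup>2 \<le> (C * cmod (f x))\<^sup>2" using assms(3) by (intro power_mono) auto
      then show "norm ((cmod (h x))\<^sup>2) \<le> norm (C\<^sup>2 * (cmod (f x))\<^sup>2)" by (simp add: power_mult_distrib)
    qed
  qed (use assms in measurable)
qed fact

lemma L2_scale: "f \<in> L2 \<Longrightarrow> (\<lambda>x. c * f x) \<in> L2"
  by (rule L2_mult_bound[of f _ "cmod c"]) (auto simp: norm_mult)

lemma L2_indicator: "f \<in> L2 \<Longrightarrow> A \<in> sets borel \<Longrightarrow> (\<lambda>x. indicator A x * f x) \<in> L2"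
  by (rule L2_mult_bound[of f _ 1]) (auto simp: norm_mult indicator_def)

lemma L2_product:
  assumes f: "f \<in> L2" and g: "g \<in> L2"
  shows "integrable lborel (\<lambda>x. cmod (f x) * cmod (g x))"
proof (rule Bochner_Integration.integrable_bound)
  show "integrable lborel (\<lambda>x. (cmod (f x))\<^sup>2 + (cmod (g x))\<^sup>2)"
    using L2_integrable[OF f] L2_integrable[OF g] by simp
  show "AE x in lborel. norm (cmod (f x) * cmod (g x)) \<le> norm ((cmod (f x))\<^sup>2 + (cmod (g x))\<^sup>2)"
  proof (rule AE_I2)
    fix x
    have "2 * (cmod (f x) * cmod (g x)) \<le> (cmod (f x))\<^sup>2 + (cmod (g x))\<^sup>2"
      using sum_squares_bound[of "cmod (f x)" "cmod (g x)"] by simp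
    moreover have "0 \<le> cmod (f x) * cmod (g x)" by simp
    ultimately have "cmod (f x) * cmod (g x) \<le> (cmod (f x))\<^sup>2 + (cmod (g x))\<^sup>2" by linarith
    then show "norm (cmod (f x) * cmod (g x)) \<le> norm ((cmod (f x))\<^sup>2 + (cmod (g x))\<^sup>2)" by simp
  qed
qed (use f g in measurable)

lemma L2_add:
  assumes f: "f \<in> L2" and g: "g \<in> L2"
  shows "(\<lambda>x. f x + g x) \<in> L2"
proof (rule L2I)
  show "integrable lborel (\<lambda>x. (cmod (f x + g x))\<^sup>2)"
  proof (rule Bochner_Integration.integrable_bound)
    show "integrable lborel (\<lambda>x. (cmod (f x))\<^sup>2 + 2 * (cmod (f x) * cmod (g x)) + (cmod (g x))\<^sup>2)"
      using L2_integrable[OF f] L2_integrable[OF g] L2_product[OF f g] by simp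
    show "AE x in lborel. norm ((cmod (f x + g x))\<^sup>2)
        \<le> norm ((cmod (f x))\<^sup>2 + 2 * (cmod (f x) * cmod (g x)) + (cmod (g x))\<^sup>2)"
    proof (rule AE_I2)
      fix x
      have "(cmod (f x + g x))\<^sup>2 \<le> (cmod (f x) + cmod (g x))\<^sup>2"
        by (intro power_mono norm_triangle_ineq) auto
      then show "norm ((cmod (f x + g x))\<^sup>2) \<le> norm ((cmod (f x))\<^sup>2 + 2 * (cmod (f x) * cmod (g x)) + (cmod (g x))\<^sup>2)"
        by (simp add: power2_sum mult.assoc)
    qed
  qed (use f g in measurable)
qed (use f g in measurable)

lemma L2_diff: "f \<in> L2 \<Longrightarrow> g \<in> L2 \<Longrightarrow> (\<lambda>x. f x - g x) \<in> L2"
  using L2_add[of f "\<lambda>x. (-1) * g x"] L2_scale[of g "-1"] by simp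

lemma L2_sum: "(\<And>i. i \<in> I \<Longrightarrow> f i \<in> L2) \<Longrightarrow> (\<lambda>x. \<Sum>i\<in>I. f i x) \<in> L2"
  by (induction I rule: infinite_finite_induct) (auto intro!: L2_add)

lemma l2_norm_cong_AE:
  assumes "f \<in> borel_measurable borel" "g \<in> borel_measurable borel" "AE x in lborel. f x = g x"
  shows "l2_norm f = l2_norm g"
  unfolding l2_norm_def
  by (intro arg_cong[of _ _ sqrt] integral_cong_AE) (use assms in \<open>auto elim!: eventually_mono\<close>)

lemma l2_inner_cong_AE:
  assumes "f \<in> borel_measurable borel" "g \<in> borel_measurable borel" "AE x in lborel. f x = g x"
    and "f' \<in> borel_measurable borel" "g' \<in> borel_measurable borel" "AE x in lborel. f' x = g' x"
  shows "l2_inner f f' = l2_inner g g'"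
  unfolding l2_inner_def
  by (intro integral_cong_AE) (use assms in \<open>auto elim!: eventually_elim2\<close>)

lemma l2_norm_nonneg [simp]: "0 \<le> l2_norm f"
  by (simp add: l2_norm_def)

lemma l2_norm_sq: "(l2_norm f)\<^sup>2 = (\<integral>x. (cmod (f x))\<^sup>2 \<partial>lborel)"
  by (simp add: l2_norm_def)

lemma l2_norm_zero [simp]: "l2_norm (\<lambda>x. 0) = 0"
  by (simp add: l2_norm_def)

lemma l2_norm_scale: "l2_norm (\<lambda>x. c * f x) = cmod c * l2_norm f"
  by (simp add: l2_norm_def norm_mult power_mult_distrib real_sqrt_mult)

lemma l2_norm_of_real_cmod: "l2_norm (\<lambda>x. of_real (cmod (f x))) = l2_norm f"
  by (simp add: l2_norm_def)

lemma l2_norm_eq_0: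
  assumes "f \<in> L2" "l2_norm f = 0" shows "AE x in lborel. f x = 0"
proof -
  have "(\<integral>x. (cmod (f x))\<^sup>2 \<partial>lborel) = 0" using assms(2) l2_norm_sq[of f] by simp
  then have "AE x in lborel. (cmod (f x))\<^sup>2 = 0"
    using integral_nonneg_eq_0_iff_AE[OF L2_integrable[OF assms(1)]] by simp
  then show ?thesis by simp
qed

lemma l2_Cauchy_Schwarz:
  assumes f: "f \<in> L2" and g: "g \<in> L2"
  shows "(\<integral>x. cmod (f x) * cmod (g x) \<partial>lborel) \<le> l2_norm f * l2_norm g"
proof -
  note i = L2_integrable[OF f] L2_integrable[OF g] L2_product[OF f g]
  show ?thesis
  proof (cases "l2_norm f = 0 \<or> l2_norm g = 0")
    case True
    then have "AE x in lborel. cmod (f x) * cmod (g x) = 0"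
      using l2_norm_eq_0[OF f] l2_norm_eq_0[OF g] by (auto elim: eventually_mono)
    then have "(\<integral>x. cmod (f x) * cmod (g x) \<partial>lborel) = 0" by (rule integral_eq_zero_AE)
    then show ?thesis by simp
  next
    case False
    define a b where "a = l2_norm f" and "b = l2_norm g"
    have ab: "a > 0" "b > 0" using False l2_norm_nonneg by (auto simp: a_def b_def less_le)
    \<comment> \<open>Weighted inequality between geometric and arithmetic mean; the weights are
      chosen so that both terms integrate to a b / 2.\<close>
    have "(\<integral>x. cmod (f x) * cmod (g x) \<partial>lborel)
        \<le> (\<integral>x. b / (2 * a) * (cmod (f x))\<^sup>2 + a / (2 * b) * (cmod (g x))\<^sup>2 \<partial>lborel)"
    proof (rule integral_mono[OF i(3)])
      fix x
      have "2 * (b * cmod (f x)) * (a * cmod (g x)) \<le> (b * cmod (f x))\<^sup>2 + (a * cmod (g x))\<^sup>2"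
        by (rule sum_squares_bound)
      then show "cmod (f x) * cmod (g x) \<le> b / (2 * a) * (cmod (f x))\<^sup>2 + a / (2 * b) * (cmod (g x))\<^sup>2"
        using ab by (simp add: field_simps power2_eq_square)
    qed (use i in simp)
    also have "\<dots> = b / (2 * a) * a\<^sup>2 + a / (2 * b) * b\<^sup>2"
      using i by (simp add: a_def b_def l2_norm_sq)
    also have "\<dots> = a * b" using ab by (simp add: field_simps power2_eq_square)
    finally show ?thesis by (simp add: a_def b_def)
  qed
qed

lemma l2_norm_triangle:
  assumes f: "f \<in> L2" and g: "g \<in> L2"
  shows "l2_norm (\<lambda>x. f x + g x) \<le> l2_norm f + l2_norm g"
proof (rule power2_le_imp_le)
  note i = L2_integrable[OF f] L2_integrable[OF g] L2_product[OF f g]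
  have "(l2_norm (\<lambda>x. f x + g x))\<^sup>2 \<le> (\<integral>x. (cmod (f x))\<^sup>2 + 2 * (cmod (f x) * cmod (g x)) + (cmod (g x))\<^sup>2 \<partial>lborel)"
    unfolding l2_norm_sq
  proof (rule integral_mono)
    fix x
    have "(cmod (f x + g x))\<^sup>2 \<le> (cmod (f x) + cmod (g x))\<^sup>2"
      by (intro power_mono norm_triangle_ineq) auto
    then show "(cmod (f x + g x))\<^sup>2 \<le> (cmod (f x))\<^sup>2 + 2 * (cmod (f x) * cmod (g x)) + (cmod (g x))\<^sup>2"
      by (simp add: power2_sum mult.assoc)
  qed (use i L2_integrable[OF L2_add[OF f g]] in simp_all)
  also have "\<dots> = (l2_norm f)\<^sup>2 + 2 * (\<integral>x. cmod (f x) * cmod (g x) \<partial>lborel) + (l2_norm g)\<^sup>2"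
    using i by (simp add: l2_norm_sq)
  also have "\<dots> \<le> (l2_norm f + l2_norm g)\<^sup>2"
    using l2_Cauchy_Schwarz[OF f g] by (simp add: power2_sum)
  finally show "(l2_norm (\<lambda>x. f x + g x))\<^sup>2 \<le> (l2_norm f + l2_norm g)\<^sup>2" .
qed simp

lemma l2_norm_sum:
  assumes "finite I" "\<And>i. i \<in> I \<Longrightarrow> f i \<in> L2"
  shows "l2_norm (\<lambda>x. \<Sum>i\<in>I. f i x) \<le> (\<Sum>i\<in>I. l2_norm (f i))"
  using assms
proof (induction I rule: finite_induct)
  case (insert i I)
  have "l2_norm (\<lambda>x. f i x + (\<Sum>i\<in>I. f i x)) \<le> l2_norm (f i) + l2_norm (\<lambda>x. \<Sum>i\<in>I. f i x)"
    by (rule l2_norm_triangle) (use insert in \<open>auto intro!: L2_sum\<close>)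
  then show ?case using insert by force
qed simp

lemma l2_inner_integrable:
  assumes f: "f \<in> L2" and g: "g \<in> L2"
  shows "integrable lborel (\<lambda>x. cnj (f x) * g x)"
  by (rule Bochner_Integration.integrable_bound[OF L2_product[OF f g]]) (use f g in \<open>auto simp: norm_mult\<close>)

lemma cmod_l2_inner:
  assumes f: "f \<in> L2" and g: "g \<in> L2"
  shows "cmod (l2_inner f g) \<le> l2_norm f * l2_norm g"
proof -
  have "cmod (l2_inner f g) \<le> (\<integral>x. cmod (cnj (f x) * g x) \<partial>lborel)"
    unfolding l2_inner_def by (rule integral_norm_bound)
  then show ?thesis using l2_Cauchy_Schwarz[OF f g] by (simp add: norm_mult)
qed

lemma l2_inner_self: "l2_inner f f = of_real ((l2_norm f)\<^sup>2)"
  unfolding l2_norm_sq l2_inner_def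
  by (subst integral_complex_of_real[symmetric]) (simp add: complex_norm_square mult.commute del: integral_complex_of_real of_real_power)

lemma l2_inner_add_right:
  "f \<in> L2 \<Longrightarrow> g \<in> L2 \<Longrightarrow> h \<in> L2 \<Longrightarrow> l2_inner f (\<lambda>x. g x + h x) = l2_inner f g + l2_inner f h"
  unfolding l2_inner_def distrib_left by (intro Bochner_Integration.integral_add l2_inner_integrable)

lemma l2_inner_diff_right:
  "f \<in> L2 \<Longrightarrow> g \<in> L2 \<Longrightarrow> h \<in> L2 \<Longrightarrow> l2_inner f (\<lambda>x. g x - h x) = l2_inner f g - l2_inner f h"
  unfolding l2_inner_def right_diff_distrib by (intro Bochner_Integration.integral_diff l2_inner_integrable)

lemma l2_inner_diff_left:
  "f \<in> L2 \<Longrightarrow> g \<in> L2 \<Longrightarrow> h \<in> L2 \<Longrightarrow> l2_inner (\<lambda>x. f x - g x) h = l2_inner f h - l2_inner g h"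
  unfolding l2_inner_def complex_cnj_diff left_diff_distrib
  by (intro Bochner_Integration.integral_diff l2_inner_integrable)

lemma l2_inner_scale_right: "l2_inner f (\<lambda>x. c * g x) = c * l2_inner f g"
  unfolding l2_inner_def by (simp add: mult.left_commute)

lemma l2_inner_cnj: "cnj (l2_inner f g) = l2_inner g f"
  using Bochner_Integration.integral_cnj[of lborel "\<lambda>x. cnj (f x) * g x"] by (simp add: l2_inner_def mult.commute)

lemma l2_inner_scale_left: "l2_inner (\<lambda>x. c * f x) g = cnj c * l2_inner f g"
  unfolding l2_inner_def by (simp add: mult.assoc)

lemma l2_inner_sum_right:
  "finite I \<Longrightarrow> f \<in> L2 \<Longrightarrow> (\<And>i. i \<in> I \<Longrightarrow> g i \<in> L2) \<Longrightarrow>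
    l2_inner f (\<lambda>x. \<Sum>i\<in>I. g i x) = (\<Sum>i\<in>I. l2_inner f (g i))"
proof (induction I rule: finite_induct)
  case (insert i I)
  then show ?case by (simp add: l2_inner_add_right L2_sum)
qed (simp add: l2_inner_def)

lemma l2_inner_sum_left:
  assumes "finite I" "f \<in> L2" "\<And>i. i \<in> I \<Longrightarrow> g i \<in> L2"
  shows "l2_inner (\<lambda>x. \<Sum>i\<in>I. g i x) f = (\<Sum>i\<in>I. l2_inner (g i) f)"
proof -
  have "cnj (l2_inner f (\<lambda>x. \<Sum>i\<in>I. g i x)) = cnj (\<Sum>i\<in>I. l2_inner f (g i))"
    by (simp only: l2_inner_sum_right[OF assms])
  then show ?thesis by (simp add: l2_inner_cnj)
qed

lemma l2_norm_diff_commute: "l2_norm (\<lambda>x. f x - g x) = l2_norm (\<lambda>x. g x - f x)"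
  by (simp add: l2_norm_def norm_minus_commute)

text \<open>Used to replace a vector by its projection onto cell functions inside a quadratic form,
  with an error linear in the distance.\<close>

lemma l2_inner_diag_close:
  assumes T: "\<And>f. f \<in> L2 \<Longrightarrow> T f \<in> L2" and B: "\<And>f. f \<in> L2 \<Longrightarrow> l2_norm (T f) \<le> B * l2_norm f"
    and Td: "\<And>f g. f \<in> L2 \<Longrightarrow> g \<in> L2 \<Longrightarrow> AE x in lborel. T (\<lambda>y. f y - g y) x = T f x - T g x"
    and f: "f \<in> L2" and g: "g \<in> L2"
  shows "cmod (l2_inner f (T f) - l2_inner g (T g)) \<le> B * l2_norm (\<lambda>x. f x - g x) * (l2_norm f + l2_norm g)"
proof -
  have fg: "(\<lambda>x. f x - g x) \<in> L2" using f g by (rule L2_diff)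
  have "l2_inner f (T f) - l2_inner g (T g) = l2_inner f (T (\<lambda>x. f x - g x)) + l2_inner (\<lambda>x. f x - g x) (T g)"
  proof -
    have "l2_inner f (T (\<lambda>x. f x - g x)) = l2_inner f (\<lambda>x. T f x - T g x)"
      by (rule l2_inner_cong_AE) (use Td[OF f g] f g fg in \<open>auto intro!: L2_measurable T L2_diff\<close>)
    then show ?thesis using T f g by (simp add: l2_inner_diff_right l2_inner_diff_left)
  qed
  also have "cmod \<dots> \<le> cmod (l2_inner f (T (\<lambda>x. f x - g x))) + cmod (l2_inner (\<lambda>x. f x - g x) (T g))"
    by (rule norm_triangle_ineq)
  also have "\<dots> \<le> l2_norm f * l2_norm (T (\<lambda>x. f x - g x)) + l2_norm (\<lambda>x. f x - g x) * l2_norm (T g)"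
    by (intro add_mono cmod_l2_inner) (use f g fg T in auto)
  also have "\<dots> \<le> l2_norm f * (B * l2_norm (\<lambda>x. f x - g x)) + l2_norm (\<lambda>x. f x - g x) * (B * l2_norm g)"
    by (intro add_mono mult_left_mono B) (use f g fg in auto)
  finally show ?thesis by (simp add: algebra_simps)
qed

lemma l2_Bessel:
  assumes e: "\<And>n. e n \<in> L2" "\<And>m n. l2_inner (e m) (e n) = of_bool (m = n)" and f: "f \<in> L2"
  shows "(\<Sum>n<(N::nat). (cmod (l2_inner (e n) f))\<^sup>2) \<le> (l2_norm f)\<^sup>2"
proof -
  define c where "c n = l2_inner (e n) f" for n
  define p where "p = (\<lambda>x. \<Sum>n<N. c n * e n x)"
  have ce: "(\<lambda>x. c n * e n x) \<in> L2" for n using e by (intro L2_scale)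
  have p: "p \<in> L2" unfolding p_def using ce by (intro L2_sum)
  have ep: "l2_inner (e n) p = c n" if "n < N" for n
  proof -
    have "l2_inner (e n) p = (\<Sum>i<N. c i * of_bool (n = i))"
      unfolding p_def using e(1) ce by (subst l2_inner_sum_right) (auto simp: l2_inner_scale_right e(2))
    then show ?thesis using that by (simp add: of_bool_def if_distrib cong: if_cong)
  qed
  have cc: "cnj z * z = of_real ((cmod z)\<^sup>2)" for z
    by (metis complex_norm_square mult.commute)
  have pf: "l2_inner p f = of_real (\<Sum>n<N. (cmod (c n))\<^sup>2)"
    unfolding p_def using ce f
    by (subst l2_inner_sum_left) (auto simp: l2_inner_scale_left c_def[symmetric] cc simp del: of_real_power)
  have pp: "l2_inner p p = of_real (\<Sum>n<N. (cmod (c n))\<^sup>2)"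
    by (subst (1) p_def, subst l2_inner_sum_left)
      (auto simp: ce p l2_inner_scale_left ep cc simp del: of_real_power)
  have fp: "l2_inner f p = of_real (\<Sum>n<N. (cmod (c n))\<^sup>2)"
    using arg_cong[OF pf, of cnj] by (simp add: l2_inner_cnj)
  have "of_real ((l2_norm (\<lambda>x. f x - p x))\<^sup>2) = l2_inner f f - of_real (\<Sum>n<N. (cmod (c n))\<^sup>2)"
    unfolding l2_inner_self[symmetric] using f p L2_diff[OF f p] pf pp fp
    by (simp add: l2_inner_diff_left l2_inner_diff_right)
  then have "(l2_norm (\<lambda>x. f x - p x))\<^sup>2 = (l2_norm f)\<^sup>2 - (\<Sum>n<N. (cmod (c n))\<^sup>2)"
    unfolding l2_inner_self of_real_diff[symmetric] of_real_eq_iff .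
  then show ?thesis using zero_le_power2[of "l2_norm (\<lambda>x. f x - p x)"] unfolding c_def by linarith
qed

locale bounded_L2_op =
  fixes T :: "'a::euclidean_space l2_op"
  assumes bounded: "bounded_op T"
begin

lemma L2 [intro, simp]: "f \<in> L2 \<Longrightarrow> T f \<in> L2"
  using bounded by (simp add: bounded_op_def)

lemma add: "f \<in> L2 \<Longrightarrow> g \<in> L2 \<Longrightarrow> AE x in lborel. T (\<lambda>y. f y + g y) x = T f x + T g x"
  using bounded by (simp add: bounded_op_def)

lemma scale: "f \<in> L2 \<Longrightarrow> AE x in lborel. T (\<lambda>y. c * f y) x = c * T f x"
  using bounded by (simp add: bounded_op_def)

lemma bound: "\<exists>B\<ge>0. \<forall>f\<in>L2. l2_norm (T f) \<le> B * l2_norm f"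
proof -
  obtain B where B: "\<And>f. f \<in> L2 \<Longrightarrow> l2_norm (T f) \<le> B * l2_norm f"
    using bounded unfolding bounded_op_def by blast
  have "l2_norm (T f) \<le> \<bar>B\<bar> * l2_norm f" if "f \<in> L2" for f
    using B[OF that] by (rule order_trans) (auto intro: mult_right_mono)
  then show ?thesis by (intro exI[of _ "\<bar>B\<bar>"]) auto
qed

lemma diff:
  assumes f: "f \<in> L2" and g: "g \<in> L2"
  shows "AE x in lborel. T (\<lambda>y. f y - g y) x = T f x - T g x"
proof -
  have "AE x in lborel. T (\<lambda>y. f y + (-1) * g y) x = T f x + T (\<lambda>y. (-1) * g y) x"
    by (rule add[OF f L2_scale[OF g]])
  moreover have "AE x in lborel. T (\<lambda>y. (-1) * g y) x = (-1) * T g x" by (rule scale[OF g])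
  ultimately show ?thesis by eventually_elim simp
qed

text \<open>Operators act on representatives, and \<open>bounded_op\<close> does not require them to
  respect equality almost everywhere. This follows from linearity and the norm bound, since T(f - g)
  then has norm 0.\<close>

lemma cong_AE:
  assumes f: "f \<in> L2" and g: "g \<in> L2" and "AE x in lborel. f x = g x"
  shows "AE x in lborel. T f x = T g x"
proof -
  obtain B where B: "B \<ge> 0" "\<forall>f\<in>L2. l2_norm (T f) \<le> B * l2_norm f" using bound by blast
  have fg: "(\<lambda>x. f x - g x) \<in> L2" using f g by (rule L2_diff)
  have "l2_norm (\<lambda>x. f x - g x) = l2_norm (\<lambda>x::'a. 0)"
    by (rule l2_norm_cong_AE[OF L2_measurable[OF fg]]) (use assms(3) in \<open>auto elim: eventually_mono\<close>)
  then have "l2_norm (T (\<lambda>x. f x - g x)) \<le> 0" using bspec[OF B(2) fg] by simp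
  then have "l2_norm (T (\<lambda>x. f x - g x)) = 0" by (simp add: order_antisym)
  from l2_norm_eq_0[OF L2[OF fg] this] diff[OF f g] show ?thesis
    by eventually_elim simp
qed

lemma sum:
  assumes "finite I" "\<And>i. i \<in> I \<Longrightarrow> f i \<in> L2"
  shows "AE x in lborel. T (\<lambda>y. \<Sum>i\<in>I. f i y) x = (\<Sum>i\<in>I. T (f i) x)"
  using assms
proof (induction I rule: finite_induct)
  case empty
  show ?case using scale[of "\<lambda>x. 0" 0] by simp
next
  case (insert i I)
  have "AE x in lborel. T (\<lambda>y. f i y + (\<Sum>i\<in>I. f i y)) x = T (f i) x + T (\<lambda>y. \<Sum>i\<in>I. f i y) x"
    using insert by (intro add L2_sum) auto
  moreover have "AE x in lborel. T (\<lambda>y. \<Sum>i\<in>I. f i y) x = (\<Sum>i\<in>I. T (f i) x)" using insert by simp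
  ultimately show ?case using insert(1,2) by (auto elim: eventually_elim2)
qed

lemma bdd_above_op_norm: "bdd_above {l2_norm (T f) | f. f \<in> L2 \<and> l2_norm f \<le> 1}"
proof -
  obtain B where B: "B \<ge> 0" "\<forall>f\<in>L2. l2_norm (T f) \<le> B * l2_norm f" using bound by blast
  show ?thesis
  proof (rule bdd_aboveI)
    fix y assume "y \<in> {l2_norm (T f) | f. f \<in> L2 \<and> l2_norm f \<le> 1}"
    then obtain f where f: "y = l2_norm (T f)" "f \<in> L2" "l2_norm f \<le> 1" by blast
    have "y \<le> B * l2_norm f" using B f by simp
    also have "\<dots> \<le> B * 1" using B(1) f(3) by (intro mult_left_mono)
    finally show "y \<le> B * 1" .
  qed
qed

lemma l2_norm_le_op_norm:
  assumes "f \<in> L2" "l2_norm f \<le> 1" shows "l2_norm (T f) \<le> op_norm T"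
  unfolding op_norm_def by (rule cSup_upper[OF _ bdd_above_op_norm]) (use assms in blast)

lemma norm_le_op_norm:
  assumes f: "f \<in> L2"
  shows "l2_norm (T f) \<le> op_norm T * l2_norm f"
proof -
  obtain B where B: "B \<ge> 0" "\<forall>f\<in>L2. l2_norm (T f) \<le> B * l2_norm f" using bound by blast
  show ?thesis
  proof (cases "l2_norm f = 0")
    case True
    then show ?thesis using bspec[OF B(2) f] by simp
  next
    case False
    define a where "a = l2_norm f"
    have a: "a > 0" using False l2_norm_nonneg[of f] by (simp add: a_def less_le)
    define g where "g = (\<lambda>x. complex_of_real (1 / a) * f x)"
    have g: "g \<in> L2" unfolding g_def using f by (rule L2_scale)
    have "l2_norm g = 1" unfolding g_def l2_norm_scale using a by (simp add: a_def norm_divide)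
    then have 1: "l2_norm (T g) \<le> op_norm T" using g by (intro l2_norm_le_op_norm) auto
    have "l2_norm (T g) = l2_norm (\<lambda>x. complex_of_real (1 / a) * T f x)"
      by (rule l2_norm_cong_AE[OF L2_measurable[OF L2[OF g]] L2_measurable[OF L2_scale[OF L2[OF f]]]])
        (unfold g_def, rule scale[OF f])
    also have "\<dots> = l2_norm (T f) / a" unfolding l2_norm_scale using a by (simp add: norm_divide)
    finally show ?thesis using 1 a by (simp add: field_simps a_def)
  qed
qed

lemma op_norm_nonneg: "0 \<le> op_norm T"
  by (rule order_trans[OF l2_norm_nonneg l2_norm_le_op_norm[OF L2_zero]]) simp

end

section \<open>The Neumann series\<close>

text \<open>\<open>inv_op\<close> is a choice, so nothing can be said about \<open>J_op\<close>
  until some bounded two-sided inverse of I - T is exhibited. The Neumann series supplies one;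
  afterwards only the defining property of the chosen inverse is used.\<close>

locale contraction_L2_op = bounded_L2_op +
  fixes q :: real
  assumes q: "0 \<le> q" "q < 1" and contraction: "\<And>f. f \<in> L2 \<Longrightarrow> l2_norm (T f) \<le> q * l2_norm f"
begin

lemma L2_iter [intro, simp]: "f \<in> L2 \<Longrightarrow> (T ^^ n) f \<in> L2"
  by (induction n) auto

lemma iter_measurable [simp, intro]: "f \<in> L2 \<Longrightarrow> (T ^^ n) f \<in> borel_measurable borel"
  using L2_iter L2_measurable by blast

lemma norm_iter: "f \<in> L2 \<Longrightarrow> l2_norm ((T ^^ n) f) \<le> q ^ n * l2_norm f"
proof (induction n)
  case (Suc n)
  have "l2_norm (T ((T ^^ n) f)) \<le> q * l2_norm ((T ^^ n) f)" using Suc by (intro contraction) auto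
  also have "\<dots> \<le> q * (q ^ n * l2_norm f)" using Suc q by (intro mult_left_mono) auto
  finally show ?case by (simp add: mult.assoc)
qed simp

text \<open>The series is summed pointwise on representatives; where it fails to converge the value
  is arbitrary, but for square integrable \<open>f\<close> this happens only on a null set.\<close>

definition neumann :: "'a l2_op" where
  "neumann f = (\<lambda>x. \<Sum>n. (T ^^ n) f x)"

lemma neumann_measurable: "f \<in> L2 \<Longrightarrow> neumann f \<in> borel_measurable borel"
  unfolding neumann_def by (rule borel_measurable_suminf) auto

text \<open>Monotone convergence applied to the partial sums of \<open>\<Sum>\<^sub>n \<bar>T\<^sup>n f\<bar>\<close> gives convergence
  almost everywhere as well as the norm bound.\<close>

lemma
  assumes f: "f \<in> L2"
  shows summable_iter: "AE x in lborel. summable (\<lambda>n. cmod ((T ^^ n) f x))"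
    and neumann_L2: "neumann f \<in> L2"
    and norm_neumann: "l2_norm (neumann f) \<le> l2_norm f / (1 - q)"
proof -
  define C where "C = l2_norm f / (1 - q)"
  have C: "C \<ge> 0" using q by (simp add: C_def)
  define G where "G N x = (\<Sum>n<N. cmod ((T ^^ n) f x))" for N x
  \<comment> \<open>Complex-valued copies of the moduli, so that the triangle inequality for
    \<open>l2_norm\<close> applies to their sums.\<close>
  define Gc where "Gc N x = (\<Sum>n<N. complex_of_real (cmod ((T ^^ n) f x)))" for N x
  have cL2: "(\<lambda>x. complex_of_real (cmod ((T ^^ n) f x))) \<in> L2" for n
  proof (rule L2_mult_bound[OF L2_iter[OF f, of n], of _ 1])
    show "(\<lambda>x. complex_of_real (cmod ((T ^^ n) f x))) \<in> borel_measurable borel"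
      using iter_measurable[OF f, of n] by measurable
  qed simp
  have GcL2: "Gc N \<in> L2" for N unfolding Gc_def using cL2 by (intro L2_sum)
  have cmodGc: "cmod (Gc N x) = G N x" for N x
    unfolding Gc_def G_def of_real_sum[symmetric] norm_of_real by (simp add: sum_nonneg)
  have normG: "l2_norm (Gc N) \<le> C" for N
  proof -
    have "l2_norm (Gc N) \<le> (\<Sum>n<N. l2_norm (\<lambda>x. complex_of_real (cmod ((T ^^ n) f x))))"
      unfolding Gc_def using cL2 by (intro l2_norm_sum) auto
    also have "\<dots> \<le> (\<Sum>n<N. q ^ n * l2_norm f)"
      unfolding l2_norm_of_real_cmod using f by (intro sum_mono norm_iter)
    also have "\<dots> \<le> (\<Sum>n. q ^ n) * l2_norm f"
      unfolding sum_distrib_right[symmetric] using q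
      by (intro mult_right_mono sum_le_suminf summable_geometric) auto
    also have "\<dots> = C" using q by (simp add: suminf_geometric C_def)
    finally show ?thesis .
  qed
  have nnG: "(\<integral>\<^sup>+x. ennreal ((G N x)\<^sup>2) \<partial>lborel) \<le> ennreal (C\<^sup>2)" for N
  proof -
    have "(\<integral>\<^sup>+x. ennreal ((G N x)\<^sup>2) \<partial>lborel) = ennreal (\<integral>x. (G N x)\<^sup>2 \<partial>lborel)"
      using L2_integrable[OF GcL2[of N]] by (intro nn_integral_eq_integral) (auto simp: cmodGc)
    also have "\<dots> = ennreal ((l2_norm (Gc N))\<^sup>2)" by (simp only: l2_norm_sq cmodGc)
    also have "\<dots> \<le> ennreal (C\<^sup>2)" using normG[of N] by (intro ennreal_leI power_mono) auto
    finally show ?thesis .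
  qed
  define H where "H x = (SUP N. ennreal ((G N x)\<^sup>2))" for x
  have meas: "(\<lambda>x. ennreal ((G N x)\<^sup>2)) \<in> borel_measurable lborel" for N
  proof -
    have [measurable]: "(T ^^ n) f \<in> borel_measurable lborel" for n using f by simp
    show ?thesis unfolding G_def by measurable
  qed
  have mono: "incseq (\<lambda>N x. ennreal ((G N x)\<^sup>2))"
    unfolding incseq_def le_fun_def G_def
    by (intro allI impI ennreal_leI power_mono sum_mono2) (auto intro: sum_nonneg)
  have intH: "(\<integral>\<^sup>+x. H x \<partial>lborel) \<le> ennreal (C\<^sup>2)"
    unfolding H_def by (subst nn_integral_monotone_convergence_SUP[OF mono meas]) (intro SUP_least nnG)
  have measH: "H \<in> borel_measurable lborel" unfolding H_def using meas by measurable
  have "(\<integral>\<^sup>+x. H x \<partial>lborel) \<noteq> \<infinity>" using intH by (auto simp: top_unique)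
  then have fin: "AE x in lborel. H x \<noteq> \<infinity>" using measH by (rule nn_integral_noteq_infinite[rotated])
  have key: "summable (\<lambda>n. cmod ((T ^^ n) f x)) \<and> ennreal ((cmod (neumann f x))\<^sup>2) \<le> H x" if "H x \<noteq> \<infinity>" for x
  proof -
    obtain b where b: "H x = ennreal b" "b \<ge> 0" using \<open>H x \<noteq> \<infinity>\<close> by (cases "H x") auto
    have Gb: "(G N x)\<^sup>2 \<le> b" for N
    proof -
      have "ennreal ((G N x)\<^sup>2) \<le> ennreal b" unfolding b(1)[symmetric] H_def by (rule SUP_upper) simp
      then show ?thesis using b(2) by simp
    qed
    have "G N x \<le> sqrt b" for N using Gb[of N] by (rule real_le_rsqrt)
    then have summ: "summable (\<lambda>n. cmod ((T ^^ n) f x))"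
      unfolding G_def by (intro summableI_nonneg_bounded) auto
    have "cmod (neumann f x) \<le> (\<Sum>n. cmod ((T ^^ n) f x))"
      unfolding neumann_def by (rule summable_norm[OF summ])
    also have "\<dots> \<le> sqrt b"
      by (rule suminf_le_const[OF summ]) (use \<open>\<And>N. G N x \<le> sqrt b\<close> in \<open>simp add: G_def\<close>)
    finally have "(cmod (neumann f x))\<^sup>2 \<le> (sqrt b)\<^sup>2" by (intro power_mono) auto
    then show ?thesis using summ b by (simp add: ennreal_leI)
  qed
  show "AE x in lborel. summable (\<lambda>n. cmod ((T ^^ n) f x))"
    using fin by eventually_elim (use key in blast)
  have le: "(\<integral>\<^sup>+x. ennreal ((cmod (neumann f x))\<^sup>2) \<partial>lborel) \<le> ennreal (C\<^sup>2)"
  proof -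
    have "(\<integral>\<^sup>+x. ennreal ((cmod (neumann f x))\<^sup>2) \<partial>lborel) \<le> (\<integral>\<^sup>+x. H x \<partial>lborel)"
      by (rule nn_integral_mono_AE) (use fin key in \<open>auto elim: eventually_mono\<close>)
    then show ?thesis using intH by simp
  qed
  note nm = neumann_measurable[OF f]
  show L2n: "neumann f \<in> L2"
  proof (rule L2I[OF nm])
    show "integrable lborel (\<lambda>x. (cmod (neumann f x))\<^sup>2)"
      by (rule integrableI_bounded) (use nm le in \<open>auto simp: le_less_trans\<close>)
  qed
  have "ennreal ((l2_norm (neumann f))\<^sup>2) \<le> ennreal (C\<^sup>2)"
    unfolding l2_norm_sq using le nn_integral_eq_integral[OF L2_integrable[OF L2n]] by simp
  then have "(l2_norm (neumann f))\<^sup>2 \<le> C\<^sup>2" by (simp add: ennreal_le_iff)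
  then have "l2_norm (neumann f) \<le> C" using C by (rule power2_le_imp_le)
  then show "l2_norm (neumann f) \<le> l2_norm f / (1 - q)" by (simp add: C_def)
qed

lemma summable_iter': "f \<in> L2 \<Longrightarrow> AE x in lborel. summable (\<lambda>n. (T ^^ n) f x)"
  by (rule eventually_mono[OF summable_iter]) (auto intro: summable_norm_cancel)

lemma neumann_cong_AE:
  assumes "\<And>n. AE x in lborel. (T ^^ n) f x = h n x"
  shows "AE x in lborel. neumann f x = (\<Sum>n. h n x)"
proof -
  have "AE x in lborel. \<forall>n. (T ^^ n) f x = h n x" using assms by (simp add: AE_all_countable)
  then show ?thesis by eventually_elim (simp add: neumann_def)
qed

lemma iter_add:
  assumes "f \<in> L2" "g \<in> L2"
  shows "AE x in lborel. (T ^^ n) (\<lambda>y. f y + g y) x = (T ^^ n) f x + (T ^^ n) g x"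
proof (induction n)
  case (Suc n)
  have "AE x in lborel. T ((T ^^ n) (\<lambda>y. f y + g y)) x = T (\<lambda>x. (T ^^ n) f x + (T ^^ n) g x) x"
    by (rule cong_AE) (use Suc assms in \<open>auto intro!: L2_add\<close>)
  moreover have "AE x in lborel. T (\<lambda>x. (T ^^ n) f x + (T ^^ n) g x) x = T ((T ^^ n) f) x + T ((T ^^ n) g) x"
    by (rule add) (use assms in auto)
  ultimately show ?case by eventually_elim simp
qed simp

lemma iter_scale:
  assumes "f \<in> L2"
  shows "AE x in lborel. (T ^^ n) (\<lambda>y. c * f y) x = c * (T ^^ n) f x"
proof (induction n)
  case (Suc n)
  have "AE x in lborel. T ((T ^^ n) (\<lambda>y. c * f y)) x = T (\<lambda>x. c * (T ^^ n) f x) x"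
    by (rule cong_AE) (use Suc assms in \<open>auto intro!: L2_scale\<close>)
  moreover have "AE x in lborel. T (\<lambda>x. c * (T ^^ n) f x) x = c * T ((T ^^ n) f) x"
    by (rule scale) (use assms in auto)
  ultimately show ?case by eventually_elim simp
qed simp

lemma neumann_bounded_op: "bounded_op neumann"
  unfolding bounded_op_def
proof (intro conjI ballI allI)
  fix f :: "'a \<Rightarrow> complex" assume f: "f \<in> L2"
  show "neumann f \<in> L2" using f by (rule neumann_L2)
  show "AE x in lborel. neumann (\<lambda>y. c * f y) x = c * neumann f x" for c
    using neumann_cong_AE[OF iter_scale[OF f]] summable_iter'[OF f]
    by eventually_elim (simp add: suminf_mult neumann_def)
  fix g :: "'a \<Rightarrow> complex" assume g: "g \<in> L2"
  show "AE x in lborel. neumann (\<lambda>y. f y + g y) x = neumann f x + neumann g x"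
    using neumann_cong_AE[OF iter_add[OF f g]] summable_iter'[OF f] summable_iter'[OF g]
    by eventually_elim (simp add: suminf_add neumann_def)
next
  show "\<exists>B. \<forall>f\<in>L2. l2_norm (neumann f) \<le> B * l2_norm f"
    using norm_neumann by (intro exI[of _ "1 / (1 - q)"]) auto
qed

text \<open>Pointwise the series telescopes, and its terms tend to 0 wherever the series for
  \<open>f\<close> converges.\<close>

lemma neumann_left_inverse:
  assumes f: "f \<in> L2"
  shows "AE x in lborel. neumann (\<lambda>y. f y - T f y) x = f x"
proof -
  have it: "AE x in lborel. (T ^^ n) (\<lambda>y. f y - T f y) x = (T ^^ n) f x - (T ^^ Suc n) f x" for n
  proof (induction n)
    case (Suc n)
    have "AE x in lborel. T ((T ^^ n) (\<lambda>y. f y - T f y)) x = T (\<lambda>x. (T ^^ n) f x - (T ^^ Suc n) f x) x"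
      by (rule cong_AE) (use Suc f in \<open>auto intro!: L2_diff L2_iter\<close>)
    moreover have "AE x in lborel. T (\<lambda>x. (T ^^ n) f x - (T ^^ Suc n) f x) x = T ((T ^^ n) f) x - T ((T ^^ Suc n) f) x"
      by (rule diff) (use f in auto)
    ultimately show ?case by eventually_elim simp
  qed simp
  from neumann_cong_AE[OF it] summable_iter'[OF f] show ?thesis
  proof eventually_elim
    case (elim x)
    have "(\<lambda>n. (T ^^ n) f x - (T ^^ Suc n) f x) sums ((T ^^ 0) f x - 0)"
      by (rule telescope_sums'[OF summable_LIMSEQ_zero[OF elim(2)]])
    then show ?case using elim(1) by (simp add: sums_iff)
  qed
qed

text \<open>\<open>T\<close> cannot be moved through a pointwise infinite sum, so the residual is
  estimated in norm: it is a tail of the series plus \<open>T\<close> applied to a tail, and both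
  are of order q^N.\<close>

lemma neumann_right_inverse:
  assumes f: "f \<in> L2"
  shows "AE x in lborel. neumann f x - T (neumann f) x = f x"
proof -
  define S where "S = neumann f"
  define P where "P N = (\<lambda>x. \<Sum>n<N. (T ^^ n) f x)" for N
  have S: "S \<in> L2" unfolding S_def using f by (rule neumann_L2)
  have P: "P N \<in> L2" for N unfolding P_def using f by (intro L2_sum) auto
  have tail: "l2_norm (\<lambda>x. S x - P N x) \<le> q ^ N * l2_norm f / (1 - q)" for N
  proof -
    have fN: "(T ^^ N) f \<in> L2" using f by simp
    have "l2_norm (\<lambda>x. S x - P N x) = l2_norm (neumann ((T ^^ N) f))"
    proof (rule l2_norm_cong_AE)
      show "AE x in lborel. S x - P N x = neumann ((T ^^ N) f) x"
        using summable_iter'[OF f]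
      proof eventually_elim
        case (elim x)
        have "neumann ((T ^^ N) f) x = (\<Sum>n. (T ^^ (n + N)) f x)" by (simp add: neumann_def funpow_add)
        then show ?case using suminf_minus_initial_segment[OF elim, of N] by (simp add: S_def P_def neumann_def)
      qed
    qed (use L2_diff[OF S P] neumann_L2[OF fN] L2_measurable in auto)
    also have "\<dots> \<le> l2_norm ((T ^^ N) f) / (1 - q)" using fN by (rule norm_neumann)
    also have "\<dots> \<le> q ^ N * l2_norm f / (1 - q)" using norm_iter[OF f] q by (intro divide_right_mono) auto
    finally show ?thesis .
  qed
  have TP: "AE x in lborel. P (Suc N) x = f x + T (P N) x" for N
  proof -
    have "AE x in lborel. T (P N) x = (\<Sum>n<N. T ((T ^^ n) f) x)"
      unfolding P_def using f by (intro sum) auto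
    then show ?thesis
    proof eventually_elim
      case (elim x)
      have "P (Suc N) x = (T ^^ 0) f x + (\<Sum>n<N. (T ^^ Suc n) f x)" unfolding P_def by (rule sum.lessThan_Suc_shift)
      then show ?case using elim by simp
    qed
  qed
  define h where "h = (\<lambda>x. S x - T S x - f x)"
  have h: "h \<in> L2" unfolding h_def using S f by (intro L2_diff) auto
  have "l2_norm h \<le> 2 * (q ^ N * l2_norm f / (1 - q))" for N
  proof -
    have Td: "AE x in lborel. T (\<lambda>x. P N x - S x) x = T (P N) x - T S x" using P S by (rule diff)
    have "l2_norm h = l2_norm (\<lambda>x. (S x - P (Suc N) x) + T (\<lambda>x. P N x - S x) x)"
    proof (rule l2_norm_cong_AE)
      show "AE x in lborel. h x = (S x - P (Suc N) x) + T (\<lambda>x. P N x - S x) x"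
        using Td TP[of N] by eventually_elim (simp add: h_def)
    qed (use h L2_add[OF L2_diff[OF S P] L2[OF L2_diff[OF P S]]] L2_measurable in auto)
    also have "\<dots> \<le> l2_norm (\<lambda>x. S x - P (Suc N) x) + l2_norm (T (\<lambda>x. P N x - S x))"
      by (rule l2_norm_triangle[OF L2_diff[OF S P] L2[OF L2_diff[OF P S]]])
    also have "l2_norm (\<lambda>x. S x - P (Suc N) x) \<le> q ^ N * l2_norm f / (1 - q)"
    proof (rule order_trans[OF tail])
      show "q ^ Suc N * l2_norm f / (1 - q) \<le> q ^ N * l2_norm f / (1 - q)"
        using q by (intro divide_right_mono mult_right_mono power_decreasing) auto
    qed
    also have "l2_norm (T (\<lambda>x. P N x - S x)) \<le> q * l2_norm (\<lambda>x. P N x - S x)"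
      by (rule contraction[OF L2_diff[OF P S]])
    also have "\<dots> \<le> 1 * l2_norm (\<lambda>x. P N x - S x)" using q by (intro mult_right_mono) auto
    also have "l2_norm (\<lambda>x. P N x - S x) = l2_norm (\<lambda>x. S x - P N x)" by (rule l2_norm_diff_commute)
    also have "1 * \<dots> \<le> q ^ N * l2_norm f / (1 - q)" using tail by simp
    finally show ?thesis by (simp add: mult.commute)
  qed
  moreover have "(\<lambda>N. 2 * (q ^ N * l2_norm f / (1 - q))) \<longlonglongrightarrow> 2 * (0 * l2_norm f / (1 - q))"
    using q by (intro tendsto_intros LIMSEQ_realpow_zero) auto
  ultimately have "l2_norm h \<le> 0" by (intro LIMSEQ_le_const) auto
  then have "l2_norm h = 0" by (simp add: order_antisym)
  from l2_norm_eq_0[OF h this] show ?thesis by eventually_elim (simp add: h_def S_def)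
qed

lemma inv_op_id_minus:
  "bounded_op (inv_op (diff_op id_op T)) \<and> (\<forall>f\<in>L2. AE x in lborel.
     inv_op (diff_op id_op T) f x - T (inv_op (diff_op id_op T) f) x = f x)"
proof -
  have "\<exists>S. bounded_op S \<and> (\<forall>f\<in>L2. (AE x in lborel. S (diff_op id_op T f) x = f x) \<and>
      (AE x in lborel. diff_op id_op T (S f) x = f x))"
    using neumann_bounded_op neumann_left_inverse neumann_right_inverse
    by (intro exI[of _ neumann]) (simp add: diff_op_def id_op_def)
  from someI_ex[OF this] show ?thesis
    unfolding inv_op_def[symmetric] by (auto simp: diff_op_def id_op_def)
qed

end

text \<open>With \<open>g = (I - K)\<^sup>-\<^sup>1 f\<close> one has \<open>\<langle>f, (J - K) f\<rangle> = \<langle>K g, (I - K) K g\<rangle>\<close>.\<close>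

lemma J_op_ge:
  assumes "bounded_op K" "hermitian_op K" "op_le K id_op" "op_norm K < 1"
  shows "bounded_op (J_op K)" and "op_le K (J_op K)"
proof -
  interpret bounded_L2_op K by unfold_locales fact
  interpret contraction_L2_op K "op_norm K"
    by unfold_locales (use op_norm_nonneg assms(4) norm_le_op_norm in auto)
  define S where "S = inv_op (diff_op id_op K)"
  have bS: "bounded_op S" and inv: "\<And>f. f \<in> L2 \<Longrightarrow> AE x in lborel. S f x - K (S f) x = f x"
    using inv_op_id_minus by (auto simp: S_def)
  interpret S: bounded_L2_op S by unfold_locales (rule bS)
  have J: "J_op K = (\<lambda>f. K (S f))" by (auto simp: J_op_def S_def)
  show "bounded_op (J_op K)"
    unfolding J bounded_op_def
  proof (intro conjI ballI allI)
    fix f :: "'a \<Rightarrow> complex" assume f: "f \<in> L2"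
    show "K (S f) \<in> L2" using f by simp
    show "AE x in lborel. K (S (\<lambda>y. c * f y)) x = c * K (S f) x" for c
    proof -
      have "AE x in lborel. K (S (\<lambda>y. c * f y)) x = K (\<lambda>y. c * S f y) x"
        by (rule cong_AE) (use S.scale f in \<open>auto intro!: L2_scale S.L2\<close>)
      with scale[OF S.L2[OF f], of c] show ?thesis by eventually_elim simp
    qed
    fix g :: "'a \<Rightarrow> complex" assume g: "g \<in> L2"
    have "AE x in lborel. K (S (\<lambda>y. f y + g y)) x = K (\<lambda>y. S f y + S g y) x"
      by (rule cong_AE) (use S.add f g in \<open>auto intro!: L2_add S.L2\<close>)
    with add[OF S.L2[OF f] S.L2[OF g]]
    show "AE x in lborel. K (S (\<lambda>y. f y + g y)) x = K (S f) x + K (S g) x" by eventually_elim simp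
  next
    obtain B where B: "B \<ge> 0" "\<forall>f\<in>L2. l2_norm (K f) \<le> B * l2_norm f" using bound by blast
    obtain C where C: "C \<ge> 0" "\<forall>f\<in>L2. l2_norm (S f) \<le> C * l2_norm f" using S.bound by blast
    have "l2_norm (K (S f)) \<le> B * C * l2_norm f" if f: "f \<in> L2" for f
    proof -
      have "l2_norm (K (S f)) \<le> B * l2_norm (S f)" using B f by simp
      also have "\<dots> \<le> B * (C * l2_norm f)" using B C f by (intro mult_left_mono) auto
      finally show ?thesis by (simp add: mult.assoc)
    qed
    then show "\<exists>B. \<forall>f\<in>L2. l2_norm (K (S f)) \<le> B * l2_norm f" by blast
  qed
  show "op_le K (J_op K)"
    unfolding op_le_def positive_op_def
  proof
    fix f :: "'a \<Rightarrow> complex" assume f: "f \<in> L2"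
    define g where "g = S f"
    have L: "g \<in> L2" "K g \<in> L2" "K (K g) \<in> L2" unfolding g_def using f by auto
    have fg: "AE x in lborel. f x = g x - K g x" using inv[OF f] by eventually_elim (simp add: g_def)
    have "AE x in lborel. K f x = K (\<lambda>x. g x - K g x) x"
      by (rule cong_AE) (use f fg L in \<open>auto intro!: L2_diff\<close>)
    with diff[OF L(1,2)] have Kf: "AE x in lborel. K g x - K f x = K (K g) x" by eventually_elim simp
    have "l2_inner f (diff_op (J_op K) K f) = l2_inner (\<lambda>x. g x - K g x) (K (K g))"
      unfolding diff_op_def J g_def[symmetric]
      by (rule l2_inner_cong_AE)
        (use f L fg Kf in \<open>auto intro!: L2_measurable L2_diff\<close>)
    also have "\<dots> = l2_inner g (K (K g)) - l2_inner (K g) (K (K g))"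
      using L by (intro l2_inner_diff_left) auto
    also have "l2_inner g (K (K g)) = l2_inner (K g) (K g)"
      using assms(2) L by (simp add: hermitian_op_def)
    also have "l2_inner (K g) (K g) - l2_inner (K g) (K (K g)) = l2_inner (K g) (diff_op id_op K (K g))"
      using L by (simp add: diff_op_def id_op_def l2_inner_diff_right)
    finally show "l2_inner f (diff_op (J_op K) K f) \<in> \<real>\<^sub>\<ge>\<^sub>0"
      using assms(3) L by (simp add: op_le_def positive_op_def)
  qed
qed

section \<open>Configurations as a measurable space\<close>

lemma space_config_space [simp]: "space config_space = configs"
  unfolding config_space_def using openin_subset by (fastforce simp: space_measure_of_conv)

lemma sets_config_space_openin: "openin vague_topology U \<Longrightarrow> U \<in> sets config_space"
  unfolding config_space_def using openin_subset by (subst sets_measure_of) fastforce+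

lemma space_fin_config_space [simp]: "space fin_config_space = fin_configs"
  unfolding fin_config_space_def space_restrict_space using fin_configs_subset by auto

text \<open>A configuration is a set and forgets multiplicities, so the image map is discontinuous
  where coordinates collide. It is therefore treated on finitely many Borel pieces, one for each set
  of indices that may list every value exactly once.\<close>

lemma borel_measurable_image_tuple:
  "(\<lambda>x. x ` {..<m}) \<in> measurable (borel :: (nat \<Rightarrow> 'a::euclidean_space) measure) config_space"
  unfolding config_space_def
proof (rule measurable_measure_of)
  show "{U. openin vague_topology U} \<subseteq> Pow (configs :: 'a set set)" using openin_subset by fastforce
  show "(\<lambda>x. x ` {..<m}) \<in> space borel \<rightarrow> configs" by (auto simp: configs_finite)
  fix U :: "'a set set" assume "U \<in> {U. openin vague_topology U}"
  then have U: "openin vague_topology U" by simp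
  text \<open>On the set where \<open>J\<close> indexes the distinct entries the image map is continuous.\<close>
  define S where "S J = {x::nat \<Rightarrow> 'a. (\<forall>i\<in>J. \<forall>l\<in>J. i \<noteq> l \<longrightarrow> x i \<noteq> x l) \<and> (\<forall>i\<in>{..<m}. \<exists>l\<in>J. x i = x l)}" for J
  have S_borel: "S J \<in> sets borel" if "J \<subseteq> {..<m}" for J
  proof -
    have J: "countable J" using that finite_subset by (blast intro: countable_finite)
    have eq: "{x::nat \<Rightarrow> 'a. x i = x l} \<in> sets borel" for i l
      by (intro borel_closed closed_Collect_eq continuous_on_product_coordinates)
    have ne: "{x::nat \<Rightarrow> 'a. i \<noteq> l \<longrightarrow> x i \<noteq> x l} \<in> sets borel" for i l
      using sets.compl_sets[OF eq[of i l]] by (cases "i = l") (simp_all add: Compl_eq_Diff_UNIV[symmetric] Collect_neg_eq)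
    have "S J = (\<Inter>i\<in>J. \<Inter>l\<in>J. {x. i \<noteq> l \<longrightarrow> x i \<noteq> x l}) \<inter> (\<Inter>i\<in>{..<m}. \<Union>l\<in>J. {x. x i = x l})"
      by (auto simp: S_def)
    moreover have U: "(UNIV :: (nat \<Rightarrow> 'a) set) \<in> sets borel" by simp
    have "(\<Inter>i\<in>J. \<Inter>l\<in>J. {x::nat \<Rightarrow> 'a. i \<noteq> l \<longrightarrow> x i \<noteq> x l}) \<in> sets borel"
      by (rule sets.countable_INT''[OF U J], rule sets.countable_INT''[OF U J], rule ne)
    moreover have "(\<Inter>i\<in>{..<m}. \<Union>l\<in>J. {x::nat \<Rightarrow> 'a. x i = x l}) \<in> sets borel"
      by (rule sets.countable_INT''[OF U countable_finite], simp, rule sets.countable_UN''[OF J], rule eq)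
    ultimately show ?thesis by (simp only: sets.Int)
  qed
  have S_image: "x ` {..<m} = x ` J" "inj_on x J" if "x \<in> S J" "J \<subseteq> {..<m}" for x J
    using that by (auto simp: S_def inj_on_def)
  have cont: "continuous_map (top_of_set (S J)) vague_topology (\<lambda>x. x ` {..<m})" if J: "J \<subseteq> {..<m}" for J
    unfolding vague_topology_def config_topology_def
  proof (rule continuous_on_generated_topo)
    fix V :: "'a set set" assume "V \<in> {{\<xi> \<in> configs. (\<Sum>\<^sub>\<infinity>x\<in>\<xi>. f x) \<in> U} |f U. f \<in> test_functions \<and> open U}"
    then obtain f :: "'a \<Rightarrow> real" and G where V: "V = {\<xi> \<in> configs. (\<Sum>\<^sub>\<infinity>x\<in>\<xi>. f x) \<in> G}"
      and f: "continuous_on UNIV f" and G: "open G" by auto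
    have "continuous_on (S J) (\<lambda>x. \<Sum>i\<in>J. f (x i))"
      by (intro continuous_on_sum continuous_on_compose2[OF f] continuous_on_subset[OF continuous_on_product_coordinates]) auto
    then have "openin (top_of_set (S J)) (S J \<inter> (\<lambda>x. \<Sum>i\<in>J. f (x i)) -` G)"
      using G by (rule continuous_openin_preimage_gen)
    moreover have "(\<Sum>\<^sub>\<infinity>z\<in>x ` {..<m}. f z) = (\<Sum>i\<in>J. f (x i))" if "x \<in> S J" for x
    proof -
      have "(\<Sum>\<^sub>\<infinity>z\<in>x ` {..<m}. f z) = (\<Sum>z\<in>x ` {..<m}. f z)" by simp
      also have "\<dots> = (\<Sum>i\<in>J. f (x i))"
        using S_image[OF that J] by (simp add: sum.reindex)
      finally show ?thesis .
    qed
    then have "(\<lambda>x. x ` {..<m}) -` V \<inter> topspace (top_of_set (S J)) = S J \<inter> (\<lambda>x. \<Sum>i\<in>J. f (x i)) -` G"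
      by (auto simp: V configs_finite)
    ultimately show "openin (top_of_set (S J)) ((\<lambda>x. x ` {..<m}) -` V \<inter> topspace (top_of_set (S J)))" by simp
  next
    have "configs \<in> {{\<xi> \<in> configs. (\<Sum>\<^sub>\<infinity>x\<in>\<xi>. f x) \<in> U} |f U. f \<in> (test_functions :: ('a \<Rightarrow> real) set) \<and> open U}"
      by (intro CollectI exI[of _ "\<lambda>x. 0"] exI[of _ UNIV]) auto
    moreover have "(\<lambda>x. x ` {..<m}) ` topspace (top_of_set (S J)) \<subseteq> configs" by (auto simp: configs_finite)
    ultimately show "(\<lambda>x. x ` {..<m}) ` topspace (top_of_set (S J))
        \<subseteq> \<Union> {{\<xi> \<in> configs. (\<Sum>\<^sub>\<infinity>x\<in>\<xi>. f x) \<in> U} |f U. f \<in> (test_functions :: ('a \<Rightarrow> real) set) \<and> open U}"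
      by (meson Union_upper subset_trans)
  qed
  have meas: "{x \<in> S J. x ` {..<m} \<in> U} \<in> sets borel" if J: "J \<subseteq> {..<m}" for J
  proof -
    have "openin (top_of_set (S J)) {x \<in> topspace (top_of_set (S J)). x ` {..<m} \<in> U}"
      using cont[OF J] U by (rule openin_continuous_map_preimage)
    then obtain T where T: "open T" "{x \<in> S J. x ` {..<m} \<in> U} = S J \<inter> T" by (auto simp: openin_open)
    then show ?thesis using S_borel[OF J] by auto
  qed
  have "(\<lambda>x. x ` {..<m}) -` U \<inter> space borel = (\<Union>J\<in>Pow {..<m}. {x \<in> S J. x ` {..<m} \<in> U})"
  proof -
    have "\<exists>J\<in>Pow {..<m}. x \<in> S J" for x :: "nat \<Rightarrow> 'a"
    proof -
      obtain J where J: "J \<subseteq> {..<m}" "inj_on x J" "x ` {..<m} = x ` J"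
        using subset_image_inj[of "x ` {..<m}" x "{..<m}"] by auto
      then have "x \<in> S J" by (force simp: S_def inj_on_def)
      then show ?thesis using J by blast
    qed
    then show ?thesis by auto
  qed
  then show "(\<lambda>x. x ` {..<m}) -` U \<inter> space borel \<in> sets (borel :: (nat \<Rightarrow> 'a) measure)"
    using meas by (auto intro!: sets.finite_UN)
qed

section \<open>Tuples of points and the measure on finite configurations\<close>

abbreviation tuples :: "nat \<Rightarrow> (nat \<Rightarrow> 'a::euclidean_space) measure" where
  "tuples m \<equiv> Pi\<^sub>M {..<m} (\<lambda>_. lborel)"

text \<open>Elements of the product space are \<open>undefined\<close> from index \<open>m\<close>
  on; padding with 0 moves them into the topological space of all sequences without changing the
  image.\<close>

lemma measurable_tuples_image: "(\<lambda>x. x ` {..<m}) \<in> measurable (tuples m) config_space"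
proof -
  have "(\<lambda>x i. if i < m then x i else 0) \<in> measurable (tuples m) (borel :: (nat \<Rightarrow> 'a) measure)"
  proof (rule measurable_coordinatewise_then_product)
    show "(\<lambda>x. if i < m then x i else 0) \<in> borel_measurable (tuples m :: (nat \<Rightarrow> 'a) measure)" for i
      using measurable_component_singleton[of i "{..<m}" "\<lambda>_. lborel :: 'a measure"]
      by (cases "i < m") simp_all
  qed
  from measurable_comp[OF this borel_measurable_image_tuple[of m]]
  show ?thesis by (simp add: comp_def cong: image_cong_simp)
qed

lemma sets_tuples_vimage:
  assumes "A \<in> sets fin_config_space"
  shows "{x \<in> space (tuples m). x ` {..<m} \<in> A} \<in> sets (tuples m)"
proof -
  obtain B where B: "B \<in> sets config_space" "A = fin_configs \<inter> B"
    using assms by (auto simp: fin_config_space_def sets_restrict_space)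
  have "{x \<in> space (tuples m). x ` {..<m} \<in> A} = (\<lambda>x. x ` {..<m}) -` B \<inter> space (tuples m)"
    using B(2) by (auto simp: fin_configs_def)
  then show ?thesis using measurable_sets[OF measurable_tuples_image B(1)] by simp
qed

lemma sets_L_measure [simp]: "sets L_measure = sets fin_config_space"
  unfolding L_measure_def
  using sets.sets_measure_of_eq[of fin_config_space] by simp

lemma space_L_measure [simp]: "space L_measure = fin_configs"
  unfolding L_measure_def using sets.space_measure_of_eq[of fin_config_space] by simp

lemma suminf_swap_ennreal:
  fixes f :: "nat \<Rightarrow> nat \<Rightarrow> ennreal"
  shows "(\<Sum>i. \<Sum>m. f i m) = (\<Sum>m. \<Sum>i. f i m)"
  using nn_integral_suminf[of f "count_space UNIV"] by (simp add: nn_integral_count_space_nat)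

text \<open>\<open>measure_of\<close> takes the prescribed values only once the set function is
  known to be countably additive; this comes layer by layer from the product measures.\<close>

lemma emeasure_L_measure:
  fixes A :: "'a::euclidean_space set set"
  assumes A: "A \<in> sets fin_config_space"
  shows "emeasure L_measure A =
    (\<Sum>m. ennreal (1 / fact m) * emeasure (tuples m) {x \<in> space (tuples m). x ` {..<m} \<in> A})"
proof (rule emeasure_measure_of[OF L_measure_def])
  show "sets fin_config_space \<subseteq> Pow fin_configs" using sets.sets_into_space[of _ fin_config_space] by auto
  show "A \<in> sets L_measure" using A by simp
  show "positive (sets (L_measure :: 'a set measure)) (\<lambda>A. \<Sum>m. ennreal (1 / fact m) *
      emeasure (tuples m) {x \<in> space (tuples m). x ` {..<m} \<in> A})"
    by (simp add: positive_def)
  show "countably_additive (sets (L_measure :: 'a set measure)) (\<lambda>A. \<Sum>m. ennreal (1 / fact m) *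
      emeasure (tuples m) {x \<in> space (tuples m). x ` {..<m} \<in> A})"
    unfolding countably_additive_def
  proof (intro allI impI)
    fix B :: "nat \<Rightarrow> 'a set set" assume B: "range B \<subseteq> sets L_measure" "disjoint_family B"
      and "\<Union> (range B) \<in> sets L_measure"
    have "(\<Sum>i. emeasure (tuples m) {x \<in> space (tuples m). x ` {..<m} \<in> B i}) =
        emeasure (tuples m) {x \<in> space (tuples m). x ` {..<m} \<in> (\<Union>i. B i)}" for m
    proof -
      have "{x \<in> space (tuples m). x ` {..<m} \<in> (\<Union>i. B i)} =
          (\<Union>i. {x \<in> space (tuples m). x ` {..<m} \<in> B i})" by auto
      moreover have "disjoint_family (\<lambda>i. {x \<in> space (tuples m). x ` {..<m} \<in> B i})"
        using B(2) by (fastforce simp: disjoint_family_on_def)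
      moreover have "range (\<lambda>i. {x \<in> space (tuples m). x ` {..<m} \<in> B i}) \<subseteq> sets (tuples m)"
        using B(1) by (intro image_subsetI sets_tuples_vimage) auto
      ultimately show ?thesis by (subst suminf_emeasure) auto
    qed
    then show "(\<Sum>i. \<Sum>m. ennreal (1 / fact m) * emeasure (tuples m) {x \<in> space (tuples m). x ` {..<m} \<in> B i})
        = (\<Sum>m. ennreal (1 / fact m) * emeasure (tuples m) {x \<in> space (tuples m). x ` {..<m} \<in> (\<Union>i. B i)})"
      by (subst suminf_swap_ennreal) simp
  qed
qed

lemma emeasure_L_measure_eq_0:
  assumes A: "A \<in> sets fin_config_space"
    and 0: "\<And>m. AE x in tuples m. x ` {..<m} \<notin> A"
  shows "emeasure L_measure A = 0"
proof -
  have "emeasure (tuples m) {x \<in> space (tuples m). x ` {..<m} \<in> A} = 0" for m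
    using 0[of m] AE_iff_measurable[OF sets_tuples_vimage[OF A, of m], of "\<lambda>x. x ` {..<m} \<notin> A"]
    by simp
  then show ?thesis by (simp add: emeasure_L_measure[OF A])
qed

text \<open>The integral is the supremum over the simple functions below \<open>f\<close>, so \<open>f\<close> may be non-measurable.\<close>

lemma nn_integral_L_measure_eq_0:
  assumes "\<And>m. AE x in tuples m. f (x ` {..<m}) = 0"
  shows "(\<integral>\<^sup>+\<alpha>. f \<alpha> \<partial>L_measure) = 0"
proof -
  have "integral\<^sup>S L_measure g = 0" if g: "simple_function L_measure g" "g \<le> f" for g
  proof -
    have A: "{\<alpha> \<in> space L_measure. g \<alpha> \<noteq> 0} \<in> sets L_measure"
      using borel_measurable_simple_function[OF g(1)] by measurable
    have "AE x in tuples m. x ` {..<m} \<notin> {\<alpha> \<in> space L_measure. g \<alpha> \<noteq> 0}" for m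
      using assms[of m]
    proof eventually_elim
      case (elim x)
      have "g (x ` {..<m}) \<le> f (x ` {..<m})" using g(2) by (rule le_funD)
      then show ?case using elim by simp
    qed
    then have "emeasure L_measure {\<alpha> \<in> space L_measure. g \<alpha> \<noteq> 0} = 0"
      using A by (intro emeasure_L_measure_eq_0) auto
    then have "AE \<alpha> in L_measure. g \<alpha> = 0"
      using AE_iff_measurable[OF A refl] by simp
    then have "(\<integral>\<^sup>+\<alpha>. g \<alpha> \<partial>L_measure) = (\<integral>\<^sup>+\<alpha>. 0 \<partial>(L_measure :: 'a set measure))" by (rule nn_integral_cong_AE)
    then show ?thesis using g(1) by (simp add: nn_integral_eq_simple_integral)
  qed
  then show ?thesis unfolding nn_integral_def by (auto simp: SUP_eq_const intro!: antisym SUP_least)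
qed

text \<open>All weights 1/m! are positive, so a null set of the whole sum is null for every number
  of points.\<close>

lemma AE_L_measure_tuples:
  assumes "AE \<alpha> in L_measure. P \<alpha>"
  shows "AE x in tuples m. P (x ` {..<m})"
proof -
  obtain N where N: "{\<alpha> \<in> space L_measure. \<not> P \<alpha>} \<subseteq> N" "emeasure L_measure N = 0" "N \<in> sets L_measure"
    using assms by (auto elim: AE_E)
  have "emeasure (tuples m) {x \<in> space (tuples m). x ` {..<m} \<in> N} = 0"
  proof -
    have "ennreal (1 / fact m) \<noteq> 0" by (simp add: ennreal_eq_0_iff not_le)
    then show ?thesis
      using N suminf_eq_zero_iff[OF summableI, of "\<lambda>m. ennreal (1 / fact m) *
          emeasure (tuples m) {x \<in> space (tuples m). x ` {..<m} \<in> N}"]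
      by (auto simp: emeasure_L_measure)
  qed
  then have "{x \<in> space (tuples m). x ` {..<m} \<in> N} \<in> null_sets (tuples m)"
    using N sets_tuples_vimage by (auto intro: null_setsI)
  then show ?thesis
    by (rule AE_I') (use N(1) in \<open>auto simp: fin_configs_def\<close>)
qed

lemma product_sigma_finite_lborel: "product_sigma_finite (\<lambda>i::nat. lborel :: 'a::euclidean_space measure)"
  by unfold_locales

lemma openin_hit_open:
  assumes "open S" shows "openin vague_topology {\<xi> \<in> configs. \<xi> \<inter> S \<noteq> {}}"
proof -
  have "{\<xi> \<in> configs. \<xi> \<inter> S \<noteq> {}} = (\<Union>(a, r)\<in>{(a, r). r > 0 \<and> ball a r \<subseteq> S}. {\<xi> \<in> configs. \<xi> \<inter> ball a r \<noteq> {}})"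
    (is "?l = ?r")
  proof
    show "?l \<subseteq> ?r"
    proof
      fix \<xi> assume "\<xi> \<in> ?l"
      then obtain a where a: "a \<in> \<xi>" "a \<in> S" "\<xi> \<in> configs" by auto
      obtain r where "r > 0" "ball a r \<subseteq> S" using assms a by (meson openE)
      then have "a \<in> \<xi> \<inter> ball a r" using a by simp
      then show "\<xi> \<in> ?r" using a \<open>r > 0\<close> \<open>ball a r \<subseteq> S\<close> by (intro UN_I[of "(a, r)"]) auto
    qed
  qed auto
  moreover have "openin vague_topology ?r"
    unfolding vague_topology_def by (intro openin_Union) (auto intro: openin_hit)
  ultimately show ?thesis by simp
qed

text \<open>Finite configurations inside a ball of volume \<open>v\<close> have measure at most the
  sum of v^m / m!, a convergent exponential series, and such balls exhaust all finite
  configurations.\<close>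

lemma sigma_finite_L_measure: "sigma_finite_measure (L_measure :: 'a::euclidean_space set measure)"
proof
  interpret product_sigma_finite "\<lambda>i::nat. lborel :: 'a measure" by (rule product_sigma_finite_lborel)
  define A where "A n = {\<alpha> \<in> fin_configs. \<alpha> \<subseteq> cball (0::'a) (real n)}" for n
  have meas: "A n \<in> sets fin_config_space" for n
  proof -
    have "{\<xi> \<in> configs. \<xi> \<inter> - cball (0::'a) (real n) \<noteq> {}} \<in> sets config_space"
      by (intro sets_config_space_openin openin_hit_open) auto
    then have "configs - {\<xi> \<in> configs. \<xi> \<inter> - cball (0::'a) (real n) \<noteq> {}} \<in> sets config_space"
      using sets.compl_sets[of _ config_space] by simp
    moreover have "A n = fin_configs \<inter> (configs - {\<xi> \<in> configs. \<xi> \<inter> - cball (0::'a) (real n) \<noteq> {}})"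
      using fin_configs_subset by (auto simp: A_def)
    ultimately show ?thesis by (auto simp: fin_config_space_def sets_restrict_space)
  qed
  have fin: "emeasure L_measure (A n) \<noteq> \<infinity>" for n
  proof -
    define v where "v = measure lborel (cball (0::'a) (real n))"
    have v: "v \<ge> 0" "emeasure lborel (cball (0::'a) (real n)) = ennreal v"
      using emeasure_lborel_cball_finite[of "0::'a" "real n"] by (auto simp: v_def emeasure_eq_ennreal_measure)
    have "emeasure (tuples m) {x \<in> space (tuples m). x ` {..<m} \<in> A n} \<le> ennreal (v ^ m)" for m
    proof -
      have "emeasure (tuples m) {x \<in> space (tuples m). x ` {..<m} \<in> A n}
          \<le> emeasure (tuples m) (Pi\<^sub>E {..<m} (\<lambda>_. cball (0::'a) (real n)))"
        by (rule emeasure_mono) (auto simp: A_def space_PiM PiE_iff extensional_def intro!: sets_PiM_I_finite)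
      also have "\<dots> = (\<Prod>i<m. emeasure lborel (cball (0::'a) (real n)))"
        by (rule emeasure_PiM) auto
      also have "\<dots> = ennreal (v ^ m)" using v by (simp add: ennreal_power)
      finally show ?thesis .
    qed
    then have "emeasure L_measure (A n) \<le> (\<Sum>m. ennreal (1 / fact m) * ennreal (v ^ m))"
      unfolding emeasure_L_measure[OF meas] by (intro suminf_le mult_left_mono) auto
    also have "\<dots> = (\<Sum>m. ennreal (v ^ m / fact m))"
      using v by (simp add: ennreal_mult[symmetric])
    also have "\<dots> < \<infinity>"
    proof -
      have "summable (\<lambda>m. v ^ m / fact m)"
        using summable_exp[of v] by (simp add: divide_inverse mult.commute)
      then have "(\<Sum>m. ennreal (v ^ m / fact m)) \<noteq> \<infinity>"
        unfolding infinity_ennreal_def using v(1) by (intro ennreal_suminf_neq_top) simp_all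
      then show ?thesis by (simp add: less_top)
    qed
    finally show ?thesis by simp
  qed
  have "(\<Union>n. A n) = fin_configs"
  proof -
    have "\<exists>n. \<alpha> \<subseteq> cball 0 (real n)" if fin\<alpha>: "finite \<alpha>" for \<alpha> :: "'a set"
    proof -
      obtain r where "\<alpha> \<subseteq> cball 0 r" using finite_imp_bounded[OF fin\<alpha>] by (auto simp: bounded_iff subset_iff)
      moreover obtain n where "r \<le> real n" using real_arch_simple by blast
      ultimately show ?thesis by (meson order_trans subset_cball)
    qed
    then show ?thesis by (auto simp: A_def fin_configs_def)
  qed
  then show "\<exists>A. countable A \<and> A \<subseteq> sets (L_measure :: 'a set measure) \<and> \<Union> A = space L_measure
      \<and> (\<forall>a\<in>A. emeasure L_measure a \<noteq> \<infinity>)"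
    using meas fin by (intro exI[of _ "range A"]) auto
qed

lemma tuples_coord_null:
  assumes N: "N \<in> null_sets lborel" and i: "i < m"
  shows "AE x in tuples m. x i \<notin> N"
proof -
  interpret product_sigma_finite "\<lambda>i::nat. lborel :: 'a::euclidean_space measure"
    by (rule product_sigma_finite_lborel)
  define Q where "Q l = (if l = i then N else UNIV)" for l
  have sets: "Q l \<in> sets lborel" for l using N by (auto simp: Q_def null_sets_def)
  have "emeasure (tuples m) (Pi\<^sub>E {..<m} Q) = (\<Prod>l<m. emeasure lborel (Q l))"
    using sets by (intro emeasure_PiM) auto
  also have "\<dots> = 0" using i N by (intro prod_zero) (auto simp: Q_def null_sets_def)
  finally have "Pi\<^sub>E {..<m} Q \<in> null_sets (tuples m)"
    using sets by (auto intro!: null_setsI sets_PiM_I_finite)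
  then show ?thesis
    by (rule AE_I') (auto simp: space_PiM PiE_iff Q_def extensional_def)
qed

lemma countable_config: "\<xi> \<in> configs \<Longrightarrow> countable \<xi>"
proof -
  assume \<xi>: "\<xi> \<in> configs"
  have "\<xi> = (\<Union>n. \<xi> \<inter> cball 0 (real n))" using real_arch_simple by fastforce
  moreover have "countable (\<Union>n. \<xi> \<inter> cball 0 (real n))"
    using finite_config_cball[OF \<xi>] by (intro countable_UN) (auto intro: countable_finite)
  ultimately show ?thesis by simp
qed

lemma sets_hits:
  assumes "open S"
  shows "{\<xi> \<in> configs. \<xi> \<inter> S \<noteq> {}} \<in> sets config_space"
    and "{\<alpha> \<in> fin_configs. \<alpha> \<inter> S \<noteq> {}} \<in> sets fin_config_space"
proof -
  show 1: "{\<xi> \<in> configs. \<xi> \<inter> S \<noteq> {}} \<in> sets config_space"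
    using assms by (intro sets_config_space_openin openin_hit_open)
  have "{\<alpha> \<in> fin_configs. \<alpha> \<inter> S \<noteq> {}} = fin_configs \<inter> {\<xi> \<in> configs. \<xi> \<inter> S \<noteq> {}}"
    using fin_configs_subset by auto
  then show "{\<alpha> \<in> fin_configs. \<alpha> \<inter> S \<noteq> {}} \<in> sets fin_config_space"
    using 1 by (auto simp: fin_config_space_def sets_restrict_space)
qed

text \<open>Finite and locally finite sets meet iff at every scale some ball of a countable family meets
  both; this gives joint measurability.\<close>

lemma AE_disjoint:
  fixes \<mu> :: "'a::euclidean_space set measure"
  assumes \<mu>: "point_process \<mu>"
  shows "AE p in L_measure \<Otimes>\<^sub>M \<mu>. fst p \<inter> snd p = {}"
proof -
  interpret P: prob_space \<mu> using \<mu> by (simp add: point_process_def)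
  interpret L: sigma_finite_measure "L_measure :: 'a set measure" by (rule sigma_finite_L_measure)
  interpret pair_sigma_finite "L_measure :: 'a set measure" \<mu> ..
  have sets\<mu>: "sets \<mu> = sets config_space" "space \<mu> = configs" using \<mu> by (auto simp: point_process_def)
  obtain Q :: "'a set" where Q: "countable Q" "\<And>X. open X \<Longrightarrow> X \<noteq> {} \<Longrightarrow> \<exists>d\<in>Q. d \<in> X"
    using countable_dense_setE by blast
  define H where "H q n = {\<alpha> \<in> fin_configs. \<alpha> \<inter> ball q (1 / real (Suc n)) \<noteq> {}} \<times>
      {\<xi> \<in> configs. \<xi> \<inter> ball q (1 / real (Suc n)) \<noteq> {}}" for q :: 'a and n
  define Z where "Z = {p \<in> space (L_measure \<Otimes>\<^sub>M \<mu>). fst p \<inter> snd p \<noteq> {}}"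
  have "Z = (\<Inter>n. \<Union>q\<in>Q. H q n)"
  proof (intro equalityI subsetI)
    fix p assume p: "p \<in> Z"
    obtain \<alpha> \<xi> where \<alpha>\<xi>: "p = (\<alpha>, \<xi>)" by (cases p)
    then obtain x where x: "x \<in> \<alpha>" "x \<in> \<xi>" "\<alpha> \<in> fin_configs" "\<xi> \<in> configs"
      using p sets\<mu> by (auto simp: Z_def space_pair_measure)
    have "p \<in> (\<Union>q\<in>Q. H q n)" for n
    proof -
      obtain q where "q \<in> Q" "q \<in> ball x (1 / real (Suc n))"
        using Q(2)[of "ball x (1 / real (Suc n))"] by auto
      then show ?thesis using x \<alpha>\<xi> by (auto simp: H_def dist_commute intro!: bexI[of _ q])
    qed
    then show "p \<in> (\<Inter>n. \<Union>q\<in>Q. H q n)" by blast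
  next
    fix p assume p: "p \<in> (\<Inter>n. \<Union>q\<in>Q. H q n)"
    obtain \<alpha> \<xi> where \<alpha>\<xi>: "p = (\<alpha>, \<xi>)" by (cases p)
    have in': "\<alpha> \<in> fin_configs" "\<xi> \<in> configs" using p \<alpha>\<xi> by (auto simp: H_def)
    have near: "\<exists>a\<in>\<alpha>. \<exists>x\<in>\<xi>. dist a x < 2 / real (Suc n)" for n
    proof -
      from p \<alpha>\<xi> obtain q where "(\<alpha>, \<xi>) \<in> H q n" by blast
      then obtain a x where ax: "a \<in> \<alpha>" "x \<in> \<xi>" "dist q a < 1 / real (Suc n)" "dist q x < 1 / real (Suc n)"
        by (auto simp: H_def)
      have "dist a x \<le> dist q a + dist q x" using dist_triangle[of a x q] by (simp add: dist_commute)
      then have "dist a x < 1 / real (Suc n) + 1 / real (Suc n)" using ax by linarith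
      then have "dist a x < 2 / real (Suc n)" by simp
      then show ?thesis using ax(1,2) by blast
    qed
    have "\<alpha> \<inter> \<xi> \<noteq> {}"
    proof
      assume disj: "\<alpha> \<inter> \<xi> = {}"
      have fin\<alpha>: "finite \<alpha>" using in' by (simp add: fin_configs_def)
      \<comment> \<open>The radius 2 suffices because 2 / (n + 1) never exceeds it; the candidates
        for close pairs are thus finite in number and have a positive minimal distance.\<close>
      define F where "F = (\<alpha> \<times> (\<xi> \<inter> (\<Union>a\<in>\<alpha>. cball a 2)))"
      have "finite F" unfolding F_def using fin\<alpha> in' by (intro finite_cartesian_product finite_config_bounded) auto
      then have "\<exists>e>0. \<forall>p\<in>F. dist (fst p) (snd p) > 0 + e"
        by (rule finite_gap) (use disj in \<open>auto simp: F_def\<close>)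
      then obtain e where e: "e > 0" "\<And>p. p \<in> F \<Longrightarrow> dist (fst p) (snd p) > e" by auto
      obtain n where n: "2 / real (Suc n) < e"
        using reals_Archimedean[of "e / 2"] e(1) by (auto simp: field_simps)
      obtain a x where ax: "a \<in> \<alpha>" "x \<in> \<xi>" "dist a x < 2 / real (Suc n)" using near by blast
      have "2 / real (Suc n) \<le> 2" by (simp add: field_simps)
      then have "dist a x \<le> 2" using ax by simp
      then have "(a, x) \<in> F" using ax by (auto simp: F_def)
      then show False using e(2)[of "(a, x)"] ax n by simp
    qed
    then show "p \<in> Z" using \<alpha>\<xi> in' sets\<mu> by (simp add: Z_def space_pair_measure)
  qed
  moreover have "H q n \<in> sets (L_measure \<Otimes>\<^sub>M \<mu>)" for q n
    unfolding H_def using sets_hits[of "ball q (1 / real (Suc n))"] sets\<mu> by (intro pair_measureI) auto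
  ultimately have Zs: "Z \<in> sets (L_measure \<Otimes>\<^sub>M \<mu>)"
    using Q(1) by (auto intro!: sets.countable_INT sets.countable_UN'')
  \<comment> \<open>For fixed \<open>\<xi>\<close>, a countable and hence Lebesgue-null set, almost
    no tuple has a coordinate in \<open>\<xi>\<close>; Fubini then gives the claim.\<close>
  have "emeasure L_measure ((\<lambda>\<alpha>. (\<alpha>, \<xi>)) -` Z) = 0" if "\<xi> \<in> space \<mu>" for \<xi>
  proof (rule emeasure_L_measure_eq_0)
    show "(\<lambda>\<alpha>. (\<alpha>, \<xi>)) -` Z \<in> sets fin_config_space"
      using sets_Pair2[OF Zs, of \<xi>] by simp
    fix m
    have "\<xi> \<in> null_sets lborel"
      using countable_config that sets\<mu> by (auto intro: countable_imp_null_set_lborel)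
    then have "AE x in tuples m. \<forall>i\<in>{..<m}. x i \<notin> \<xi>"
      by (intro AE_finite_allI tuples_coord_null) auto
    then show "AE x in tuples m. x ` {..<m} \<notin> (\<lambda>\<alpha>. (\<alpha>, \<xi>)) -` Z"
      by eventually_elim (auto simp: Z_def)
  qed
  then have "(\<integral>\<^sup>+\<xi>. emeasure L_measure ((\<lambda>\<alpha>. (\<alpha>, \<xi>)) -` Z) \<partial>\<mu>) = (\<integral>\<^sup>+\<xi>. 0 \<partial>\<mu>)"
    by (intro nn_integral_cong) auto
  then have "emeasure (L_measure \<Otimes>\<^sub>M \<mu>) Z = 0" using emeasure_pair_measure_alt2[OF Zs] by simp
  then have "Z \<in> null_sets (L_measure \<Otimes>\<^sub>M \<mu>)" using Zs by auto
  then show ?thesis by (rule AE_I') (auto simp: Z_def)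
qed

section \<open>Almost sure absence of degenerate subsets\<close>

lemma AE_snd_pair:
  assumes "sigma_finite_measure M1" "sigma_finite_measure M2" "AE y in M2. P y"
  shows "AE p in M1 \<Otimes>\<^sub>M M2. P (snd p)"
proof -
  interpret M1: sigma_finite_measure M1 by fact
  interpret M2: sigma_finite_measure M2 by fact
  obtain N where N: "{y \<in> space M2. \<not> P y} \<subseteq> N" "emeasure M2 N = 0" "N \<in> sets M2"
    using assms(3) by (auto elim: AE_E)
  have "emeasure (M1 \<Otimes>\<^sub>M M2) (space M1 \<times> N) = 0"
    using N by (simp add: M2.emeasure_pair_measure_Times)
  then have "space M1 \<times> N \<in> null_sets (M1 \<Otimes>\<^sub>M M2)" using N by (intro null_setsI) auto
  then show ?thesis by (rule AE_I') (use N(1) in \<open>auto simp: space_pair_measure\<close>)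
qed

text \<open>Every finite set lies in the ball of radius n with minimal distance at least 1/(n + 1)
  once n is large. The set in question is therefore a countable union of vaguely closed
  sets.\<close>

lemma sets_degenerate:
  fixes j :: "'a::euclidean_space \<Rightarrow> 'a \<Rightarrow> complex"
  assumes jc: "continuous_on UNIV (\<lambda>(x, y). j x y)"
  shows "{\<xi> \<in> configs. \<exists>\<beta>\<subseteq>\<xi>. finite \<beta> \<and> kdet j \<beta> = 0} \<in> sets config_space"
proof -
  define bad where "bad n \<beta> \<longleftrightarrow> \<beta> \<subseteq> cball 0 (real n) \<and>
      (\<forall>x\<in>\<beta>. \<forall>y\<in>\<beta>. x \<noteq> y \<longrightarrow> dist x y \<ge> 1 / real (Suc n)) \<and> kdet j \<beta> = 0" for n \<beta>
  have "{\<xi> \<in> configs. \<forall>\<beta>\<subseteq>\<xi>. finite \<beta> \<longrightarrow> \<not> bad n \<beta>} \<in> sets config_space" for n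
    unfolding bad_def by (intro sets_config_space_openin openin_no_degenerate_subset[OF jc]) simp
  then have m1: "(\<Union>n. configs - {\<xi> \<in> configs. \<forall>\<beta>\<subseteq>\<xi>. finite \<beta> \<longrightarrow> \<not> bad n \<beta>}) \<in> sets config_space"
    using sets.compl_sets[of _ config_space] by (intro sets.countable_UN) auto
  have ex_bad: "\<exists>n. bad n \<beta>" if \<beta>: "finite \<beta>" "kdet j \<beta> = 0" for \<beta>
  proof -
    obtain r where r: "\<beta> \<subseteq> cball 0 r" using finite_imp_bounded[OF \<beta>(1)] by (auto simp: bounded_iff subset_iff)
    have "\<exists>e>0. \<forall>p\<in>{p\<in>\<beta> \<times> \<beta>. fst p \<noteq> snd p}. dist (fst p) (snd p) > 0 + e"
      by (rule finite_gap) (use \<beta> in auto)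
    then obtain e where e: "e > 0" "\<And>x y. x \<in> \<beta> \<Longrightarrow> y \<in> \<beta> \<Longrightarrow> x \<noteq> y \<Longrightarrow> dist x y > e" by auto
    obtain n where n: "real n \<ge> max r (1 / e)" using real_arch_simple by blast
    have "1 / real (Suc n) \<le> e" using n e(1) by (simp add: field_simps)
    then have "\<forall>x\<in>\<beta>. \<forall>y\<in>\<beta>. x \<noteq> y \<longrightarrow> dist x y \<ge> 1 / real (Suc n)"
      using e(2) by (meson less_imp_le order_trans)
    moreover have "\<beta> \<subseteq> cball 0 (real n)" using r n subset_cball[of r "real n" "0::'a"] by auto
    ultimately have "bad n \<beta>" using \<beta>(2) unfolding bad_def by simp
    then show ?thesis by blast
  qed
  have m2: "(\<Union>n. configs - {\<xi> \<in> configs. \<forall>\<beta>\<subseteq>\<xi>. finite \<beta> \<longrightarrow> \<not> bad n \<beta>}) =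
      {\<xi> \<in> configs. \<exists>\<beta>\<subseteq>\<xi>. finite \<beta> \<and> kdet j \<beta> = 0}"
  proof (intro equalityI subsetI)
    fix \<xi> assume "\<xi> \<in> (\<Union>n. configs - {\<xi> \<in> configs. \<forall>\<beta>\<subseteq>\<xi>. finite \<beta> \<longrightarrow> \<not> bad n \<beta>})"
    then obtain n \<beta> where "\<xi> \<in> configs" "\<beta> \<subseteq> \<xi>" "finite \<beta>" "bad n \<beta>" by auto
    moreover from this have "kdet j \<beta> = 0" by (simp add: bad_def)
    ultimately show "\<xi> \<in> {\<xi> \<in> configs. \<exists>\<beta>\<subseteq>\<xi>. finite \<beta> \<and> kdet j \<beta> = 0}" by auto
  next
    fix \<xi> assume "\<xi> \<in> {\<xi> \<in> configs. \<exists>\<beta>\<subseteq>\<xi>. finite \<beta> \<and> kdet j \<beta> = 0}"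
    then obtain \<beta> where \<beta>: "\<xi> \<in> configs" "\<beta> \<subseteq> \<xi>" "finite \<beta>" "kdet j \<beta> = 0" by auto
    obtain n where "bad n \<beta>" using ex_bad[OF \<beta>(3,4)] by blast
    then show "\<xi> \<in> (\<Union>n. configs - {\<xi> \<in> configs. \<forall>\<beta>\<subseteq>\<xi>. finite \<beta> \<longrightarrow> \<not> bad n \<beta>})"
      using \<beta> by auto
  qed
  show ?thesis using m1 unfolding m2 .
qed

text \<open>The correlation formula equates the expected number of finite subsets of \<xi> lying in
  \<open>B\<close> with an integral whose integrand vanishes on almost all tuples. A degenerate
  \<xi> has such a subset, namely its singular \<beta>, so the count is at least 1 on
  \<open>B\<close>.\<close>

lemma AE_no_degenerate_subset:
  fixes j :: "'a::euclidean_space \<Rightarrow> 'a \<Rightarrow> complex"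
  assumes jc: "continuous_on UNIV (\<lambda>(x, y). j x y)" and \<mu>: "determinantal_process \<mu> k"
    and deg: "\<And>m. AE x in tuples m. (\<exists>\<beta>\<subseteq>x ` {..<m}. kdet j \<beta> = 0) \<longrightarrow> kdet k (x ` {..<m}) = 0"
  shows "AE \<xi> in \<mu>. \<forall>\<beta>\<subseteq>\<xi>. finite \<beta> \<longrightarrow> kdet j \<beta> \<noteq> 0"
proof -
  define B where "B = {\<xi> \<in> configs. \<exists>\<beta>\<subseteq>\<xi>. finite \<beta> \<and> kdet j \<beta> = 0}"
  have B: "B \<in> sets config_space" unfolding B_def by (rule sets_degenerate[OF jc])
  have sets\<mu>: "sets \<mu> = sets config_space" "space \<mu> = configs"
    using \<mu> by (auto simp: determinantal_process_def point_process_def)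
  define u :: "'a set \<Rightarrow> real" where "u = indicator B"
  have "u \<in> borel_measurable fin_config_space"
    unfolding u_def fin_config_space_def using B by (intro measurable_restrict_space1 borel_measurable_indicator)
  then have "(\<integral>\<^sup>+\<xi>. (\<integral>\<^sup>+\<alpha>. ennreal (u \<alpha>) \<partial>count_space {\<alpha> \<in> fin_configs. \<alpha> \<subseteq> \<xi>}) \<partial>\<mu>) =
        (\<integral>\<^sup>+\<alpha>. ennreal (u \<alpha>) * ennreal (Re (kdet k \<alpha>)) \<partial>L_measure)"
    using \<mu> by (simp add: determinantal_process_def u_def)
  also have "\<dots> = 0"
  proof (rule nn_integral_L_measure_eq_0)
    show "AE x in tuples m. ennreal (u (x ` {..<m})) * ennreal (Re (kdet k (x ` {..<m}))) = 0" for m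
      using deg[of m] by eventually_elim (auto simp: u_def B_def indicator_def)
  qed
  finally have 0: "(\<integral>\<^sup>+\<xi>. (\<integral>\<^sup>+\<alpha>. ennreal (u \<alpha>) \<partial>count_space {\<alpha> \<in> fin_configs. \<alpha> \<subseteq> \<xi>}) \<partial>\<mu>) = 0" .
  have "emeasure \<mu> B = (\<integral>\<^sup>+\<xi>. indicator B \<xi> \<partial>\<mu>)" using B sets\<mu> by simp
  also have "\<dots> \<le> (\<integral>\<^sup>+\<xi>. (\<integral>\<^sup>+\<alpha>. ennreal (u \<alpha>) \<partial>count_space {\<alpha> \<in> fin_configs. \<alpha> \<subseteq> \<xi>}) \<partial>\<mu>)"
  proof (rule nn_integral_mono)
    fix \<xi> assume "\<xi> \<in> space \<mu>"
    show "indicator B \<xi> \<le> (\<integral>\<^sup>+\<alpha>. ennreal (u \<alpha>) \<partial>count_space {\<alpha> \<in> fin_configs. \<alpha> \<subseteq> \<xi>})"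
    proof (cases "\<xi> \<in> B")
      case True
      then obtain \<beta> where \<beta>: "\<beta> \<subseteq> \<xi>" "finite \<beta>" "kdet j \<beta> = 0" by (auto simp: B_def)
      then have u\<beta>: "u \<beta> = 1" by (auto simp: u_def B_def indicator_def configs_finite)
      have "(1::ennreal) = (\<integral>\<^sup>+\<alpha>. indicator {\<beta>} \<alpha> \<partial>count_space {\<alpha> \<in> fin_configs. \<alpha> \<subseteq> \<xi>})"
        using \<beta> by (subst nn_integral_indicator) (auto simp: fin_configs_def)
      also have "\<dots> \<le> (\<integral>\<^sup>+\<alpha>. ennreal (u \<alpha>) \<partial>count_space {\<alpha> \<in> fin_configs. \<alpha> \<subseteq> \<xi>})"
        by (intro nn_integral_mono) (auto simp: u\<beta> indicator_def)
      finally show ?thesis using True by simp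
    qed simp
  qed
  finally have "emeasure \<mu> B = 0" using 0 by simp
  then have "B \<in> null_sets \<mu>" using B sets\<mu> by auto
  then show ?thesis by (rule AE_I') (auto simp: B_def sets\<mu>)
qed

section \<open>Null sets of tuples and cell averages\<close>

text \<open>Convergence of kernels is known off null sets of pairs, while determinants involve m
  points. Fubini, with the coordinates \<open>i\<close> and \<open>l\<close> split off, transfers
  the null set.\<close>

lemma AE_tuples_pair:
  fixes P :: "'a::euclidean_space \<times> 'a \<Rightarrow> bool"
  assumes "AE p in lborel \<Otimes>\<^sub>M lborel. P p" and i: "i < m" "l < m" "i \<noteq> l"
  shows "AE x in tuples m. P (x i, x l)"
proof -
  interpret product_sigma_finite "\<lambda>i::nat. lborel :: 'a measure" by (rule product_sigma_finite_lborel)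
  obtain N where N: "{p \<in> space (lborel \<Otimes>\<^sub>M lborel). \<not> P p} \<subseteq> N" "emeasure (lborel \<Otimes>\<^sub>M lborel) N = 0"
      "N \<in> sets (lborel \<Otimes>\<^sub>M (lborel :: 'a measure))"
    using assms(1) by (auto elim: AE_E)
  define J where "J = {..<m} - {i, l}"
  have IJ: "{i, l} \<union> J = {..<m}" "{i, l} \<inter> J = {}" using i by (auto simp: J_def)
  define f where "f x y = (indicator N (x, y) :: ennreal)" for x y
  have f [measurable]: "case_prod f \<in> borel_measurable (lborel \<Otimes>\<^sub>M lborel)"
    unfolding f_def case_prod_beta' prod.collapse using N(3) by measurable
  have comp: "(\<lambda>x. (x i, x l)) \<in> measurable (tuples m) (lborel \<Otimes>\<^sub>M (lborel :: 'a measure))"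
    using i by (intro measurable_Pair measurable_component_singleton) auto
  have f': "(\<lambda>x. f (x i) (x l)) \<in> borel_measurable (Pi\<^sub>M ({i, l} \<union> J) (\<lambda>_. lborel))"
    unfolding IJ using measurable_comp[OF comp f] by (simp add: comp_def)
  have "(\<integral>\<^sup>+x. f (x i) (x l) \<partial>tuples m)
      = (\<integral>\<^sup>+x. (\<integral>\<^sup>+y. f (merge {i, l} J (x, y) i) (merge {i, l} J (x, y) l) \<partial>Pi\<^sub>M J (\<lambda>_. lborel)) \<partial>Pi\<^sub>M {i, l} (\<lambda>_. lborel))"
    using product_nn_integral_fold[OF IJ(2) _ _ f'] IJ by (simp add: J_def)
  \<comment> \<open>The factor for the remaining coordinates is infinite unless there are none; in
    \<open>ennreal\<close> its product with 0 is still 0.\<close>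
  also have "\<dots> = (\<integral>\<^sup>+x. f (x i) (x l) * emeasure (Pi\<^sub>M J (\<lambda>_. lborel :: 'a measure)) (space (Pi\<^sub>M J (\<lambda>_. lborel :: 'a measure))) \<partial>Pi\<^sub>M {i, l} (\<lambda>_. lborel))"
    by (intro nn_integral_cong) (simp add: merge_def)
  also have "\<dots> = (\<integral>\<^sup>+x. f (x i) (x l) \<partial>Pi\<^sub>M {i, l} (\<lambda>_. lborel)) * emeasure (Pi\<^sub>M J (\<lambda>_. lborel :: 'a measure)) (space (Pi\<^sub>M J (\<lambda>_. lborel :: 'a measure)))"
  proof (rule nn_integral_multc)
    have "(\<lambda>x. (x i, x l)) \<in> measurable (Pi\<^sub>M {i, l} (\<lambda>_. lborel)) (lborel \<Otimes>\<^sub>M (lborel :: 'a measure))"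
      by (intro measurable_Pair measurable_component_singleton) auto
    from measurable_comp[OF this f]
    show "(\<lambda>x. f (x i) (x l)) \<in> borel_measurable (Pi\<^sub>M {i, l} (\<lambda>_. lborel))" by (simp add: comp_def)
  qed
  also have "(\<integral>\<^sup>+x. f (x i) (x l) \<partial>Pi\<^sub>M {i, l} (\<lambda>_. lborel)) = (\<integral>\<^sup>+z. f (fst z) (snd z) \<partial>(lborel \<Otimes>\<^sub>M lborel))"
    using i(3) f by (intro product_nn_integral_pair)
  also have "\<dots> = 0" unfolding f_def using N by simp
  finally have "(\<integral>\<^sup>+x. f (x i) (x l) \<partial>tuples m) = 0" by simp
  then have "AE x in tuples m. f (x i) (x l) = 0"
    using f' unfolding IJ by (simp add: nn_integral_0_iff_AE)
  then show ?thesis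
  proof eventually_elim
    case (elim x)
    then have "(x i, x l) \<notin> N" by (auto simp: f_def)
    then show ?case using N(1) by (auto simp: space_pair_measure)
  qed
qed

text \<open>Conversely, positivity for almost all two-point configurations is stated through tuples
  indexed by numbers; this brings it to the product measure on which operators and kernels
  live.\<close>

lemma AE_pair_of_tuples:
  fixes P :: "'a::euclidean_space \<times> 'a \<Rightarrow> bool"
  assumes meas: "{p \<in> space (lborel \<Otimes>\<^sub>M lborel). \<not> P p} \<in> sets (lborel \<Otimes>\<^sub>M lborel)"
    and P: "AE x in tuples 2. P (x 0, x 1)"
  shows "AE p in lborel \<Otimes>\<^sub>M lborel. P p"
proof -
  interpret product_sigma_finite "\<lambda>i::nat. lborel :: 'a measure" by (rule product_sigma_finite_lborel)
  define N where "N = {p \<in> space (lborel \<Otimes>\<^sub>M (lborel :: 'a measure)). \<not> P p}"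
  have N: "N \<in> sets (lborel \<Otimes>\<^sub>M lborel)" using meas by (simp add: N_def)
  define f where "f x y = (indicator N (x, y) :: ennreal)" for x y
  have f: "case_prod f \<in> borel_measurable (lborel \<Otimes>\<^sub>M lborel)"
    unfolding f_def case_prod_beta' prod.collapse using N by measurable
  have two: "{..<2::nat} = {0, 1}" by auto
  have "emeasure (lborel \<Otimes>\<^sub>M lborel) N = (\<integral>\<^sup>+z. f (fst z) (snd z) \<partial>(lborel \<Otimes>\<^sub>M lborel))"
    using N by (simp add: f_def)
  also have "\<dots> = (\<integral>\<^sup>+x. f (x 0) (x 1) \<partial>tuples 2)"
    unfolding two using product_nn_integral_pair[of f 0 1] f by simp
  also have "\<dots> = (\<integral>\<^sup>+x. 0 \<partial>(tuples 2 :: (nat \<Rightarrow> 'a) measure))"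
    by (rule nn_integral_cong_AE) (use P in \<open>auto elim!: eventually_mono simp: f_def N_def\<close>)
  finally have "N \<in> null_sets (lborel \<Otimes>\<^sub>M lborel)" using N by auto
  then show ?thesis by (rule AE_I') (simp add: N_def)
qed

lemma AE_single_of_tuples:
  fixes P :: "'a::euclidean_space \<Rightarrow> bool"
  assumes meas: "{x. \<not> P x} \<in> sets borel" and P: "AE x in tuples 1. P (x 0)"
  shows "AE x in lborel. P x"
proof -
  interpret product_sigma_finite "\<lambda>i::nat. lborel :: 'a measure" by (rule product_sigma_finite_lborel)
  define N where "N = {x. \<not> P x}"
  have N: "N \<in> sets lborel" using meas by (simp add: N_def)
  have one: "{..<1::nat} = {0}" by auto
  have "emeasure lborel N = (\<integral>\<^sup>+z. indicator N z \<partial>lborel)" using N by simp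
  also have "\<dots> = (\<integral>\<^sup>+x. indicator N (x 0) \<partial>tuples 1)"
    unfolding one using product_nn_integral_singleton[of "indicator N" 0] N by simp
  also have "\<dots> = (\<integral>\<^sup>+x. 0 \<partial>(tuples 1 :: (nat \<Rightarrow> 'a) measure))"
    by (rule nn_integral_cong_AE) (use P in \<open>auto elim!: eventually_mono simp: N_def\<close>)
  finally have "N \<in> null_sets lborel" using N by auto
  then show ?thesis by (rule AE_I') (simp add: N_def)
qed

subsection \<open>Averages over the cells of a partition\<close>

text \<open>The conditional expectation given \<open>\<phi>\<close>, as a function of the label.
  Cells of measure zero get the value 0.\<close>

definition cell_avg :: "'x measure \<Rightarrow> ('x \<Rightarrow> 'c) \<Rightarrow> ('x \<Rightarrow> complex) \<Rightarrow> 'c \<Rightarrow> complex" where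
  "cell_avg M \<phi> f c = (\<integral>\<omega>. indicator (\<phi> -` {c}) \<omega> * f \<omega> \<partial>M) / of_real (measure M (\<phi> -` {c} \<inter> space M))"

context
  fixes M :: "'x measure" and \<phi> :: "'x \<Rightarrow> 'c"
  assumes fin: "finite_measure M" and \<phi>: "\<phi> \<in> measurable M (count_space UNIV)" and rng: "finite (range \<phi>)"
begin

lemma cell_sets: "\<phi> -` {c} \<inter> space M \<in> sets M"
  using \<phi> by (rule measurable_sets) simp

lemma
  fixes h :: "'c \<Rightarrow> 'e::{banach, second_countable_topology}"
  shows integrable_finite_range: "integrable M (\<lambda>\<omega>. h (\<phi> \<omega>))"
    and integral_finite_range: "(\<integral>\<omega>. h (\<phi> \<omega>) \<partial>M) = (\<Sum>c\<in>range \<phi>. measure M (\<phi> -` {c} \<inter> space M) *\<^sub>R h c)"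
proof -
  interpret finite_measure M by (rule fin)
  have eq: "h (\<phi> \<omega>) = (\<Sum>c\<in>range \<phi>. indicator (\<phi> -` {c} \<inter> space M) \<omega> *\<^sub>R h c)" if "\<omega> \<in> space M" for \<omega>
  proof -
    have "(\<Sum>c\<in>range \<phi>. indicator (\<phi> -` {c} \<inter> space M) \<omega> *\<^sub>R h c) = (\<Sum>c\<in>range \<phi>. if \<phi> \<omega> = c then h c else 0)"
      using that by (intro sum.cong) (auto simp: indicator_def)
    then show ?thesis using rng by simp
  qed
  have int: "integrable M (\<lambda>\<omega>. indicator (\<phi> -` {c} \<inter> space M) \<omega> *\<^sub>R h c)" for c
    using cell_sets[of c] by (intro integrable_scaleR_left) (auto simp: emeasure_eq_measure)
  show "integrable M (\<lambda>\<omega>. h (\<phi> \<omega>))"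
    using int by (subst Bochner_Integration.integrable_cong[OF refl eq]) auto
  have "(\<integral>\<omega>. h (\<phi> \<omega>) \<partial>M) = (\<integral>\<omega>. (\<Sum>c\<in>range \<phi>. indicator (\<phi> -` {c} \<inter> space M) \<omega> *\<^sub>R h c) \<partial>M)"
    by (rule Bochner_Integration.integral_cong[OF refl eq])
  also have "\<dots> = (\<Sum>c\<in>range \<phi>. measure M (\<phi> -` {c} \<inter> space M) *\<^sub>R h c)"
    using int cell_sets by (subst Bochner_Integration.integral_sum) (auto simp: emeasure_eq_measure)
  finally show "(\<integral>\<omega>. h (\<phi> \<omega>) \<partial>M) = (\<Sum>c\<in>range \<phi>. measure M (\<phi> -` {c} \<inter> space M) *\<^sub>R h c)" .
qed

lemma integrable_cell:
  assumes "integrable M (f :: 'x \<Rightarrow> complex)"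
  shows "integrable M (\<lambda>\<omega>. indicator (\<phi> -` {c}) \<omega> * f \<omega>)"
proof -
  have "integrable M (\<lambda>\<omega>. indicator (\<phi> -` {c} \<inter> space M) \<omega> *\<^sub>R f \<omega>)"
    using integrable_mult_indicator[OF cell_sets assms] .
  then show ?thesis
    by (rule Bochner_Integration.integrable_cong[OF refl, THEN iffD1, rotated]) (auto simp: indicator_def)
qed

lemma sum_cells:
  "\<omega> \<in> space M \<Longrightarrow> (\<Sum>c\<in>range \<phi>. indicator (\<phi> -` {c}) \<omega> * (f \<omega> :: 'e::comm_semiring_1)) = f \<omega>"
  using rng by (simp add: indicator_def if_distrib[of "\<lambda>x. x * _"] cong: if_cong)

text \<open>Averaging is a contraction in \<open>L\<^sup>1\<close> that fixes functions of \<open>\<phi>\<close>.\<close>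

lemma cell_avg_L1:
  assumes f: "integrable M f"
  shows "(\<integral>\<omega>. cmod (cell_avg M \<phi> f (\<phi> \<omega>) - f \<omega>) \<partial>M) \<le> 2 * (\<integral>\<omega>. cmod (f \<omega> - G (\<phi> \<omega>)) \<partial>M)"
proof -
  interpret finite_measure M by (rule fin)
  define d where "d \<omega> = f \<omega> - G (\<phi> \<omega>)" for \<omega>
  have d: "integrable M d" unfolding d_def by (intro Bochner_Integration.integrable_diff f integrable_finite_range)
  define \<mu> where "\<mu> c = measure M (\<phi> -` {c} \<inter> space M)" for c
  have cell: "\<mu> c * cmod (cell_avg M \<phi> f c - G c) \<le> (\<integral>\<omega>. indicator (\<phi> -` {c}) \<omega> * cmod (d \<omega>) \<partial>M)" for c
  proof (cases "\<mu> c = 0")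
    case True
    then show ?thesis by (simp add: integral_nonneg_AE)
  next
    case False
    then have pos: "\<mu> c > 0" by (simp add: \<mu>_def zero_less_measure_iff)
    have "(\<integral>\<omega>. indicator (\<phi> -` {c}) \<omega> * d \<omega> \<partial>M) = (\<integral>\<omega>. indicator (\<phi> -` {c}) \<omega> * f \<omega> - indicator (\<phi> -` {c} \<inter> space M) \<omega> *\<^sub>R G c \<partial>M)"
      by (intro Bochner_Integration.integral_cong) (auto simp: d_def indicator_def)
    also have "\<dots> = (\<integral>\<omega>. indicator (\<phi> -` {c}) \<omega> * f \<omega> \<partial>M) - of_real (\<mu> c) * G c"
    proof (subst Bochner_Integration.integral_diff)
      show "integrable M (\<lambda>\<omega>. indicator (\<phi> -` {c} \<inter> space M) \<omega> *\<^sub>R G c)"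
        using cell_sets[of c] by (intro integrable_scaleR_left) (auto simp: emeasure_eq_measure)
      have "(\<integral>\<omega>. indicator (\<phi> -` {c} \<inter> space M) \<omega> *\<^sub>R G c \<partial>M) = of_real (\<mu> c) * G c"
        using cell_sets[of c] by (subst integral_scaleR_left) (auto simp: emeasure_eq_measure \<mu>_def scaleR_conv_of_real)
      then show "(\<integral>\<omega>. indicator (\<phi> -` {c}) \<omega> * f \<omega> \<partial>M) - (\<integral>\<omega>. indicator (\<phi> -` {c} \<inter> space M) \<omega> *\<^sub>R G c \<partial>M)
          = (\<integral>\<omega>. indicator (\<phi> -` {c}) \<omega> * f \<omega> \<partial>M) - of_real (\<mu> c) * G c" by simp
    qed (rule integrable_cell[OF f])
    finally have "(\<integral>\<omega>. indicator (\<phi> -` {c}) \<omega> * d \<omega> \<partial>M) = of_real (\<mu> c) * (cell_avg M \<phi> f c - G c)"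
      using pos by (simp add: cell_avg_def \<mu>_def[symmetric] right_diff_distrib)
    then have "\<mu> c * cmod (cell_avg M \<phi> f c - G c) = cmod (\<integral>\<omega>. indicator (\<phi> -` {c}) \<omega> * d \<omega> \<partial>M)"
      using pos by (simp add: norm_mult)
    also have "\<dots> \<le> (\<integral>\<omega>. cmod (indicator (\<phi> -` {c}) \<omega> * d \<omega>) \<partial>M)" by (rule integral_norm_bound)
    also have "\<dots> = (\<integral>\<omega>. indicator (\<phi> -` {c}) \<omega> * cmod (d \<omega>) \<partial>M)"
      by (intro Bochner_Integration.integral_cong) (auto simp: indicator_def)
    finally show ?thesis .
  qed
  have ic: "integrable M (\<lambda>\<omega>. indicator (\<phi> -` {c}) \<omega> * cmod (d \<omega>))" for c
  proof -
    have "(\<lambda>\<omega>. cmod (indicator (\<phi> -` {c}) \<omega> * d \<omega>)) = (\<lambda>\<omega>. indicator (\<phi> -` {c}) \<omega> * cmod (d \<omega>))"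
      by (auto simp: indicator_def)
    then show ?thesis using integrable_norm[OF integrable_cell[OF d, of c]] by simp
  qed
  have "(\<integral>\<omega>. cmod (cell_avg M \<phi> f (\<phi> \<omega>) - G (\<phi> \<omega>)) \<partial>M) = (\<Sum>c\<in>range \<phi>. \<mu> c * cmod (cell_avg M \<phi> f c - G c))"
    by (subst integral_finite_range) (simp add: \<mu>_def)
  also have "\<dots> \<le> (\<Sum>c\<in>range \<phi>. \<integral>\<omega>. indicator (\<phi> -` {c}) \<omega> * cmod (d \<omega>) \<partial>M)"
    by (intro sum_mono cell)
  also have "\<dots> = (\<integral>\<omega>. (\<Sum>c\<in>range \<phi>. indicator (\<phi> -` {c}) \<omega> * cmod (d \<omega>)) \<partial>M)"
    using ic by (subst Bochner_Integration.integral_sum) auto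
  also have "\<dots> = (\<integral>\<omega>. cmod (d \<omega>) \<partial>M)"
    by (intro Bochner_Integration.integral_cong refl sum_cells)
  finally have 1: "(\<integral>\<omega>. cmod (cell_avg M \<phi> f (\<phi> \<omega>) - G (\<phi> \<omega>)) \<partial>M) \<le> (\<integral>\<omega>. cmod (d \<omega>) \<partial>M)" .
  have "(\<integral>\<omega>. cmod (cell_avg M \<phi> f (\<phi> \<omega>) - f \<omega>) \<partial>M)
      \<le> (\<integral>\<omega>. cmod (cell_avg M \<phi> f (\<phi> \<omega>) - G (\<phi> \<omega>)) + cmod (d \<omega>) \<partial>M)"
  proof (rule integral_mono)
    fix \<omega> show "cmod (cell_avg M \<phi> f (\<phi> \<omega>) - f \<omega>) \<le> cmod (cell_avg M \<phi> f (\<phi> \<omega>) - G (\<phi> \<omega>)) + cmod (d \<omega>)"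
      using norm_triangle_ineq4[of "cell_avg M \<phi> f (\<phi> \<omega>) - G (\<phi> \<omega>)" "d \<omega>"] by (simp add: d_def)
  qed (use f d integrable_finite_range[of "\<lambda>c. cell_avg M \<phi> f c"] integrable_finite_range[of "\<lambda>c. cmod (cell_avg M \<phi> f c - G c)"] in auto)
  also have "\<dots> = (\<integral>\<omega>. cmod (cell_avg M \<phi> f (\<phi> \<omega>) - G (\<phi> \<omega>)) \<partial>M) + (\<integral>\<omega>. cmod (d \<omega>) \<partial>M)"
    using d integrable_finite_range[of "\<lambda>c. cmod (cell_avg M \<phi> f c - G c)"] by (intro Bochner_Integration.integral_add) auto
  finally show ?thesis using 1 by (simp add: d_def)
qed

end

subsection \<open>Finite partitions given by labels\<close>

text \<open>A finite Borel partition is encoded by a labelling function whose fibres are the cells.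
  Refinement then becomes factorization, and functions constant on cells become functions of the
  label.\<close>

definition labels :: "('a::topological_space \<Rightarrow> nat) set" where
  "labels = {\<pi> \<in> measurable borel (count_space UNIV). finite (range \<pi>)}"

definition label_refines :: "('a \<Rightarrow> nat) \<Rightarrow> ('a \<Rightarrow> nat) \<Rightarrow> bool" where
  "label_refines \<pi> \<pi>' \<longleftrightarrow> (\<exists>g. \<pi>' = g \<circ> \<pi>)"

lemma label_refines_trans: "label_refines a b \<Longrightarrow> label_refines b c \<Longrightarrow> label_refines a c"
  by (auto simp: label_refines_def comp_assoc[symmetric])

lemma labels_const: "(\<lambda>x. c) \<in> labels"
  by (simp add: labels_def)

lemma labels_refine2:
  assumes "\<pi>1 \<in> labels" "\<pi>2 \<in> labels"
  shows "\<exists>\<pi>\<in>labels. label_refines \<pi> \<pi>1 \<and> label_refines \<pi> \<pi>2"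
proof
  let ?\<pi> = "\<lambda>x. prod_encode (\<pi>1 x, \<pi>2 x)"
  have "range ?\<pi> \<subseteq> prod_encode ` (range \<pi>1 \<times> range \<pi>2)" by auto
  then have "finite (range ?\<pi>)" by (rule finite_subset) (use assms in \<open>auto simp: labels_def\<close>)
  moreover have "?\<pi> \<in> measurable borel (count_space UNIV)"
  proof -
    have "?\<pi> -` {c} \<inter> space borel \<in> sets borel" for c
    proof -
      have "?\<pi> -` {c} = (\<pi>1 -` {fst (prod_decode c)} \<inter> space borel) \<inter> (\<pi>2 -` {snd (prod_decode c)} \<inter> space borel)"
        by (auto simp: prod_encode_inverse)
      also have "\<dots> \<in> sets borel"
        using assms by (intro sets.Int measurable_sets) (auto simp: labels_def)
      finally show ?thesis by simp
    qed
    then show ?thesis by (subst measurable_count_space_eq2_countable) auto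
  qed
  ultimately show "?\<pi> \<in> labels" by (simp add: labels_def)
  show "label_refines ?\<pi> \<pi>1 \<and> label_refines ?\<pi> \<pi>2"
    unfolding label_refines_def
    by (intro conjI exI[of _ "fst \<circ> prod_decode"] exI[of _ "snd \<circ> prod_decode"]) auto
qed

lemma labels_refine:
  assumes "finite I" "\<And>i. i \<in> I \<Longrightarrow> \<pi> i \<in> labels"
  shows "\<exists>\<pi>'\<in>labels. \<forall>i\<in>I. label_refines \<pi>' (\<pi> i)"
  using assms
proof (induction I rule: finite_induct)
  case empty
  then show ?case using labels_const by blast
next
  case (insert i I)
  then obtain \<pi>' where \<pi>': "\<pi>' \<in> labels" "\<forall>i\<in>I. label_refines \<pi>' (\<pi> i)" by auto
  obtain \<pi>'' where "\<pi>'' \<in> labels" "label_refines \<pi>'' \<pi>'" "label_refines \<pi>'' (\<pi> i)"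
    using labels_refine2[OF \<pi>'(1), of "\<pi> i"] insert by auto
  then show ?case using \<pi>' by (auto intro: label_refines_trans)
qed

lemma labels_of_set: "A \<in> sets borel \<Longrightarrow> (\<lambda>x. if x \<in> A then 1 else 0) \<in> labels"
  unfolding labels_def
proof (intro CollectI conjI)
  assume A: "A \<in> sets borel"
  show "(\<lambda>x. if x \<in> A then 1 else 0) \<in> measurable borel (count_space UNIV)"
    by (rule measurable_If_set) (use A in auto)
  show "finite (range (\<lambda>x. if x \<in> A then 1 else (0::nat)))"
    by (rule finite_subset[of _ "{0, 1}"]) auto
qed

text \<open>Finitely many balls of radius e / 2 cover the set; a label that determines membership in
  each of them puts two equally labelled points into a common ball.\<close>

lemma labels_small_diameter:
  fixes S :: "'a::euclidean_space set"
  assumes "bounded S" "e > 0"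
  shows "\<exists>\<pi>\<in>labels. \<forall>x\<in>S. \<forall>y\<in>S. \<pi> x = \<pi> y \<longrightarrow> dist x y < e"
proof -
  have "compact (closure S)" using assms(1) by simp
  then obtain C where C: "finite C" "closure S \<subseteq> (\<Union>c\<in>C. ball c (e / 2))"
    using assms(2) compact_eq_totally_bounded[of "closure S"] by (meson half_gt_zero)
  have "\<exists>\<pi>\<in>labels. \<forall>c\<in>C. label_refines \<pi> (\<lambda>x. if x \<in> ball c (e / 2) then 1 else 0)"
    by (rule labels_refine[OF C(1)]) (rule labels_of_set, simp)
  then obtain \<pi> where \<pi>: "\<pi> \<in> labels" "\<forall>c\<in>C. label_refines \<pi> (\<lambda>x. if x \<in> ball c (e / 2) then 1 else 0)"
    by blast
  have "dist x y < e" if xy: "x \<in> S" "y \<in> S" "\<pi> x = \<pi> y" for x y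
  proof -
    have "x \<in> (\<Union>c\<in>C. ball c (e / 2))" using C(2) closure_subset[of S] xy(1) by (meson subsetD)
    then obtain c where c: "c \<in> C" "x \<in> ball c (e / 2)" by auto
    obtain g where g: "(\<lambda>x. if x \<in> ball c (e / 2) then 1 else (0::nat)) = g \<circ> \<pi>"
      using bspec[OF \<pi>(2) c(1)] unfolding label_refines_def by (rule exE)
    have "(if x \<in> ball c (e / 2) then 1 else 0) = (if y \<in> ball c (e / 2) then 1 else (0::nat))"
      using fun_cong[OF g, of x] fun_cong[OF g, of y] xy by simp
    then have "y \<in> ball c (e / 2)" using c by (simp split: if_splits)
    then show ?thesis using c dist_triangle_half_r[of c x e y] by simp
  qed
  then show ?thesis using \<pi>(1) by blast
qed

lemma labels_of_simple:
  assumes "simple_function M f" "sets M = sets borel"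
  shows "\<exists>\<pi>\<in>labels. \<exists>g. f = g \<circ> \<pi>"
proof
  have sp: "space M = UNIV" using sets_eq_imp_space_eq[OF assms(2)] by simp
  have fin: "finite (range f)" using assms(1) sp by (simp add: simple_function_def)
  then have cnt: "countable (range f)" by (rule countable_finite)
  show "to_nat_on (range f) \<circ> f \<in> labels"
  proof -
    have "f \<in> measurable M (count_space UNIV)"
      using assms(1) by (rule measurable_simple_function)
    then have "to_nat_on (range f) \<circ> f \<in> measurable M (count_space UNIV)" by (rule measurable_comp) simp
    then have "to_nat_on (range f) \<circ> f \<in> measurable borel (count_space UNIV)"
      using measurable_cong_sets[OF assms(2) refl] by blast
    moreover have "range (to_nat_on (range f) \<circ> f) = to_nat_on (range f) ` range f" by auto
    then have "finite (range (to_nat_on (range f) \<circ> f))" using fin by (simp only: finite_imageI)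
    ultimately show ?thesis by (simp add: labels_def)
  qed
  show "\<exists>g. f = g \<circ> (to_nat_on (range f) \<circ> f)"
    using cnt by (intro exI[of _ "from_nat_into (range f)"]) (auto simp: fun_eq_iff)
qed

text \<open>A simple function is constant on the cells of a finite partition, so density of simple
  functions is density of functions of labels. The exponent 2 serves the basis vectors, the exponent
  1 the diagonal of the kernel.\<close>

lemma labels_approx:
  fixes f :: "'a::euclidean_space \<Rightarrow> complex"
  assumes M: "sets M = sets borel" and f: "f \<in> borel_measurable M" and p: "p > 0"
    and int: "integrable M (\<lambda>x. cmod (f x) ^ p)" and e: "e > 0"
  shows "\<exists>\<pi>\<in>labels. \<exists>g. (\<integral>x. cmod (f x - g (\<pi> x)) ^ p \<partial>M) < e"
proof -
  have sp: "space M = UNIV" using sets_eq_imp_space_eq[OF M] by simp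
  obtain F where F: "\<And>i. simple_function M (F i)" "\<And>x. (\<lambda>i. F i x) \<longlonglongrightarrow> f x"
    "\<And>i x. dist (F i x) 0 \<le> 2 * dist (f x) 0"
    using borel_measurable_implies_sequence_metric[OF f, of 0] sp by auto
  have [measurable]: "F i \<in> borel_measurable M" for i using F(1) by (rule borel_measurable_simple_function)
  note [measurable] = f
  have "(\<lambda>i. \<integral>x. cmod (f x - F i x) ^ p \<partial>M) \<longlonglongrightarrow> (\<integral>x. 0 \<partial>M)"
  proof (rule integral_dominated_convergence)
    \<comment> \<open>The approximants satisfy |F i x| \<le> 2 |f x|, so the difference is at most 3
      |f x|.\<close>
    show "integrable M (\<lambda>x. 3 ^ p * cmod (f x) ^ p)" using int by simp
    show "AE x in M. (\<lambda>i. cmod (f x - F i x) ^ p) \<longlonglongrightarrow> 0"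
    proof (rule AE_I2)
      fix x
      have "(\<lambda>i. cmod (f x - F i x) ^ p) \<longlonglongrightarrow> cmod (f x - f x) ^ p"
        by (intro tendsto_intros F)
      then show "(\<lambda>i. cmod (f x - F i x) ^ p) \<longlonglongrightarrow> 0" using p by (simp add: power_0_left)
    qed
    show "AE x in M. norm (cmod (f x - F i x) ^ p) \<le> 3 ^ p * cmod (f x) ^ p" for i
    proof (rule AE_I2)
      fix x
      have "cmod (f x - F i x) \<le> cmod (f x) + cmod (F i x)" by (rule norm_triangle_ineq4)
      also have "\<dots> \<le> 3 * cmod (f x)" using F(3)[of i x] by simp
      finally have "cmod (f x - F i x) ^ p \<le> (3 * cmod (f x)) ^ p" by (rule power_mono) simp
      then show "norm (cmod (f x - F i x) ^ p) \<le> 3 ^ p * cmod (f x) ^ p" by (simp add: power_mult_distrib)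
    qed
  qed measurable
  then have "eventually (\<lambda>i. (\<integral>x. cmod (f x - F i x) ^ p \<partial>M) < e) sequentially"
    using e by (intro order_tendstoD(2)) auto
  then obtain i where i: "(\<integral>x. cmod (f x - F i x) ^ p \<partial>M) < e" by (auto simp: eventually_sequentially)
  obtain \<pi> g where "\<pi> \<in> labels" "F i = g \<circ> \<pi>" using labels_of_simple[OF F(1) M] by blast
  then show ?thesis using i by (intro bexI[of _ \<pi>] exI[of _ g]) auto
qed

definition pair_label :: "('a \<Rightarrow> nat) \<Rightarrow> 'a \<times> 'a \<Rightarrow> nat \<times> nat" where
  "pair_label \<pi> p = (\<pi> (fst p), \<pi> (snd p))"

lemma measurable_label:
  "\<pi> \<in> labels \<Longrightarrow> sets M = sets borel \<Longrightarrow> \<pi> \<in> measurable M (count_space UNIV)"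
  unfolding labels_def using measurable_cong_sets by blast

lemma measurable_pair_label:
  assumes "\<pi> \<in> labels" "sets M = sets borel"
  shows "pair_label \<pi> \<in> measurable (M \<Otimes>\<^sub>M M) (count_space UNIV)"
proof -
  have [measurable]: "\<pi> \<in> measurable M (count_space UNIV)" using assms by (rule measurable_label)
  have "(\<lambda>p. (\<pi> (fst p), \<pi> (snd p))) \<in> measurable (M \<Otimes>\<^sub>M M) (count_space UNIV \<Otimes>\<^sub>M count_space UNIV)"
    by measurable
  then show ?thesis by (simp add: pair_label_def[abs_def] pair_measure_countable)
qed

lemma finite_range_pair_label: "\<pi> \<in> labels \<Longrightarrow> finite (range (pair_label \<pi>))"
  by (rule finite_subset[of _ "range \<pi> \<times> range \<pi>"]) (auto simp: pair_label_def labels_def)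

context
  fixes M :: "'a::euclidean_space measure"
  assumes finM: "finite_measure M" and setsM: "sets M = sets borel"
begin

lemma finite_pairM: "finite_measure (M \<Otimes>\<^sub>M M)"
proof -
  interpret finite_measure M by (rule finM)
  interpret pair_sigma_finite M M ..
  show ?thesis by (rule finite_measure_pair_measure[OF finM finM])
qed

text \<open>One partition is used in both variables, because compressing an operator to cell
  functions involves the same cells on either side.\<close>

definition pair_approx :: "('a \<times> 'a \<Rightarrow> complex) \<Rightarrow> bool" where
  "pair_approx h \<longleftrightarrow> (\<forall>e>0. \<exists>\<pi>\<in>labels. \<exists>G. (\<integral>p. cmod (h p - G (pair_label \<pi> p)) \<partial>(M \<Otimes>\<^sub>M M)) < e)"

lemma integrable_pair_label: "\<pi> \<in> labels \<Longrightarrow> integrable (M \<Otimes>\<^sub>M M) (\<lambda>p. G (pair_label \<pi> p) :: complex)"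
  using integrable_finite_range[OF finite_pairM measurable_pair_label finite_range_pair_label] setsM by blast

lemma pair_approx_add:
  assumes f: "integrable (M \<Otimes>\<^sub>M M) f" "pair_approx f" and g: "integrable (M \<Otimes>\<^sub>M M) g" "pair_approx g"
  shows "pair_approx (\<lambda>p. f p + g p)"
  unfolding pair_approx_def
proof (intro allI impI)
  fix e :: real assume "e > 0"
  then obtain \<pi>1 G1 \<pi>2 G2 where 1: "\<pi>1 \<in> labels" "(\<integral>p. cmod (f p - G1 (pair_label \<pi>1 p)) \<partial>(M \<Otimes>\<^sub>M M)) < e / 2"
    and 2: "\<pi>2 \<in> labels" "(\<integral>p. cmod (g p - G2 (pair_label \<pi>2 p)) \<partial>(M \<Otimes>\<^sub>M M)) < e / 2"
    using f(2) g(2) unfolding pair_approx_def by (meson half_gt_zero)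
  obtain \<pi> g1 g2 where \<pi>: "\<pi> \<in> labels" "\<pi>1 = g1 \<circ> \<pi>" "\<pi>2 = g2 \<circ> \<pi>"
    using labels_refine2[OF 1(1) 2(1)] by (auto simp: label_refines_def)
  define G where "G q = G1 (g1 (fst q), g1 (snd q)) + G2 (g2 (fst q), g2 (snd q))" for q
  have G: "G (pair_label \<pi> p) = G1 (pair_label \<pi>1 p) + G2 (pair_label \<pi>2 p)" for p
    by (simp add: G_def pair_label_def \<pi>)
  note i = integrable_pair_label[OF 1(1), of G1] integrable_pair_label[OF 2(1), of G2]
  have "(\<integral>p. cmod (f p + g p - G (pair_label \<pi> p)) \<partial>(M \<Otimes>\<^sub>M M))
      \<le> (\<integral>p. cmod (f p - G1 (pair_label \<pi>1 p)) + cmod (g p - G2 (pair_label \<pi>2 p)) \<partial>(M \<Otimes>\<^sub>M M))"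
  proof (rule integral_mono)
    fix p
    show "cmod (f p + g p - G (pair_label \<pi> p)) \<le> cmod (f p - G1 (pair_label \<pi>1 p)) + cmod (g p - G2 (pair_label \<pi>2 p))"
      unfolding G using norm_triangle_ineq[of "f p - G1 (pair_label \<pi>1 p)" "g p - G2 (pair_label \<pi>2 p)"]
      by (simp add: algebra_simps)
  qed (use f g i integrable_pair_label[OF \<pi>(1), of G] in auto)
  also have "\<dots> = (\<integral>p. cmod (f p - G1 (pair_label \<pi>1 p)) \<partial>(M \<Otimes>\<^sub>M M)) + (\<integral>p. cmod (g p - G2 (pair_label \<pi>2 p)) \<partial>(M \<Otimes>\<^sub>M M))"
    using f g i by (intro Bochner_Integration.integral_add) auto
  also have "\<dots> < e" using 1 2 by simp
  finally show "\<exists>\<pi>\<in>labels. \<exists>G. (\<integral>p. cmod (f p + g p - G (pair_label \<pi> p)) \<partial>(M \<Otimes>\<^sub>M M)) < e"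
    using \<pi>(1) by blast
qed

lemma pair_approx_limit:
  assumes s: "\<And>i. integrable (M \<Otimes>\<^sub>M M) (s i)" "\<And>i. pair_approx (s i)"
    and lim: "\<And>p. (\<lambda>i::nat. s i p) \<longlonglongrightarrow> f p" and bd: "\<And>i p. cmod (s i p) \<le> w p"
    and w: "integrable (M \<Otimes>\<^sub>M M) w" and f: "integrable (M \<Otimes>\<^sub>M M) f"
  shows "pair_approx f"
  unfolding pair_approx_def
proof (intro allI impI)
  fix e :: real assume e: "e > 0"
  have "(\<lambda>i. \<integral>p. cmod (f p - s i p) \<partial>(M \<Otimes>\<^sub>M M)) \<longlonglongrightarrow> (\<integral>p. 0 \<partial>(M \<Otimes>\<^sub>M M))"
  proof (rule integral_dominated_convergence)
    show "integrable (M \<Otimes>\<^sub>M M) (\<lambda>p. cmod (f p) + w p)" using f w by simp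
    show "AE p in M \<Otimes>\<^sub>M M. (\<lambda>i. cmod (f p - s i p)) \<longlonglongrightarrow> 0"
    proof (rule AE_I2)
      fix p
      have "(\<lambda>i. cmod (f p - s i p)) \<longlonglongrightarrow> cmod (f p - f p)" by (intro tendsto_intros lim)
      then show "(\<lambda>i. cmod (f p - s i p)) \<longlonglongrightarrow> 0" by simp
    qed
    show "AE p in M \<Otimes>\<^sub>M M. norm (cmod (f p - s i p)) \<le> cmod (f p) + w p" for i
    proof (rule AE_I2)
      fix p show "norm (cmod (f p - s i p)) \<le> cmod (f p) + w p"
        using norm_triangle_ineq4[of "f p" "s i p"] bd[of i p] by simp
    qed
  qed (use f s in auto)
  then have "eventually (\<lambda>i. (\<integral>p. cmod (f p - s i p) \<partial>(M \<Otimes>\<^sub>M M)) < e / 2) sequentially"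
    using e by (intro order_tendstoD(2)) auto
  then obtain i where i: "(\<integral>p. cmod (f p - s i p) \<partial>(M \<Otimes>\<^sub>M M)) < e / 2" by (auto simp: eventually_sequentially)
  obtain \<pi> G where \<pi>: "\<pi> \<in> labels" "(\<integral>p. cmod (s i p - G (pair_label \<pi> p)) \<partial>(M \<Otimes>\<^sub>M M)) < e / 2"
    using s(2)[of i] e unfolding pair_approx_def by (meson half_gt_zero)
  note int = integrable_pair_label[OF \<pi>(1), of G]
  have "(\<integral>p. cmod (f p - G (pair_label \<pi> p)) \<partial>(M \<Otimes>\<^sub>M M))
      \<le> (\<integral>p. cmod (f p - s i p) + cmod (s i p - G (pair_label \<pi> p)) \<partial>(M \<Otimes>\<^sub>M M))"
  proof (rule integral_mono)
    fix p show "cmod (f p - G (pair_label \<pi> p)) \<le> cmod (f p - s i p) + cmod (s i p - G (pair_label \<pi> p))"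
      using norm_triangle_ineq[of "f p - s i p" "s i p - G (pair_label \<pi> p)"] by simp
  qed (use f s int in auto)
  also have "\<dots> = (\<integral>p. cmod (f p - s i p) \<partial>(M \<Otimes>\<^sub>M M)) + (\<integral>p. cmod (s i p - G (pair_label \<pi> p)) \<partial>(M \<Otimes>\<^sub>M M))"
    using f s int by (intro Bochner_Integration.integral_add) auto
  also have "\<dots> < e" using i \<pi> by simp
  finally show "\<exists>\<pi>\<in>labels. \<exists>G. (\<integral>p. cmod (f p - G (pair_label \<pi> p)) \<partial>(M \<Otimes>\<^sub>M M)) < e"
    using \<pi>(1) by blast
qed

lemma pair_approx_exact:
  assumes "\<pi> \<in> labels" "\<And>p. h p = G (pair_label \<pi> p)"
  shows "pair_approx h"
  unfolding pair_approx_def using assms by (intro allI impI bexI[of _ \<pi>] exI[of _ G]) auto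

lemma pair_approx_scale:
  assumes "pair_approx h" shows "pair_approx (\<lambda>p. c * h p)"
  unfolding pair_approx_def
proof (intro allI impI)
  fix e :: real assume e: "e > 0"
  then have "e / (cmod c + 1) > 0" by (simp add: add_nonneg_pos)
  then obtain \<pi> G where \<pi>: "\<pi> \<in> labels" "(\<integral>p. cmod (h p - G (pair_label \<pi> p)) \<partial>(M \<Otimes>\<^sub>M M)) < e / (cmod c + 1)"
    using assms unfolding pair_approx_def by blast
  have "(\<integral>p. cmod (c * h p - c * G (pair_label \<pi> p)) \<partial>(M \<Otimes>\<^sub>M M)) = cmod c * (\<integral>p. cmod (h p - G (pair_label \<pi> p)) \<partial>(M \<Otimes>\<^sub>M M))"
    by (simp add: norm_mult flip: right_diff_distrib)
  also have "\<dots> \<le> (cmod c + 1) * (\<integral>p. cmod (h p - G (pair_label \<pi> p)) \<partial>(M \<Otimes>\<^sub>M M))"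
    by (intro mult_right_mono integral_nonneg_AE) auto
  also have "\<dots> < e"
    using \<pi>(2) pos_less_divide_eq[of "cmod c + 1"] by (simp add: mult.commute add_nonneg_pos)
  finally show "\<exists>\<pi>\<in>labels. \<exists>G. (\<integral>p. cmod (c * h p - G (pair_label \<pi> p)) \<partial>(M \<Otimes>\<^sub>M M)) < e"
    using \<pi>(1) by (intro bexI[of _ \<pi>] exI[of _ "\<lambda>q. c * G q"]) auto
qed

text \<open>Rectangles are stable under intersection and are approximated exactly by a common
  refinement; complements and countable disjoint unions preserve the property, so Dynkin's theorem
  gives all measurable sets.\<close>

lemma pair_approx_indicator:
  assumes "A \<in> sets (M \<Otimes>\<^sub>M M)"
  shows "pair_approx (indicator A)"
proof -
  interpret P: finite_measure "M \<Otimes>\<^sub>M M" by (rule finite_pairM)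
  let ?R = "{a \<times> b | a b. a \<in> sets M \<and> b \<in> sets M}"
  have sp: "space M = UNIV" using sets_eq_imp_space_eq[OF setsM] by simp
  have ind: "integrable (M \<Otimes>\<^sub>M M) (indicator A :: _ \<Rightarrow> complex)" if "A \<in> sets (M \<Otimes>\<^sub>M M)" for A
  proof -
    have "integrable (M \<Otimes>\<^sub>M M) (\<lambda>p. indicator A p *\<^sub>R (1::complex))"
      using that by (intro integrable_scaleR_left) (auto simp: P.emeasure_eq_measure)
    moreover have "(\<lambda>p. indicator A p *\<^sub>R (1::complex)) = indicator A" by (auto simp: indicator_def)
    ultimately show ?thesis by simp
  qed
  have sets: "sets (M \<Otimes>\<^sub>M M) = sigma_sets UNIV ?R" by (simp add: sets_pair_measure sp)
  have "Int_stable ?R"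
  proof (rule Int_stableI)
    fix a b assume "a \<in> ?R" "b \<in> ?R"
    then obtain a1 a2 b1 b2 where "a = a1 \<times> a2" "b = b1 \<times> b2" "a1 \<in> sets M" "a2 \<in> sets M" "b1 \<in> sets M" "b2 \<in> sets M"
      by blast
    then have "a \<inter> b = (a1 \<inter> b1) \<times> (a2 \<inter> b2)" "a1 \<inter> b1 \<in> sets M" "a2 \<inter> b2 \<in> sets M" by auto
    then show "a \<inter> b \<in> ?R" by blast
  qed
  moreover have "?R \<subseteq> Pow UNIV" by simp
  moreover have "A \<in> sigma_sets UNIV ?R" using assms sets by simp
  ultimately show ?thesis
  proof (induction A rule: sigma_sets_induct_disjoint)
    case (basic A)
    then obtain a b where A: "A = a \<times> b" "a \<in> sets borel" "b \<in> sets borel" using setsM by auto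
    obtain \<pi> g1 g2 where \<pi>: "\<pi> \<in> labels" "(\<lambda>x. if x \<in> a then 1 else (0::nat)) = g1 \<circ> \<pi>"
        "(\<lambda>x. if x \<in> b then 1 else (0::nat)) = g2 \<circ> \<pi>"
      using labels_refine2[OF labels_of_set[OF A(2)] labels_of_set[OF A(3)]] by (auto simp: label_refines_def)
    have g: "g1 (\<pi> x) = (if x \<in> a then 1 else 0)" "g2 (\<pi> x) = (if x \<in> b then 1 else 0)" for x
      using fun_cong[OF \<pi>(2), of x] fun_cong[OF \<pi>(3), of x] by simp_all
    have "indicator A p = (of_nat (g1 (fst (pair_label \<pi> p))) * of_nat (g2 (snd (pair_label \<pi> p))) :: complex)" for p
      by (cases p) (simp add: A pair_label_def indicator_def g)
    then show ?case by (rule pair_approx_exact[OF \<pi>(1)])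
  next
    case empty
    show ?case by (rule pair_approx_exact[OF labels_const, of _ "\<lambda>_. 0"]) simp
  next
    case (compl A)
    then have A: "A \<in> sets (M \<Otimes>\<^sub>M M)" using sets by simp
    have 1: "pair_approx (\<lambda>p. 1)" by (rule pair_approx_exact[OF labels_const, of _ "\<lambda>_. 1"]) simp
    have "pair_approx (\<lambda>p. 1 + (-1) * indicator A p)"
      using ind[OF A] by (intro pair_approx_add 1 pair_approx_scale compl) auto
    moreover have "(\<lambda>p. 1 + (-1) * indicator A p :: complex) = indicator (UNIV - A)"
      by (auto simp: fun_eq_iff indicator_def)
    ultimately show ?case by simp
  next
    case (union A)
    have A: "A i \<in> sets (M \<Otimes>\<^sub>M M)" for i using union sets by auto
    have fin: "pair_approx (indicator (\<Union>i<n. A i))" for n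
    proof (induction n)
      case 0
      show ?case by (rule pair_approx_exact[OF labels_const, of _ "\<lambda>_. 0"]) simp
    next
      case (Suc n)
      have "pair_approx (\<lambda>p. indicator (\<Union>i<n. A i) p + indicator (A n) p)"
        using A by (intro pair_approx_add Suc union(3) ind) auto
      moreover have "(\<lambda>p. indicator (\<Union>i<n. A i) p + indicator (A n) p :: complex) = indicator (\<Union>i<Suc n. A i)"
      proof
        fix p
        have "A i \<inter> A n = {}" if "i < n" for i
          using disjoint_family_onD[OF union(1), of i n] that by simp
        then have "(\<Union>i<n. A i) \<inter> A n = {}" by blast
        moreover have "(\<Union>i<Suc n. A i) = (\<Union>i<n. A i) \<union> A n" by (auto simp: less_Suc_eq)
        ultimately show "indicator (\<Union>i<n. A i) p + indicator (A n) p = (indicator (\<Union>i<Suc n. A i) p :: complex)"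
          by (simp add: indicator_add)
      qed
      ultimately show ?case by simp
    qed
    show ?case
    proof (rule pair_approx_limit[where s = "\<lambda>n. indicator (\<Union>i<n. A i)" and w = "\<lambda>_. 1"])
      show "(\<lambda>n. indicator (\<Union>i<n. A i) p) \<longlonglongrightarrow> (indicator (\<Union>i. A i) p :: complex)" for p
        by (rule LIMSEQ_indicator_UN)
      show "integrable (M \<Otimes>\<^sub>M M) (indicator (\<Union>i. A i) :: _ \<Rightarrow> complex)" by (rule ind) (use A in auto)
      show "integrable (M \<Otimes>\<^sub>M M) (indicator (\<Union>i<n. A i) :: _ \<Rightarrow> complex)" for n by (rule ind) (use A in auto)
      show "cmod (indicator (\<Union>i<n. A i) p) \<le> 1" for n p by (simp add: indicator_def)
    qed (use fin in auto)
  qed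
qed

lemma pair_approx_integrable:
  assumes "integrable (M \<Otimes>\<^sub>M M) h" shows "pair_approx h"
  using assms
proof (induction h rule: integrable_induct)
  case (base A c)
  have "pair_approx (\<lambda>p. c * indicator A p)" using base by (intro pair_approx_scale pair_approx_indicator)
  moreover have "(\<lambda>p. c * indicator A p) = (\<lambda>p. indicator A p *\<^sub>R c)" by (auto simp: indicator_def)
  ultimately show ?case by simp
next
  case (add f g)
  then show ?case by (intro pair_approx_add)
next
  case (lim f s)
  have sp: "space (M \<Otimes>\<^sub>M M) = UNIV"
    using sets_eq_imp_space_eq[OF setsM] by (simp add: space_pair_measure)
  show ?case
    by (rule pair_approx_limit[of s f "\<lambda>p. 2 * cmod (f p)"]) (use lim sp in auto)
qed

end

section \<open>Compression to cells\<close>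

text \<open>Lebesgue measure restricted to \<open>\<Lambda>\<close> as a density, so that its
  underlying space remains \<open>UNIV\<close> and labels can stay total functions.\<close>

abbreviation nu :: "'a::euclidean_space set \<Rightarrow> 'a measure" where
  "nu \<Lambda> \<equiv> density lborel (\<lambda>x. ennreal (indicator \<Lambda> x))"

lemma AE_nu:
  assumes "\<Lambda> \<in> sets borel"
  shows "(AE x in nu \<Lambda>. P x) \<longleftrightarrow> (AE x in lborel. x \<in> \<Lambda> \<longrightarrow> P x)"
  using assms by (subst AE_density) (auto simp: indicator_def)

lemma integral_nu:
  fixes f :: "'a::euclidean_space \<Rightarrow> complex"
  assumes "\<Lambda> \<in> sets borel" "f \<in> borel_measurable borel"
  shows "(\<integral>x. f x \<partial>nu \<Lambda>) = (\<integral>x. indicator \<Lambda> x * f x \<partial>lborel)"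
  using assms by (subst integral_density) (auto simp: indicator_scaleR_eq_if indicator_def intro!: Bochner_Integration.integral_cong)

lemma integrable_nu:
  fixes f :: "'a::euclidean_space \<Rightarrow> 'b::{banach, second_countable_topology}"
  assumes "\<Lambda> \<in> sets borel" "f \<in> borel_measurable borel"
  shows "integrable (nu \<Lambda>) f \<longleftrightarrow> set_integrable lborel \<Lambda> f"
  using assms by (subst integrable_density) (auto simp: set_integrable_def)

lemma finite_measure_nu:
  fixes \<Lambda> :: "'a::euclidean_space set"
  assumes "\<Lambda> \<in> bdd_borel" shows "finite_measure (nu \<Lambda>)"
proof
  have "emeasure (nu \<Lambda>) (space (nu \<Lambda>)) = emeasure lborel \<Lambda>"
    using assms by (subst emeasure_density) (auto simp: bdd_borel_def ennreal_indicator)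
  then show "emeasure (nu \<Lambda>) (space (nu \<Lambda>)) \<noteq> \<infinity>"
    using assms emeasure_bounded_finite[of \<Lambda>] by (auto simp: bdd_borel_def)
qed

lemma AE_nu_pair:
  assumes "\<Lambda> \<in> bdd_borel"
  shows "(AE p in nu \<Lambda> \<Otimes>\<^sub>M nu \<Lambda>. P p) \<longleftrightarrow> (AE p in lborel \<Otimes>\<^sub>M lborel. fst p \<in> \<Lambda> \<and> snd p \<in> \<Lambda> \<longrightarrow> P p)"
proof -
  interpret finite_measure "nu \<Lambda>" using assms by (rule finite_measure_nu)
  have \<Lambda>: "\<Lambda> \<in> sets borel" using assms by (simp add: bdd_borel_def)
  have "nu \<Lambda> \<Otimes>\<^sub>M nu \<Lambda> = density (lborel \<Otimes>\<^sub>M lborel) (\<lambda>(x, y). ennreal (indicator \<Lambda> x) * ennreal (indicator \<Lambda> y))"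
    by (rule pair_measure_density) (use \<Lambda> in \<open>auto intro: sigma_finite_measure_axioms sigma_finite_lborel\<close>)
  moreover have "(\<lambda>(x, y). ennreal (indicator \<Lambda> x) * ennreal (indicator \<Lambda> y)) \<in> borel_measurable (lborel \<Otimes>\<^sub>M lborel)"
    using \<Lambda> by measurable
  ultimately have "(AE p in nu \<Lambda> \<Otimes>\<^sub>M nu \<Lambda>. P p) \<longleftrightarrow> (AE p in lborel \<Otimes>\<^sub>M lborel.
      0 < (case p of (x, y) \<Rightarrow> ennreal (indicator \<Lambda> x) * ennreal (indicator \<Lambda> y)) \<longrightarrow> P p)"
    by (simp only: AE_density)
  also have "\<dots> \<longleftrightarrow> (AE p in lborel \<Otimes>\<^sub>M lborel. fst p \<in> \<Lambda> \<and> snd p \<in> \<Lambda> \<longrightarrow> P p)"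
    by (intro AE_cong) (auto simp: indicator_def of_bool_def split: if_splits)
  finally show ?thesis .
qed

text \<open>The indicator of a cell within \<open>\<Lambda>\<close>, normalized to integral 1, so
  that pairing an operator with two of these functions yields a mean value of its kernel. A cell of
  measure zero gives the zero function.\<close>

definition cell_fun :: "'a::euclidean_space set \<Rightarrow> ('a \<Rightarrow> nat) \<Rightarrow> nat \<Rightarrow> 'a \<Rightarrow> complex" where
  "cell_fun \<Lambda> \<pi> a x = indicator \<Lambda> x * indicator (\<pi> -` {a}) x / of_real (measure (nu \<Lambda>) (\<pi> -` {a}))"

lemma sets_label: "\<pi> \<in> labels \<Longrightarrow> \<pi> -` A \<in> sets borel"
  using measurable_sets[of \<pi> borel "count_space UNIV" A] by (simp add: labels_def)

lemma L2_indicator_cell: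
  assumes "\<Lambda> \<in> bdd_borel" "\<pi> \<in> labels"
  shows "(\<lambda>x. indicator \<Lambda> x * indicator (\<pi> -` {a}) x :: complex) \<in> L2"
proof (rule L2I)
  have \<Lambda>: "\<Lambda> \<in> sets borel" "bounded \<Lambda>" using assms by (auto simp: bdd_borel_def)
  note Q = sets_label[OF assms(2), of "{a}"]
  show "(\<lambda>x. indicator \<Lambda> x * indicator (\<pi> -` {a}) x :: complex) \<in> borel_measurable borel"
    using \<Lambda> Q by measurable
  have "emeasure lborel (\<Lambda> \<inter> \<pi> -` {a}) < \<infinity>"
    using \<Lambda> by (intro emeasure_bounded_finite) (auto intro: bounded_subset)
  then have "integrable lborel (indicator (\<Lambda> \<inter> \<pi> -` {a}) :: 'a \<Rightarrow> real)"
    using \<Lambda> Q by (intro integrable_real_indicator) auto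
  moreover have "(\<lambda>x. (cmod (indicator \<Lambda> x * indicator (\<pi> -` {a}) x))\<^sup>2) = (indicator (\<Lambda> \<inter> \<pi> -` {a}) :: 'a \<Rightarrow> real)"
    by (auto simp: indicator_def)
  ultimately show "integrable lborel (\<lambda>x. (cmod (indicator \<Lambda> x * indicator (\<pi> -` {a}) x))\<^sup>2)" by simp
qed

lemma L2_cell_fun:
  assumes "\<Lambda> \<in> bdd_borel" "\<pi> \<in> labels"
  shows "cell_fun \<Lambda> \<pi> a \<in> L2"
  using L2_scale[OF L2_indicator_cell[OF assms, of a], of "inverse (of_real (measure (nu \<Lambda>) (\<pi> -` {a})))"]
  by (simp add: cell_fun_def[abs_def] divide_inverse mult.commute)

text \<open>Here information about an operator becomes information about its kernel. Fubini merges
  the two integrals, which is why integrability of the kernel on the square is required.\<close>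

lemma inner_cells_eq_avg:
  assumes \<Lambda>: "\<Lambda> \<in> bdd_borel" and \<pi>: "\<pi> \<in> labels" and T: "bounded_op T" and k: "integral_kernel T k"
    and int: "integrable (nu \<Lambda> \<Otimes>\<^sub>M nu \<Lambda>) (\<lambda>p. k (fst p) (snd p))"
  shows "l2_inner (cell_fun \<Lambda> \<pi> a) (T (cell_fun \<Lambda> \<pi> b)) =
    cell_avg (nu \<Lambda> \<Otimes>\<^sub>M nu \<Lambda>) (pair_label \<pi>) (\<lambda>p. k (fst p) (snd p)) (a, b)"
proof -
  interpret F: finite_measure "nu \<Lambda>" using \<Lambda> by (rule finite_measure_nu)
  interpret P: pair_sigma_finite "nu \<Lambda>" "nu \<Lambda>" ..
  interpret T: bounded_L2_op T by unfold_locales (rule T)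
  have \<Lambda>b: "\<Lambda> \<in> sets borel" using \<Lambda> by (simp add: bdd_borel_def)
  note [measurable] = \<Lambda>b sets_label[OF \<pi>]
  have km [measurable]: "(\<lambda>(x, y). k x y) \<in> borel_measurable (lborel \<Otimes>\<^sub>M lborel)"
    using k by (simp add: integral_kernel_def)
  define A B where "A = \<pi> -` {a}" and "B = \<pi> -` {b}"
  have AB [measurable]: "A \<in> sets borel" "B \<in> sets borel" unfolding A_def B_def by (rule sets_label[OF \<pi>])+
  define wa wb where "wa = measure (nu \<Lambda>) A" and "wb = measure (nu \<Lambda>) B"
  define u v where "u = cell_fun \<Lambda> \<pi> a" and "v = cell_fun \<Lambda> \<pi> b"
  have uv: "u \<in> L2" "v \<in> L2" using L2_cell_fun[OF \<Lambda> \<pi>] by (auto simp: u_def v_def)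
  have [measurable]: "u \<in> borel_measurable borel" "v \<in> borel_measurable borel" using uv L2_measurable by auto
  have inner: "(\<integral>y. k x y * v y \<partial>lborel) = (\<integral>y. indicator B y * k x y \<partial>nu \<Lambda>) / of_real wb" for x
  proof -
    have "(\<integral>y. indicator B y * k x y \<partial>nu \<Lambda>) / of_real wb = (\<integral>y. indicator \<Lambda> y * (indicator B y * k x y) \<partial>lborel) / of_real wb"
      by (subst integral_nu) (auto simp: \<Lambda>b)
    also have "\<dots> = (\<integral>y. k x y * v y \<partial>lborel)"
      unfolding v_def cell_fun_def B_def[symmetric] wb_def[symmetric] integral_divide_zero[symmetric]
      by (intro Bochner_Integration.integral_cong) auto
    finally show ?thesis by simp
  qed
  have "l2_inner u (T v) = (\<integral>x. cnj (u x) * (\<integral>y. k x y * v y \<partial>lborel) \<partial>lborel)"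
    unfolding l2_inner_def
  proof (rule integral_cong_AE)
    show "AE x in lborel. cnj (u x) * T v x = cnj (u x) * (\<integral>y. k x y * v y \<partial>lborel)"
    proof -
      have "AE x in lborel. T v x = (\<integral>y. k x y * v y \<partial>lborel)"
        using k uv(2) unfolding integral_kernel_def by (auto elim: eventually_mono)
      then show ?thesis by eventually_elim simp
    qed
  qed (use L2_measurable[OF T.L2[OF uv(2)]] in measurable)
  also have "\<dots> = (\<integral>x. indicator \<Lambda> x * (indicator A x * (\<integral>y. indicator B y * k x y \<partial>nu \<Lambda>) / of_real (wa * wb)) \<partial>lborel)"
    unfolding inner unfolding u_def cell_fun_def A_def[symmetric] wa_def[symmetric]
    by (intro Bochner_Integration.integral_cong) (auto simp: indicator_def)
  also have "\<dots> = (\<integral>x. indicator A x * (\<integral>y. indicator B y * k x y \<partial>nu \<Lambda>) / of_real (wa * wb) \<partial>nu \<Lambda>)"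
    by (subst integral_nu) auto
  also have "\<dots> = (\<integral>x. indicator A x * (\<integral>y. indicator B y * k x y \<partial>nu \<Lambda>) \<partial>nu \<Lambda>) / of_real (wa * wb)"
    by simp
  also have "(\<integral>x. indicator A x * (\<integral>y. indicator B y * k x y \<partial>nu \<Lambda>) \<partial>nu \<Lambda>)
      = (\<integral>x. (\<integral>y. indicator (A \<times> B) (x, y) * k (fst (x, y)) (snd (x, y)) \<partial>nu \<Lambda>) \<partial>nu \<Lambda>)"
    by (intro Bochner_Integration.integral_cong refl) (simp add: indicator_times mult.assoc)
  also have "\<dots> = (\<integral>p. indicator (A \<times> B) p * k (fst p) (snd p) \<partial>(nu \<Lambda> \<Otimes>\<^sub>M nu \<Lambda>))"
  proof (rule P.integral_fst')
    have "A \<times> B \<in> sets (nu \<Lambda> \<Otimes>\<^sub>M nu \<Lambda>)" using AB by (intro pair_measureI) auto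
    then have "integrable (nu \<Lambda> \<Otimes>\<^sub>M nu \<Lambda>) (\<lambda>p. indicator (A \<times> B) p *\<^sub>R k (fst p) (snd p))"
      using int by (rule integrable_mult_indicator)
    moreover have "(\<lambda>p. indicator (A \<times> B) p *\<^sub>R k (fst p) (snd p)) = (\<lambda>p. indicator (A \<times> B) p * k (fst p) (snd p))"
      by (auto simp: indicator_def)
    ultimately show "integrable (nu \<Lambda> \<Otimes>\<^sub>M nu \<Lambda>) (\<lambda>p. indicator (A \<times> B) p * k (fst p) (snd p))" by simp
  qed
  also have "A \<times> B = pair_label \<pi> -` {(a, b)}" by (auto simp: A_def B_def pair_label_def)
  also have "wa * wb = measure (nu \<Lambda> \<Otimes>\<^sub>M nu \<Lambda>) (pair_label \<pi> -` {(a, b)} \<inter> space (nu \<Lambda> \<Otimes>\<^sub>M nu \<Lambda>))"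
  proof -
    have "pair_label \<pi> -` {(a, b)} \<inter> space (nu \<Lambda> \<Otimes>\<^sub>M nu \<Lambda>) = A \<times> B"
      by (auto simp: A_def B_def pair_label_def space_pair_measure)
    then show ?thesis
      using AB by (simp add: wa_def wb_def measure_def F.emeasure_pair_measure_Times enn2real_mult)
  qed
  finally show ?thesis by (simp add: u_def v_def cell_avg_def)
qed

text \<open>The matrix form at coefficients \<open>c\<close> is the operator form of J - K at the
  combination of the \<open>v x\<close> with these coefficients.\<close>

lemma kposdef_op_diff:
  assumes J: "bounded_op J" and K: "bounded_op K" and le: "op_le K J" and S: "finite S"
    and v: "\<And>x. x \<in> S \<Longrightarrow> v x \<in> L2"
  shows "kposdef (\<lambda>x y. l2_inner (v x) (J (v y)) - l2_inner (v x) (K (v y))) S"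
  unfolding kposdef_def
proof
  fix c :: "_ \<Rightarrow> complex"
  interpret J: bounded_L2_op J by unfold_locales (rule J)
  interpret K: bounded_L2_op K by unfold_locales (rule K)
  define f where "f = (\<lambda>t. \<Sum>x\<in>S. c x * v x t)"
  have cv: "(\<lambda>t. c x * v x t) \<in> L2" if "x \<in> S" for x using v[OF that] by (rule L2_scale)
  have f: "f \<in> L2" unfolding f_def using cv by (rule L2_sum)
  have lin: "l2_inner f (T f) = (\<Sum>x\<in>S. \<Sum>y\<in>S. cnj (c x) * l2_inner (v x) (T (v y)) * c y)"
    if T: "bounded_op T" for T
  proof -
    interpret T: bounded_L2_op T by unfold_locales (rule T)
    have "AE t in lborel. \<forall>y\<in>S. T (\<lambda>t. c y * v y t) t = c y * T (v y) t"
      using T.scale v S by (intro AE_finite_allI) auto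
    moreover have "AE t in lborel. T f t = (\<Sum>y\<in>S. T (\<lambda>t. c y * v y t) t)"
      unfolding f_def using S cv by (rule T.sum)
    ultimately have "AE t in lborel. T f t = (\<Sum>y\<in>S. c y * T (v y) t)"
      by eventually_elim simp
    then have "l2_inner f (T f) = l2_inner f (\<lambda>t. \<Sum>y\<in>S. c y * T (v y) t)"
      using f v by (intro l2_inner_cong_AE) (auto intro!: L2_measurable L2_sum L2_scale)
    also have "\<dots> = (\<Sum>y\<in>S. c y * l2_inner f (T (v y)))"
      using f v S by (subst l2_inner_sum_right) (auto intro!: L2_scale simp: l2_inner_scale_right)
    also have "\<dots> = (\<Sum>y\<in>S. \<Sum>x\<in>S. cnj (c x) * l2_inner (v x) (T (v y)) * c y)"
    proof (rule sum.cong[OF refl])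
      fix y assume y: "y \<in> S"
      have "l2_inner f (T (v y)) = (\<Sum>x\<in>S. cnj (c x) * l2_inner (v x) (T (v y)))"
        unfolding f_def using cv v y S by (subst l2_inner_sum_left) (auto simp: l2_inner_scale_left)
      then show "c y * l2_inner f (T (v y)) = (\<Sum>x\<in>S. cnj (c x) * l2_inner (v x) (T (v y)) * c y)"
        by (simp add: sum_distrib_left mult_ac)
    qed
    also have "\<dots> = (\<Sum>x\<in>S. \<Sum>y\<in>S. cnj (c x) * l2_inner (v x) (T (v y)) * c y)" by (rule sum.swap)
    finally show ?thesis .
  qed
  have "l2_inner f (diff_op J K f) = l2_inner f (J f) - l2_inner f (K f)"
    unfolding diff_op_def using f by (intro l2_inner_diff_right) auto
  also have "\<dots> = (\<Sum>x\<in>S. \<Sum>y\<in>S. cnj (c x) * (l2_inner (v x) (J (v y)) - l2_inner (v x) (K (v y))) * c y)"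
    unfolding lin[OF J] lin[OF K] by (simp add: sum_subtractf algebra_simps)
  finally have eq: "l2_inner f (diff_op J K f) =
      (\<Sum>x\<in>S. \<Sum>y\<in>S. cnj (c x) * (l2_inner (v x) (J (v y)) - l2_inner (v x) (K (v y))) * c y)" .
  have "l2_inner f (diff_op J K f) \<in> \<real>\<^sub>\<ge>\<^sub>0" using le f by (simp add: op_le_def positive_op_def)
  then show "(\<Sum>x\<in>S. \<Sum>y\<in>S. cnj (c x) * (l2_inner (v x) (J (v y)) - l2_inner (v x) (K (v y))) * c y) \<in> \<real>\<^sub>\<ge>\<^sub>0"
    unfolding eq .
qed

section \<open>Projections onto finite families of functions\<close>

lemma bounded_op_zero: "bounded_op zero_op"
  by (auto simp: bounded_op_def zero_op_def intro: exI[of _ 0])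

lemma kposdef_positive_op:
  assumes "bounded_op K" "op_le zero_op K" "finite S" "\<And>x. x \<in> S \<Longrightarrow> v x \<in> L2"
  shows "kposdef (\<lambda>x y. l2_inner (v x) (K (v y))) S"
  using kposdef_op_diff[OF assms(1) bounded_op_zero assms(2,3), of v] assms(4)
  by (simp add: zero_op_def l2_inner_def)

lemma positive_op_inner: "op_le zero_op K \<Longrightarrow> f \<in> L2 \<Longrightarrow> l2_inner f (K f) \<in> \<real>\<^sub>\<ge>\<^sub>0"
  by (simp add: op_le_def positive_op_def diff_op_def zero_op_def)

text \<open>Norm \<open>0\<close> arises from cells of measure zero.\<close>

locale sub_orthonormal =
  fixes I :: "'i set" and w :: "'i \<Rightarrow> 'a::euclidean_space \<Rightarrow> complex"
  assumes fin: "finite I" and wL2: "\<And>a. a \<in> I \<Longrightarrow> w a \<in> L2"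
    and orth: "\<And>a b. a \<in> I \<Longrightarrow> b \<in> I \<Longrightarrow> a \<noteq> b \<Longrightarrow> l2_inner (w a) (w b) = 0"
    and norm01: "\<And>a. a \<in> I \<Longrightarrow> l2_inner (w a) (w a) = 0 \<or> l2_inner (w a) (w a) = 1"
begin

definition proj :: "('a \<Rightarrow> complex) \<Rightarrow> 'a \<Rightarrow> complex" where
  "proj f = (\<lambda>x. \<Sum>a\<in>I. l2_inner (w a) f * w a x)"

lemma proj_L2: "proj f \<in> L2"
  unfolding proj_def by (intro L2_sum L2_scale wL2)

lemma combination_norm:
  "(l2_norm (\<lambda>x. \<Sum>a\<in>I. c a * w a x))\<^sup>2 \<le> (\<Sum>a\<in>I. (cmod (c a))\<^sup>2)"
proof -
  define p where "p = (\<lambda>x. \<Sum>a\<in>I. c a * w a x)"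
  have cw: "(\<lambda>x. c a * w a x) \<in> L2" if "a \<in> I" for a using wL2[OF that] by (rule L2_scale)
  have p: "p \<in> L2" unfolding p_def using cw by (rule L2_sum)
  have wp: "l2_inner (w a) p = c a * l2_inner (w a) (w a)" if "a \<in> I" for a
  proof -
    have "l2_inner (w a) p = (\<Sum>b\<in>I. c b * l2_inner (w a) (w b))"
      unfolding p_def using fin wL2[OF that] cw by (subst l2_inner_sum_right) (auto simp: l2_inner_scale_right)
    also have "\<dots> = (\<Sum>b\<in>I. if b = a then c a * l2_inner (w a) (w a) else 0)"
      using orth[OF that] by (intro sum.cong) auto
    finally show ?thesis using fin that by simp
  qed
  have "l2_inner p p = (\<Sum>a\<in>I. cnj (c a) * l2_inner (w a) p)"
    by (subst (1) p_def, subst l2_inner_sum_left) (auto simp: fin cw p l2_inner_scale_left)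
  also have "\<dots> = (\<Sum>a\<in>I. of_real ((cmod (c a))\<^sup>2) * l2_inner (w a) (w a))"
    by (intro sum.cong) (simp_all add: wp complex_norm_square mult_ac del: of_real_power)
  finally have "Re (l2_inner p p) = (\<Sum>a\<in>I. (cmod (c a))\<^sup>2 * Re (l2_inner (w a) (w a)))"
    by (simp del: of_real_power)
  also have "\<dots> \<le> (\<Sum>a\<in>I. (cmod (c a))\<^sup>2)"
  proof (rule sum_mono)
    fix a assume "a \<in> I"
    then have "Re (l2_inner (w a) (w a)) \<le> 1" using norm01[of a] by auto
    then show "(cmod (c a))\<^sup>2 * Re (l2_inner (w a) (w a)) \<le> (cmod (c a))\<^sup>2" by (simp add: mult_left_le)
  qed
  finally show ?thesis unfolding l2_inner_self p_def by simp
qed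

text \<open>The sum \<open>C\<close> of the squared coefficients dominates the squared norm of
  \<open>proj f\<close> and equals its pairing with \<open>f\<close>; Cauchy-Schwarz then removes
  one factor.\<close>

lemma norm_proj:
  assumes f: "f \<in> L2" shows "l2_norm (proj f) \<le> l2_norm f"
proof -
  define C where "C = (\<Sum>a\<in>I. (cmod (l2_inner (w a) f))\<^sup>2)"
  have pf: "l2_inner (proj f) f = of_real C"
  proof -
    have "l2_inner (proj f) f = (\<Sum>a\<in>I. cnj (l2_inner (w a) f) * l2_inner (w a) f)"
      unfolding proj_def using f fin wL2 by (subst l2_inner_sum_left) (auto simp: l2_inner_scale_left intro!: L2_scale)
    also have "\<dots> = of_real C"
      unfolding C_def of_real_sum by (intro sum.cong) (simp_all add: complex_norm_square mult.commute del: of_real_power)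
    finally show ?thesis .
  qed
  have le: "(l2_norm (proj f))\<^sup>2 \<le> C" unfolding proj_def C_def by (rule combination_norm)
  have "C = cmod (l2_inner (proj f) f)"
    unfolding pf norm_of_real by (simp add: C_def sum_nonneg)
  also have "\<dots> \<le> l2_norm (proj f) * l2_norm f" by (rule cmod_l2_inner[OF proj_L2 f])
  finally have "l2_norm (proj f) * l2_norm (proj f) \<le> l2_norm (proj f) * l2_norm f"
    using le by (simp add: power2_eq_square)
  then show ?thesis
    by (cases "l2_norm (proj f) = 0") (auto simp: less_le)
qed

text \<open>Up to the factor 2, \<open>proj f\<close> is as close to \<open>f\<close> as any
  \<open>s\<close> in the span: the error splits into f - s and the projection of s - f.\<close>

lemma proj_close:
  assumes f: "f \<in> L2" and s: "s \<in> L2" and fix_s: "AE x in lborel. proj s x = s x"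
  shows "l2_norm (\<lambda>x. f x - proj f x) \<le> 2 * l2_norm (\<lambda>x. f x - s x)"
proof -
  have fs: "(\<lambda>x. s x - f x) \<in> L2" using s f by (rule L2_diff)
  have pd: "proj (\<lambda>x. s x - f x) = (\<lambda>x. proj s x - proj f x)"
    using s f wL2 by (auto simp: proj_def l2_inner_diff_right left_diff_distrib sum_subtractf)
  have "l2_norm (\<lambda>x. f x - proj f x) = l2_norm (\<lambda>x. (f x - s x) + proj (\<lambda>x. s x - f x) x)"
    unfolding pd
    by (rule l2_norm_cong_AE)
      (use fix_s f s proj_L2 in \<open>auto elim: eventually_mono intro!: L2_measurable L2_diff L2_add\<close>)
  also have "\<dots> \<le> l2_norm (\<lambda>x. f x - s x) + l2_norm (proj (\<lambda>x. s x - f x))"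
    by (rule l2_norm_triangle[OF L2_diff[OF f s] proj_L2])
  also have "l2_norm (proj (\<lambda>x. s x - f x)) \<le> l2_norm (\<lambda>x. s x - f x)" using fs by (rule norm_proj)
  also have "l2_norm (\<lambda>x. s x - f x) = l2_norm (\<lambda>x. f x - s x)" by (rule l2_norm_diff_commute)
  finally show ?thesis by simp
qed

text \<open>The compression of a positive operator to a finite-dimensional space is a sum of rank-one
  operators; Bessel's inequality applies to each of them.\<close>

lemma trace_bound:
  assumes K: "bounded_op K" "op_le zero_op K"
    and e: "\<And>n. e n \<in> L2" "\<And>m n. l2_inner (e m) (e n) = of_bool (m = n)"
  shows "(\<Sum>n<(N::nat). Re (l2_inner (proj (e n)) (K (proj (e n))))) \<le> (\<Sum>a\<in>I. Re (l2_inner (w a) (K (w a))))"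
proof -
  interpret K: bounded_L2_op K by unfold_locales (rule K(1))
  define A where "A a b = l2_inner (w a) (K (w b))" for a b
  have "kposdef A I"
    unfolding A_def by (rule kposdef_positive_op) (use K fin wL2 in auto)
  from kposdef_factorization[OF fin this] obtain R c
    where c: "\<And>a b. a \<in> I \<Longrightarrow> b \<in> I \<Longrightarrow> A a b = (\<Sum>r<(R::nat). c r a * cnj (c r b))" by blast
  \<comment> \<open>With these vectors, the quadratic form of \<open>K\<close> at a projected vector
    is the sum over r of its squared pairings with \<open>\<phi> r\<close>, which makes the sum over
    n accessible to Bessel's inequality.\<close>
  define \<phi> where "\<phi> r = (\<lambda>x. \<Sum>a\<in>I. c r a * w a x)" for r
  have cw: "(\<lambda>x. c r a * w a x) \<in> L2" if "a \<in> I" for a r using wL2[OF that] by (rule L2_scale)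
  have \<phi>: "\<phi> r \<in> L2" for r unfolding \<phi>_def using cw by (rule L2_sum)
  have form: "l2_inner (proj (e n)) (K (proj (e n))) = (\<Sum>r<R. of_real ((cmod (l2_inner (e n) (\<phi> r)))\<^sup>2))" for n
  proof -
    define d where "d a = l2_inner (w a) (e n)" for a
    have dw: "(\<lambda>x. d a * w a x) \<in> L2" if "a \<in> I" for a using wL2[OF that] by (rule L2_scale)
    have e\<phi>: "l2_inner (e n) (\<phi> r) = (\<Sum>a\<in>I. c r a * cnj (d a))" for r
      unfolding \<phi>_def using e fin cw
      by (subst l2_inner_sum_right) (auto simp: l2_inner_scale_right d_def l2_inner_cnj)
    have "AE x in lborel. \<forall>b\<in>I. K (\<lambda>t. d b * w b t) x = d b * K (w b) x"
      using K.scale wL2 fin by (intro AE_finite_allI) auto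
    moreover have "AE x in lborel. K (proj (e n)) x = (\<Sum>b\<in>I. K (\<lambda>t. d b * w b t) x)"
      unfolding proj_def d_def[symmetric] using fin dw by (rule K.sum)
    ultimately have "AE x in lborel. K (proj (e n)) x = (\<Sum>b\<in>I. d b * K (w b) x)"
      by eventually_elim simp
    then have "l2_inner (proj (e n)) (K (proj (e n))) = l2_inner (proj (e n)) (\<lambda>x. \<Sum>b\<in>I. d b * K (w b) x)"
      using proj_L2 wL2 by (intro l2_inner_cong_AE) (auto intro!: L2_measurable L2_sum L2_scale)
    also have "\<dots> = (\<Sum>b\<in>I. d b * l2_inner (proj (e n)) (K (w b)))"
      using proj_L2 wL2 fin by (subst l2_inner_sum_right) (auto intro!: L2_scale simp: l2_inner_scale_right)
    also have "\<dots> = (\<Sum>b\<in>I. \<Sum>a\<in>I. d b * (cnj (d a) * A a b))"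
    proof (rule sum.cong[OF refl])
      fix b assume b: "b \<in> I"
      have "l2_inner (proj (e n)) (K (w b)) = (\<Sum>a\<in>I. cnj (d a) * A a b)"
        unfolding proj_def d_def[symmetric] A_def using dw wL2 b fin
        by (subst l2_inner_sum_left) (auto simp: l2_inner_scale_left)
      then show "d b * l2_inner (proj (e n)) (K (w b)) = (\<Sum>a\<in>I. d b * (cnj (d a) * A a b))"
        by (simp add: sum_distrib_left)
    qed
    also have "\<dots> = (\<Sum>b\<in>I. \<Sum>a\<in>I. \<Sum>r<R. (c r a * cnj (d a)) * (cnj (c r b) * d b))"
      by (intro sum.cong refl) (simp add: c sum_distrib_left mult_ac)
    also have "\<dots> = (\<Sum>r<R. (\<Sum>a\<in>I. c r a * cnj (d a)) * (\<Sum>b\<in>I. cnj (c r b) * d b))"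
    proof -
      have "(\<Sum>b\<in>I. \<Sum>a\<in>I. \<Sum>r<R. (c r a * cnj (d a)) * (cnj (c r b) * d b))
          = (\<Sum>b\<in>I. \<Sum>r<R. \<Sum>a\<in>I. (c r a * cnj (d a)) * (cnj (c r b) * d b))"
        by (intro sum.cong refl sum.swap)
      also have "\<dots> = (\<Sum>r<R. \<Sum>b\<in>I. \<Sum>a\<in>I. (c r a * cnj (d a)) * (cnj (c r b) * d b))"
        by (rule sum.swap)
      finally show ?thesis by (simp add: sum_distrib_left sum_distrib_right)
    qed
    also have "\<dots> = (\<Sum>r<R. l2_inner (e n) (\<phi> r) * cnj (l2_inner (e n) (\<phi> r)))"
      unfolding e\<phi> by (simp add: cnj_sum)
    finally show ?thesis by (simp only: complex_norm_square)
  qed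
  have "(\<Sum>n<N. Re (l2_inner (proj (e n)) (K (proj (e n))))) = (\<Sum>n<N. \<Sum>r<R. (cmod (l2_inner (e n) (\<phi> r)))\<^sup>2)"
    unfolding form by (simp del: of_real_power)
  also have "\<dots> = (\<Sum>r<R. \<Sum>n<N. (cmod (l2_inner (e n) (\<phi> r)))\<^sup>2)" by (rule sum.swap)
  also have "\<dots> \<le> (\<Sum>r<R. (l2_norm (\<phi> r))\<^sup>2)" using e \<phi> by (intro sum_mono l2_Bessel)
  also have "\<dots> \<le> (\<Sum>r<R. \<Sum>a\<in>I. (cmod (c r a))\<^sup>2)"
    unfolding \<phi>_def by (intro sum_mono combination_norm)
  also have "\<dots> = (\<Sum>a\<in>I. \<Sum>r<R. (cmod (c r a))\<^sup>2)" by (rule sum.swap)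
  also have "\<dots> = (\<Sum>a\<in>I. Re (A a a))"
  proof (rule sum.cong[OF refl])
    fix a assume a: "a \<in> I"
    have "A a a = (\<Sum>r<R. of_real ((cmod (c r a))\<^sup>2))" unfolding c[OF a a] by (simp only: complex_norm_square)
    then show "(\<Sum>r<R. (cmod (c r a))\<^sup>2) = Re (A a a)" by (simp del: of_real_power)
  qed
  finally show ?thesis by (simp add: A_def)
qed

end

section \<open>The trace and the diagonal of the kernel\<close>

lemma integral_kernel_measurable:
  fixes K :: "'a::euclidean_space l2_op"
  assumes "integral_kernel K k"
  shows "(\<lambda>p. k (fst p) (snd p)) \<in> borel_measurable (borel \<Otimes>\<^sub>M borel)"
proof -
  have "(\<lambda>(x, y). k x y) \<in> borel_measurable (lborel \<Otimes>\<^sub>M lborel)" using assms by (simp add: integral_kernel_def)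
  moreover have "sets (lborel \<Otimes>\<^sub>M lborel) = sets (borel \<Otimes>\<^sub>M (borel :: 'a measure))"
    by (rule sets_pair_measure_cong) auto
  ultimately show ?thesis using measurable_cong_sets by (simp add: case_prod_beta')
qed

lemma integral_kernel_diag_measurable:
  fixes K :: "'a::euclidean_space l2_op"
  assumes "integral_kernel K k"
  shows "(\<lambda>x. k x x) \<in> borel_measurable borel"
proof -
  have "(\<lambda>x::'a. (x, x)) \<in> measurable borel (borel \<Otimes>\<^sub>M borel)" by measurable
  from measurable_comp[OF this integral_kernel_measurable[OF assms]] show ?thesis by (simp add: comp_def)
qed

text \<open>\<open>diag\<close> and \<open>dom\<close> are what positive definiteness gives for sets
  of one and two points. \<open>basis\<close> is listed because \<open>op_trace\<close> picks an
  orthonormal basis by choice and has meaning only if one exists.\<close>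

locale correlation_kernel_on =
  fixes \<Lambda> :: "'a::euclidean_space set" and K :: "'a l2_op" and k :: "'a \<Rightarrow> 'a \<Rightarrow> complex"
  assumes \<Lambda>: "\<Lambda> \<in> bdd_borel" and K: "bounded_op K" and pos: "op_le zero_op K" and ker: "integral_kernel K k"
    and diag: "AE x in lborel. k x x \<in> \<real>\<^sub>\<ge>\<^sub>0"
    and dom: "AE p in lborel \<Otimes>\<^sub>M lborel. cmod (k (fst p) (snd p)) \<le>
        (Re (k (fst p) (fst p)) + Re (k (snd p) (snd p))) / 2"
    and diag_int: "set_integrable lborel \<Lambda> (\<lambda>x. k x x)"
    and tr: "op_trace (compress \<Lambda> K) = (LINT x:\<Lambda>|lborel. k x x)"
    and basis: "\<exists>e::nat \<Rightarrow> 'a \<Rightarrow> complex. orthonormal_basis e"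
begin

sublocale K: bounded_L2_op K by unfold_locales (rule K)

sublocale F: finite_measure "nu \<Lambda>" using \<Lambda> by (rule finite_measure_nu)

sublocale P: pair_sigma_finite "nu \<Lambda>" "nu \<Lambda>" ..

lemma \<Lambda>_borel [measurable, simp]: "\<Lambda> \<in> sets borel"
  using \<Lambda> by (simp add: bdd_borel_def)

lemmas k_measurable [measurable] = integral_kernel_measurable[OF ker]
  and diag_measurable [measurable] = integral_kernel_diag_measurable[OF ker]

lemma sets_nu_pair: "sets (nu \<Lambda> \<Otimes>\<^sub>M nu \<Lambda>) = sets (borel \<Otimes>\<^sub>M borel)"
  by (rule sets_pair_measure_cong) auto

lemma k_measurable_nu [measurable]: "(\<lambda>p. k (fst p) (snd p)) \<in> borel_measurable (nu \<Lambda> \<Otimes>\<^sub>M nu \<Lambda>)"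
  using k_measurable measurable_cong_sets[OF sets_nu_pair refl] by blast

lemma integrable_diag: "integrable (nu \<Lambda>) (\<lambda>x. k x x)"
  using diag_int by (subst integrable_nu) auto

lemma diag_nu: "AE x in nu \<Lambda>. k x x \<in> \<real>\<^sub>\<ge>\<^sub>0"
  using diag by (subst AE_nu) (auto elim: eventually_mono)

lemma dom_nu: "AE p in nu \<Lambda> \<Otimes>\<^sub>M nu \<Lambda>. cmod (k (fst p) (snd p)) \<le>
        (Re (k (fst p) (fst p)) + Re (k (snd p) (snd p))) / 2"
  using dom by (subst AE_nu_pair[OF \<Lambda>]) (auto elim: eventually_mono)

lemma integrable_Re_diag: "integrable (nu \<Lambda>) (\<lambda>x. Re (k x x))"
  using integrable_diag by (rule integrable_Re)

lemma
  fixes f :: "'a \<Rightarrow> real"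
  assumes f: "integrable (nu \<Lambda>) f" "f \<in> borel_measurable borel" and AB: "A \<in> sets borel" "B \<in> sets borel"
  shows integrable_fst_rect: "integrable (nu \<Lambda> \<Otimes>\<^sub>M nu \<Lambda>) (\<lambda>p. indicator A (fst p) * f (fst p) * indicator B (snd p))"
    and integral_fst_rect: "(\<integral>p. indicator A (fst p) * f (fst p) * indicator B (snd p) \<partial>(nu \<Lambda> \<Otimes>\<^sub>M nu \<Lambda>)) =
      (\<integral>x. indicator A x * f x \<partial>nu \<Lambda>) * measure (nu \<Lambda>) B"
    and integrable_snd_rect: "integrable (nu \<Lambda> \<Otimes>\<^sub>M nu \<Lambda>) (\<lambda>p. indicator B (fst p) * (indicator A (snd p) * f (snd p)))"
    and integral_snd_rect: "(\<integral>p. indicator B (fst p) * (indicator A (snd p) * f (snd p)) \<partial>(nu \<Lambda> \<Otimes>\<^sub>M nu \<Lambda>)) =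
      (\<integral>x. indicator A x * f x \<partial>nu \<Lambda>) * measure (nu \<Lambda>) B"
proof -
  note [measurable] = f(2) AB
  have fA: "integrable (nu \<Lambda>) (\<lambda>x. indicator A x * f x)"
    using integrable_real_mult_indicator[of A "nu \<Lambda>" f] f(1) AB by (simp add: mult.commute)
  have fB: "integrable (nu \<Lambda>) (indicator B :: 'a \<Rightarrow> real)"
    using AB by (intro integrable_real_indicator) (auto simp: F.emeasure_eq_measure)
  have iB: "(\<integral>y. indicator B y \<partial>nu \<Lambda>) = measure (nu \<Lambda>) B" using AB by simp
  have m: "(\<lambda>p. indicator A (fst p) * f (fst p) * indicator B (snd p)) \<in> borel_measurable (nu \<Lambda> \<Otimes>\<^sub>M nu \<Lambda>)"
    "(\<lambda>p. indicator B (fst p) * (indicator A (snd p) * f (snd p))) \<in> borel_measurable (nu \<Lambda> \<Otimes>\<^sub>M nu \<Lambda>)"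
    unfolding measurable_cong_sets[OF sets_nu_pair refl] by measurable
  show 1: "integrable (nu \<Lambda> \<Otimes>\<^sub>M nu \<Lambda>) (\<lambda>p. indicator A (fst p) * f (fst p) * indicator B (snd p))"
  proof (rule P.Fubini_integrable[OF m(1)])
    have "integrable (nu \<Lambda>) (\<lambda>x. norm (indicator A x * f x) * measure (nu \<Lambda>) B)"
      using fA by (intro integrable_mult_left integrable_norm)
    show "integrable (nu \<Lambda>) (\<lambda>x. \<integral>y. norm (indicator A (fst (x, y)) * f (fst (x, y)) * indicator B (snd (x, y))) \<partial>nu \<Lambda>)"
    proof -
      have "(\<integral>y. norm (indicator A (fst (x, y)) * f (fst (x, y)) * indicator B (snd (x, y))) \<partial>nu \<Lambda>)
          = (\<integral>y. norm (indicator A x * f x) * indicator B y \<partial>nu \<Lambda>)" for x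
        by (intro Bochner_Integration.integral_cong) (auto simp: indicator_def)
      then show ?thesis using \<open>integrable (nu \<Lambda>) (\<lambda>x. norm (indicator A x * f x) * measure (nu \<Lambda>) B)\<close> iB
        by simp
    qed
    show "AE x in nu \<Lambda>. integrable (nu \<Lambda>) (\<lambda>y. indicator A (fst (x, y)) * f (fst (x, y)) * indicator B (snd (x, y)))"
      using fB by (intro AE_I2) simp
  qed
  show "(\<integral>p. indicator A (fst p) * f (fst p) * indicator B (snd p) \<partial>(nu \<Lambda> \<Otimes>\<^sub>M nu \<Lambda>)) =
      (\<integral>x. indicator A x * f x \<partial>nu \<Lambda>) * measure (nu \<Lambda>) B"
    using P.integral_fst'[OF 1] iB by simp
  show 2: "integrable (nu \<Lambda> \<Otimes>\<^sub>M nu \<Lambda>) (\<lambda>p. indicator B (fst p) * (indicator A (snd p) * f (snd p)))"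
  proof (rule P.Fubini_integrable[OF m(2)])
    have "integrable (nu \<Lambda>) (\<lambda>x. indicator B x * (\<integral>y. norm (indicator A y * f y) \<partial>nu \<Lambda>))"
      using fB by (intro integrable_mult_left)
    show "integrable (nu \<Lambda>) (\<lambda>x. \<integral>y. norm (indicator B (fst (x, y)) * (indicator A (snd (x, y)) * f (snd (x, y)))) \<partial>nu \<Lambda>)"
    proof -
      have "(\<integral>y. norm (indicator B (fst (x, y)) * (indicator A (snd (x, y)) * f (snd (x, y)))) \<partial>nu \<Lambda>)
          = (\<integral>y. indicator B x * norm (indicator A y * f y) \<partial>nu \<Lambda>)" for x
        by (intro Bochner_Integration.integral_cong) (auto simp: indicator_def)
      then show ?thesis using \<open>integrable (nu \<Lambda>) (\<lambda>x. indicator B x * (\<integral>y. norm (indicator A y * f y) \<partial>nu \<Lambda>))\<close>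
        by simp
    qed
    show "AE x in nu \<Lambda>. integrable (nu \<Lambda>) (\<lambda>y. indicator B (fst (x, y)) * (indicator A (snd (x, y)) * f (snd (x, y))))"
      using fA by (intro AE_I2) simp
  qed
  show "(\<integral>p. indicator B (fst p) * (indicator A (snd p) * f (snd p)) \<partial>(nu \<Lambda> \<Otimes>\<^sub>M nu \<Lambda>)) =
      (\<integral>x. indicator A x * f x \<partial>nu \<Lambda>) * measure (nu \<Lambda>) B"
    using P.integral_fst'[OF 2] iB by (simp add: mult.commute)
qed

text \<open>The diagonal dominates: on a set of finite measure, integrability of k(x,x) controls the
  kernel on the whole square.\<close>

lemma integrable_k: "integrable (nu \<Lambda> \<Otimes>\<^sub>M nu \<Lambda>) (\<lambda>p. k (fst p) (snd p))"
proof (rule Bochner_Integration.integrable_bound)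
  show "integrable (nu \<Lambda> \<Otimes>\<^sub>M nu \<Lambda>) (\<lambda>p. (Re (k (fst p) (fst p)) + Re (k (snd p) (snd p))) / 2)"
    using integrable_fst_rect[OF integrable_Re_diag, of UNIV UNIV] integrable_snd_rect[OF integrable_Re_diag, of UNIV UNIV]
    by simp
  show "AE p in nu \<Lambda> \<Otimes>\<^sub>M nu \<Lambda>. cmod (k (fst p) (snd p)) \<le> norm ((Re (k (fst p) (fst p)) + Re (k (snd p) (snd p))) / 2)"
    using dom_nu by eventually_elim simp
qed simp

section \<open>Traces of cell compressions and the mass of the diagonal\<close>

abbreviation "wt \<pi> a \<equiv> measure (nu \<Lambda>) (\<pi> -` {a})"

definition diag_mass :: real where "diag_mass = (\<integral>x. Re (k x x) \<partial>nu \<Lambda>)"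

definition cell_diag :: "('a \<Rightarrow> nat) \<Rightarrow> nat \<Rightarrow> complex" where
  "cell_diag \<pi> a = l2_inner (cell_fun \<Lambda> \<pi> a) (K (cell_fun \<Lambda> \<pi> a))"

text \<open>The trace of the compression of \<open>K\<close> to the span of the cell functions;
  \<open>wt \<pi> a\<close> is the factor between \<open>cell_fun\<close> and the normalized
  \<open>unit_cell\<close> in the quadratic form.\<close>

definition cell_trace :: "('a \<Rightarrow> nat) \<Rightarrow> real" where
  "cell_trace \<pi> = (\<Sum>a\<in>range \<pi>. wt \<pi> a * Re (cell_diag \<pi> a))"

lemma cell_diag_nonneg: "\<pi> \<in> labels \<Longrightarrow> cell_diag \<pi> a \<in> \<real>\<^sub>\<ge>\<^sub>0"
  unfolding cell_diag_def using pos L2_cell_fun[OF \<Lambda>] by (rule positive_op_inner)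

text \<open>The real part of k(x,y) is bounded by the mean of the two diagonal values. Averaging
  over the cell times itself leaves the diagonal integral over the cell, divided by the
  weight.\<close>

lemma cell_weight_le:
  assumes \<pi>: "\<pi> \<in> labels"
  shows "wt \<pi> a * Re (cell_diag \<pi> a) \<le> (\<integral>x. indicator (\<pi> -` {a}) x * Re (k x x) \<partial>nu \<Lambda>)"
proof (cases "wt \<pi> a = 0")
  case True
  have "0 \<le> (\<integral>x. indicator (\<pi> -` {a}) x * Re (k x x) \<partial>nu \<Lambda>)"
    by (rule integral_nonneg_AE) (use diag_nu in \<open>auto elim!: eventually_mono simp: complex_nonneg_Reals_iff\<close>)
  then show ?thesis using True by simp
next
  case False
  define Q where "Q = \<pi> -` {a}"
  define w where "w = measure (nu \<Lambda>) Q"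
  have w: "w > 0" using False by (simp add: w_def Q_def zero_less_measure_iff)
  have Q [measurable]: "Q \<in> sets borel" unfolding Q_def using \<pi> by (rule sets_label)
  have cell: "pair_label \<pi> -` {(a, a)} = Q \<times> Q" by (auto simp: pair_label_def Q_def)
  have mQ: "measure (nu \<Lambda> \<Otimes>\<^sub>M nu \<Lambda>) (Q \<times> Q \<inter> space (nu \<Lambda> \<Otimes>\<^sub>M nu \<Lambda>)) = w * w"
    using Q by (simp add: space_pair_measure w_def measure_def F.emeasure_pair_measure_Times enn2real_mult)
  have intQ: "integrable (nu \<Lambda> \<Otimes>\<^sub>M nu \<Lambda>) (\<lambda>p. indicator (Q \<times> Q) p * k (fst p) (snd p))"
  proof -
    have "Q \<times> Q \<in> sets (nu \<Lambda> \<Otimes>\<^sub>M nu \<Lambda>)" using Q by (intro pair_measureI) auto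
    then have "integrable (nu \<Lambda> \<Otimes>\<^sub>M nu \<Lambda>) (\<lambda>p. indicator (Q \<times> Q) p *\<^sub>R k (fst p) (snd p))"
      using integrable_k by (rule integrable_mult_indicator)
    moreover have "(\<lambda>p. indicator (Q \<times> Q) p *\<^sub>R k (fst p) (snd p)) = (\<lambda>p. indicator (Q \<times> Q) p * k (fst p) (snd p))"
      by (auto simp: indicator_def)
    ultimately show ?thesis by simp
  qed
  define I where "I = (\<integral>x. indicator Q x * Re (k x x) \<partial>nu \<Lambda>)"
  note i1 = integrable_fst_rect[OF integrable_Re_diag _ Q Q] integral_fst_rect[OF integrable_Re_diag _ Q Q]
  note i2 = integrable_snd_rect[OF integrable_Re_diag _ Q Q] integral_snd_rect[OF integrable_Re_diag _ Q Q]
  let ?d1 = "\<lambda>p. indicator Q (fst p) * Re (k (fst p) (fst p)) * indicator Q (snd p)"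
  let ?d2 = "\<lambda>p. indicator Q (fst p) * (indicator Q (snd p) * Re (k (snd p) (snd p)))"
  have "Re (cell_diag \<pi> a) = Re (\<integral>p. indicator (Q \<times> Q) p * k (fst p) (snd p) \<partial>(nu \<Lambda> \<Otimes>\<^sub>M nu \<Lambda>)) / (w * w)"
    unfolding cell_diag_def inner_cells_eq_avg[OF \<Lambda> \<pi> K ker integrable_k] cell_avg_def cell mQ
    by (simp flip: of_real_mult)
  also have "Re (\<integral>p. indicator (Q \<times> Q) p * k (fst p) (snd p) \<partial>(nu \<Lambda> \<Otimes>\<^sub>M nu \<Lambda>)) =
      (\<integral>p. Re (indicator (Q \<times> Q) p * k (fst p) (snd p)) \<partial>(nu \<Lambda> \<Otimes>\<^sub>M nu \<Lambda>))"
    using intQ by (rule integral_Re[symmetric])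
  also have "\<dots> \<le> (\<integral>p. (?d1 p + ?d2 p) / 2 \<partial>(nu \<Lambda> \<Otimes>\<^sub>M nu \<Lambda>))"
  proof (rule integral_mono_AE)
    show "integrable (nu \<Lambda> \<Otimes>\<^sub>M nu \<Lambda>) (\<lambda>p. Re (indicator (Q \<times> Q) p * k (fst p) (snd p)))"
      using intQ by (rule integrable_Re)
    show "integrable (nu \<Lambda> \<Otimes>\<^sub>M nu \<Lambda>) (\<lambda>p. (?d1 p + ?d2 p) / 2)" using i1(1) i2(1) by simp
    show "AE p in nu \<Lambda> \<Otimes>\<^sub>M nu \<Lambda>. Re (indicator (Q \<times> Q) p * k (fst p) (snd p)) \<le> (?d1 p + ?d2 p) / 2"
      using dom_nu
    proof eventually_elim
      case (elim p)
      have "Re (k (fst p) (snd p)) \<le> (Re (k (fst p) (fst p)) + Re (k (snd p) (snd p))) / 2"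
        using elim complex_Re_le_cmod order_trans by blast
      then show ?case by (cases p) (simp add: indicator_def)
    qed
  qed
  also have "\<dots> = (I * w + I * w) / 2"
    using i1 i2 by (simp add: I_def w_def)
  finally have "Re (cell_diag \<pi> a) \<le> I * w / (w * w)" using w by (simp add: divide_right_mono)
  then have "w * Re (cell_diag \<pi> a) \<le> I" using w by (simp add: field_simps)
  then show ?thesis by (simp add: I_def w_def Q_def)
qed

lemma sum_cell_integrals:
  assumes \<pi>: "\<pi> \<in> labels" and f: "integrable (nu \<Lambda>) (f :: 'a \<Rightarrow> real)"
  shows "(\<Sum>a\<in>range \<pi>. \<integral>x. indicator (\<pi> -` {a}) x * f x \<partial>nu \<Lambda>) = (\<integral>x. f x \<partial>nu \<Lambda>)"
proof -
  have "integrable (nu \<Lambda>) (\<lambda>x. indicator (\<pi> -` {a}) x * f x)" for a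
    using integrable_real_mult_indicator[of "\<pi> -` {a}" "nu \<Lambda>" f] f sets_label[OF \<pi>] by (simp add: mult.commute)
  then have "(\<Sum>a\<in>range \<pi>. \<integral>x. indicator (\<pi> -` {a}) x * f x \<partial>nu \<Lambda>) =
      (\<integral>x. (\<Sum>a\<in>range \<pi>. indicator (\<pi> -` {a}) x * f x) \<partial>nu \<Lambda>)"
    by (subst Bochner_Integration.integral_sum) auto
  also have "\<dots> = (\<integral>x. f x \<partial>nu \<Lambda>)"
    using \<pi> by (intro Bochner_Integration.integral_cong refl)
      (simp add: labels_def indicator_def if_distrib[of "\<lambda>x. x * _"] cong: if_cong)
  finally show ?thesis .
qed

lemma cell_trace_le: "\<pi> \<in> labels \<Longrightarrow> cell_trace \<pi> \<le> diag_mass"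
  unfolding cell_trace_def diag_mass_def sum_cell_integrals[OF _ integrable_Re_diag, symmetric]
  by (intro sum_mono cell_weight_le)

lemma AE_cell_weight_pos:
  assumes \<pi>: "\<pi> \<in> labels"
  shows "AE x in nu \<Lambda>. wt \<pi> (\<pi> x) > 0"
proof -
  have "AE x in nu \<Lambda>. x \<notin> \<pi> -` {a} \<or> wt \<pi> a > 0" for a
  proof (cases "wt \<pi> a = 0")
    case True
    then have "\<pi> -` {a} \<in> null_sets (nu \<Lambda>)"
      using sets_label[OF \<pi>, of "{a}"] by (intro null_setsI) (auto simp: F.emeasure_eq_measure)
    then show ?thesis by (rule AE_I') auto
  next
    case False
    then show ?thesis by (simp add: zero_less_measure_iff)
  qed
  then have "AE x in nu \<Lambda>. \<forall>a. x \<notin> \<pi> -` {a} \<or> wt \<pi> a > 0" by (intro AE_all_countable[THEN iffD2] allI)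
  then show ?thesis by eventually_elim auto
qed

text \<open>\<open>cell_fun\<close> has squared norm 1 / \<open>wt \<pi> a\<close>, so the square
  root of the weight normalizes it in the 2-norm; cells of measure zero stay at 0.\<close>

definition unit_cell :: "('a \<Rightarrow> nat) \<Rightarrow> nat \<Rightarrow> 'a \<Rightarrow> complex" where
  "unit_cell \<pi> a = (\<lambda>x. of_real (sqrt (wt \<pi> a)) * cell_fun \<Lambda> \<pi> a x)"

lemma unit_cell_L2: "\<pi> \<in> labels \<Longrightarrow> unit_cell \<pi> a \<in> L2"
  unfolding unit_cell_def using L2_cell_fun[OF \<Lambda>] by (intro L2_scale)

lemma inner_cell_fun:
  assumes \<pi>: "\<pi> \<in> labels"
  shows "l2_inner (cell_fun \<Lambda> \<pi> a) (\<lambda>x. indicator \<Lambda> x * g (\<pi> x)) = (if wt \<pi> a = 0 then 0 else g a)"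
proof -
  define Q where "Q = \<pi> -` {a}"
  have Q: "Q \<in> sets borel" unfolding Q_def using \<pi> by (rule sets_label)
  have "l2_inner (cell_fun \<Lambda> \<pi> a) (\<lambda>x. indicator \<Lambda> x * g (\<pi> x)) =
      (\<integral>x. indicator \<Lambda> x * (indicator Q x *\<^sub>R (g a / of_real (wt \<pi> a))) \<partial>lborel)"
    unfolding l2_inner_def cell_fun_def
    by (intro Bochner_Integration.integral_cong) (auto simp: indicator_def Q_def)
  also have "\<dots> = (\<integral>x. indicator Q x *\<^sub>R (g a / of_real (wt \<pi> a)) \<partial>nu \<Lambda>)"
    using Q by (subst integral_nu) auto
  also have "\<dots> = measure (nu \<Lambda>) Q *\<^sub>R (g a / of_real (wt \<pi> a))"
    using Q by (subst integral_scaleR_left) (auto simp: F.emeasure_eq_measure)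
  finally show ?thesis by (simp add: Q_def scaleR_conv_of_real)
qed

lemma sub_orthonormal_cells:
  assumes \<pi>: "\<pi> \<in> labels"
  shows "sub_orthonormal (range \<pi>) (unit_cell \<pi>)"
proof
  show "finite (range \<pi>)" using \<pi> by (simp add: labels_def)
  show "unit_cell \<pi> a \<in> L2" for a using \<pi> by (rule unit_cell_L2)
  have inner: "l2_inner (unit_cell \<pi> a) (unit_cell \<pi> b) = (if a = b \<and> wt \<pi> a \<noteq> 0 then 1 else 0)" for a b
  proof -
    have "unit_cell \<pi> b = (\<lambda>x. of_real (sqrt (wt \<pi> b) / wt \<pi> b) * (indicator \<Lambda> x * (if \<pi> x = b then 1 else 0)))"
      by (auto simp: unit_cell_def cell_fun_def indicator_def fun_eq_iff)
    then have "l2_inner (unit_cell \<pi> a) (unit_cell \<pi> b) =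
        of_real (sqrt (wt \<pi> a)) * (of_real (sqrt (wt \<pi> b) / wt \<pi> b) * (if wt \<pi> a = 0 then 0 else if a = b then 1 else 0))"
      using inner_cell_fun[OF \<pi>, of a "\<lambda>c. if c = b then 1 else 0"]
      by (simp only: unit_cell_def[of \<pi> a] l2_inner_scale_left l2_inner_scale_right complex_cnj_complex_of_real)
    then show ?thesis by (auto simp flip: of_real_mult)
  qed
  show "l2_inner (unit_cell \<pi> a) (unit_cell \<pi> b) = 0" if "a \<noteq> b" for a b using that inner by simp
  show "l2_inner (unit_cell \<pi> a) (unit_cell \<pi> a) = 0 \<or> l2_inner (unit_cell \<pi> a) (unit_cell \<pi> a) = 1" for a
    unfolding inner by simp
qed

lemma L2_label_fun:
  assumes \<pi>: "\<pi> \<in> labels"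
  shows "(\<lambda>x. indicator \<Lambda> x * g (\<pi> x) :: complex) \<in> L2"
proof -
  have "(\<lambda>x. \<Sum>a\<in>range \<pi>. g a * (indicator \<Lambda> x * indicator (\<pi> -` {a}) x)) \<in> L2"
    using L2_indicator_cell[OF \<Lambda> \<pi>] by (intro L2_sum L2_scale)
  moreover have "(\<lambda>x. \<Sum>a\<in>range \<pi>. g a * (indicator \<Lambda> x * indicator (\<pi> -` {a}) x)) = (\<lambda>x. indicator \<Lambda> x * g (\<pi> x))"
  proof
    fix x
    have "(\<Sum>a\<in>range \<pi>. g a * (indicator \<Lambda> x * indicator (\<pi> -` {a}) x)) = (\<Sum>a\<in>range \<pi>. if \<pi> x = a then indicator \<Lambda> x * g a else 0)"
      by (intro sum.cong) (auto simp: indicator_def)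
    then show "(\<Sum>a\<in>range \<pi>. g a * (indicator \<Lambda> x * indicator (\<pi> -` {a}) x)) = indicator \<Lambda> x * g (\<pi> x)"
      using \<pi> by (simp add: labels_def)
  qed
  ultimately show ?thesis by simp
qed

text \<open>If the first \<open>N\<close> basis vectors are nearly constant on cells, their
  restrictions to \<open>\<Lambda>\<close> are within 2d of their projections. Each quadratic form
  then changes by at most B (2d)(1 + 1), and the projected sum is bounded by the cell trace.\<close>

lemma trace_partial_sum_le:
  assumes \<pi>: "\<pi> \<in> labels" and e: "\<And>n. e n \<in> L2" "\<And>m n. l2_inner (e m) (e n) = of_bool (m = n)"
    and B: "B \<ge> 0" "\<And>f. f \<in> L2 \<Longrightarrow> l2_norm (K f) \<le> B * l2_norm f"
    and d: "d \<ge> 0" and appr: "\<And>n. n < N \<Longrightarrow> \<exists>g. (\<integral>x. (cmod (e n x - g (\<pi> x)))\<^sup>2 \<partial>nu \<Lambda>) \<le> d\<^sup>2"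
  shows "(\<Sum>n<N. Re (l2_inner (\<lambda>x. indicator \<Lambda> x * e n x) (K (\<lambda>x. indicator \<Lambda> x * e n x)))) \<le> cell_trace \<pi> + real N * (4 * B * d)"
proof -
  interpret S: sub_orthonormal "range \<pi>" "unit_cell \<pi>" using \<pi> by (rule sub_orthonormal_cells)
  define f where "f n = (\<lambda>x. indicator \<Lambda> x * e n x)" for n
  have f: "f n \<in> L2" for n unfolding f_def using e(1) by (intro L2_indicator) auto
  have ne: "l2_norm (e n) = 1" for n
    using l2_inner_self[of "e n"] e(2)[of n n] l2_norm_nonneg[of "e n"]
    by (simp add: power2_eq_1_iff del: l2_norm_nonneg flip: of_real_power)
  have nf: "l2_norm (f n) \<le> 1" for n
  proof -
    have "(l2_norm (f n))\<^sup>2 \<le> (l2_norm (e n))\<^sup>2"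
      unfolding l2_norm_sq using L2_integrable[OF f] L2_integrable[OF e(1)]
      by (intro integral_mono) (auto simp: f_def indicator_def)
    then have "(l2_norm (f n))\<^sup>2 \<le> 1\<^sup>2" using ne by simp
    then show ?thesis by (rule power2_le_imp_le) simp
  qed
  have pf: "S.proj (f n) = S.proj (e n)" for n
  proof -
    have "l2_inner (unit_cell \<pi> a) (f n) = l2_inner (unit_cell \<pi> a) (e n)" for a
      unfolding l2_inner_def f_def unit_cell_def cell_fun_def
      by (intro Bochner_Integration.integral_cong) (auto simp: indicator_def)
    then show ?thesis by (simp add: S.proj_def)
  qed
  have close: "l2_norm (\<lambda>x. f n x - S.proj (f n) x) \<le> 2 * d" if n: "n < N" for n
  proof -
    obtain g where g: "(\<integral>x. (cmod (e n x - g (\<pi> x)))\<^sup>2 \<partial>nu \<Lambda>) \<le> d\<^sup>2" using appr[OF n] by blast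
    define s where "s = (\<lambda>x. indicator \<Lambda> x * g (\<pi> x))"
    have s: "s \<in> L2" unfolding s_def using \<pi> by (rule L2_label_fun)
    have "(l2_norm (\<lambda>x. f n x - s x))\<^sup>2 = (\<integral>x. indicator \<Lambda> x *\<^sub>R (cmod (e n x - g (\<pi> x)))\<^sup>2 \<partial>lborel)"
      unfolding l2_norm_sq by (intro Bochner_Integration.integral_cong) (auto simp: f_def s_def indicator_def)
    also have "\<dots> = (\<integral>x. (cmod (e n x - g (\<pi> x)))\<^sup>2 \<partial>nu \<Lambda>)"
    proof (rule integral_density[symmetric])
      have "(\<lambda>x. g (\<pi> x)) \<in> borel_measurable borel"
      proof -
        have "\<pi> \<in> measurable borel (count_space UNIV)" using \<pi> by (simp add: labels_def)
        moreover have "g \<in> measurable (count_space UNIV) borel" by simp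
        ultimately show ?thesis by (rule measurable_compose)
      qed
      then show "(\<lambda>x. (cmod (e n x - g (\<pi> x)))\<^sup>2) \<in> borel_measurable lborel"
        using L2_measurable[OF e(1)[of n]] by measurable
    qed auto
    finally have "(l2_norm (\<lambda>x. f n x - s x))\<^sup>2 \<le> d\<^sup>2" using g by simp
    then have fs: "l2_norm (\<lambda>x. f n x - s x) \<le> d" using d by (rule power2_le_imp_le)
    have "AE x in lborel. x \<in> \<Lambda> \<longrightarrow> wt \<pi> (\<pi> x) > 0"
      using AE_cell_weight_pos[OF \<pi>] by (simp add: AE_nu)
    then have "AE x in lborel. S.proj s x = s x"
    proof eventually_elim
      case (elim x)
      have "l2_inner (unit_cell \<pi> a) s * unit_cell \<pi> a x = (if \<pi> x = a then s x else 0)" for a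
      proof -
        have "l2_inner (unit_cell \<pi> a) s = of_real (sqrt (wt \<pi> a)) * (if wt \<pi> a = 0 then 0 else g a)"
          unfolding unit_cell_def l2_inner_scale_left s_def inner_cell_fun[OF \<pi>] by simp
        moreover have "complex_of_real (sqrt (wt \<pi> a)) * of_real (sqrt (wt \<pi> a)) = of_real (wt \<pi> a)"
          by (simp flip: of_real_mult)
        ultimately have "l2_inner (unit_cell \<pi> a) s * unit_cell \<pi> a x
            = of_real (wt \<pi> a) * (if wt \<pi> a = 0 then 0 else g a) * cell_fun \<Lambda> \<pi> a x"
          unfolding unit_cell_def by (simp add: mult_ac)
        then show ?thesis using elim by (auto simp: cell_fun_def s_def indicator_def)
      qed
      then show ?case using S.fin by (simp add: S.proj_def)
    qed
    from S.proj_close[OF f s this] fs show ?thesis by (meson mult_left_mono order_trans zero_le_numeral)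
  qed
  have step: "Re (l2_inner (f n) (K (f n))) \<le> Re (l2_inner (S.proj (e n)) (K (S.proj (e n)))) + 4 * B * d" if n: "n < N" for n
  proof -
    have "cmod (l2_inner (f n) (K (f n)) - l2_inner (S.proj (f n)) (K (S.proj (f n))))
        \<le> B * l2_norm (\<lambda>x. f n x - S.proj (f n) x) * (l2_norm (f n) + l2_norm (S.proj (f n)))"
      by (rule l2_inner_diag_close) (use B f S.proj_L2 K.diff in auto)
    also have "\<dots> \<le> B * (2 * d) * (1 + 1)"
      using close[OF n] nf[of n] S.norm_proj[OF f[of n]] B(1) d
      by (intro mult_mono add_mono mult_nonneg_nonneg add_nonneg_nonneg) auto
    finally have "Re (l2_inner (f n) (K (f n)) - l2_inner (S.proj (f n)) (K (S.proj (f n)))) \<le> 4 * B * d"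
      using complex_Re_le_cmod order_trans by fastforce
    then show ?thesis by (simp add: pf)
  qed
  have "(\<Sum>n<N. Re (l2_inner (f n) (K (f n)))) \<le> (\<Sum>n<N. Re (l2_inner (S.proj (e n)) (K (S.proj (e n)))) + 4 * B * d)"
    using step by (intro sum_mono) auto
  also have "\<dots> = (\<Sum>n<N. Re (l2_inner (S.proj (e n)) (K (S.proj (e n))))) + real N * (4 * B * d)"
    by (simp add: sum.distrib)
  also have "(\<Sum>n<N. Re (l2_inner (S.proj (e n)) (K (S.proj (e n))))) \<le> (\<Sum>a\<in>range \<pi>. Re (l2_inner (unit_cell \<pi> a) (K (unit_cell \<pi> a))))"
    by (rule S.trace_bound[OF K pos e])
  also have "\<dots> = cell_trace \<pi>"
    unfolding cell_trace_def
  proof (rule sum.cong[OF refl])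
    fix a
    have u: "cell_fun \<Lambda> \<pi> a \<in> L2" using \<Lambda> \<pi> by (rule L2_cell_fun)
    have "l2_inner (unit_cell \<pi> a) (K (unit_cell \<pi> a)) =
        l2_inner (unit_cell \<pi> a) (\<lambda>x. of_real (sqrt (wt \<pi> a)) * K (cell_fun \<Lambda> \<pi> a) x)"
      using K.scale[OF u, of "of_real (sqrt (wt \<pi> a))"] unit_cell_L2[OF \<pi>, of a] u
      by (intro l2_inner_cong_AE) (auto simp: unit_cell_def intro!: L2_measurable L2_scale)
    also have "\<dots> = of_real (sqrt (wt \<pi> a) * sqrt (wt \<pi> a)) * cell_diag \<pi> a"
      unfolding of_real_mult mult.assoc
      by (subst unit_cell_def, simp only: l2_inner_scale_left l2_inner_scale_right cell_diag_def
          complex_cnj_complex_of_real)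
    finally show "Re (l2_inner (unit_cell \<pi> a) (K (unit_cell \<pi> a))) = wt \<pi> a * Re (cell_diag \<pi> a)" by simp
  qed
  finally show ?thesis by (simp add: f_def)
qed

text \<open>The lower bound that complements \<open>cell_trace_le\<close>: the trace condition
  identifies \<open>diag_mass\<close> with the full trace, finitely many terms nearly exhaust it,
  and each partition fine enough for these terms captures them.\<close>

lemma exists_partition_trace:
  assumes eps: "\<epsilon> > 0"
  shows "\<exists>\<pi>0\<in>labels. \<forall>\<pi>\<in>labels. label_refines \<pi> \<pi>0 \<longrightarrow> diag_mass - cell_trace \<pi> \<le> \<epsilon>"
proof -
  \<comment> \<open>The same choice as inside \<open>op_trace\<close>, so that the trace condition
    speaks about this very basis.\<close>
  define e :: "nat \<Rightarrow> 'a \<Rightarrow> complex" where "e = (SOME e. orthonormal_basis e)"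
  have "orthonormal_basis e" unfolding e_def using basis by (rule someI_ex)
  then have e: "\<And>n. e n \<in> L2" "\<And>m n. l2_inner (e m) (e n) = of_bool (m = n)"
    by (auto simp: orthonormal_basis_def)
  define f where "f n = (\<lambda>x. indicator \<Lambda> x * e n x)" for n
  have f: "f n \<in> L2" for n unfolding f_def using e(1) by (intro L2_indicator) auto
  define t where "t n = l2_inner (f n) (K (f n))" for n
  have t: "t n \<in> \<real>\<^sub>\<ge>\<^sub>0" for n unfolding t_def using pos f by (rule positive_op_inner)
  then have t': "t n = of_real (Re (t n))" "Re (t n) \<ge> 0" for n
    using t[of n] by (auto simp: complex_nonneg_Reals_iff complex_eq_iff)
  have tc: "l2_inner (e n) (compress \<Lambda> K (e n)) = t n" for n
    unfolding t_def l2_inner_def compress_def f_def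
    by (intro Bochner_Integration.integral_cong) (auto simp: indicator_def)
  obtain B where B: "B \<ge> 0" "\<forall>f\<in>L2. l2_norm (K f) \<le> B * l2_norm f" using K.bound by blast
  have approx: "\<exists>\<pi>0\<in>labels. \<forall>\<pi>\<in>labels. label_refines \<pi> \<pi>0 \<longrightarrow> (\<Sum>n<N. Re (t n)) \<le> cell_trace \<pi> + \<eta>" if \<eta>: "\<eta> > 0" for N \<eta>
  proof -
    \<comment> \<open>The scale makes N times the error 4 B d at most \<eta>; both summands 1 keep
      the denominator positive when N or B is 0.\<close>
    define d where "d = \<eta> / ((real N + 1) * (4 * B + 1))"
    have d: "d > 0" using \<eta> B(1) by (auto simp: d_def intro!: divide_pos_pos mult_pos_pos)
    have "real N * (4 * B * d) \<le> (real N + 1) * ((4 * B + 1) * d)"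
      using d B(1) by (intro mult_mono) auto
    also have "\<dots> = \<eta>"
    proof -
      have "(real N + 1) * (4 * B + 1) \<noteq> 0" using B(1) by auto
      then have "((real N + 1) * (4 * B + 1)) * d = \<eta>" unfolding d_def by (rule nonzero_mult_div_cancel_left[of _ \<eta>, unfolded times_divide_eq_right[symmetric]])
      then show ?thesis by (simp only: mult.assoc)
    qed
    finally have small: "real N * (4 * B * d) \<le> \<eta>" .
    have "\<exists>\<pi>\<in>labels. \<exists>g. (\<integral>x. cmod (e n x - g (\<pi> x)) ^ 2 \<partial>nu \<Lambda>) < d\<^sup>2" for n
    proof (rule labels_approx)
      show "integrable (nu \<Lambda>) (\<lambda>x. cmod (e n x) ^ 2)"
      proof (subst integrable_nu)
        show "set_integrable lborel \<Lambda> (\<lambda>x. cmod (e n x) ^ 2)"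
          unfolding set_integrable_def
          using L2_integrable[OF e(1)[of n]] by (intro integrable_mult_indicator) auto
      qed (use L2_measurable[OF e(1)[of n]] in auto)
    qed (use L2_measurable[OF e(1)[of n]] d in auto)
    then obtain \<pi>1 g1 where \<pi>1: "\<And>n. \<pi>1 n \<in> labels" "\<And>n. (\<integral>x. (cmod (e n x - g1 n (\<pi>1 n x)))\<^sup>2 \<partial>nu \<Lambda>) < d\<^sup>2"
      by metis
    obtain \<pi>0 where \<pi>0: "\<pi>0 \<in> labels" "\<forall>n\<in>{..<N}. label_refines \<pi>0 (\<pi>1 n)"
      using labels_refine[of "{..<N}" \<pi>1] \<pi>1(1) by auto
    have "(\<Sum>n<N. Re (t n)) \<le> cell_trace \<pi> + \<eta>" if \<pi>: "\<pi> \<in> labels" "label_refines \<pi> \<pi>0" for \<pi>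
    proof -
      have "\<exists>g. (\<integral>x. (cmod (e n x - g (\<pi> x)))\<^sup>2 \<partial>nu \<Lambda>) \<le> d\<^sup>2" if n: "n < N" for n
      proof -
        have "label_refines \<pi> (\<pi>1 n)" using \<pi>0(2) n \<pi>(2) by (auto intro: label_refines_trans)
        then obtain g where "\<pi>1 n = g \<circ> \<pi>" by (auto simp: label_refines_def)
        then show ?thesis using \<pi>1(2)[of n] by (intro exI[of _ "\<lambda>a. g1 n (g a)"]) (simp add: less_imp_le)
      qed
      then have "(\<Sum>n<N. Re (t n)) \<le> cell_trace \<pi> + real N * (4 * B * d)"
        unfolding t_def f_def using B d by (intro trace_partial_sum_le[OF \<pi>(1) e]) auto
      then show ?thesis using small by simp
    qed
    then show ?thesis using \<pi>0(1) by blast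
  qed
  \<comment> \<open>Summability has to precede the use of \<open>op_trace\<close>: only for a
    convergent series does its infinite sum describe a limit of partial sums.\<close>
  have le: "(\<Sum>n<N. Re (t n)) \<le> diag_mass" for N
  proof (rule field_le_epsilon)
    fix \<eta> :: real assume "\<eta> > 0"
    then obtain \<pi>0 where \<pi>0: "\<pi>0 \<in> labels" "\<forall>\<pi>\<in>labels. label_refines \<pi> \<pi>0 \<longrightarrow> (\<Sum>n<N. Re (t n)) \<le> cell_trace \<pi> + \<eta>"
      using approx by blast
    moreover have "label_refines \<pi>0 \<pi>0" by (auto simp: label_refines_def intro!: exI[of _ id])
    ultimately show "(\<Sum>n<N. Re (t n)) \<le> diag_mass + \<eta>" using cell_trace_le[of \<pi>0] by force
  qed
  have summ: "summable (\<lambda>n. Re (t n))" using t'(2) le by (rule summableI_nonneg_bounded)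
  then have "(\<lambda>n. complex_of_real (Re (t n))) sums of_real (\<Sum>n. Re (t n))"
    by (intro sums_of_real summable_sums)
  then have "t sums of_real (\<Sum>n. Re (t n))" using t'(1) by simp
  then have "op_trace (compress \<Lambda> K) = of_real (\<Sum>n. Re (t n))"
    by (simp add: op_trace_def Let_def e_def[symmetric] tc sums_iff)
  moreover have "(LINT x:\<Lambda>|lborel. k x x) = (\<integral>x. k x x \<partial>nu \<Lambda>)"
    unfolding set_lebesgue_integral_def by (rule integral_density[symmetric]) auto
  ultimately have "complex_of_real (\<Sum>n. Re (t n)) = (\<integral>x. k x x \<partial>nu \<Lambda>)" using tr by simp
  then have "(\<Sum>n. Re (t n)) = diag_mass"
    unfolding diag_mass_def using integral_Re[OF integrable_diag] by (metis Re_complex_of_real)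
  then have "(\<lambda>n. Re (t n)) sums diag_mass" using summ by (simp add: sums_iff)
  then have "(\<lambda>N. \<Sum>n<N. Re (t n)) \<longlonglongrightarrow> diag_mass" by (simp add: sums_def)
  then have "eventually (\<lambda>N. diag_mass - \<epsilon> / 2 < (\<Sum>n<N. Re (t n))) sequentially"
    using eps by (intro order_tendstoD(1)) auto
  then obtain N where N: "diag_mass - \<epsilon> / 2 < (\<Sum>n<N. Re (t n))" by (auto simp: eventually_sequentially)
  obtain \<pi>0 where \<pi>0: "\<pi>0 \<in> labels" "\<forall>\<pi>\<in>labels. label_refines \<pi> \<pi>0 \<longrightarrow> (\<Sum>n<N. Re (t n)) \<le> cell_trace \<pi> + \<epsilon> / 2"
    using approx[of "\<epsilon> / 2" N] eps by auto
  have "diag_mass - cell_trace \<pi> \<le> \<epsilon>" if "\<pi> \<in> labels" "label_refines \<pi> \<pi>0" for \<pi>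
    using \<pi>0(2) that N by force
  then show ?thesis using \<pi>0(1) by blast
qed

end

section \<open>Domination of the correlation kernel\<close>

context correlation_kernel_on
begin

lemma label_nu: "\<pi> \<in> labels \<Longrightarrow> \<pi> \<in> measurable (nu \<Lambda>) (count_space UNIV)"
  by (rule measurable_label) auto

text \<open>On every cell the compressed value is at most the average of the diagonal. All
  differences have the same sign, so their total absolute size is the difference of the totals
  \<open>diag_mass\<close> and \<open>cell_trace \<pi>\<close>. The second term is the error of
  averaging the diagonal itself.\<close>

lemma diagonal_error:
  assumes \<pi>: "\<pi> \<in> labels"
  shows "(\<integral>x. cmod (cell_diag \<pi> (\<pi> x) - k x x) \<partial>nu \<Lambda>) \<le> (diag_mass - cell_trace \<pi>) + 2 * (\<integral>x. cmod (k x x - g (\<pi> x)) \<partial>nu \<Lambda>)"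
proof -
  have rng: "finite (range \<pi>)" using \<pi> by (simp add: labels_def)
  note cell = F.finite_measure_axioms label_nu[OF \<pi>] rng
  define av where "av = cell_avg (nu \<Lambda>) \<pi> (\<lambda>x. k x x)"
  have 1: "(\<integral>x. cmod (av (\<pi> x) - k x x) \<partial>nu \<Lambda>) \<le> 2 * (\<integral>x. cmod (k x x - g (\<pi> x)) \<partial>nu \<Lambda>)"
    unfolding av_def by (rule cell_avg_L1[OF cell integrable_diag])
  have le: "wt \<pi> a * cmod (cell_diag \<pi> a - av a) \<le> (\<integral>x. indicator (\<pi> -` {a}) x * Re (k x x) \<partial>nu \<Lambda>) - wt \<pi> a * Re (cell_diag \<pi> a)" for a
  proof (cases "wt \<pi> a = 0")
    case True
    then show ?thesis using cell_weight_le[OF \<pi>, of a] by simp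
  next
    case False
    define I where "I = (\<integral>x. indicator (\<pi> -` {a}) x * Re (k x x) \<partial>nu \<Lambda>)"
    have "(\<integral>x. indicator (\<pi> -` {a}) x * k x x \<partial>nu \<Lambda>) = (\<integral>x. complex_of_real (indicator (\<pi> -` {a}) x * Re (k x x)) \<partial>nu \<Lambda>)"
    proof (rule integral_cong_AE)
      show "AE x in nu \<Lambda>. indicator (\<pi> -` {a}) x * k x x = complex_of_real (indicator (\<pi> -` {a}) x * Re (k x x))"
        using diag_nu by eventually_elim (auto simp: complex_nonneg_Reals_iff complex_eq_iff indicator_def)
    qed (use sets_label[OF \<pi>, of "{a}"] in measurable)
    also have "\<dots> = of_real I" unfolding I_def by (rule integral_complex_of_real)
    finally have av: "of_real (wt \<pi> a) * av a = of_real I" using False by (simp add: av_def cell_avg_def)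
    have "cell_diag \<pi> a = of_real (Re (cell_diag \<pi> a))"
      using cell_diag_nonneg[OF \<pi>, of a] by (auto simp: complex_nonneg_Reals_iff complex_eq_iff)
    then have "of_real (wt \<pi> a) * (cell_diag \<pi> a - av a) = of_real (wt \<pi> a * Re (cell_diag \<pi> a) - I)"
      using av by (metis of_real_diff of_real_mult right_diff_distrib)
    then have "cmod (of_real (wt \<pi> a) * (cell_diag \<pi> a - av a)) = \<bar>wt \<pi> a * Re (cell_diag \<pi> a) - I\<bar>"
      by (simp only: norm_of_real)
    then show ?thesis using cell_weight_le[OF \<pi>, of a] by (simp add: norm_mult I_def)
  qed
  have "(\<integral>x. cmod (cell_diag \<pi> (\<pi> x) - av (\<pi> x)) \<partial>nu \<Lambda>) = (\<Sum>a\<in>range \<pi>. wt \<pi> a * cmod (cell_diag \<pi> a - av a))"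
    using integral_finite_range[OF cell, of "\<lambda>a. cmod (cell_diag \<pi> a - av a)"] by simp
  also have "\<dots> \<le> (\<Sum>a\<in>range \<pi>. (\<integral>x. indicator (\<pi> -` {a}) x * Re (k x x) \<partial>nu \<Lambda>) - wt \<pi> a * Re (cell_diag \<pi> a))"
    by (intro sum_mono le)
  also have "\<dots> = diag_mass - cell_trace \<pi>"
    by (simp add: sum_subtractf sum_cell_integrals[OF \<pi> integrable_Re_diag] diag_mass_def cell_trace_def)
  finally have 2: "(\<integral>x. cmod (cell_diag \<pi> (\<pi> x) - av (\<pi> x)) \<partial>nu \<Lambda>) \<le> diag_mass - cell_trace \<pi>" .
  have i1: "integrable (nu \<Lambda>) (\<lambda>x. cell_diag \<pi> (\<pi> x))" "integrable (nu \<Lambda>) (\<lambda>x. av (\<pi> x))"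
    using integrable_finite_range[OF cell] by blast+
  have "(\<integral>x. cmod (cell_diag \<pi> (\<pi> x) - k x x) \<partial>nu \<Lambda>) \<le> (\<integral>x. cmod (cell_diag \<pi> (\<pi> x) - av (\<pi> x)) + cmod (av (\<pi> x) - k x x) \<partial>nu \<Lambda>)"
  proof (rule integral_mono)
    fix x show "cmod (cell_diag \<pi> (\<pi> x) - k x x) \<le> cmod (cell_diag \<pi> (\<pi> x) - av (\<pi> x)) + cmod (av (\<pi> x) - k x x)"
      using norm_triangle_ineq[of "cell_diag \<pi> (\<pi> x) - av (\<pi> x)" "av (\<pi> x) - k x x"] by simp
  qed (use i1 integrable_diag in auto)
  also have "\<dots> = (\<integral>x. cmod (cell_diag \<pi> (\<pi> x) - av (\<pi> x)) \<partial>nu \<Lambda>) + (\<integral>x. cmod (av (\<pi> x) - k x x) \<partial>nu \<Lambda>)"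
    using i1 integrable_diag by (intro Bochner_Integration.integral_add) auto
  finally show ?thesis using 1 2 by simp
qed

definition pair_avg :: "('a \<Rightarrow> nat) \<Rightarrow> 'a \<times> 'a \<Rightarrow> complex" where
  "pair_avg \<pi> p = l2_inner (cell_fun \<Lambda> \<pi> (\<pi> (fst p))) (K (cell_fun \<Lambda> \<pi> (\<pi> (snd p))))"

lemma pair_avg_eq:
  assumes "\<pi> \<in> labels"
  shows "pair_avg \<pi> p = cell_avg (nu \<Lambda> \<Otimes>\<^sub>M nu \<Lambda>) (pair_label \<pi>) (\<lambda>p. k (fst p) (snd p)) (pair_label \<pi> p)"
  unfolding pair_avg_def inner_cells_eq_avg[OF \<Lambda> assms K ker integrable_k] by (simp add: pair_label_def)

lemma finite_pair_nu: "finite_measure (nu \<Lambda> \<Otimes>\<^sub>M nu \<Lambda>)"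
  by (rule finite_pairM[OF F.finite_measure_axioms]) simp

text \<open>Each requirement is reduced to a condition inherited by refinements, so a common
  refinement meets all of them.\<close>

lemma exists_good_partition:
  assumes e: "\<epsilon> > 0"
  shows "\<exists>\<pi>\<in>labels. (\<forall>x\<in>\<Lambda>. \<forall>y\<in>\<Lambda>. \<pi> x = \<pi> y \<longrightarrow> dist x y < \<epsilon>) \<and>
    (\<integral>p. cmod (pair_avg \<pi> p - k (fst p) (snd p)) \<partial>(nu \<Lambda> \<Otimes>\<^sub>M nu \<Lambda>)) \<le> \<epsilon> \<and>
    (\<integral>x. cmod (cell_diag \<pi> (\<pi> x) - k x x) \<partial>nu \<Lambda>) \<le> \<epsilon>"
proof -
  have bdd: "bounded \<Lambda>" using \<Lambda> by (simp add: bdd_borel_def)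
  obtain \<pi>1 where \<pi>1: "\<pi>1 \<in> labels" "\<forall>x\<in>\<Lambda>. \<forall>y\<in>\<Lambda>. \<pi>1 x = \<pi>1 y \<longrightarrow> dist x y < \<epsilon>"
    using labels_small_diameter[OF bdd e] by blast
  have "pair_approx (nu \<Lambda>) (\<lambda>p. k (fst p) (snd p))"
    by (rule pair_approx_integrable[OF F.finite_measure_axioms _ integrable_k]) simp
  then obtain \<pi>2 G where \<pi>2: "\<pi>2 \<in> labels"
    "(\<integral>p. cmod (k (fst p) (snd p) - G (pair_label \<pi>2 p)) \<partial>(nu \<Lambda> \<Otimes>\<^sub>M nu \<Lambda>)) < \<epsilon> / 2"
    unfolding pair_approx_def[OF F.finite_measure_axioms, of, simplified] using e by (meson half_gt_zero)
  have "\<exists>\<pi>\<in>labels. \<exists>g. (\<integral>x. cmod (k x x - g (\<pi> x)) ^ 1 \<partial>nu \<Lambda>) < \<epsilon> / 4"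
    by (rule labels_approx) (use e integrable_norm[OF integrable_diag] in auto)
  then obtain \<pi>3 g where \<pi>3: "\<pi>3 \<in> labels" "(\<integral>x. cmod (k x x - g (\<pi>3 x)) \<partial>nu \<Lambda>) < \<epsilon> / 4"
    by auto
  obtain \<pi>4 where \<pi>4: "\<pi>4 \<in> labels" "\<And>\<pi>. \<pi> \<in> labels \<Longrightarrow> label_refines \<pi> \<pi>4 \<Longrightarrow> diag_mass - cell_trace \<pi> \<le> \<epsilon> / 2"
    using exists_partition_trace[of "\<epsilon> / 2"] e by auto
  obtain \<pi>5 where \<pi>5: "\<pi>5 \<in> labels" "label_refines \<pi>5 \<pi>1" "label_refines \<pi>5 \<pi>2"
    using labels_refine2[OF \<pi>1(1) \<pi>2(1)] by blast
  obtain \<pi>6 where \<pi>6: "\<pi>6 \<in> labels" "label_refines \<pi>6 \<pi>3" "label_refines \<pi>6 \<pi>4"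
    using labels_refine2[OF \<pi>3(1) \<pi>4(1)] by blast
  obtain \<pi> where \<pi>: "\<pi> \<in> labels" "label_refines \<pi> \<pi>5" "label_refines \<pi> \<pi>6"
    using labels_refine2[OF \<pi>5(1) \<pi>6(1)] by blast
  obtain h1 h2 h3 where h: "\<pi>1 = h1 \<circ> \<pi>" "\<pi>2 = h2 \<circ> \<pi>" "\<pi>3 = h3 \<circ> \<pi>"
    using label_refines_trans[OF \<pi>(2) \<pi>5(2)] label_refines_trans[OF \<pi>(2) \<pi>5(3)] label_refines_trans[OF \<pi>(3) \<pi>6(2)]
    by (auto simp: label_refines_def)
  have d: "\<forall>x\<in>\<Lambda>. \<forall>y\<in>\<Lambda>. \<pi> x = \<pi> y \<longrightarrow> dist x y < \<epsilon>" using \<pi>1(2) by (simp add: h)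
  have "(\<integral>p. cmod (pair_avg \<pi> p - k (fst p) (snd p)) \<partial>(nu \<Lambda> \<Otimes>\<^sub>M nu \<Lambda>))
      \<le> 2 * (\<integral>p. cmod (k (fst p) (snd p) - (\<lambda>q. G (h2 (fst q), h2 (snd q))) (pair_label \<pi> p)) \<partial>(nu \<Lambda> \<Otimes>\<^sub>M nu \<Lambda>))"
    unfolding pair_avg_eq[OF \<pi>(1)]
    by (rule cell_avg_L1[OF finite_pair_nu measurable_pair_label[OF \<pi>(1)] finite_range_pair_label[OF \<pi>(1)] integrable_k]) simp
  also have "\<dots> \<le> \<epsilon>" using \<pi>2(2) by (simp add: pair_label_def h)
  finally have p: "(\<integral>p. cmod (pair_avg \<pi> p - k (fst p) (snd p)) \<partial>(nu \<Lambda> \<Otimes>\<^sub>M nu \<Lambda>)) \<le> \<epsilon>" .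
  have "(\<integral>x. cmod (cell_diag \<pi> (\<pi> x) - k x x) \<partial>nu \<Lambda>) \<le> (diag_mass - cell_trace \<pi>) + 2 * (\<integral>x. cmod (k x x - (g \<circ> h3) (\<pi> x)) \<partial>nu \<Lambda>)"
    by (rule diagonal_error[OF \<pi>(1)])
  also have "\<dots> \<le> \<epsilon> / 2 + \<epsilon> / 2"
    using \<pi>4(2)[OF \<pi>(1) label_refines_trans[OF \<pi>(3) \<pi>6(3)]] \<pi>3(2) by (intro add_mono) (simp_all add: h)
  finally show ?thesis using \<pi>(1) d p by auto
qed

text \<open>Convergence in mean becomes convergence almost everywhere along a subsequence. A second
  extraction handles the diagonal, about which the statement for pairs says nothing.\<close>

lemma AE_subsequence_to_kernel:
  "\<exists>\<pi> :: nat \<Rightarrow> 'a \<Rightarrow> nat. (\<forall>n. \<pi> n \<in> labels) \<and>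
    (\<forall>\<epsilon>>0. eventually (\<lambda>n. \<forall>x\<in>\<Lambda>. \<forall>y\<in>\<Lambda>. \<pi> n x = \<pi> n y \<longrightarrow> dist x y < \<epsilon>) sequentially) \<and>
    (AE p in nu \<Lambda> \<Otimes>\<^sub>M nu \<Lambda>. (\<lambda>n. pair_avg (\<pi> n) p) \<longlonglongrightarrow> k (fst p) (snd p)) \<and>
    (AE x in nu \<Lambda>. (\<lambda>n. pair_avg (\<pi> n) (x, x)) \<longlonglongrightarrow> k x x)"
proof -
  have "\<forall>n. \<exists>\<pi>. \<pi> \<in> labels \<and> (\<forall>x\<in>\<Lambda>. \<forall>y\<in>\<Lambda>. \<pi> x = \<pi> y \<longrightarrow> dist x y < 1 / real (Suc n)) \<and>
    (\<integral>p. cmod (pair_avg \<pi> p - k (fst p) (snd p)) \<partial>(nu \<Lambda> \<Otimes>\<^sub>M nu \<Lambda>)) \<le> 1 / real (Suc n) \<and>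
    (\<integral>x. cmod (cell_diag \<pi> (\<pi> x) - k x x) \<partial>nu \<Lambda>) \<le> 1 / real (Suc n)"
  proof
    fix n
    have "0 < 1 / real (Suc n)" by simp
    from exists_good_partition[OF this]
    show "\<exists>\<pi>. \<pi> \<in> labels \<and> (\<forall>x\<in>\<Lambda>. \<forall>y\<in>\<Lambda>. \<pi> x = \<pi> y \<longrightarrow> dist x y < 1 / real (Suc n)) \<and>
      (\<integral>p. cmod (pair_avg \<pi> p - k (fst p) (snd p)) \<partial>(nu \<Lambda> \<Otimes>\<^sub>M nu \<Lambda>)) \<le> 1 / real (Suc n) \<and>
      (\<integral>x. cmod (cell_diag \<pi> (\<pi> x) - k x x) \<partial>nu \<Lambda>) \<le> 1 / real (Suc n)"
      unfolding Bex_def .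
  qed
  from choice[OF this] obtain \<pi> where \<pi>0: "\<forall>n. \<pi> n \<in> labels \<and>
    (\<forall>x\<in>\<Lambda>. \<forall>y\<in>\<Lambda>. \<pi> n x = \<pi> n y \<longrightarrow> dist x y < 1 / real (Suc n)) \<and>
    (\<integral>p. cmod (pair_avg (\<pi> n) p - k (fst p) (snd p)) \<partial>(nu \<Lambda> \<Otimes>\<^sub>M nu \<Lambda>)) \<le> 1 / real (Suc n) \<and>
    (\<integral>x. cmod (cell_diag (\<pi> n) (\<pi> n x) - k x x) \<partial>nu \<Lambda>) \<le> 1 / real (Suc n)" ..
  note c1 = spec[OF \<pi>0] note c2 = c1[THEN conjunct2] note c3 = c2[THEN conjunct2]
  note \<pi> = c1[THEN conjunct1] c2[THEN conjunct1] c3[THEN conjunct1] c3[THEN conjunct2]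
  have inv0: "(\<lambda>n. 1 / real (Suc n)) \<longlonglongrightarrow> 0" using LIMSEQ_inverse_real_of_nat by (simp add: inverse_eq_divide)
  have ip: "integrable (nu \<Lambda> \<Otimes>\<^sub>M nu \<Lambda>) (\<lambda>p. pair_avg (\<pi> n) p - k (fst p) (snd p))" for n
  proof -
    have "integrable (nu \<Lambda> \<Otimes>\<^sub>M nu \<Lambda>) (\<lambda>p. pair_avg (\<pi> n) p)"
      unfolding pair_avg_eq[OF \<pi>(1)]
      by (rule integrable_pair_label[OF F.finite_measure_axioms _ \<pi>(1)]) simp
    then show ?thesis using integrable_k by (rule Bochner_Integration.integrable_diff)
  qed
  have "(\<lambda>n. \<integral>p. norm (pair_avg (\<pi> n) p - k (fst p) (snd p)) \<partial>(nu \<Lambda> \<Otimes>\<^sub>M nu \<Lambda>)) \<longlonglongrightarrow> 0"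
    by (rule tendsto_sandwich[OF _ _ tendsto_const inv0]) (use \<pi>(3) in \<open>auto intro!: always_eventually integral_nonneg_AE simp del: of_nat_Suc\<close>)
  from tendsto_L1_AE_subseq[OF ip this] obtain r1 where r1: "strict_mono r1"
    "AE p in nu \<Lambda> \<Otimes>\<^sub>M nu \<Lambda>. (\<lambda>n. pair_avg (\<pi> (r1 n)) p - k (fst p) (snd p)) \<longlonglongrightarrow> 0" by blast
  have id: "integrable (nu \<Lambda>) (\<lambda>x. cell_diag (\<pi> n) (\<pi> n x) - k x x)" for n
  proof -
    have "integrable (nu \<Lambda>) (\<lambda>x. cell_diag (\<pi> n) (\<pi> n x))"
      using \<pi>(1)[of n] by (intro integrable_finite_range[OF F.finite_measure_axioms label_nu]) (auto simp: labels_def)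
    then show ?thesis using integrable_diag by (rule Bochner_Integration.integrable_diff)
  qed
  have "(\<lambda>n. \<integral>x. norm (cell_diag (\<pi> n) (\<pi> n x) - k x x) \<partial>nu \<Lambda>) \<longlonglongrightarrow> 0"
    by (rule tendsto_sandwich[OF _ _ tendsto_const inv0]) (use \<pi>(4) in \<open>auto intro!: always_eventually integral_nonneg_AE simp del: of_nat_Suc\<close>)
  from LIMSEQ_subseq_LIMSEQ[OF this r1(1)]
  have "(\<lambda>n. \<integral>x. norm (cell_diag (\<pi> (r1 n)) (\<pi> (r1 n) x) - k x x) \<partial>nu \<Lambda>) \<longlonglongrightarrow> 0" by (simp add: comp_def)
  from tendsto_L1_AE_subseq[OF id this] obtain r2 where r2: "strict_mono r2"
    "AE x in nu \<Lambda>. (\<lambda>n. cell_diag (\<pi> (r1 (r2 n))) (\<pi> (r1 (r2 n)) x) - k x x) \<longlonglongrightarrow> 0" by blast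
  define \<rho> where "\<rho> n = \<pi> (r1 (r2 n))" for n
  have sm: "strict_mono (r1 \<circ> r2)" using r1(1) r2(1) by (rule strict_mono_o)
  have "eventually (\<lambda>n. \<forall>x\<in>\<Lambda>. \<forall>y\<in>\<Lambda>. \<rho> n x = \<rho> n y \<longrightarrow> dist x y < \<epsilon>) sequentially" if "\<epsilon> > 0" for \<epsilon>
  proof -
    have "eventually (\<lambda>n. 1 / real (Suc n) < \<epsilon>) sequentially" using inv0 that by (rule order_tendstoD(2))
    then show ?thesis
    proof eventually_elim
      case (elim n)
      have "n \<le> r1 (r2 n)" using seq_suble[OF sm, of n] by simp
      then have "1 / real (Suc (r1 (r2 n))) \<le> 1 / real (Suc n)" by (intro divide_left_mono) auto
      then have "1 / real (Suc (r1 (r2 n))) < \<epsilon>" using elim by simp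
      then show ?case using \<pi>(2)[of "r1 (r2 n)"] unfolding \<rho>_def by (meson order.strict_trans)
    qed
  qed
  moreover have "AE p in nu \<Lambda> \<Otimes>\<^sub>M nu \<Lambda>. (\<lambda>n. pair_avg (\<rho> n) p) \<longlonglongrightarrow> k (fst p) (snd p)"
    using r1(2)
  proof eventually_elim
    case (elim p)
    from LIMSEQ_subseq_LIMSEQ[OF elim r2(1)] show ?case by (simp add: \<rho>_def comp_def LIM_zero_iff)
  qed
  moreover have "AE x in nu \<Lambda>. (\<lambda>n. pair_avg (\<rho> n) (x, x)) \<longlonglongrightarrow> k x x"
    using r2(2) by eventually_elim (simp add: \<rho>_def pair_avg_def cell_diag_def LIM_zero_iff)
  ultimately show ?thesis using \<pi>(1) by (intro exI[of _ \<rho>]) (auto simp: \<rho>_def)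
qed

text \<open>For a continuous kernel the averages over shrinking cells converge at each individual
  pair, diagonal pairs included, as long as the cells have positive measure.\<close>

lemma continuous_kernel_avg:
  assumes J: "bounded_op J" "integral_kernel J j" and jc: "continuous_on UNIV (\<lambda>(x, y). j x y)"
    and \<pi>: "\<And>n. \<pi> n \<in> labels"
    and diam: "\<And>\<epsilon>. \<epsilon> > 0 \<Longrightarrow> eventually (\<lambda>n. \<forall>x\<in>\<Lambda>. \<forall>y\<in>\<Lambda>. \<pi> n x = \<pi> n y \<longrightarrow> dist x y < \<epsilon>) sequentially"
    and x: "x \<in> \<Lambda>" "\<And>n. wt (\<pi> n) (\<pi> n x) > 0" and y: "y \<in> \<Lambda>" "\<And>n. wt (\<pi> n) (\<pi> n y) > 0"
  shows "(\<lambda>n. l2_inner (cell_fun \<Lambda> (\<pi> n) (\<pi> n x)) (J (cell_fun \<Lambda> (\<pi> n) (\<pi> n y)))) \<longlonglongrightarrow> j x y"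
proof (rule tendstoI)
  fix \<epsilon> :: real assume e: "\<epsilon> > 0"
  interpret PF: finite_measure "nu \<Lambda> \<Otimes>\<^sub>M nu \<Lambda>" by (rule finite_pair_nu)
  have jm: "(\<lambda>p. j (fst p) (snd p)) \<in> borel_measurable (nu \<Lambda> \<Otimes>\<^sub>M nu \<Lambda>)"
    using integral_kernel_measurable[OF J(2)] measurable_cong_sets[OF sets_nu_pair refl] by blast
  have AE\<Lambda>: "AE p in nu \<Lambda> \<Otimes>\<^sub>M nu \<Lambda>. fst p \<in> \<Lambda> \<and> snd p \<in> \<Lambda>"
    by (subst AE_nu_pair[OF \<Lambda>]) simp
  have int: "integrable (nu \<Lambda> \<Otimes>\<^sub>M nu \<Lambda>) (\<lambda>p. j (fst p) (snd p))"
  proof -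
    have "compact (closure \<Lambda> \<times> closure \<Lambda>)" using \<Lambda> by (intro compact_Times) (auto simp: bdd_borel_def)
    then have "compact ((\<lambda>(x, y). j x y) ` (closure \<Lambda> \<times> closure \<Lambda>))"
      using continuous_on_subset[OF jc] by (intro compact_continuous_image) auto
    then obtain C where C: "\<forall>z\<in>(\<lambda>(x, y). j x y) ` (closure \<Lambda> \<times> closure \<Lambda>). cmod z \<le> C"
      using compact_imp_bounded bounded_iff by blast
    have "AE p in nu \<Lambda> \<Otimes>\<^sub>M nu \<Lambda>. cmod (j (fst p) (snd p)) \<le> C"
      using AE\<Lambda>
    proof eventually_elim
      case (elim p)
      then have "p \<in> closure \<Lambda> \<times> closure \<Lambda>" using closure_subset[of \<Lambda>] by (cases p) auto
      then show ?case using C by (cases p) auto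
    qed
    then show ?thesis using jm by (rule PF.integrable_const_bound)
  qed
  have "isCont (\<lambda>(x, y). j x y) (x, y)" using jc by (simp add: continuous_on_eq_continuous_at)
  then obtain d where d: "d > 0" "\<And>p. dist p (x, y) < d \<Longrightarrow> dist (case p of (x, y) \<Rightarrow> j x y) (j x y) < \<epsilon> / 2"
    using e unfolding continuous_at_eps_delta by (metis case_prod_conv half_gt_zero)
  have "eventually (\<lambda>n. \<forall>x\<in>\<Lambda>. \<forall>y\<in>\<Lambda>. \<pi> n x = \<pi> n y \<longrightarrow> dist x y < d / 2) sequentially"
    using d(1) by (intro diam) simp
  then show "eventually (\<lambda>n. dist (l2_inner (cell_fun \<Lambda> (\<pi> n) (\<pi> n x)) (J (cell_fun \<Lambda> (\<pi> n) (\<pi> n y)))) (j x y) < \<epsilon>) sequentially"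
  proof eventually_elim
    case (elim n)
    define Q where "Q = pair_label (\<pi> n) -` {(\<pi> n x, \<pi> n y)}"
    have Q: "Q = \<pi> n -` {\<pi> n x} \<times> \<pi> n -` {\<pi> n y}" by (auto simp: Q_def pair_label_def)
    have Qs: "Q \<in> sets (nu \<Lambda> \<Otimes>\<^sub>M nu \<Lambda>)" unfolding Q using sets_label[OF \<pi>] by (intro pair_measureI) auto
    define m where "m = measure (nu \<Lambda> \<Otimes>\<^sub>M nu \<Lambda>) Q"
    have m: "m > 0"
    proof -
      have "m = wt (\<pi> n) (\<pi> n x) * wt (\<pi> n) (\<pi> n y)"
        unfolding m_def Q using sets_label[OF \<pi>]
        by (simp add: measure_def F.emeasure_pair_measure_Times enn2real_mult)
      then show ?thesis using x(2) y(2) by simp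
    qed
    have sp: "Q \<inter> space (nu \<Lambda> \<Otimes>\<^sub>M nu \<Lambda>) = Q" by (auto simp: space_pair_measure)
    have iQ: "integrable (nu \<Lambda> \<Otimes>\<^sub>M nu \<Lambda>) (\<lambda>p. indicator Q p *\<^sub>R j (fst p) (snd p))"
      using Qs int by (rule integrable_mult_indicator)
    have iQ': "integrable (nu \<Lambda> \<Otimes>\<^sub>M nu \<Lambda>) (\<lambda>p. indicator Q p *\<^sub>R j x y)"
      using Qs by (intro integrable_scaleR_left) (auto simp: PF.emeasure_eq_measure)
    have iQr: "integrable (nu \<Lambda> \<Otimes>\<^sub>M nu \<Lambda>) (indicator Q :: _ \<Rightarrow> real)"
      using Qs by (intro integrable_real_indicator) (auto simp: PF.emeasure_eq_measure)
    define z where "z = l2_inner (cell_fun \<Lambda> (\<pi> n) (\<pi> n x)) (J (cell_fun \<Lambda> (\<pi> n) (\<pi> n y)))"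
    have "z = (\<integral>p. indicator Q p * j (fst p) (snd p) \<partial>(nu \<Lambda> \<Otimes>\<^sub>M nu \<Lambda>)) / of_real m"
      unfolding z_def inner_cells_eq_avg[OF \<Lambda> \<pi> J int] cell_avg_def Q_def[symmetric] sp m_def ..
    then have "of_real m * z = (\<integral>p. indicator Q p * j (fst p) (snd p) \<partial>(nu \<Lambda> \<Otimes>\<^sub>M nu \<Lambda>))"
      using m by simp
    also have "\<dots> = (\<integral>p. indicator Q p *\<^sub>R j (fst p) (snd p) \<partial>(nu \<Lambda> \<Otimes>\<^sub>M nu \<Lambda>))"
      by (intro Bochner_Integration.integral_cong) (auto simp: indicator_def)
    finally have "of_real m * z - of_real m * j x y =
        (\<integral>p. indicator Q p *\<^sub>R j (fst p) (snd p) \<partial>(nu \<Lambda> \<Otimes>\<^sub>M nu \<Lambda>)) - (\<integral>p. indicator Q p *\<^sub>R j x y \<partial>(nu \<Lambda> \<Otimes>\<^sub>M nu \<Lambda>))"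
      using Qs by (subst integral_scaleR_left) (auto simp: PF.emeasure_eq_measure m_def scaleR_conv_of_real)
    also have "\<dots> = (\<integral>p. indicator Q p *\<^sub>R j (fst p) (snd p) - indicator Q p *\<^sub>R j x y \<partial>(nu \<Lambda> \<Otimes>\<^sub>M nu \<Lambda>))"
      using iQ iQ' by (rule Bochner_Integration.integral_diff[symmetric])
    also have "cmod \<dots> \<le> (\<integral>p. cmod (indicator Q p *\<^sub>R j (fst p) (snd p) - indicator Q p *\<^sub>R j x y) \<partial>(nu \<Lambda> \<Otimes>\<^sub>M nu \<Lambda>))"
      by (rule integral_norm_bound)
    also have "\<dots> \<le> (\<integral>p. indicator Q p * (\<epsilon> / 2) \<partial>(nu \<Lambda> \<Otimes>\<^sub>M nu \<Lambda>))"
    proof (rule integral_mono_AE)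
      show "AE p in nu \<Lambda> \<Otimes>\<^sub>M nu \<Lambda>. cmod (indicator Q p *\<^sub>R j (fst p) (snd p) - indicator Q p *\<^sub>R j x y) \<le> indicator Q p * (\<epsilon> / 2)"
        using AE\<Lambda>
      proof eventually_elim
        case (elim p)
        show ?case
        proof (cases "p \<in> Q")
          case True
          then have "\<pi> n (fst p) = \<pi> n x" "\<pi> n (snd p) = \<pi> n y" by (auto simp: Q)
          then have "dist (fst p) x < d / 2" "dist (snd p) y < d / 2"
            using elim x(1) y(1) \<open>\<forall>x\<in>\<Lambda>. \<forall>y\<in>\<Lambda>. \<pi> n x = \<pi> n y \<longrightarrow> dist x y < d / 2\<close> by auto
          moreover have "dist p (x, y) \<le> dist (fst p) x + dist (snd p) y"
            by (cases p) (simp add: dist_Pair_Pair sqrt_sum_squares_le_sum del: dist_norm)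
          ultimately have "dist p (x, y) < d" by simp
          from d(2)[OF this] show ?thesis using True by (cases p) (simp add: dist_norm)
        qed simp
      qed
    qed (use iQ iQ' iQr in auto)
    also have "\<dots> = m * (\<epsilon> / 2)" using Qs by (simp add: m_def)
    finally have "cmod (of_real m * (z - j x y)) \<le> m * (\<epsilon> / 2)" by (simp add: right_diff_distrib)
    then have "cmod (z - j x y) \<le> \<epsilon> / 2" using m by (simp add: norm_mult)
    then show ?case using e by (simp add: dist_norm z_def)
  qed
qed

text \<open>The compressed matrices are positive semidefinite for every tuple, and the nonnegative
  reals are closed. Almost everywhere all entries converge, so the inequality passes to the
  limit.\<close>

lemma AE_tuples_kposdef_diff:
  assumes J: "bounded_op J" "integral_kernel J j" and jc: "continuous_on UNIV (\<lambda>(x, y). j x y)"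
    and le: "op_le K J"
  shows "AE x in tuples m. (\<forall>i<m. x i \<in> \<Lambda>) \<longrightarrow> kposdef (\<lambda>y z. j y z - k y z) (x ` {..<m})"
proof -
  obtain \<pi> where \<pi>: "\<And>n. \<pi> n \<in> labels"
    "\<And>\<epsilon>. \<epsilon> > 0 \<Longrightarrow> eventually (\<lambda>n. \<forall>x\<in>\<Lambda>. \<forall>y\<in>\<Lambda>. \<pi> n x = \<pi> n y \<longrightarrow> dist x y < \<epsilon>) sequentially"
    "AE p in nu \<Lambda> \<Otimes>\<^sub>M nu \<Lambda>. (\<lambda>n. pair_avg (\<pi> n) p) \<longlonglongrightarrow> k (fst p) (snd p)"
    "AE x in nu \<Lambda>. (\<lambda>n. pair_avg (\<pi> n) (x, x)) \<longlonglongrightarrow> k x x"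
    using AE_subsequence_to_kernel by blast
  define Pd where "Pd p \<longleftrightarrow> (fst p \<in> \<Lambda> \<and> snd p \<in> \<Lambda> \<longrightarrow> (\<lambda>n. pair_avg (\<pi> n) p) \<longlonglongrightarrow> k (fst p) (snd p))" for p
  define Ps where "Ps x \<longleftrightarrow> (x \<in> \<Lambda> \<longrightarrow> (\<lambda>n. pair_avg (\<pi> n) (x, x)) \<longlonglongrightarrow> k x x \<and> (\<forall>n. wt (\<pi> n) (\<pi> n x) > 0))" for x
  have "AE p in lborel \<Otimes>\<^sub>M lborel. Pd p" using \<pi>(3) unfolding AE_nu_pair[OF \<Lambda>] Pd_def .
  then have "AE x in tuples m. Pd (x i, x l)" if "i < m" "l < m" "i \<noteq> l" for i l
    using that by (rule AE_tuples_pair)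
  then have 1: "AE x in tuples m. \<forall>i\<in>{..<m}. \<forall>l\<in>{..<m}. i \<noteq> l \<longrightarrow> Pd (x i, x l)"
    by (intro AE_finite_allI) auto
  have "AE x in nu \<Lambda>. \<forall>n. wt (\<pi> n) (\<pi> n x) > 0"
    by (intro AE_all_countable[THEN iffD2] allI AE_cell_weight_pos \<pi>)
  with \<pi>(4) have "AE x in nu \<Lambda>. (\<lambda>n. pair_avg (\<pi> n) (x, x)) \<longlonglongrightarrow> k x x \<and> (\<forall>n. wt (\<pi> n) (\<pi> n x) > 0)"
    by eventually_elim simp
  then have "AE x in lborel. Ps x" unfolding AE_nu[OF \<Lambda>_borel] Ps_def .
  then obtain N where N: "{x \<in> space lborel. \<not> Ps x} \<subseteq> N" "emeasure lborel N = 0" "N \<in> sets lborel"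
    by (rule AE_E)
  have "AE x in tuples m. \<forall>i\<in>{..<m}. x i \<notin> N"
    using N(2,3) by (intro AE_finite_allI tuples_coord_null null_setsI) auto
  with 1 show ?thesis
  proof eventually_elim
    case (elim x)
    show ?case
    proof
      assume x\<Lambda>: "\<forall>i<m. x i \<in> \<Lambda>"
      define S where "S = x ` {..<m}"
      have S: "y \<in> \<Lambda>" "Ps y" if "y \<in> S" for y using that x\<Lambda> elim(2) N(1) by (auto simp: S_def)
      \<comment> \<open>Diagonal entries use the separate convergence on the diagonal; two different
        points come from different coordinates, where convergence for pairs applies.\<close>
      have limK: "(\<lambda>n. pair_avg (\<pi> n) (y, z)) \<longlonglongrightarrow> k y z" if yz: "y \<in> S" "z \<in> S" for y z
      proof (cases "y = z")
        case True
        then show ?thesis using S[OF yz(1)] by (simp add: Ps_def)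
      next
        case False
        then obtain i l where "i < m" "l < m" "i \<noteq> l" "y = x i" "z = x l" using yz by (auto simp: S_def)
        then have "Pd (y, z)" using elim(1) by blast
        then show ?thesis using S(1)[OF yz(1)] S(1)[OF yz(2)] by (simp add: Pd_def)
      qed
      have limJ: "(\<lambda>n. l2_inner (cell_fun \<Lambda> (\<pi> n) (\<pi> n y)) (J (cell_fun \<Lambda> (\<pi> n) (\<pi> n z)))) \<longlonglongrightarrow> j y z"
        if yz: "y \<in> S" "z \<in> S" for y z
        by (rule continuous_kernel_avg[OF J jc \<pi>(1,2)]) (use S yz in \<open>auto simp: Ps_def\<close>)
      show "kposdef (\<lambda>y z. j y z - k y z) (x ` {..<m})"
        unfolding kposdef_def S_def[symmetric]
      proof
        fix c :: "'a \<Rightarrow> complex"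
        let ?F = "\<lambda>n. \<Sum>y\<in>S. \<Sum>z\<in>S. cnj (c y) * (l2_inner (cell_fun \<Lambda> (\<pi> n) (\<pi> n y)) (J (cell_fun \<Lambda> (\<pi> n) (\<pi> n z)))
            - pair_avg (\<pi> n) (y, z)) * c z"
        have "?F n \<in> \<real>\<^sub>\<ge>\<^sub>0" for n
          using kposdef_op_diff[OF J(1) K le, of S "\<lambda>y. cell_fun \<Lambda> (\<pi> n) (\<pi> n y)"] L2_cell_fun[OF \<Lambda> \<pi>(1)]
          by (simp add: kposdef_def pair_avg_def S_def)
        moreover have "?F \<longlonglongrightarrow> (\<Sum>y\<in>S. \<Sum>z\<in>S. cnj (c y) * (j y z - k y z) * c z)"
          by (intro tendsto_sum tendsto_mult tendsto_diff tendsto_const limK limJ)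
        ultimately show "(\<Sum>y\<in>S. \<Sum>z\<in>S. cnj (c y) * (j y z - k y z) * c z) \<in> \<real>\<^sub>\<ge>\<^sub>0"
          using closed_sequentially[OF closed_nonneg_Reals_complex, of ?F] by blast
      qed
    qed
  qed
qed

end

text \<open>The test vector with entries 1 and \<open>u\<close>, where the phase \<open>u\<close>
  makes the cross terms equal to -|k(x,y)|, gives the bound directly.\<close>

lemma kposdef_pair_bound:
  assumes "kposdef k {x, y}"
  shows "cmod (k x y) \<le> (Re (k x x) + Re (k y y)) / 2"
proof (cases "x = y")
  case True
  then have "k x x \<in> \<real>\<^sub>\<ge>\<^sub>0" using kposdef_diag[OF assms, of x] by simp
  then show ?thesis using True by (auto simp: complex_nonneg_Reals_iff cmod_eq_Re)
next
  case False
  \<comment> \<open>The value 1 for a vanishing entry keeps \<open>u\<close> on the unit circle,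
    where division by zero would give 0.\<close>
  define u where "u = (if k x y = 0 then 1 else - cnj (k x y) / of_real (cmod (k x y)))"
  have u: "cnj u * u = 1" "k x y * u = - of_real (cmod (k x y))"
  proof -
    have "cmod u = 1" by (simp add: u_def norm_divide)
    then show "cnj u * u = 1" using complex_norm_square[of u] by (simp add: mult.commute)
    show "k x y * u = - of_real (cmod (k x y))"
      using complex_norm_square[of "k x y"] by (simp add: u_def power2_eq_square divide_simps)
  qed
  have herm: "k y x = cnj (k x y)" using kposdef_hermitian[OF assms, of y x] by simp
  define c where "c z = (if z = x then 1 else u)" for z
  have "(\<Sum>z\<in>{x, y}. \<Sum>w\<in>{x, y}. cnj (c z) * k z w * c w) = k x x + k x y * u + cnj (k x y * u) + (cnj u * u) * k y y"
    using False by (simp add: c_def herm algebra_simps)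
  also have "\<dots> = k x x + k y y - 2 * of_real (cmod (k x y))" unfolding u by simp
  finally have "k x x + k y y - 2 * of_real (cmod (k x y)) \<in> \<real>\<^sub>\<ge>\<^sub>0"
    using spec[OF assms[unfolded kposdef_def], of c] by simp
  then show ?thesis by (simp add: complex_nonneg_Reals_iff)
qed

text \<open>Positive definiteness for almost all configurations, read off for one and two points,
  supplies the assumptions of the local argument. Balls of integer radius exhaust the space, and
  countably many null sets are discarded.\<close>

lemma AE_tuples_kernel_le:
  fixes K :: "'a::euclidean_space l2_op"
  assumes K: "bounded_op K" "local_trace_class K" "op_le zero_op K" "correlation_kernel K k"
    and J: "bounded_op J" "integral_kernel J j" "continuous_on UNIV (\<lambda>(x, y). j x y)" "op_le K J"
  shows "AE x in tuples m. kposdef (\<lambda>y z. j y z - k y z) (x ` {..<m})"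
proof -
  have ker: "integral_kernel K k" and pd: "AE \<alpha> in L_measure. kposdef k \<alpha>"
    and tr: "\<And>\<Lambda>. \<Lambda> \<in> bdd_borel \<Longrightarrow> set_integrable lborel \<Lambda> (\<lambda>x. k x x) \<and>
        op_trace (compress \<Lambda> K) = (LINT x:\<Lambda>|lborel. k x x)"
    using K(4) by (auto simp: correlation_kernel_def)
  note km [measurable] = integral_kernel_measurable[OF ker]
  note dm [measurable] = integral_kernel_diag_measurable[OF ker]
  have "AE x in tuples 1. kposdef k (x ` {..<1})" using pd by (rule AE_L_measure_tuples)
  then have "AE x in tuples 1. k (x 0) (x 0) \<in> \<real>\<^sub>\<ge>\<^sub>0"
    by eventually_elim (rule kposdef_diag, auto)
  moreover have "{x. k x x \<notin> \<real>\<^sub>\<ge>\<^sub>0} \<in> sets borel"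
  proof -
    have "(\<lambda>x. k x x) -` (- \<real>\<^sub>\<ge>\<^sub>0) \<inter> space borel \<in> sets borel"
      using dm by (rule measurable_sets) (simp add: borel_open open_Compl)
    then show ?thesis by (simp add: vimage_def)
  qed
  ultimately have diag: "AE x in lborel. k x x \<in> \<real>\<^sub>\<ge>\<^sub>0" by (intro AE_single_of_tuples)
  have "AE x in tuples 2. kposdef k (x ` {..<2})" using pd by (rule AE_L_measure_tuples)
  then have "AE x in tuples 2. cmod (k (x 0) (x 1)) \<le> (Re (k (x 0) (x 0)) + Re (k (x 1) (x 1))) / 2"
  proof eventually_elim
    case (elim x)
    have "x ` {..<2} = {x 0, x 1}" by (auto simp: numeral_2_eq_2 lessThan_Suc)
    then show ?case using elim by (intro kposdef_pair_bound) simp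
  qed
  then have dom: "AE p in lborel \<Otimes>\<^sub>M lborel. cmod (k (fst p) (snd p)) \<le>
        (Re (k (fst p) (fst p)) + Re (k (snd p) (snd p))) / 2"
  proof (intro AE_pair_of_tuples)
    have "sets (lborel \<Otimes>\<^sub>M lborel) = sets (borel \<Otimes>\<^sub>M (borel :: 'a measure))"
      by (rule sets_pair_measure_cong) auto
    moreover have "{p \<in> space (borel \<Otimes>\<^sub>M borel). \<not> cmod (k (fst p) (snd p)) \<le>
        (Re (k (fst p) (fst p)) + Re (k (snd p) (snd p))) / 2} \<in> sets (borel \<Otimes>\<^sub>M (borel :: 'a measure))"
      by measurable
    ultimately show "{p \<in> space (lborel \<Otimes>\<^sub>M lborel). \<not> cmod (k (fst p) (snd p)) \<le>
        (Re (k (fst p) (fst p)) + Re (k (snd p) (snd p))) / 2} \<in> sets (lborel \<Otimes>\<^sub>M (lborel :: 'a measure))"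
      by (simp add: space_pair_measure)
  qed simp
  \<comment> \<open>\<open>trace_class\<close> contains the existence of an orthonormal basis;
    compression to the empty set is enough to extract it.\<close>
  have basis: "\<exists>e::nat \<Rightarrow> 'a \<Rightarrow> complex. orthonormal_basis e"
  proof -
    have "{} \<in> (bdd_borel :: 'a set set)" by (simp add: bdd_borel_def)
    then have "trace_class (compress {} K)" using K(2) by (simp add: local_trace_class_def)
    then show ?thesis unfolding trace_class_def by blast
  qed
  have "AE x in tuples m. (\<forall>i<m. x i \<in> cball 0 (real n)) \<longrightarrow> kposdef (\<lambda>y z. j y z - k y z) (x ` {..<m})" for n
  proof -
    have \<Lambda>: "cball (0::'a) (real n) \<in> bdd_borel" by (simp add: bdd_borel_def)
    interpret correlation_kernel_on "cball (0::'a) (real n)" K k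
      by unfold_locales (use \<Lambda> K ker diag dom tr[OF \<Lambda>] basis in auto)
    show ?thesis by (rule AE_tuples_kposdef_diff[OF J])
  qed
  then have "AE x in tuples m. \<forall>n. (\<forall>i<m. x i \<in> cball 0 (real n)) \<longrightarrow> kposdef (\<lambda>y z. j y z - k y z) (x ` {..<m})"
    by (intro AE_all_countable[THEN iffD2] allI)
  then show ?thesis
  proof eventually_elim
    case (elim x)
    have "bounded (x ` {..<m})" by (simp add: finite_imp_bounded)
    then obtain r where r: "\<forall>i<m. norm (x i) \<le> r" by (auto simp: bounded_iff)
    obtain n where n: "r \<le> real n" using real_arch_simple by blast
    have "\<forall>i<m. x i \<in> cball 0 (real n)" using r n by (auto intro: order_trans)
    then show ?case using elim by blast
  qed
qed

theorem proposition3p9: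
  fixes K :: "'a::euclidean_space l2_op"
    and k j :: "'a \<Rightarrow> 'a \<Rightarrow> complex"
    and \<mu> :: "'a set measure"
    and R :: real
  assumes "bounded_op K" and "hermitian_op K" and "local_trace_class K"
    and "op_le zero_op K" and "op_le K id_op" and "op_norm K < 1"
    and "correlation_kernel K k"
    and "determinantal_process \<mu> k"
    and a: "integral_kernel (J_op K) j" "continuous_on UNIV (\<lambda>(x, y). j x y)"
    and b: "0 \<le> R" "\<And>x y. norm (x - y) > R \<Longrightarrow> j x y = 0"
    and c: "AE \<xi> in \<mu>. \<not> has_infinite_cluster R \<xi>"
  shows "(AE (\<alpha>, \<xi>) in L_measure \<Otimes>\<^sub>M \<mu>.
            topcontinuous_at
              (prod_topology weak_topology (subtopology vague_topology (nondegenerate j)))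
              euclidean (\<lambda>(\<alpha>, \<xi>). c_star j \<alpha> \<xi>) (\<alpha>, \<xi>))
       \<and> (AE (\<alpha>, \<xi>) in L_measure \<Otimes>\<^sub>M \<mu>.
            topcontinuous_at (prod_topology weak_topology vague_topology)
              euclidean (\<lambda>(\<alpha>, \<xi>). cluster_ratio R j \<alpha> \<xi>) (\<alpha>, \<xi>))
       \<and> (AE (\<alpha>, \<xi>) in L_measure \<Otimes>\<^sub>M \<mu>. c_star j \<alpha> \<xi> = cluster_ratio R j \<alpha> \<xi>)"
proof -
  have \<mu>: "point_process \<mu>" using assms(8) by (simp add: determinantal_process_def)
  interpret M: prob_space \<mu> using \<mu> by (simp add: point_process_def)
  have sp: "space \<mu> = configs" using \<mu> by (simp add: point_process_def)
  note J = J_op_ge[OF assms(1,2,5,6)]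
  \<comment> \<open>On almost every tuple both k and j - k are positive semidefinite, so a singular
    subset for j forces the correlation function to vanish.\<close>
  have deg: "AE x in tuples m. (\<exists>\<beta>\<subseteq>x ` {..<m}. kdet j \<beta> = 0) \<longrightarrow> kdet k (x ` {..<m}) = 0" for m
  proof -
    have "AE x in tuples m. kposdef k (x ` {..<m})"
      using assms(7) by (intro AE_L_measure_tuples) (simp add: correlation_kernel_def)
    moreover have "AE x in tuples m. kposdef (\<lambda>y z. j y z - k y z) (x ` {..<m})"
      by (rule AE_tuples_kernel_le[OF assms(1,3,4,7) J(1) a J(2)])
    ultimately show ?thesis
    proof eventually_elim
      case (elim x)
      then show ?case using kdet_eq_0_mono[OF elim] by blast
    qed
  qed
  have nd: "AE p in L_measure \<Otimes>\<^sub>M \<mu>. \<forall>\<beta>\<subseteq>snd p. finite \<beta> \<longrightarrow> kdet j \<beta> \<noteq> 0"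
    by (rule AE_snd_pair[OF sigma_finite_L_measure M.sigma_finite_measure_axioms
          AE_no_degenerate_subset[OF a(2) assms(8) deg]])
  have np: "AE p in L_measure \<Otimes>\<^sub>M \<mu>. \<not> has_infinite_cluster R (snd p)"
    by (rule AE_snd_pair[OF sigma_finite_L_measure M.sigma_finite_measure_axioms c])
  have "AE p in L_measure \<Otimes>\<^sub>M \<mu>. p \<in> space (L_measure \<Otimes>\<^sub>M \<mu>)" by (rule AE_space)
  with nd np AE_disjoint[OF \<mu>]
  have "AE p in L_measure \<Otimes>\<^sub>M \<mu>.
      topcontinuous_at (prod_topology weak_topology (subtopology vague_topology (nondegenerate j)))
        euclidean (\<lambda>(\<alpha>, \<xi>). c_star j \<alpha> \<xi>) p
    \<and> topcontinuous_at (prod_topology weak_topology vague_topology)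
        euclidean (\<lambda>(\<alpha>, \<xi>). cluster_ratio R j \<alpha> \<xi>) p
    \<and> c_star j (fst p) (snd p) = cluster_ratio R j (fst p) (snd p)"
  proof eventually_elim
    case (elim p)
    obtain \<alpha> \<xi> where p: "p = (\<alpha>, \<xi>)" by (cases p)
    have "finite \<alpha>" "\<xi> \<in> configs" using elim(4) sp by (auto simp: p space_pair_measure fin_configs_def)
    moreover have "\<And>\<beta>. finite \<beta> \<Longrightarrow> \<beta> \<subseteq> \<xi> \<Longrightarrow> kdet j \<beta> \<noteq> 0" using elim(1) by (auto simp: p)
    moreover have "\<not> has_infinite_cluster R \<xi>" "\<alpha> \<inter> \<xi> = {}" using elim(2,3) by (auto simp: p)
    ultimately show ?case
      using topcontinuous_cluster_functionals[of \<alpha> \<xi> R j] a(2) b by (simp add: p)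
  qed
  then show ?thesis by (auto elim: eventually_mono)
qed

end
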